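(* Assume that $\mu_\rho$ is purely absolutely continuous, i.e. $\mu_\rho(dx)=\psi_\rho(x)\,dx$, and that: (A.1) there exists $\alpha>0$ such that, for $\delta>0$, $$\sup_{|h|\le\delta}\|\psi_\rho(\cdot+h)+\psi_\rho(\cdot-h)-2\psi_\rho(\cdot)\|_{L^1([0,2\pi])}=O(\delta^\alpha);$$ (A.2) there exists $\gamma>0$ such that $\frac{1}{\psi_\rho}\in L^\gamma([0,2\pi])$, i.e. $\int_0^{2\pi}\psi_\rho(x)^{-\gamma}\,dx<+\infty$. Then, $\mathbb{P}$-almost surely, $$\lim_{n\to+\infty}\frac{\mathcal{N}(f_n,[0,2\pi])}{n}=\frac{2}{\sqrt3}.$$
   Context: Let $\mu_\rho$ be a symmetric probability measure on $[-\pi,\pi]$ (the spectral measure), regarded as a measure on the circle $\mathbb{R}/2\pi\mathbb{Z}$, and let $\rho(k)=\int_{-\pi}^{\pi}e^{-ikx}\,\mu_\rho(dx)$, $k\in\mathbb{Z}$. On a probability space $(\Omega,\mathcal{F},\mathbb{P})$ with expectation $\mathbb{E}$, let $(a_k)_{k\ge1}$ and $(b_k)_{k\ge1}$ be two independent centered stationary Gaussian sequences with $\mathbb{E}[a_ka_\ell]=\mathbb{E}[b_kb_\ell]=\rho(|k-\ell|)$ for $k,\ell\ge1$ (so each variable has variance $\rho(0)=1$). For $n\ge1$ set $f_n(x)=\frac{1}{\sqrt n}\sum_{k=1}^n a_k\cos(kx)+b_k\sin(kx)$. For a function $f$ and an interval $[a,b]$, $\mathcal{N}(f,[a,b])=\#\{t\in[a,b]: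 f(t)=0\}$. The density $\psi_\rho$ is regarded as a $2\pi$-periodic function. *)

theory Defs
  imports "HOL-Probability.Probability"
begin

definition spectral_measure :: "real measure \<Rightarrow> bool" where
  "spectral_measure \<mu> \<longleftrightarrow>
     prob_space \<mu> \<and>
     sets \<mu> = sets (restrict_space borel {-pi..pi}) \<and>
     distr \<mu> \<mu> uminus = \<mu>"

text \<open>Complex-valued by definition; the values are real by the symmetry of the measure.\<close>

definition correlation :: "real measure \<Rightarrow> int \<Rightarrow> complex" where
  "correlation \<mu> k = (\<integral>x. exp (- \<i> * of_int k * of_real x) \<partial>\<mu>)"

text \<open>A density is a nonnegative, \<open>2\<pi>\<close>-periodic Borel representative.\<close>

definition spectral_density :: "real measure \<Rightarrow> (real \<Rightarrow> real) \<Rightarrow> bool" where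
  "spectral_density \<mu> \<psi> \<longleftrightarrow>
     \<psi> \<in> borel_measurable borel \<and>
     (\<forall>x. 0 \<le> \<psi> x) \<and>
     (\<forall>x. \<psi> (x + 2 * pi) = \<psi> x) \<and>
     \<mu> = density (restrict_space lborel {-pi..pi}) (\<lambda>x. ennreal (\<psi> x))"

text \<open>Degenerate (constant) Gaussians are included: they arise as linear combinations
  with zero variance.\<close>

definition gaussian_law :: "real \<Rightarrow> real \<Rightarrow> real measure" where
  "gaussian_law m \<sigma> =
     (if \<sigma> = 0 then return borel m else density lborel (\<lambda>x. ennreal (normal_density m \<sigma> x)))"

definition gaussian_variable :: "'w measure \<Rightarrow> ('w \<Rightarrow> real) \<Rightarrow> bool" where
  "gaussian_variable M X \<longleftrightarrow>
     X \<in> borel_measurable M \<and> (\<exists>m \<sigma>. 0 \<le> \<sigma> \<and> distr M borel X = gaussian_law m \<sigma>)"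

text \<open>Joint Gaussianity: every finite linear combination is Gaussian.\<close>

definition gaussian_process :: "'w measure \<Rightarrow> 'i set \<Rightarrow> ('i \<Rightarrow> 'w \<Rightarrow> real) \<Rightarrow> bool" where
  "gaussian_process M I X \<longleftrightarrow>
     (\<forall>J c. finite J \<longrightarrow> J \<subseteq> I \<longrightarrow> gaussian_variable M (\<lambda>\<omega>. \<Sum>j\<in>J. c j * X j \<omega>))"

text \<open>Stationarity is the dependence of the covariance on \<open>\<bar>k - l\<bar>\<close> only; the index \<open>0\<close>
  is not part of the sequence.\<close>

definition stationary_gaussian_sequence ::
    "'w measure \<Rightarrow> (int \<Rightarrow> complex) \<Rightarrow> (nat \<Rightarrow> 'w \<Rightarrow> real) \<Rightarrow> bool" where
  "stationary_gaussian_sequence M \<rho> X \<longleftrightarrow>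
     gaussian_process M {1..} X \<and>
     (\<forall>k\<ge>1. (\<integral>\<omega>. X k \<omega> \<partial>M) = 0) \<and>
     (\<forall>k\<ge>1. \<forall>l\<ge>1. complex_of_real (\<integral>\<omega>. X k \<omega> * X l \<omega> \<partial>M) = \<rho> \<bar>int k - int l\<bar>)"

definition independent_sequences ::
    "'w measure \<Rightarrow> (nat \<Rightarrow> 'w \<Rightarrow> real) \<Rightarrow> (nat \<Rightarrow> 'w \<Rightarrow> real) \<Rightarrow> bool" where
  "independent_sequences M X Y \<longleftrightarrow>
     prob_space.indep_var M
       (\<Pi>\<^sub>M k\<in>{1..}. borel) (\<lambda>\<omega>. \<lambda>k\<in>{1..}. X k \<omega>)
       (\<Pi>\<^sub>M k\<in>{1..}. borel) (\<lambda>\<omega>. \<lambda>k\<in>{1..}. Y k \<omega>)"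

definition trig_sum :: "(nat \<Rightarrow> real) \<Rightarrow> (nat \<Rightarrow> real) \<Rightarrow> nat \<Rightarrow> real \<Rightarrow> real" where
  "trig_sum a b n x =
     1 / sqrt (real n) * (\<Sum>k=1..n. a k * cos (real k * x) + b k * sin (real k * x))"

text \<open>Counted with the counting measure, so that an infinite zero set gives \<open>\<infinity>\<close>
  (whereas \<^const>\<open>card\<close> would give \<open>0\<close>).\<close>

definition num_zeros :: "(real \<Rightarrow> real) \<Rightarrow> real set \<Rightarrow> ennreal" where
  "num_zeros f I = emeasure (count_space UNIV) {t \<in> I. f t = 0}"

text \<open>The order bound is for \<open>\<delta>\<close> tending to \<open>0\<close> from the right.\<close>

definition L1_second_difference_smooth :: "(real \<Rightarrow> real) \<Rightarrow> real \<Rightarrow> bool" where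
  "L1_second_difference_smooth \<psi> \<alpha> \<longleftrightarrow>
     (\<lambda>\<delta>. SUP h\<in>{h. \<bar>h\<bar> \<le> \<delta>}. LBINT x:{0..2*pi}. \<bar>\<psi> (x + h) + \<psi> (x - h) - 2 * \<psi> x\<bar>)
       \<in> O[at_right 0](\<lambda>\<delta>. \<delta> powr \<alpha>)"

text \<open>The inverse is taken in \<^typ>\<open>ennreal\<close>, where \<open>inverse 0 = \<infinity>\<close>; hence the condition
  forces \<open>\<psi> > 0\<close> almost everywhere.\<close>

definition inverse_in_Lp :: "(real \<Rightarrow> real) \<Rightarrow> real \<Rightarrow> bool" where
  "inverse_in_Lp \<psi> \<gamma> \<longleftrightarrow>
     (\<integral>\<^sup>+x\<in>{0..2*pi}. inverse (ennreal (\<psi> x powr \<gamma>)) \<partial>lborel) < \<infinity>"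

end

theory Submission imports Defs "HOL-Real_Asymp.Real_Asymp" begin

text \<open>Let \<open>f\<close> be the normalised sum of \<open>n\<close> terms and \<open>s(x)^2 = 2 pi \<psi>(x)\<close>. The covariances are the
Fourier coefficients of \<open>\<psi>\<close>, so the variance of \<open>f(x)\<close> is a Fejer-type mean of \<open>2 pi \<psi>\<close> and
tends to \<open>s^2\<close> in \<open>L1\<close>. The proof looks at \<open>f\<close> at a point \<open>x\<close> that is uniform on the circle,
for a fixed outcome \<open>w\<close>.

Almost surely, the pair \<open>f(x)/s(x)\<close>, \<open>f(x + ep/n)/s(x)\<close> becomes a standard Gaussian pair with
correlation \<open>sin ep/ep\<close>. Indeed its characteristic function is an average over \<open>x\<close> whose mean over
\<open>w\<close> has the right limit and whose variance is at most a constant times the mean of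
\<open>r(k - l)^2\<close> over \<open>k, l <= n\<close> (\<open>concentration_char\<close>, \<open>cov_form_square_integral\<close>). Smoothness of \<open>\<psi>\<close> in
\<open>L1\<close> gives a power decay of \<open>r\<close>, hence a power rate, hence almost sure convergence along
\<open>n = (j + 1)^Q\<close> for a large \<open>Q\<close>; between two such indices \<open>f\<close> changes little in \<open>L2\<close>
(\<open>trig_field_block_L2\<close>, \<open>AE_phi\<close>).

The number of zeros times \<open>h = ep/n\<close> is the integral over \<open>x\<close> of the number of zeros in the window
\<open>(x, x + h)\<close>. A sign change across the window forces a zero, and its limiting probability
\<open>P = 1/2 - arctan(..)/pi\<close> satisfies \<open>2 pi P/ep --> 2/sqrt 3\<close> as \<open>ep --> 0\<close> (\<open>gauss_quadrant\<close>,
\<open>sinc_asymptotics\<close>). The other windows that contain zeros contribute \<open>o(ep)\<close>: by Rolle's theorem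
\<open>p\<close> zeros in a window force \<open>|f(x)| <= ep^p M_p(x)\<close> where \<open>M_p\<close> averages the \<open>p\<close>-th derivative, rescaled by
\<open>n^p\<close>, over the window (\<open>many_zeros_small\<close>, \<open>even_zero_small\<close>), so that either \<open>f(x)\<close> is very small or \<open>M_p(x)\<close>
is very large. Derivatives are bounded in mean square. Small values of \<open>f\<close> are controlled twice.
For large \<open>p\<close> integrability of \<open>\<psi>\<close> to a negative power gives, almost surely, a bound
\<open>C 2^(- be i)\<close> for the measure of \<open>{|f| <= 2^-i}\<close>, uniformly in \<open>i\<close> and in large \<open>n\<close>
(\<open>AE_small_ball_tail\<close>). For \<open>p = 2\<close> that exponent is too weak, and the Gaussian limit on the set \<open>s >= et\<close>
is used instead; its complement is negligible for small \<open>et\<close> because \<open>\<psi> > 0\<close> almost everywhere.\<close>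

section \<open>The circle as a measure space\<close>

abbreviation bm :: "'a measure => ('a => 'b::topological_space) set" where "bm \<equiv> borel_measurable"

abbreviation cpx :: "real => complex" where "cpx \<equiv> of_real"

definition circ :: "real measure" where
 "circ = restrict_space lborel {0..2*pi}"

abbreviation circ_integral :: "(real => 'b::{banach, second_countable_topology}) => 'b" (binder "CI " 10) where
 "CI x. f x \<equiv> \<integral>x. f x \<partial>circ"

abbreviation circ_nn_integral :: "(real => ennreal) => ennreal" (binder "CN " 10) where
 "CN x. f x \<equiv> \<integral>\<^sup>+x. f x \<partial>circ"

lemma space_circ: "space circ = {0..2*pi}"
 by (simp add: circ_def space_restrict_space)

lemma measurable_circ: "f \<in> bm borel ==> f \<in> bm circ"
 unfolding circ_def by (simp add: measurable_restrict_space1)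

lemma measurable_circ_id: "(%x. x) \<in> measurable circ borel"
 unfolding circ_def by (rule measurable_restrict_space1) simp

lemma emeasure_circ_space: "emeasure circ (space circ) = ennreal (2*pi)"
 unfolding circ_def by (simp add: space_restrict_space emeasure_restrict_space)

lemma finite_measure_circ: "finite_measure circ"
 by (rule finite_measureI) (simp add: emeasure_circ_space)

interpretation circ: finite_measure circ by (rule finite_measure_circ)

lemma measure_circ_space: "measure circ (space circ) = 2*pi"
 using emeasure_circ_space by (simp add: measure_def)

lemma nn_integral_circ:
 "(CN x. f x) = (\<integral>\<^sup>+x. f x*indicator {0..2*pi} x \<partial>lborel)"
 unfolding circ_def by (simp add: nn_integral_restrict_space)

lemma nn_integral_circ_Ico:
 "(CN x. f x) = (\<integral>\<^sup>+x. f x*indicator {0..<2*pi} x \<partial>lborel)"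
 unfolding nn_integral_circ
proof (rule nn_integral_cong_AE)
 have "AE x in lborel. x \<noteq> 2*pi" by (rule AE_lborel_singleton)
 then show "AE x in lborel. f x*indicator {0..2*pi} x = f x*indicator {0..<2*pi} x"
  by eventually_elim (auto simp: indicator_def)
qed

lemma periodic_int:
 fixes g :: "real => 'b"
 assumes "!!x. g (x + 2*pi) = g x"
 shows "g (x + 2*pi* of_int k) = g x"
proof -
 have nat: "g (y + 2*pi* of_nat m) = g y" for m y
 proof (induction m)
  case (Suc m)
  have "g (y + 2*pi* of_nat (Suc m)) = g ((y + 2*pi* of_nat m) + 2*pi)"
   by (simp add: algebra_simps)
  then show ?case using Suc assms by simp
 qed simp
 show ?thesis
 proof (cases "k \<ge> 0")
  case True
  then show ?thesis using nat[of x "nat k"] by simp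
 next
  case False
  then show ?thesis using nat[of "x + 2*pi* of_int k" "nat (-k)"] by simp
 qed
qed

lemma nn_integral_circ_shift:
 fixes g :: "real => ennreal"
 assumes [measurable]: "g \<in> bm borel" and per: "!!x. g (x + 2*pi) = g x"
 shows "(CN x. g (x + v)) = (CN x. g x)"
proof -
 define k where "k = \<lfloor>v/(2*pi)\<rfloor>"
 define u where "u = v - 2*pi* of_int k"
 have "of_int k <= v/(2*pi)" "v/(2*pi) < of_int k + 1" unfolding k_def by linarith+
 then have u: "0 <= u" "u < 2*pi" unfolding u_def by (simp_all add: field_simps)
 have gv: "g (x + v) = g (x + u)" for x
  using periodic_int[of g, OF per, of "x + u" k] by (simp add: u_def algebra_simps)
 have "(CN x. g (x + v)) = (\<integral>\<^sup>+x. g (u + 1*x)*indicator {u..<u+2*pi} (u + 1*x) \<partial>lborel)"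
  unfolding nn_integral_circ_Ico gv
  by (intro nn_integral_cong) (auto simp: indicator_def add.commute)
 also have "... = (\<integral>\<^sup>+x. g x*indicator {u..<u+2*pi} x \<partial>lborel)"
  using nn_integral_real_affine[of "%x. g x*indicator {u..<u+2*pi} x" 1 u] by simp
 also have "... = (\<integral>\<^sup>+x. g x*indicator {u..<2*pi} x + g x*indicator {2*pi..<u+2*pi} x \<partial>lborel)"
  using u by (intro nn_integral_cong) (auto simp: indicator_def)
 also have "... = (\<integral>\<^sup>+x. g x*indicator {u..<2*pi} x \<partial>lborel) + (\<integral>\<^sup>+x. g x*indicator {2*pi..<u+2*pi} x \<partial>lborel)"
  by (rule nn_integral_add) simp_all
 also have "(\<integral>\<^sup>+x. g x*indicator {2*pi..<u+2*pi} x \<partial>lborel) =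
   (\<integral>\<^sup>+x. g (2*pi + 1*x)*indicator {2*pi..<u+2*pi} (2*pi + 1*x) \<partial>lborel)"
  using nn_integral_real_affine[of "%x. g x*indicator {2*pi..<u+2*pi} x" 1 "2*pi"] by simp
 also have "... = (\<integral>\<^sup>+x. g x*indicator {0..<u} x \<partial>lborel)"
  using per by (intro nn_integral_cong) (auto simp: indicator_def add.commute)
 also have "(\<integral>\<^sup>+x. g x*indicator {u..<2*pi} x \<partial>lborel) + (\<integral>\<^sup>+x. g x*indicator {0..<u} x \<partial>lborel) =
   (\<integral>\<^sup>+x. g x*indicator {u..<2*pi} x + g x*indicator {0..<u} x \<partial>lborel)"
  by (rule nn_integral_add[symmetric]) simp_all
 also have "... = (CN x. g x)"
  unfolding nn_integral_circ_Ico using u by (intro nn_integral_cong) (auto simp: indicator_def)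
 finally show ?thesis .
qed

lemma nn_integral_circ_reflect:
 fixes g :: "real => ennreal"
 assumes [measurable]: "g \<in> bm borel" and per: "!!x. g (x + 2*pi) = g x"
 shows "(CN x. g (v - x)) = (CN x. g x)"
proof -
 have "(CN x. g (v - x)) = (\<integral>\<^sup>+x. g (v - 2*pi + (2*pi + (-1)*x))*indicator {0..2*pi} (2*pi + (-1)*x) \<partial>lborel)"
  unfolding nn_integral_circ by (intro nn_integral_cong) (auto simp: indicator_def)
 also have "... = (\<integral>\<^sup>+x. g (v - 2*pi + x)*indicator {0..2*pi} x \<partial>lborel)"
  using nn_integral_real_affine[of "%x. g (v - 2*pi + x)*indicator {0..2*pi} x" "-1" "2*pi"] by simp
 also have "... = (CN x. g (x + (v - 2*pi)))"
  unfolding nn_integral_circ by (simp add: add.commute)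
 also have "... = (CN x. g x)" by (rule nn_integral_circ_shift) fact+
 finally show ?thesis .
qed

lemma nn_integral_Icc_pi:
 fixes g :: "real => ennreal"
 assumes [measurable]: "g \<in> bm borel" and per: "!!x. g (x + 2*pi) = g x"
 shows "(\<integral>\<^sup>+x. g x*indicator {-pi..pi} x \<partial>lborel) = (CN x. g x)"
proof -
 have "(\<integral>\<^sup>+x. g x*indicator {-pi..pi} x \<partial>lborel) = (\<integral>\<^sup>+x. g (-pi + 1*x)*indicator {-pi..pi} (-pi + 1*x) \<partial>lborel)"
  using nn_integral_real_affine[of "%x. g x*indicator {-pi..pi} x" 1 "-pi"] by simp
 also have "... = (CN x. g (x + (-pi)))"
  unfolding nn_integral_circ by (intro nn_integral_cong) (auto simp: indicator_def)
 also have "... = (CN x. g x)" by (rule nn_integral_circ_shift) fact+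
 finally show ?thesis .
qed

text \<open>Passing from nonnegative to Bochner integrals of periodic functions: a periodic function
 factors through the reduction modulo \<open>2\<pi>\<close>, so equality of the images of two measures under
 that reduction is enough.\<close>

definition wrap :: "real => real" where
 "wrap x = x - 2*pi* of_int \<lfloor>x/(2*pi)\<rfloor>"

lemma wrap_periodic: "wrap (x + 2*pi) = wrap x"
proof -
 have "(x + 2*pi)/(2*pi) = x/(2*pi) + 1" by (simp add: field_simps)
 then show ?thesis unfolding wrap_def by (simp add: algebra_simps)
qed

lemma measurable_wrap [measurable]: "wrap \<in> bm borel"
 unfolding wrap_def[abs_def] by measurable

lemma periodic_wrap:
 fixes g :: "real => 'b"
 assumes "!!x. g (x + 2*pi) = g x"
 shows "g (wrap x) = g x"
 using periodic_int[of g, OF assms, of x "- \<lfloor>x/(2*pi)\<rfloor>"] by (simp add: wrap_def algebra_simps)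

lemma integral_periodic_transfer:
 fixes g :: "real => 'b::{banach, second_countable_topology}"
 assumes g: "g \<in> bm borel" and per: "!!x. g (x + 2*pi) = g x"
  and T: "T \<in> measurable N borel"
  and eq: "!!h::real => ennreal. h \<in> bm borel ==> (!!x. h (x + 2*pi) = h x) ==>
    (\<integral>\<^sup>+x. h (T x) \<partial>N) = (CN x. h x)"
 shows "(\<integral>x. g (T x) \<partial>N) = (CI x. g x)"
  and "integrable N (%x. g (T x)) \<longleftrightarrow> integrable circ g"
proof -
 note [measurable] = g T
 have m1: "(%x. wrap (T x)) \<in> measurable N borel" by measurable
 have m2: "wrap \<in> measurable circ borel" by (rule measurable_circ) measurable
 have "distr N borel (%x. wrap (T x)) = distr circ borel wrap"
 proof (rule measure_eqI)
  fix B assume "B \<in> sets (distr N borel (%x. wrap (T x)))"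
  then have B [measurable]: "B \<in> sets borel" by simp
  have i1: "emeasure (distr N borel (%x. wrap (T x))) B = (\<integral>\<^sup>+x. indicator B (wrap (T x)) \<partial>N)"
   using nn_integral_distr[OF m1, of "indicator B"] B by simp
  have i2: "emeasure (distr circ borel wrap) B = (CN x. indicator B (wrap x))"
   using nn_integral_distr[OF m2, of "indicator B"] B by simp
  show "emeasure (distr N borel (%x. wrap (T x))) B = emeasure (distr circ borel wrap) B"
   unfolding i1 i2 by (rule eq) (simp_all add: wrap_periodic)
 qed simp
 note * = this
 have "(\<integral>x. g (T x) \<partial>N) = (\<integral>x. g (wrap (T x)) \<partial>N)" by (simp add: periodic_wrap[of g, OF per])
 also have "... = (\<integral>x. g x \<partial>distr N borel (%x. wrap (T x)))" using m1 g by (simp add: integral_distr)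
 also have "... = (CI x. g (wrap x))" using m2 g by (simp add: * integral_distr)
 finally show "(\<integral>x. g (T x) \<partial>N) = (CI x. g x)" by (simp add: periodic_wrap[of g, OF per])
 have "integrable N (%x. g (T x)) \<longleftrightarrow> integrable N (%x. g (wrap (T x)))" by (simp add: periodic_wrap[of g, OF per])
 also have "... \<longleftrightarrow> integrable (distr N borel (%x. wrap (T x))) g" using m1 g by (simp add: integrable_distr_eq)
 also have "... \<longleftrightarrow> integrable circ (%x. g (wrap x))" using m2 g by (simp add: * integrable_distr_eq)
 finally show "integrable N (%x. g (T x)) \<longleftrightarrow> integrable circ g" by (simp add: periodic_wrap[of g, OF per])
qed

lemma integral_circ_cis:
 "(CI x. cis (of_int k*x)) = (if k = 0 then cpx (2*pi) else 0)"
proof (cases "k = 0")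
 case True
 then show ?thesis by (simp add: measure_circ_space scaleR_conv_of_real)
next
 case False
 have "(CI x. cis (of_int k*x)) = (CI x. cis (of_int k*(x + pi/of_int k)))"
 proof (rule integral_periodic_transfer(1)[symmetric, where g = "%x. cis (of_int k*x)"])
  show "(%x. cis (of_int k*x)) \<in> bm borel"
   by (intro borel_measurable_continuous_onI) (auto intro!: continuous_intros)
  show "cis (of_int k*(x + 2*pi)) = cis (of_int k*x)" for x
  proof -
   have "cis (of_int k*(x + 2*pi)) = cis (of_int k*x)*cis (2*pi* of_int k)"
    by (simp add: cis_mult algebra_simps)
   then show ?thesis by simp
  qed
  show "(%x. x + pi/of_int k) \<in> measurable circ borel" by (rule measurable_circ) measurable
 qed (rule nn_integral_circ_shift)
 also have "... = (CI x. - cis (of_int k*x))"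
  using False by (intro Bochner_Integration.integral_cong refl) (simp add: distrib_left cis_mult[symmetric])
 finally have "(CI x. cis (of_int k*x)) = - (CI x. cis (of_int k*x))" by simp
 then show ?thesis using False by simp
qed

lemma integrable_circ_bounded:
 fixes f :: "real => 'b::{banach, second_countable_topology}"
 assumes "f \<in> bm circ" "!!x. norm (f x) <= B"
 shows "integrable circ f"
 using assms by (intro circ.integrable_const_bound[where B = B]) auto

lemma integral_circ_trig_prod:
 fixes z w :: "nat => complex"
 shows "(CI x. (\<Sum>k=1..n. z k*cis (real k*x))*cnj (\<Sum>k=1..n. w k*cis (real k*x)))
  = 2*pi*(\<Sum>k=1..n. z k*cnj (w k))"
proof -
 have m: "(%x. cis (c*x)) \<in> bm circ" for c
  by (intro measurable_circ borel_measurable_continuous_onI) (auto intro!: continuous_intros)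
 have i: "integrable circ (%x. cis (c*x))" for c
  by (rule integrable_circ_bounded[OF m, where B = 1]) simp
 have "(CI x. (\<Sum>k=1..n. z k*cis (real k*x))*cnj (\<Sum>k=1..n. w k*cis (real k*x)))
   = (CI x. (\<Sum>k=1..n. \<Sum>l=1..n. z k*cnj (w l)*cis (of_int (int k - int l)*x)))"
 proof (intro Bochner_Integration.integral_cong refl)
  fix x
  have "cis (real k*x)*cnj (cis (real l*x)) = cis (of_int (int k - int l)*x)" for k l
   by (simp add: cis_cnj cis_mult algebra_simps)
  then have *: "z k*cis (real k*x)*cnj (w l*cis (real l*x)) = z k*cnj (w l)*cis (of_int (int k - int l)*x)" for k l
   by (metis (no_types, opaque_lifting) complex_cnj_mult mult.assoc mult.left_commute)
  show "(\<Sum>k=1..n. z k*cis (real k*x))*cnj (\<Sum>k=1..n. w k*cis (real k*x)) =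
    (\<Sum>k=1..n. \<Sum>l=1..n. z k*cnj (w l)*cis (of_int (int k - int l)*x))"
   unfolding cnj_sum sum_product * by (rule refl)
 qed
 also have "... = (\<Sum>k=1..n. \<Sum>l=1..n. z k*cnj (w l)*(CI x. cis (of_int (int k - int l)*x)))"
  by (subst Bochner_Integration.integral_sum, intro Bochner_Integration.integrable_sum integrable_mult_right i)
   (subst Bochner_Integration.integral_sum, intro integrable_mult_right i, simp)
 also have "... = (\<Sum>k=1..n. \<Sum>l=1..n. if k = l then 2*pi*(z k*cnj (w l)) else 0)"
  by (intro sum.cong refl, subst integral_circ_cis) auto
 also have "... = 2*pi*(\<Sum>k=1..n. z k*cnj (w k))"
  by (simp add: sum.delta sum_distrib_left)
 finally show ?thesis .
qed

lemma integral_circ_parseval: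
 fixes z :: "nat => complex"
 shows "(CI x. (cmod (\<Sum>k=1..n. z k*cis (real k*x)))^2) = 2*pi*(\<Sum>k=1..n. (cmod (z k))^2)"
proof -
 have "cpx (CI x. (cmod (\<Sum>k=1..n. z k*cis (real k*x)))^2) =
   (CI x. (\<Sum>k=1..n. z k*cis (real k*x))*cnj (\<Sum>k=1..n. z k*cis (real k*x)))"
  by (simp only: integral_complex_of_real[symmetric] complex_norm_square)
 also have "... = cpx (2*pi*(\<Sum>k=1..n. (cmod (z k))^2))"
  unfolding integral_circ_trig_prod by (simp only: of_real_mult of_real_sum complex_norm_square of_real_numeral)
 finally show ?thesis by (simp only: of_real_eq_iff)
qed

section \<open>Linear forms in a pair of Gaussian sequences\<close>

definition pairing :: "(nat => real) => (nat => real) => nat => (nat => complex) => real" where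
 "pairing al be n z = (\<Sum>k=1..n. Re (z k)*al k + Im (z k)*be k)"

definition cov_form :: "(int => real) => nat => (nat => complex) => (nat => complex) => real" where
 "cov_form r n z w = (\<Sum>k=1..n. \<Sum>l=1..n. r (int k - int l)*Re (z k*cnj (w l)))"

text \<open>A named copy of the standard normal law, so that simplification does not unfold its density.\<close>

definition std_gauss :: "real measure" where "std_gauss = std_normal_distribution"

lemma prob_space_std_gauss: "prob_space std_gauss"
 unfolding std_gauss_def by (rule prob_space_normal_density) simp

lemma sets_std_gauss [simp, measurable_cong]: "sets std_gauss = sets borel"
 by (simp add: std_gauss_def)

lemma space_std_gauss [simp]: "space std_gauss = UNIV"
 by (simp add: std_gauss_def)

interpretation std_gauss: prob_space std_gauss by (rule prob_space_std_gauss)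

lemma char_std_gauss: "char std_gauss t = exp (- (t^2)/2)"
 by (simp add: std_gauss_def char_std_normal_distribution)

lemma gaussian_law_eq_distr:
 assumes "0 <= si"
 shows "gaussian_law m si = distr std_gauss borel (%y. m + si*y)"
proof (cases "si = 0")
 case True
 show ?thesis using True by (simp add: gaussian_law_def std_gauss.distr_const)
next
 case False
 have "distributed std_gauss lborel (%x. x) std_normal_density"
  by (auto simp: distributed_def distr_id2 std_gauss_def)
 from std_gauss.normal_density_affine[OF this, of si m] False assms
 have "distr std_gauss lborel (%x. m + si*x) = density lborel (normal_density m si)"
  by (simp add: distributed_def)
 moreover have "distr std_gauss borel (%x. m + si*x) = distr std_gauss lborel (%x. m + si*x)"
  by (rule distr_cong) auto
 ultimately show ?thesis using False by (simp add: gaussian_law_def)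
qed

lemma std_gauss_moments:
 shows "(\<integral>y. y \<partial>std_gauss) = 0" "(\<integral>y. y^2 \<partial>std_gauss) = 1" "(\<integral>y. y^4 \<partial>std_gauss) = 3"
  "integrable std_gauss (%y. y)" "integrable std_gauss (%y. y^k)"
 unfolding std_gauss_def
proof -
 show "(\<integral>y. y \<partial>std_normal_distribution) = 0" using integral_std_normal_distribution_moment_odd[of 1] by simp
 show "(\<integral>y. y^2 \<partial>std_normal_distribution) = 1"
  using std_normal_distribution_even_moments(1)[of 1] by (simp add: numeral_2_eq_2)
 show "(\<integral>y. y^4 \<partial>std_normal_distribution) = 3"
  using std_normal_distribution_even_moments(1)[of 2] by (simp add: fact_numeral)
 show "integrable std_normal_distribution (%y. y)" using integrable_std_normal_distribution_moment[of 1] by simp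
 show "integrable std_normal_distribution (%y. y^k)" by (rule integrable_std_normal_distribution_moment)
qed

lemma measurable_std_gauss: "f \<in> bm borel ==> f \<in> bm std_gauss"
 by measurable

context prob_space begin

lemma integral_via_distr:
 fixes g :: "real => 'c::{banach, second_countable_topology}"
 assumes "distr M borel X = distr std_gauss borel (%y. m + si*y)" "X \<in> bm M"
  and [measurable]: "g \<in> bm borel"
 shows "(\<integral>w. g (X w) \<partial>M) = (\<integral>y. g (m + si*y) \<partial>std_gauss)"
  and "integrable M (%w. g (X w)) \<longleftrightarrow> integrable std_gauss (%y. g (m + si*y))"
proof -
 have m: "(%y. m + si*y) \<in> measurable std_gauss borel" by (rule measurable_std_gauss) measurable
 show "(\<integral>w. g (X w) \<partial>M) = (\<integral>y. g (m + si*y) \<partial>std_gauss)"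
  using integral_distr[OF assms(2,3)] integral_distr[OF m assms(3)] assms(1) by simp
 show "integrable M (%w. g (X w)) \<longleftrightarrow> integrable std_gauss (%y. g (m + si*y))"
  using integrable_distr_eq[OF assms(2,3)] integrable_distr_eq[OF m assms(3)] assms(1) by simp
qed

lemma char_via_distr:
 assumes "distr M borel X = distr std_gauss borel (%y. si*y)" "X \<in> bm M"
 shows "char (distr M borel X) t = exp (- (t^2 * si^2)/2)"
proof -
 have m: "(%y. si*y) \<in> measurable std_gauss borel" by (rule measurable_std_gauss) measurable
 have "char (distr M borel X) t = (\<integral>y. iexp (t*(si*y)) \<partial>std_gauss)"
  unfolding assms(1) char_def by (subst integral_distr[OF m]) auto
 also have "... = char std_gauss (t * si)" by (simp add: char_def mult.assoc)
 finally show ?thesis by (simp add: char_std_gauss power_mult_distrib)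
qed

text \<open>A centred Gaussian variable has the law of its standard deviation times a standard normal one; this covers the degenerate case and turns moments and characteristic functions into integrals over \<open>std_gauss\<close>.\<close>

lemma centered_gaussian:
 assumes "gaussian_variable M X" "(\<integral>w. X w \<partial>M) = 0"
 shows "distr M borel X = distr std_gauss borel (%y. sqrt (\<integral>w. (X w)^2 \<partial>M)*y)"
  "X \<in> bm M"
  "integrable M (%w. (X w)^2)"
proof -
 from assms obtain m si where X: "X \<in> bm M" and si: "0 <= si"
  and d: "distr M borel X = distr std_gauss borel (%y. m + si*y)"
  by (auto simp: gaussian_variable_def gaussian_law_eq_distr)
 have "(\<integral>w. X w \<partial>M) = m"
  using integral_via_distr(1)[OF d X, of "%x. x"] std_gauss.prob_space
  by (simp add: std_gauss_moments)
 then have m: "m = 0" using assms(2) by simp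
 have "(\<integral>w. (X w)^2 \<partial>M) = si^2"
  using integral_via_distr(1)[OF d X, of "%x. x^2"] m
  by (simp add: power_mult_distrib std_gauss_moments)
 then have s: "sqrt (\<integral>w. (X w)^2 \<partial>M) = si" using si by simp
 show "distr M borel X = distr std_gauss borel (%y. sqrt (\<integral>w. (X w)^2 \<partial>M)*y)"
  unfolding s using d m by simp
 show "X \<in> bm M" by fact
 show "integrable M (%w. (X w)^2)"
  using integral_via_distr(2)[OF d X, of "%x. x^2"] std_gauss_moments(5)[of 2] m
  by (simp add: power_mult_distrib)
qed

lemma integrable_prod_square:
 fixes X Y :: "'a => real"
 assumes [measurable]: "X \<in> bm M" "Y \<in> bm M"
  and "integrable M (%w. (X w)^2)" "integrable M (%w. (Y w)^2)"
 shows "integrable M (%w. X w*Y w)"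
proof (rule Bochner_Integration.integrable_bound)
 show "integrable M (%w. (X w)^2 + (Y w)^2)" using assms by simp
 have "\<bar>x*y\<bar> <= x^2 + y^2" for x y :: real
 proof -
  have "0 <= (\<bar>x\<bar> - \<bar>y\<bar>)^2" by simp
  then have "2*(\<bar>x\<bar>*\<bar>y\<bar>) <= x^2 + y^2" by (simp add: power2_diff)
  moreover have "0 <= \<bar>x\<bar>*\<bar>y\<bar>" by simp
  ultimately show ?thesis unfolding abs_mult by linarith
 qed
 then show "AE w in M. norm (X w*Y w) <= norm ((X w)^2 + (Y w)^2)" by (simp add: abs_mult[symmetric])
qed measurable

end

locale gauss_pair = prob_space M for M :: "'w measure" +
 fixes a b :: "nat => 'w => real" and r :: "int => real"
 assumes gaussian: "gaussian_process M {1..} a" "gaussian_process M {1..} b"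
  and centered: "!!k. 1 <= k ==> (\<integral>wo. a k wo \<partial>M) = 0" "!!k. 1 <= k ==> (\<integral>wo. b k wo \<partial>M) = 0"
  and covariance: "!!k l. 1 <= k ==> 1 <= l ==> (\<integral>wo. a k wo*a l wo \<partial>M) = r (int k - int l)"
   "!!k l. 1 <= k ==> 1 <= l ==> (\<integral>wo. b k wo*b l wo \<partial>M) = r (int k - int l)"
  and indep: "independent_sequences M a b"
  and r_sym: "!!j. r (- j) = r j"
begin

definition lin :: "nat => (nat => complex) => 'w => real" where
 "lin n z wo = pairing (%k. a k wo) (%k. b k wo) n z"

abbreviation cov :: "nat => (nat => complex) => (nat => complex) => real" where
 "cov \<equiv> cov_form r"

lemma half_sum:
 assumes X: "gaussian_process M {1..} X" and c: "!!k. 1 <= k ==> (\<integral>w. X k w \<partial>M) = 0"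
  and cv: "!!k l. 1 <= k ==> 1 <= l ==> (\<integral>w. X k w*X l w \<partial>M) = r (int k - int l)"
 shows "gaussian_variable M (%w. \<Sum>k=1..n. c k*X k w)"
  "(\<integral>w. (\<Sum>k=1..n. c k*X k w) \<partial>M) = 0"
  "(\<integral>w. (\<Sum>k=1..n. c k*X k w)^2 \<partial>M) = (\<Sum>k=1..n. \<Sum>l=1..n. c k*c l*r (int k - int l))"
  "!!k. 1 <= k ==> X k \<in> bm M"
proof -
 show g: "gaussian_variable M (%w. \<Sum>k=1..n. c k*X k w)" for n c
  using X unfolding gaussian_process_def by (elim allE[of _ "{1..n}"]) auto
 have g1: "gaussian_variable M (X k)" if "1 <= k" for k
  using X[unfolded gaussian_process_def, rule_format, of "{k}" "%_. 1"] that by simp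
 note sq = centered_gaussian[OF g1 c]
 show m: "!!k. 1 <= k ==> X k \<in> bm M" using sq by blast
 have i2: "integrable M (%w. X k w*X l w)" if "1 <= k" "1 <= l" for k l
  using that sq by (intro integrable_prod_square) auto
 have i1: "integrable M (X k)" if "1 <= k" for k
  using integrable_prod_square[of "X k" "%_. 1"] that sq by auto
 show "(\<integral>w. (\<Sum>k=1..n. c k*X k w) \<partial>M) = 0"
  using i1 c by (subst Bochner_Integration.integral_sum) auto
 have "(\<integral>w. (\<Sum>k=1..n. c k*X k w)^2 \<partial>M) = (\<integral>w. (\<Sum>k=1..n. \<Sum>l=1..n. c k*c l*(X k w*X l w)) \<partial>M)"
  by (simp add: power2_eq_square sum_product mult_ac)
 also have "... = (\<Sum>k=1..n. \<Sum>l=1..n. c k*c l*(\<integral>w. X k w*X l w \<partial>M))"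
 proof -
  have i3: "integrable M (%w. c k*c l*(X k w*X l w))" if "k \<in> {1..n}" "l \<in> {1..n}" for k l
   using that by (intro integrable_mult_right i2) auto
  show ?thesis
   by (subst Bochner_Integration.integral_sum, intro Bochner_Integration.integrable_sum i3, assumption+,
     intro sum.cong refl, subst Bochner_Integration.integral_sum, intro i3, assumption+, simp)
 qed
 also have "... = (\<Sum>k=1..n. \<Sum>l=1..n. c k*c l*r (int k - int l))"
  using cv by (intro sum.cong refl) auto
 finally show "(\<integral>w. (\<Sum>k=1..n. c k*X k w)^2 \<partial>M) = (\<Sum>k=1..n. \<Sum>l=1..n. c k*c l*r (int k - int l))" .
qed

lemma ab_measurable [measurable]:
 "1 <= k ==> a k \<in> bm M" "1 <= k ==> b k \<in> bm M"
 using half_sum(4)[OF gaussian(1) centered(1) covariance(1)] half_sum(4)[OF gaussian(2) centered(2) covariance(2)]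
 by auto

lemma lin_split: "lin n z = (%w. (\<Sum>k=1..n. Re (z k)*a k w) + (\<Sum>k=1..n. Im (z k)*b k w))"
 by (simp add: lin_def[abs_def] pairing_def sum.distrib)

lemma lin_measurable [measurable]: "lin n z \<in> bm M"
 unfolding lin_split by (intro borel_measurable_add borel_measurable_sum borel_measurable_times) auto

lemma cov_split:
 "cov n z z = (\<Sum>k=1..n. \<Sum>l=1..n. Re (z k)*Re (z l)*r (int k - int l)) +
   (\<Sum>k=1..n. \<Sum>l=1..n. Im (z k)*Im (z l)*r (int k - int l))"
 unfolding cov_form_def sum.distrib[symmetric]
 by (intro sum.cong refl) (simp add: algebra_simps)

text \<open>Independence of the two sequences makes the characteristic function of a linear form a product of two Gaussian ones.\<close>

lemma lin_distr_aux:
 shows "distr M borel (lin n z) = distr std_gauss borel (%y. sqrt (cov n z z)*y)"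
  and cov_nonneg: "0 <= cov n z z"
proof -
 define A where "A = (%w. \<Sum>k=1..n. Re (z k)*a k w)"
 define B where "B = (%w. \<Sum>k=1..n. Im (z k)*b k w)"
 define va where "va = (\<integral>w. (A w)^2 \<partial>M)"
 define vb where "vb = (\<integral>w. (B w)^2 \<partial>M)"
 note ha = half_sum(1-3)[OF gaussian(1) centered(1) covariance(1), where n = n and c = "%k. Re (z k)"]
 note hb = half_sum(1-3)[OF gaussian(2) centered(2) covariance(2), where n = n and c = "%k. Im (z k)"]
 have cov: "cov n z z = va + vb" unfolding cov_split va_def vb_def A_def B_def using ha(3) hb(3) by simp
 have "0 <= va" "0 <= vb" unfolding va_def vb_def by simp_all
 then show nn: "0 <= cov n z z" unfolding cov by simp
 have da: "distr M borel A = distr std_gauss borel (%y. sqrt va*y)" and ma [measurable]: "A \<in> bm M"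
  using centered_gaussian[OF ha(1,2)] unfolding A_def va_def by simp_all
 have db: "distr M borel B = distr std_gauss borel (%y. sqrt vb*y)" and mb [measurable]: "B \<in> bm M"
  using centered_gaussian[OF hb(1,2)] unfolding B_def vb_def by simp_all
 have "indep_var borel ((%f. \<Sum>k=1..n. Re (z k)*f k) \<circ> (%w. \<lambda>k\<in>{1..}. a k w))
   borel ((%f. \<Sum>k=1..n. Im (z k)*f k) \<circ> (%w. \<lambda>k\<in>{1..}. b k w))"
  using indep unfolding independent_sequences_def
  by (rule indep_var_compose) (auto intro!: borel_measurable_sum borel_measurable_times measurable_component_singleton)
 then have ind: "indep_var borel A borel B" by (simp add: A_def B_def comp_def)
 have l: "lin n z = (%w. A w + B w)" unfolding lin_split A_def B_def ..
 have m: "(%y. sqrt (cov n z z)*y) \<in> measurable std_gauss borel" by (rule measurable_std_gauss) measurable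
 show "distr M borel (lin n z) = distr std_gauss borel (%y. sqrt (cov n z z)*y)"
 proof (rule Levy_uniqueness)
  show "real_distribution (distr M borel (lin n z))" by simp
  show "real_distribution (distr std_gauss borel (%y. sqrt (cov n z z)*y))" using m by (rule std_gauss.real_distribution_distr)
  show "char (distr M borel (lin n z)) = char (distr std_gauss borel (%y. sqrt (cov n z z)*y))"
  proof
   fix t
   have "char (distr M borel (lin n z)) t = char (distr M borel A) t*char (distr M borel B) t"
    unfolding l by (rule char_distr_add[OF ind])
   also have "... = exp (- (t^2*cov n z z)/2)"
    unfolding char_via_distr[OF da ma] char_via_distr[OF db mb] cov
    using \<open>0 <= va\<close> \<open>0 <= vb\<close> by (simp add: exp_of_real[symmetric] exp_add[symmetric] field_simps)
   also have "... = char (distr std_gauss borel (%y. sqrt (cov n z z)*y)) t"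
    using std_gauss.char_via_distr[OF refl m] nn by simp
   finally show "char (distr M borel (lin n z)) t = char (distr std_gauss borel (%y. sqrt (cov n z z)*y)) t" .
  qed
 qed
qed

lemma lin_distr: "distr M borel (lin n z) = distr std_gauss borel (%y. 0 + sqrt (cov n z z)*y)"
 using lin_distr_aux by simp

lemma lin_char: "(\<integral>w. iexp (lin n z w) \<partial>M) = cpx (exp (- cov n z z/2))"
 using char_via_distr[OF lin_distr_aux(1)[of n z] lin_measurable, of 1] cov_nonneg[of n z]
 by (simp add: char_def integral_distr)

lemma lin_moments:
 "(\<integral>w. (lin n z w)^2 \<partial>M) = cov n z z"
 "(\<integral>w. (lin n z w)^4 \<partial>M) = 3*(cov n z z)^2"
 "integrable M (%w. (lin n z w)^k)"
proof -
 show "(\<integral>w. (lin n z w)^2 \<partial>M) = cov n z z"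
  using integral_via_distr(1)[OF lin_distr lin_measurable, of "%x. x^2" n z] cov_nonneg[of n z]
  by (simp add: power_mult_distrib std_gauss_moments)
 have "sqrt c ^ 4 = c^2" if "0 <= c" for c :: real
  using that by (metis numeral_Bit0 power_add power2_eq_square real_sqrt_pow2 mult_2)
 then show "(\<integral>w. (lin n z w)^4 \<partial>M) = 3*(cov n z z)^2"
  using integral_via_distr(1)[OF lin_distr lin_measurable, of "%x. x^4" n z] cov_nonneg[of n z]
  by (simp add: power_mult_distrib std_gauss_moments)
 show "integrable M (%w. (lin n z w)^k)"
  using integral_via_distr(2)[OF lin_distr lin_measurable, of "%x. x^k" n z]
  by (simp add: power_mult_distrib std_gauss_moments)
qed

lemma lin_add: "lin n (%k. z k + w k) wo = lin n z wo + lin n w wo"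
 by (simp add: lin_def pairing_def sum.distrib[symmetric] algebra_simps)

lemma lin_diff: "lin n (%k. z k - w k) wo = lin n z wo - lin n w wo"
 by (simp add: lin_def pairing_def sum_subtractf[symmetric] algebra_simps)

lemma cov_sym: "cov n z w = cov n w z"
proof -
 have "cov n z w = (\<Sum>l=1..n. \<Sum>k=1..n. r (int k - int l)*Re (z k*cnj (w l)))"
  unfolding cov_form_def by (rule sum.swap)
 also have "... = cov n w z"
  unfolding cov_form_def
 proof (intro sum.cong refl)
  fix k l
  have "r (int l - int k) = r (int k - int l)" using r_sym[of "int l - int k"] by simp
  then show "r (int l - int k)*Re (z l*cnj (w k)) = r (int k - int l)*Re (w k*cnj (z l))" by simp
 qed
 finally show ?thesis .
qed

lemma cov_add: "cov n (%k. z k + w k) (%k. z k + w k) = cov n z z + cov n w w + 2*cov n z w"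
proof -
 have "cov n (%k. z k + w k) (%k. z k + w k) = cov n z z + cov n w w + cov n z w + cov n w z"
  unfolding cov_form_def sum.distrib[symmetric] by (intro sum.cong refl) (simp add: algebra_simps)
 then show ?thesis using cov_sym[of n w z] by simp
qed

lemma cov_diff: "cov n (%k. z k - w k) (%k. z k - w k) = cov n z z + cov n w w - 2*cov n z w"
proof -
 have "cov n (%k. z k - w k) (%k. z k - w k) = cov n z z + cov n w w - cov n z w - cov n w z"
  unfolding cov_form_def sum.distrib[symmetric] sum_subtractf[symmetric]
  by (intro sum.cong refl) (simp add: algebra_simps)
 then show ?thesis using cov_sym[of n w z] by simp
qed

text \<open>Isserlis formula for two squares, by polarisation: \<open>X^2 Y^2\<close> is a combination of the fourth powers of \<open>X + Y\<close>, \<open>X - Y\<close>, \<open>X\<close> and \<open>Y\<close>, and each of these linear forms is Gaussian.\<close>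

lemma lin_product_squares:
 shows "(\<integral>wo. (lin n z wo)^2*(lin n w wo)^2 \<partial>M) = cov n z z*cov n w w + 2*(cov n z w)^2"
  and "integrable M (%wo. (lin n z wo)^2*(lin n w wo)^2)"
proof -
 let ?p = "%k. z k + w k" and ?m = "%k. z k - w k"
 have eq: "(lin n z wo)^2*(lin n w wo)^2 =
   (lin n ?p wo ^ 4 + lin n ?m wo ^ 4 - 2*lin n z wo ^ 4 - 2*lin n w wo ^ 4)/12" for wo
  unfolding lin_add lin_diff by (simp add: power4_eq_xxxx power2_eq_square algebra_simps)
 show "integrable M (%wo. (lin n z wo)^2*(lin n w wo)^2)"
  unfolding eq by (intro integrable_divide Bochner_Integration.integrable_diff Bochner_Integration.integrable_add integrable_mult_right lin_moments)
 show "(\<integral>wo. (lin n z wo)^2*(lin n w wo)^2 \<partial>M) = cov n z z*cov n w w + 2*(cov n z w)^2"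
  unfolding eq using lin_moments(3)[of n ?p 4] lin_moments(3)[of n ?m 4] lin_moments(3)[of n z 4] lin_moments(3)[of n w 4]
  by (simp add: lin_moments(2) cov_add cov_diff cov_sym[of n w z] power2_eq_square algebra_simps)
qed

end

section \<open>Concentration of averages over a parameter\<close>

text \<open>The variance of a parameter average is the double average of the covariances, so a pointwise covariance bound suffices.\<close>

lemma (in prob_space) second_moment_average:
 fixes g :: "'a => 'p => complex"
 assumes nu: "finite_measure mz"
  and gm: "(%x. g (fst x) (snd x)) \<in> bm (M \<Otimes>\<^sub>M mz)"
  and gi: "!!wo. wo \<in> space M ==> integrable mz (g wo)"
  and gg: "integrable (M \<Otimes>\<^sub>M (mz \<Otimes>\<^sub>M mz)) (%(wo, x). g wo (fst x)*cnj (g wo (snd x)))"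
  and K: "!!p q. cmod (\<integral>wo. g wo p*cnj (g wo q) \<partial>M) <= K p q"
 shows "(\<integral>\<^sup>+wo. ennreal ((cmod (\<integral>p. g wo p \<partial>mz))^2) \<partial>M) <= (\<integral>\<^sup>+p. \<integral>\<^sup>+q. ennreal (K p q) \<partial>mz \<partial>mz)"
proof -
 interpret mz: finite_measure mz by fact
 interpret nn: pair_sigma_finite mz mz ..
 interpret P: pair_sigma_finite M "mz \<Otimes>\<^sub>M mz"
  by (intro pair_sigma_finite.intro sigma_finite_measure_axioms nn.sigma_finite_measure_axioms)
 define f where "f = (%wo x. g wo (fst x)*cnj (g wo (snd x)))"
 have fi: "integrable (M \<Otimes>\<^sub>M (mz \<Otimes>\<^sub>M mz)) (%(wo, x). f wo x)" using gg unfolding f_def .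
 have sq: "cpx ((cmod (\<integral>p. g wo p \<partial>mz))^2) = (\<integral>x. f wo x \<partial>(mz \<Otimes>\<^sub>M mz))" if w: "wo \<in> space M" for wo
 proof -
  have i1: "integrable mz (g wo)" using gi w .
  have i2: "integrable mz (%q. cnj (g wo q))" using i1 by simp
  have prod: "integrable (mz \<Otimes>\<^sub>M mz) (%(p, q). g wo p*cnj (g wo q))"
  proof (rule nn.Fubini_integrable)
   show "(%(p, q). g wo p*cnj (g wo q)) \<in> bm (mz \<Otimes>\<^sub>M mz)"
    using borel_measurable_integrable[OF i1] borel_measurable_integrable[OF i2] by measurable
   show "integrable mz (%p. \<integral>q. norm (case (p, q) of (p, q) => g wo p*cnj (g wo q)) \<partial>mz)"
    using i1 by (simp add: norm_mult)
   show "AE p in mz. integrable mz (%q. case (p, q) of (p, q) => g wo p*cnj (g wo q))"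
    using i2 by simp
  qed
  have "(\<integral>x. f wo x \<partial>(mz \<Otimes>\<^sub>M mz)) = (\<integral>p. \<integral>q. g wo p*cnj (g wo q) \<partial>mz \<partial>mz)"
   using nn.integral_fst'[OF prod] by (simp add: f_def case_prod_unfold)
  also have "... = (\<integral>p. g wo p \<partial>mz)*cnj (\<integral>p. g wo p \<partial>mz)" by (simp add: i1 i2)
  finally show ?thesis by (simp only: complex_norm_square)
 qed
 have Fi: "integrable M (%wo. \<integral>x. f wo x \<partial>(mz \<Otimes>\<^sub>M mz))"
  using P.integrable_fst'[OF fi] by simp
 then have Fi': "integrable M (%wo. cpx ((cmod (\<integral>p. g wo p \<partial>mz))^2))"
  by (subst Bochner_Integration.integrable_cong[OF refl sq])
 then have ri: "integrable M (%wo. (cmod (\<integral>p. g wo p \<partial>mz))^2)"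
  using integrable_Re[OF Fi'] by simp
 define E where "E = (%x. \<integral>wo. f wo x \<partial>M)"
 have Ei: "integrable (mz \<Otimes>\<^sub>M mz) E" unfolding E_def by (rule P.integrable_snd[OF fi])
 have "cpx (\<integral>wo. (cmod (\<integral>p. g wo p \<partial>mz))^2 \<partial>M) = (\<integral>wo. \<integral>x. f wo x \<partial>(mz \<Otimes>\<^sub>M mz) \<partial>M)"
  unfolding integral_complex_of_real[symmetric] by (rule Bochner_Integration.integral_cong[OF refl sq])
 also have "... = (\<integral>x. E x \<partial>(mz \<Otimes>\<^sub>M mz))" unfolding E_def by (rule P.Fubini_integral[OF fi, symmetric])
 finally have "\<bar>\<integral>wo. (cmod (\<integral>p. g wo p \<partial>mz))^2 \<partial>M\<bar> = cmod (\<integral>x. E x \<partial>(mz \<Otimes>\<^sub>M mz))"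
  by (metis norm_of_real)
 then have le: "(\<integral>wo. (cmod (\<integral>p. g wo p \<partial>mz))^2 \<partial>M) <= (\<integral>x. cmod (E x) \<partial>(mz \<Otimes>\<^sub>M mz))"
  using integral_norm_bound[of "mz \<Otimes>\<^sub>M mz" E] by linarith
 have "(\<integral>\<^sup>+wo. ennreal ((cmod (\<integral>p. g wo p \<partial>mz))^2) \<partial>M) = ennreal (\<integral>wo. (cmod (\<integral>p. g wo p \<partial>mz))^2 \<partial>M)"
  by (rule nn_integral_eq_integral[OF ri]) simp
 also have "... <= ennreal (\<integral>x. cmod (E x) \<partial>(mz \<Otimes>\<^sub>M mz))" using le by (rule ennreal_leI)
 also have "... = (\<integral>\<^sup>+x. ennreal (cmod (E x)) \<partial>(mz \<Otimes>\<^sub>M mz))"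
  using Ei by (intro nn_integral_eq_integral[symmetric]) auto
 also have "... = (\<integral>\<^sup>+p. \<integral>\<^sup>+q. ennreal (cmod (E (p, q))) \<partial>mz \<partial>mz)"
  using borel_measurable_integrable[OF Ei] by (intro mz.nn_integral_fst[symmetric]) measurable
 also have "... <= (\<integral>\<^sup>+p. \<integral>\<^sup>+q. ennreal (K p q) \<partial>mz \<partial>mz)"
  using K by (intro nn_integral_mono ennreal_leI) (simp add: E_def f_def)
 finally show ?thesis .
qed

lemma exp_diff_bound:
 fixes c s :: real
 assumes "\<bar>c\<bar> <= s"
 shows "\<bar>exp (- (s - c)) - exp (- s)\<bar> <= \<bar>c\<bar>"
proof (cases "c \<ge> 0")
 case True
 have "exp (- (s - c)) - exp (- s) = exp (- (s - c))*(1 - exp (- c))"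
  by (simp add: algebra_simps exp_add[symmetric])
 moreover have "1 - exp (- c) <= c" using exp_ge_add_one_self[of "-c"] by linarith
 moreover have "0 <= 1 - exp (-c)" using True by simp
 moreover have "exp (- (s - c)) <= 1" using assms by simp
 ultimately show ?thesis
  using True mult_mono[of "exp (- (s - c))" 1 "1 - exp (-c)" c] by (simp add: abs_mult)
next
 case False
 have "exp (- s) - exp (- (s - c)) = exp (- s)*(1 - exp c)"
  by (simp add: algebra_simps exp_add[symmetric])
 moreover have "1 - exp c <= - c" using exp_ge_add_one_self[of c] by linarith
 moreover have "0 <= 1 - exp c" using False by simp
 moreover have "exp (- s) <= 1" using assms by simp
 ultimately have "exp (- s) - exp (- (s - c)) <= - c" "0 <= exp (- s) - exp (- (s - c))"
  using False mult_mono[of "exp (- s)" 1 "1 - exp c" "-c"] by simp_all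
 then show ?thesis using False by linarith
qed

context gauss_pair begin

lemma lin_measurable_pair:
 assumes z: "!!k. (%p. z p k) \<in> bm mz"
 shows "(%x. lin n (z (snd x)) (fst x)) \<in> bm (M \<Otimes>\<^sub>M mz)"
 unfolding lin_def pairing_def
proof (intro borel_measurable_sum borel_measurable_add borel_measurable_times)
 fix k assume k: "k \<in> {1..n}"
 have [measurable]: "(%p. Re (z p k)) \<in> bm mz" "(%p. Im (z p k)) \<in> bm mz"
  using z[of k] by simp_all
 have [measurable]: "a k \<in> bm M" "b k \<in> bm M" using k ab_measurable by auto
 show "(%x. Re (z (snd x) k)) \<in> bm (M \<Otimes>\<^sub>M mz)" by measurable
 show "(%x. Im (z (snd x) k)) \<in> bm (M \<Otimes>\<^sub>M mz)" by measurable
 show "(%x. a k (fst x)) \<in> bm (M \<Otimes>\<^sub>M mz)" by measurable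
 show "(%x. b k (fst x)) \<in> bm (M \<Otimes>\<^sub>M mz)" by measurable
qed

lemma cov_measurable:
 assumes z: "!!k. (%p. z p k) \<in> bm mz" and w: "!!k. (%p. w p k) \<in> bm mz"
 shows "(%p. cov n (z p) (w p)) \<in> bm mz"
proof -
 have "(%p. Re (z p k*cnj (w p l))) \<in> bm mz" for k l
 proof -
  have "(%p. Re (z p k)*Re (w p l) + Im (z p k)*Im (w p l)) \<in> bm mz"
   using z[of k] w[of l] by (intro borel_measurable_add borel_measurable_times) simp_all
  then show ?thesis by simp
 qed
 then show ?thesis unfolding cov_form_def by (intro borel_measurable_sum borel_measurable_times) auto
qed

lemma cov_bound: "\<bar>cov n z w\<bar> <= (cov n z z + cov n w w)/2"
proof -
 have "0 <= cov n z z + cov n w w + 2*cov n z w" "0 <= cov n z z + cov n w w - 2*cov n z w"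
  using cov_nonneg[of n "%k. z k + w k"] cov_nonneg[of n "%k. z k - w k"] by (simp_all add: cov_add cov_diff)
 then show ?thesis by (simp add: abs_le_iff)
qed

lemma integral_exp_lin_diff:
 "(\<integral>wo. iexp (lin n z wo)*cnj (iexp (lin n w wo)) \<partial>M)
  = cpx (exp (- ((cov n z z + cov n w w)/2 - cov n z w)))"
proof -
 have "iexp (lin n z wo)*cnj (iexp (lin n w wo)) =
   iexp (lin n (%k. z k - w k) wo)" for wo
  unfolding lin_diff by (simp add: exp_cnj exp_add[symmetric] algebra_simps)
 then show ?thesis by (simp add: lin_char cov_diff field_simps)
qed

text \<open>For jointly Gaussian \<open>X\<close>, \<open>Y\<close> the covariance of \<open>exp(iX)\<close> and \<open>exp(iY)\<close> is at most the absolute covariance of \<open>X\<close> and \<open>Y\<close>, uniformly in the variances.\<close>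

lemma concentration_char:
 assumes nu: "finite_measure mz" and z: "!!k. (%p. z p k) \<in> bm mz"
 shows "(\<integral>\<^sup>+wo. ennreal ((cmod ((\<integral>p. iexp (lin n (z p) wo) \<partial>mz)
      - cpx (\<integral>p. exp (- cov n (z p) (z p)/2) \<partial>mz)))^2) \<partial>M)
     <= (\<integral>\<^sup>+p. \<integral>\<^sup>+q. ennreal \<bar>cov n (z p) (z q)\<bar> \<partial>mz \<partial>mz)"
proof -
 interpret mz: finite_measure mz by fact
 interpret nn: finite_measure "mz \<Otimes>\<^sub>M mz" by (rule finite_measure_pair_measure[OF nu nu])
 interpret P: finite_measure "M \<Otimes>\<^sub>M (mz \<Otimes>\<^sub>M mz)"
  by (rule finite_measure_pair_measure[OF nn.finite_measure_axioms finite_measure_axioms])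
 define e where "e = (%wo p. iexp (lin n (z p) wo))"
 define c where "c = (%p. cpx (exp (- cov n (z p) (z p)/2)))"
 define g where "g = (%wo p. e wo p - c p)"
 have lm [measurable]: "(%x. lin n (z (snd x)) (fst x)) \<in> bm (M \<Otimes>\<^sub>M mz)"
  by (rule lin_measurable_pair[OF z])
 have cm [measurable]: "(%p. cov n (z p) (z p)) \<in> bm mz" by (rule cov_measurable[OF z z])
 have em [measurable]: "(%x. e (fst x) (snd x)) \<in> bm (M \<Otimes>\<^sub>M mz)"
  unfolding e_def by measurable
 have c'm [measurable]: "c \<in> bm mz" unfolding c_def by measurable
 have gm [measurable]: "(%x. g (fst x) (snd x)) \<in> bm (M \<Otimes>\<^sub>M mz)"
  unfolding g_def by measurable
 have em1 [measurable]: "e wo \<in> bm mz" if "wo \<in> space M" for wo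
  using measurable_Pair2[OF em that] by simp
 have em2: "(%wo. e wo p) \<in> bm M" for p unfolding e_def by measurable
 have e1: "cmod (e wo p) = 1" for wo p unfolding e_def by (simp add: norm_exp_i_times)
 have c1: "cmod (c p) <= 1" for p unfolding c_def using cov_nonneg by simp
 have g2: "cmod (g wo p) <= 2" for wo p
  unfolding g_def using norm_triangle_ineq4[of "e wo p" "c p"] e1[of wo p] c1[of p] by linarith
 have ei: "integrable mz (e wo)" if "wo \<in> space M" for wo
  using e1 by (intro mz.integrable_const_bound[where B = 1] em1 that) auto
 have ci: "integrable mz c" using c1 by (intro mz.integrable_const_bound[where B = 1]) auto
 have "(\<integral>p. iexp (lin n (z p) wo) \<partial>mz)
      - cpx (\<integral>p. exp (- cov n (z p) (z p)/2) \<partial>mz) = (\<integral>p. g wo p \<partial>mz)"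
  if "wo \<in> space M" for wo
 proof -
  have "cpx (\<integral>p. exp (- cov n (z p) (z p)/2) \<partial>mz) = (\<integral>p. c p \<partial>mz)"
   unfolding c_def integral_complex_of_real ..
  then show ?thesis using ei[OF that] ci by (simp add: g_def e_def)
 qed
 then have "(\<integral>\<^sup>+wo. ennreal ((cmod ((\<integral>p. iexp (lin n (z p) wo) \<partial>mz)
      - cpx (\<integral>p. exp (- cov n (z p) (z p)/2) \<partial>mz)))^2) \<partial>M)
   = (\<integral>\<^sup>+wo. ennreal ((cmod (\<integral>p. g wo p \<partial>mz))^2) \<partial>M)"
  by (intro nn_integral_cong) simp
 also have "... <= (\<integral>\<^sup>+p. \<integral>\<^sup>+q. ennreal \<bar>cov n (z p) (z q)\<bar> \<partial>mz \<partial>mz)"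
 proof (rule second_moment_average[OF nu gm])
  fix wo assume w: "wo \<in> space M"
  show "integrable mz (g wo)" unfolding g_def using ei[OF w] ci by (rule Bochner_Integration.integrable_diff)
 next
  have m1: "(%x. g (fst x) (fst (snd x))) \<in> bm (M \<Otimes>\<^sub>M (mz \<Otimes>\<^sub>M mz))"
  proof -
   have "(%x. (fst x, fst (snd x))) \<in> measurable (M \<Otimes>\<^sub>M (mz \<Otimes>\<^sub>M mz)) (M \<Otimes>\<^sub>M mz)" by measurable
   from measurable_compose[OF this gm] show ?thesis by simp
  qed
  have m2: "(%x. g (fst x) (snd (snd x))) \<in> bm (M \<Otimes>\<^sub>M (mz \<Otimes>\<^sub>M mz))"
  proof -
   have "(%x. (fst x, snd (snd x))) \<in> measurable (M \<Otimes>\<^sub>M (mz \<Otimes>\<^sub>M mz)) (M \<Otimes>\<^sub>M mz)" by measurable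
   from measurable_compose[OF this gm] show ?thesis by simp
  qed
  have m2': "(%x. cnj (g (fst x) (snd (snd x)))) \<in> bm (M \<Otimes>\<^sub>M (mz \<Otimes>\<^sub>M mz))"
   using measurable_compose[OF m2, of cnj borel] by (simp add: borel_measurable_continuous_onI continuous_on_cnj)
  show "integrable (M \<Otimes>\<^sub>M (mz \<Otimes>\<^sub>M mz)) (%(wo, x). g wo (fst x)*cnj (g wo (snd x)))"
  proof (rule P.integrable_const_bound[where B = 4])
   show "(%(wo, x). g wo (fst x)*cnj (g wo (snd x))) \<in> bm (M \<Otimes>\<^sub>M (mz \<Otimes>\<^sub>M mz))"
    unfolding case_prod_unfold by (intro borel_measurable_times m1 m2')
   show "AE x in M \<Otimes>\<^sub>M (mz \<Otimes>\<^sub>M mz). norm (case x of (wo, x) => g wo (fst x)*cnj (g wo (snd x))) <= 4"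
    using mult_mono[OF g2 g2] by (intro AE_I2) (auto simp: norm_mult case_prod_unfold)
  qed
 next
  fix p q
  have ee: "(\<integral>wo. e wo p*cnj (e wo q) \<partial>M) = cpx (exp (- ((cov n (z p) (z p) + cov n (z q) (z q))/2 - cov n (z p) (z q))))"
   unfolding e_def by (rule integral_exp_lin_diff)
  have e': "(\<integral>wo. e wo p \<partial>M) = c p" for p unfolding e_def c_def by (rule lin_char)
  have cc: "cnj (c p) = c p" for p by (simp add: c_def)
  have ie: "integrable M (%wo. e wo p)" for p
   using e1 em2 by (intro integrable_const_bound[where B = 1]) auto
  have iec: "integrable M (%wo. cnj (e wo p))" for p using ie[of p] by simp
  have iee: "integrable M (%wo. e wo p*cnj (e wo q))"
  proof (rule integrable_const_bound[where B = 1])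
   show "(%wo. e wo p*cnj (e wo q)) \<in> bm M"
    using borel_measurable_integrable[OF ie] borel_measurable_integrable[OF iec] by (rule borel_measurable_times)
  qed (use e1 in \<open>auto simp: norm_mult\<close>)
  have "(\<integral>wo. g wo p*cnj (g wo q) \<partial>M) = (\<integral>wo. e wo p*cnj (e wo q) - e wo p*c q - c p*cnj (e wo q) + c p*c q \<partial>M)"
   by (simp add: g_def cc algebra_simps)
  also have "... = (\<integral>wo. e wo p*cnj (e wo q) \<partial>M) - (\<integral>wo. e wo p \<partial>M)*c q - c p*cnj (\<integral>wo. e wo q \<partial>M) + c p*c q"
   using iee ie iec by (simp add: prob_space)
  also have "... = cpx (exp (- ((cov n (z p) (z p) + cov n (z q) (z q))/2 - cov n (z p) (z q))) - exp (- ((cov n (z p) (z p) + cov n (z q) (z q))/2)))"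
  proof -
   have "c p*c q = cpx (exp (- ((cov n (z p) (z p) + cov n (z q) (z q))/2)))"
    unfolding c_def of_real_mult[symmetric] exp_add[symmetric] by (simp add: field_simps)
   then show ?thesis unfolding ee e' cc of_real_diff by simp
  qed
  finally have eq: "(\<integral>wo. g wo p*cnj (g wo q) \<partial>M) = ..." .
  show "cmod (\<integral>wo. g wo p*cnj (g wo q) \<partial>M) <= \<bar>cov n (z p) (z q)\<bar>"
   unfolding eq norm_of_real by (rule exp_diff_bound[OF cov_bound])
 qed
 finally show ?thesis .
qed

lemma lin_bound:
 assumes "!!k. k \<in> {1..n} ==> cmod (z k) <= B"
 shows "\<bar>lin n z w\<bar> <= B*(\<Sum>k=1..n. \<bar>a k w\<bar> + \<bar>b k w\<bar>)"
proof -
 have "\<bar>lin n z w\<bar> <= (\<Sum>k=1..n. \<bar>Re (z k)*a k w + Im (z k)*b k w\<bar>)"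
  unfolding lin_def pairing_def by (rule sum_abs)
 also have "... <= (\<Sum>k=1..n. B*(\<bar>a k w\<bar> + \<bar>b k w\<bar>))"
 proof (rule sum_mono)
  fix k assume k: "k \<in> {1..n}"
  have "\<bar>Re (z k)\<bar> <= B" "\<bar>Im (z k)\<bar> <= B"
   using assms[OF k] abs_Re_le_cmod[of "z k"] abs_Im_le_cmod[of "z k"] by linarith+
  then have "\<bar>Re (z k)*a k w\<bar> <= B*\<bar>a k w\<bar>" "\<bar>Im (z k)*b k w\<bar> <= B*\<bar>b k w\<bar>"
   by (simp_all add: abs_mult mult_right_mono)
  then show "\<bar>Re (z k)*a k w + Im (z k)*b k w\<bar> <= B*(\<bar>a k w\<bar> + \<bar>b k w\<bar>)"
   by (simp add: distrib_left)
 qed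
 finally show ?thesis by (simp add: sum_distrib_left)
qed

lemma cov_abs_bound:
 assumes "!!k. k \<in> {1..n} ==> cmod (z k) <= B"
 shows "cov n z z <= B^2*(\<Sum>k=1..n. \<Sum>l=1..n. \<bar>r (int k - int l)\<bar>)"
 unfolding cov_form_def sum_distrib_left
proof (intro sum_mono)
 fix k l assume "k \<in> {1..n}" "l \<in> {1..n}"
 then have "cmod (z k)*cmod (z l) <= B*B" using assms by (intro mult_mono) (auto intro: order_trans[OF norm_ge_zero])
 then have "\<bar>Re (z k*cnj (z l))\<bar> <= B^2"
  using abs_Re_le_cmod[of "z k*cnj (z l)"] by (simp add: norm_mult power2_eq_square)
 then have "\<bar>r (int k - int l)\<bar>*\<bar>Re (z k*cnj (z l))\<bar> <= \<bar>r (int k - int l)\<bar>*B^2" by (intro mult_left_mono) auto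
 then show "r (int k - int l)*Re (z k*cnj (z l)) <= B^2*\<bar>r (int k - int l)\<bar>"
  using abs_ge_self[of "r (int k - int l)*Re (z k*cnj (z l))"] unfolding abs_mult by (simp only: mult.commute)
qed

text \<open>The covariance of two squares is twice the squared covariance.\<close>

lemma concentration_square:
 assumes nu: "finite_measure mz" and z: "!!k. (%p. z p k) \<in> bm mz"
  and B: "!!p k. k \<in> {1..n} ==> cmod (z p k) <= B"
 shows "(\<integral>\<^sup>+wo. ennreal (((\<integral>p. (lin n (z p) wo)^2 \<partial>mz) - (\<integral>p. cov n (z p) (z p) \<partial>mz))^2) \<partial>M)
     <= (\<integral>\<^sup>+p. \<integral>\<^sup>+q. ennreal (2*(cov n (z p) (z q))^2) \<partial>mz \<partial>mz)"
proof -
 interpret mz: finite_measure mz by fact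
 interpret nn: finite_measure "mz \<Otimes>\<^sub>M mz" by (rule finite_measure_pair_measure[OF nu nu])
 interpret P: pair_sigma_finite M "mz \<Otimes>\<^sub>M mz" ..
 define T where "T = (%wo p. (lin n (z p) wo)^2)"
 define V where "V = (%p. cov n (z p) (z p))"
 define Vb where "Vb = B^2*(\<Sum>k=1..n. \<Sum>l=1..n. \<bar>r (int k - int l)\<bar>)"
 have V0: "0 <= V p" "V p <= Vb" for p
  unfolding V_def Vb_def using cov_nonneg cov_abs_bound[of n "z p" B] B by auto
 have lm [measurable]: "(%x. lin n (z (snd x)) (fst x)) \<in> bm (M \<Otimes>\<^sub>M mz)"
  by (rule lin_measurable_pair[OF z])
 have Vm [measurable]: "V \<in> bm mz" unfolding V_def by (rule cov_measurable[OF z z])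
 have Tm [measurable]: "(%x. T (fst x) (snd x)) \<in> bm (M \<Otimes>\<^sub>M mz)"
  unfolding T_def by measurable
 have Tm1 [measurable]: "T wo \<in> bm mz" if "wo \<in> space M" for wo
  using measurable_Pair2[OF Tm that] by simp
 have Tb: "T wo p <= (B*(\<Sum>k=1..n. \<bar>a k wo\<bar> + \<bar>b k wo\<bar>))^2" for wo p
  unfolding T_def using lin_bound[of n "z p" B wo] B power_mono[of "\<bar>lin n (z p) wo\<bar>" _ 2] by simp
 have Ti: "integrable mz (T wo)" if "wo \<in> space M" for wo
  using Tb[of wo] Tm1[OF that] by (intro mz.integrable_const_bound[where B = "(B*(\<Sum>k=1..n. \<bar>a k wo\<bar> + \<bar>b k wo\<bar>))^2"]) (auto simp: T_def)
 have Vi: "integrable mz V" using V0 by (intro mz.integrable_const_bound[where B = Vb]) auto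
 define g where "g = (%wo p. cpx (T wo p - V p))"
 have gm [measurable]: "(%x. g (fst x) (snd x)) \<in> bm (M \<Otimes>\<^sub>M mz)"
  unfolding g_def by measurable
 have iT: "integrable M (%wo. T wo p)" for p unfolding T_def by (rule lin_moments)
 have iTT: "integrable M (%wo. T wo p*T wo q)" for p q unfolding T_def by (rule lin_product_squares)
 have ET: "(\<integral>wo. T wo p \<partial>M) = V p" for p unfolding T_def V_def by (rule lin_moments)
 have ETT: "(\<integral>wo. T wo p*T wo q \<partial>M) = V p*V q + 2*(cov n (z p) (z q))^2" for p q
  unfolding T_def V_def by (rule lin_product_squares)
 have T0: "0 <= T wo p" for wo p by (simp add: T_def)
 have prod: "(T wo p - V p)*(T wo q - V q) = T wo p*T wo q - V q*T wo p - V p*T wo q + V p*V q" for wo p q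
  by (simp add: algebra_simps)
 have iprod: "integrable M (%wo. (T wo p - V p)*(T wo q - V q))" for p q
  unfolding prod using iT iTT by (intro Bochner_Integration.integrable_add Bochner_Integration.integrable_diff integrable_mult_right) auto
 have Eprod: "(\<integral>wo. (T wo p - V p)*(T wo q - V q) \<partial>M) = 2*(cov n (z p) (z q))^2" for p q
  unfolding prod using iT iTT by (simp add: ET ETT prob_space algebra_simps)
 have "((\<integral>p. (lin n (z p) wo)^2 \<partial>mz) - (\<integral>p. cov n (z p) (z p) \<partial>mz))^2 = (cmod (\<integral>p. g wo p \<partial>mz))^2"
  if "wo \<in> space M" for wo
 proof -
  have "(\<integral>p. g wo p \<partial>mz) = cpx ((\<integral>p. T wo p \<partial>mz) - (\<integral>p. V p \<partial>mz))"
   unfolding g_def integral_complex_of_real using Ti[OF that] Vi by simp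
  then have "(cmod (\<integral>p. g wo p \<partial>mz))^2 = ((\<integral>p. T wo p \<partial>mz) - (\<integral>p. V p \<partial>mz))^2"
   by (simp only: norm_of_real power2_abs)
  then show ?thesis by (simp add: T_def V_def)
 qed
 then have "(\<integral>\<^sup>+wo. ennreal (((\<integral>p. (lin n (z p) wo)^2 \<partial>mz) - (\<integral>p. cov n (z p) (z p) \<partial>mz))^2) \<partial>M)
   = (\<integral>\<^sup>+wo. ennreal ((cmod (\<integral>p. g wo p \<partial>mz))^2) \<partial>M)"
  by (intro nn_integral_cong) simp
 also have "... <= (\<integral>\<^sup>+p. \<integral>\<^sup>+q. ennreal (2*(cov n (z p) (z q))^2) \<partial>mz \<partial>mz)"
 proof (rule second_moment_average[OF nu gm])
  fix wo assume w: "wo \<in> space M"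
  show "integrable mz (g wo)" unfolding g_def using Ti[OF w] Vi
   by (intro integrable_of_real Bochner_Integration.integrable_diff)
 next
  define F where "F = (%wo x. (T wo (fst x) - V (fst x))*(T wo (snd x) - V (snd x)))"
  have m1 [measurable]: "(%x. T (fst x) (fst (snd x))) \<in> bm (M \<Otimes>\<^sub>M (mz \<Otimes>\<^sub>M mz))"
  proof -
   have "(%x. (fst x, fst (snd x))) \<in> measurable (M \<Otimes>\<^sub>M (mz \<Otimes>\<^sub>M mz)) (M \<Otimes>\<^sub>M mz)" by measurable
   from measurable_compose[OF this Tm] show ?thesis by simp
  qed
  have m2 [measurable]: "(%x. T (fst x) (snd (snd x))) \<in> bm (M \<Otimes>\<^sub>M (mz \<Otimes>\<^sub>M mz))"
  proof -
   have "(%x. (fst x, snd (snd x))) \<in> measurable (M \<Otimes>\<^sub>M (mz \<Otimes>\<^sub>M mz)) (M \<Otimes>\<^sub>M mz)" by measurable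
   from measurable_compose[OF this Tm] show ?thesis by simp
  qed
  have Fm [measurable]: "(%x. F (fst x) (snd x)) \<in> bm (M \<Otimes>\<^sub>M (mz \<Otimes>\<^sub>M mz))"
   unfolding F_def by measurable
  have Fb: "\<bar>F wo x\<bar> <= T wo (fst x)*T wo (snd x) + Vb*T wo (fst x) + Vb*T wo (snd x) + Vb*Vb" for wo x
  proof -
   have "\<bar>F wo x\<bar> <= (T wo (fst x) + Vb)*(T wo (snd x) + Vb)"
    unfolding F_def abs_mult using T0[of wo "fst x"] T0[of wo "snd x"] V0[of "fst x"] V0[of "snd x"]
    by (intro mult_mono) auto
   then show ?thesis by (simp add: algebra_simps)
  qed
  have EF: "(\<integral>\<^sup>+wo. ennreal \<bar>F wo x\<bar> \<partial>M) <= ennreal (6*Vb*Vb)" for x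
  proof -
   have "(\<integral>\<^sup>+wo. ennreal \<bar>F wo x\<bar> \<partial>M) <= (\<integral>\<^sup>+wo. ennreal (T wo (fst x)*T wo (snd x) + Vb*T wo (fst x) + Vb*T wo (snd x) + Vb*Vb) \<partial>M)"
    by (intro nn_integral_mono ennreal_leI Fb)
   also have "... = ennreal (\<integral>wo. T wo (fst x)*T wo (snd x) + Vb*T wo (fst x) + Vb*T wo (snd x) + Vb*Vb \<partial>M)"
    using iT iTT by (intro nn_integral_eq_integral AE_I2 order_trans[OF abs_ge_zero Fb]) simp_all
   also have "... = ennreal (V (fst x)*V (snd x) + 2*(cov n (z (fst x)) (z (snd x)))^2 + Vb*V (fst x) + Vb*V (snd x) + Vb*Vb)"
    using iT iTT by (simp add: ET ETT prob_space)
   also have "... <= ennreal (6*Vb*Vb)"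
   proof (rule ennreal_leI)
    have Vb0: "0 <= Vb" using V0[of "fst x"] by linarith
    have "\<bar>cov n (z (fst x)) (z (snd x))\<bar> <= Vb"
    proof -
     have "V (fst x) + V (snd x) <= Vb + Vb" by (intro add_mono V0)
     then have "(V (fst x) + V (snd x))/2 <= Vb" by simp
     then show ?thesis using cov_bound[of n "z (fst x)" "z (snd x)"] unfolding V_def by (rule order_trans[rotated])
    qed
    then have "(cov n (z (fst x)) (z (snd x)))^2 <= Vb*Vb"
     using power_mono[of "\<bar>cov n (z (fst x)) (z (snd x))\<bar>" Vb 2] by (simp add: power2_eq_square)
    moreover have "V (fst x)*V (snd x) <= Vb*Vb" "Vb*V (fst x) <= Vb*Vb" "Vb*V (snd x) <= Vb*Vb"
     using V0 Vb0 by (auto intro!: mult_mono)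
    ultimately show "V (fst x)*V (snd x) + 2*(cov n (z (fst x)) (z (snd x)))^2 + Vb*V (fst x) + Vb*V (snd x) + Vb*Vb <= 6*Vb*Vb"
     by linarith
   qed
   finally show ?thesis .
  qed
  have "(\<integral>\<^sup>+y. ennreal \<bar>F (fst y) (snd y)\<bar> \<partial>(M \<Otimes>\<^sub>M (mz \<Otimes>\<^sub>M mz))) = (\<integral>\<^sup>+x. \<integral>\<^sup>+wo. ennreal \<bar>F wo x\<bar> \<partial>M \<partial>(mz \<Otimes>\<^sub>M mz))"
   using P.nn_integral_snd[of "%y. ennreal \<bar>F (fst y) (snd y)\<bar>"] by simp
  also have "... <= (\<integral>\<^sup>+x. ennreal (6*Vb*Vb) \<partial>(mz \<Otimes>\<^sub>M mz))" by (intro nn_integral_mono EF)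
  also have "... < \<infinity>" using nn.emeasure_finite[of "space (mz \<Otimes>\<^sub>M mz)"] by (simp add: ennreal_mult_less_top ennreal_mult_eq_top_iff less_top[symmetric])
  finally have "integrable (M \<Otimes>\<^sub>M (mz \<Otimes>\<^sub>M mz)) (%y. F (fst y) (snd y))"
   by (intro integrableI_bounded) auto
  then have "integrable (M \<Otimes>\<^sub>M (mz \<Otimes>\<^sub>M mz)) (%y. cpx (F (fst y) (snd y)))" by (rule integrable_of_real)
  then show "integrable (M \<Otimes>\<^sub>M (mz \<Otimes>\<^sub>M mz)) (%(wo, x). g wo (fst x)*cnj (g wo (snd x)))"
   by (simp add: g_def F_def case_prod_unfold)
 next
  fix p q
  have "(\<integral>wo. g wo p*cnj (g wo q) \<partial>M) = cpx (\<integral>wo. (T wo p - V p)*(T wo q - V q) \<partial>M)"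
   unfolding integral_complex_of_real[symmetric] by (simp add: g_def)
  then show "cmod (\<integral>wo. g wo p*cnj (g wo q) \<partial>M) <= 2*(cov n (z p) (z q))^2"
   unfolding Eprod by (simp only: norm_of_real) simp
 qed
 finally show ?thesis .
qed

end

section \<open>Coefficient vectors of trigonometric sums\<close>

text \<open>The symbol \<open>tt\<close> weights the frequency \<open>k\<close> by \<open>tt(k/n)\<close>. Shifts of \<open>x\<close> by multiples of \<open>1/n\<close>, derivatives divided by powers of \<open>n\<close>, and linear combinations of these are all given by a change of symbol.\<close>

definition wave :: "nat => (real => complex) => real => nat => complex" where
 "wave n tt x k = tt (real k/real n)/sqrt (real n)*cis (real k*x)"

definition symbol_mass :: "nat => (real => complex) => real" where
 "symbol_mass n tt = (\<Sum>k=1..n. (cmod (tt (real k/real n)))^2)/real n"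

definition kernel :: "nat => (real => complex) => real => real" where
 "kernel n tt v = (cmod (\<Sum>k=1..n. wave n tt v k))^2"

definition mean_square_corr :: "(int => real) => nat => real" where
 "mean_square_corr r n = (\<Sum>k=1..n. \<Sum>l=1..n. (r (int k - int l))^2)/(real n)^2"

lemma measurable_cis [measurable]: "cis \<in> bm borel"
 by (intro borel_measurable_continuous_onI continuous_on_cis continuous_on_id)

lemma measurable_wave [measurable]: "(%x. wave n tt x k) \<in> bm borel"
 unfolding wave_def by measurable

lemma measurable_kernel [measurable]: "kernel n tt \<in> bm borel"
 unfolding kernel_def[abs_def] by measurable

lemma wave_periodic: "wave n tt (x + 2*pi) k = wave n tt x k"
proof -
 have "cis (real k*(x + 2*pi)) = cis (real k*x)*cis (2*pi*real k)"
  by (simp add: cis_mult algebra_simps)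
 also have "cis (2*pi*real k) = 1" using cis_multiple_2pi[of "real k"] by simp
 finally show ?thesis by (simp add: wave_def)
qed

lemma kernel_periodic: "kernel n tt (x + 2*pi) = kernel n tt x"
 unfolding kernel_def wave_periodic ..

lemma kernel_nonneg: "0 <= kernel n tt v"
 by (simp add: kernel_def)

lemma cmod_wave: "cmod (wave n tt x k) = cmod (tt (real k/real n))/sqrt (real n)"
 by (simp add: wave_def norm_mult norm_divide)

lemma nn_parseval:
 "(CN x. ennreal ((cmod (\<Sum>k=1..n. z k*cis (real k*x)))^2)) = ennreal (2*pi*(\<Sum>k=1..n. (cmod (z k))^2))"
proof -
 have m: "(%x. (cmod (\<Sum>k=1..n. z k*cis (real k*x)))^2) \<in> bm circ"
  by (rule measurable_circ) measurable
 have "integrable circ (%x. (cmod (\<Sum>k=1..n. z k*cis (real k*x)))^2)"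
 proof (rule integrable_circ_bounded[OF m])
  fix x
  have "cmod (\<Sum>k=1..n. z k*cis (real k*x)) <= (\<Sum>k=1..n. cmod (z k))"
   by (rule order_trans[OF norm_sum]) (simp add: norm_mult)
  then show "norm ((cmod (\<Sum>k=1..n. z k*cis (real k*x)))^2) <= (\<Sum>k=1..n. cmod (z k))^2"
   by (simp add: power_mono)
 qed
 then show ?thesis by (subst nn_integral_eq_integral) (simp_all only: integral_circ_parseval, simp)
qed

lemma kernel_eq: "kernel n tt v = (cmod (\<Sum>k=1..n. (tt (real k/real n)/sqrt (real n))*cis (real k * v)))^2"
 by (simp add: kernel_def wave_def)

lemma sum_coeff: "(\<Sum>k=1..n. (cmod (tt (real k/real n)/cpx (sqrt (real n))))^2) = symbol_mass n tt"
 by (simp add: symbol_mass_def norm_divide power_divide sum_divide_distrib)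

lemma nn_integral_kernel: "(CN v. ennreal (kernel n tt v)) = ennreal (2*pi * symbol_mass n tt)"
 using sum_coeff[where tt = tt and n = n] by (simp only: kernel_eq nn_parseval)

lemma integral_kernel: "(CI v. kernel n tt v) = 2*pi * symbol_mass n tt"
 using sum_coeff[where tt = tt and n = n] by (simp only: kernel_eq integral_circ_parseval)

lemma kernel_bounded: "\<exists>K. \<forall>v. kernel n tt v <= K"
proof (intro exI allI)
 fix v
 have "cmod (\<Sum>k=1..n. wave n tt v k) <= (\<Sum>k=1..n. cmod (tt (real k/real n))/sqrt (real n))"
  by (rule order_trans[OF norm_sum]) (simp add: cmod_wave)
 then show "kernel n tt v <= (\<Sum>k=1..n. cmod (tt (real k/real n))/sqrt (real n))^2"
  unfolding kernel_def by (rule power_mono) simp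
qed

text \<open>Multiplication by \<open>1 - cis v\<close> differentiates the coefficients, so the second moment of
 the kernel about the origin is a sum of squared increments of the symbol.\<close>

lemma kernel_tail:
 assumes n: "1 <= n" and B: "!!t. 0 <= t ==> t <= 1 ==> cmod (tt t) <= B"
  and L: "!!s t. 0 <= s ==> s <= 1 ==> 0 <= t ==> t <= 1 ==> cmod (tt s - tt t) <= L*\<bar>s - t\<bar>"
 shows "(CN v. ennreal (kernel n tt v * (2 - 2*cos v))) <= ennreal (2*pi*(2*B^2 + L^2)/real n)"
proof -
 define c where "c = (%k. if k \<in> {1..n} then tt (real k/real n)/sqrt (real n) else 0)"
 define dc where "dc = (%k. c k - c (k - 1))"
 have n0: "0 < real n" using n by simp
 have sq: "(cmod (1 - cis v))^2 = 2 - 2*cos v" for v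
 proof -
  have "(cmod (1 - cis v))^2 = (1 - cos v)^2 + (sin v)^2" by (simp add: cmod_def)
  also have "... = 2 - 2*cos v" using sin_cos_squared_add[of v] by (simp add: power2_eq_square algebra_simps)
  finally show ?thesis .
 qed
 have tele: "(1 - cis v)*(\<Sum>k=1..n. c k*cis (real k * v)) = (\<Sum>k=1..Suc n. dc k*cis (real k * v))" for v
 proof -
  have "cis v * (\<Sum>k=1..n. c k*cis (real k * v)) = (\<Sum>k=1..n. c k*cis (real (Suc k) * v))"
   unfolding sum_distrib_left
  proof (rule sum.cong[OF refl])
   fix k
   have "cis v * cis (real k * v) = cis (real (Suc k) * v)" by (simp add: cis_mult algebra_simps)
   then show "cis v * (c k*cis (real k * v)) = c k*cis (real (Suc k) * v)" by (metis mult.left_commute)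
  qed
  also have "... = (\<Sum>k=2..Suc n. c (k - 1)*cis (real k * v))"
   using sum.shift_bounds_cl_Suc_ivl[of "%k. c (k - 1)*cis (real k * v)" 1 n] by (simp add: numeral_2_eq_2)
  also have "... = (\<Sum>k=1..Suc n. c (k - 1)*cis (real k * v))"
   by (subst (2) sum.atLeast_Suc_atMost) (simp_all add: c_def numeral_2_eq_2)
  finally have "cis v * (\<Sum>k=1..n. c k*cis (real k * v)) = (\<Sum>k=1..Suc n. c (k - 1)*cis (real k * v))" .
  moreover have "(\<Sum>k=1..n. c k*cis (real k * v)) = (\<Sum>k=1..Suc n. c k*cis (real k * v))"
   by (simp add: c_def)
  ultimately show ?thesis
   by (simp only: left_diff_distrib mult_1 dc_def sum_subtractf)
 qed
 have k: "kernel n tt v * (2 - 2*cos v) = (cmod (\<Sum>k=1..Suc n. dc k*cis (real k * v)))^2" for v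
 proof -
  have "(\<Sum>k=1..n. wave n tt v k) = (\<Sum>k=1..n. c k*cis (real k * v))"
   by (intro sum.cong) (simp_all add: wave_def c_def)
  then show ?thesis unfolding tele[symmetric] sq[symmetric] kernel_def norm_mult power_mult_distrib by simp
 qed
 have B0: "0 <= B" using B[of 0] norm_ge_zero[of "tt 0"] by linarith
 have e1: "(cmod (dc 1))^2 <= B^2/n"
  using B[of "1/n"] n by (simp add: dc_def c_def norm_divide power_divide divide_right_mono power_mono)
 have e2: "(cmod (dc (Suc n)))^2 <= B^2/n"
  using B[of 1] n by (simp add: dc_def c_def norm_divide power_divide divide_right_mono power_mono)
 have mid: "(cmod (dc k))^2 <= L^2/n ^ 3" if "k \<in> {2..n}" for k
 proof -
  have kk: "1 <= k" "k <= n" using that by auto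
  have "dc k = (tt (k/n) - tt (real (k - 1)/n))/sqrt n"
  proof -
   have "k \<in> {1..n}" "k - 1 \<in> {1..n}" using that by auto
   then show ?thesis by (simp only: dc_def c_def if_True diff_divide_distrib)
  qed
  then have "cmod (dc k) = cmod (tt (k/n) - tt (real (k - 1)/n))/sqrt n" by (simp add: norm_divide)
  also have "... <= (L*\<bar>k/n - real (k - 1)/n\<bar>)/sqrt n"
   using kk by (intro divide_right_mono L) auto
  also have "\<bar>k/n - real (k - 1)/n\<bar> = 1/n" using kk by (simp add: of_nat_diff diff_divide_distrib[symmetric])
  finally have "(cmod (dc k))^2 <= (L*(1/n)/sqrt n)^2" by (intro power_mono) auto
  also have "... = L^2/n ^ 3" using n0 by (simp add: power_divide power3_eq_cube power2_eq_square)
  finally show ?thesis .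
 qed
 have "(\<Sum>k=1..Suc n. (cmod (dc k))^2) = (cmod (dc 1))^2 + (\<Sum>k=2..n. (cmod (dc k))^2) + (cmod (dc (Suc n)))^2"
  using n by (simp add: sum.atLeast_Suc_atMost numeral_2_eq_2)
 also have "... <= B^2/n + real n*(L^2/n ^ 3) + B^2/n"
 proof -
  have "(\<Sum>k=2..n. (cmod (dc k))^2) <= real (card {2..n})*(L^2/n ^ 3)" by (rule sum_bounded_above[OF mid])
  also have "... <= real n*(L^2/n ^ 3)" by (intro mult_right_mono) auto
  finally show ?thesis using e1 e2 by linarith
 qed
 also have "... <= (2*B^2 + L^2)/n"
 proof -
  have "real n*(L^2/n ^ 3) = L^2/n/n" using n0 by (simp add: power3_eq_cube)
  also have "... <= L^2/n/1" using n by (intro divide_left_mono) auto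
  finally show ?thesis by (simp add: add_divide_distrib)
 qed
 finally have S: "(\<Sum>k=1..Suc n. (cmod (dc k))^2) <= (2*B^2 + L^2)/n" .
 have "(CN v. ennreal (kernel n tt v * (2 - 2*cos v))) = ennreal (2*pi*(\<Sum>k=1..Suc n. (cmod (dc k))^2))"
  unfolding k by (rule nn_parseval)
 also have "... <= ennreal (2*pi*((2*B^2 + L^2)/n))" by (intro ennreal_leI mult_left_mono S) simp
 finally show ?thesis by simp
qed

text \<open>The covariance is a trigonometric polynomial in \<open>y\<close> whose coefficients are trigonometric polynomials in \<open>x\<close>; applying Parseval twice leaves the mean of \<open>r(k - l)^2\<close>.\<close>

lemma cov_form_square_integral:
 assumes n: "1 <= n" and B: "!!t. 0 <= t ==> t <= 1 ==> cmod (tt t) <= B"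
  and B': "!!t. 0 <= t ==> t <= 1 ==> cmod (tt' t) <= B"
 shows "(CN x. (CN y. ennreal ((cov_form r n (wave n tt x) (wave n tt' y))^2)))
   <= ennreal (4*pi^2*B ^ 4*mean_square_corr r n)"
proof -
 have n0: "0 < real n" using n by simp
 have tn: "(cmod (tt (real k/n)))^2 <= B^2" "(cmod (tt' (real k/n)))^2 <= B^2" if "k \<in> {1..n}" for k
  using B[of "k/n"] B'[of "k/n"] that by (auto intro!: power_mono)
 define S where "S = (%x l. \<Sum>k=1..n. of_real (r (int k - int l))*wave n tt x k)"
 have pt: "(cov_form r n (wave n tt x) (wave n tt' y))^2 <=
   (cmod (\<Sum>l=1..n. (cnj (S x l)*(tt' (real l/real n)/sqrt (real n)))*cis (real l*y)))^2" for x y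
 proof -
  have "cov_form r n (wave n tt x) (wave n tt' y) =
    Re (\<Sum>k=1..n. \<Sum>l=1..n. of_real (r (int k - int l))*(wave n tt x k*cnj (wave n tt' y l)))"
   by (simp add: cov_form_def)
  also have "(\<Sum>k=1..n. \<Sum>l=1..n. of_real (r (int k - int l))*(wave n tt x k*cnj (wave n tt' y l))) =
    (\<Sum>l=1..n. S x l*cnj (wave n tt' y l))"
   unfolding S_def by (subst sum.swap) (simp add: sum_distrib_right mult.assoc)
  also have "... = cnj (\<Sum>l=1..n. cnj (S x l)*wave n tt' y l)" by simp
  finally have "\<bar>cov_form r n (wave n tt x) (wave n tt' y)\<bar> <= cmod (\<Sum>l=1..n. cnj (S x l)*wave n tt' y l)"
   by (metis abs_Re_le_cmod complex_mod_cnj)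
  then have "\<bar>cov_form r n (wave n tt x) (wave n tt' y)\<bar>^2 <= (cmod (\<Sum>l=1..n. cnj (S x l)*wave n tt' y l))^2"
   by (rule power_mono) simp
  then show ?thesis by (simp add: wave_def mult.assoc)
 qed
 have S2: "(CN x. ennreal ((cmod (S x l))^2)) <= ennreal (2*pi*(B^2/n*(\<Sum>k=1..n. (r (int k - int l))^2)))" for l
 proof -
  have "(CN x. ennreal ((cmod (S x l))^2)) =
    (CN x. ennreal ((cmod (\<Sum>k=1..n. (of_real (r (int k - int l))*(tt (real k/real n)/sqrt (real n)))*cis (real k*x)))^2))"
   by (simp add: S_def wave_def mult.assoc)
  also have "... = ennreal (2*pi*(\<Sum>k=1..n. (cmod (of_real (r (int k - int l))*(tt (real k/real n)/sqrt (real n))))^2))"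
   by (rule nn_parseval)
  also have "... <= ennreal (2*pi*(B^2/n*(\<Sum>k=1..n. (r (int k - int l))^2)))"
  proof (intro ennreal_leI mult_left_mono)
   show "(\<Sum>k=1..n. (cmod (of_real (r (int k - int l))*(tt (real k/real n)/sqrt (real n))))^2) <= B^2/n*(\<Sum>k=1..n. (r (int k - int l))^2)"
    unfolding sum_distrib_left
   proof (rule sum_mono)
    fix k assume "k \<in> {1..n}"
    then have "(r (int k - int l))^2*((cmod (tt (real k/n)))^2/n) <= (r (int k - int l))^2*(B^2/n)"
     using tn by (intro mult_left_mono divide_right_mono) auto
    then show "(cmod (of_real (r (int k - int l))*(tt (real k/real n)/sqrt (real n))))^2 <= B^2/n*(r (int k - int l))^2"
     by (simp add: norm_mult norm_divide power_mult_distrib power_divide mult.commute)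
   qed
  qed simp
  finally show ?thesis .
 qed
 have Sm [measurable]: "(%x. S x l) \<in> bm circ" for l
  by (rule measurable_circ) (unfold S_def, measurable)
 have "(CN x. (CN y. ennreal ((cov_form r n (wave n tt x) (wave n tt' y))^2)))
   <= (CN x. (CN y. ennreal ((cmod (\<Sum>l=1..n. (cnj (S x l)*(tt' (real l/real n)/sqrt (real n)))*cis (real l*y)))^2)))"
  by (intro nn_integral_mono ennreal_leI pt)
 also have "... = (CN x. ennreal (2*pi*(\<Sum>l=1..n. (cmod (cnj (S x l)*(tt' (real l/real n)/sqrt (real n))))^2)))"
  by (intro nn_integral_cong nn_parseval)
 also have "... <= (CN x. (\<Sum>l=1..n. ennreal (2*pi*(B^2/n))*ennreal ((cmod (S x l))^2)))"
 proof (intro nn_integral_mono)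
  fix x
  have "2*pi*(\<Sum>l=1..n. (cmod (cnj (S x l)*(tt' (real l/real n)/sqrt (real n))))^2) <= (\<Sum>l=1..n. 2*pi*(B^2/n)*(cmod (S x l))^2)"
   unfolding sum_distrib_left
  proof (rule sum_mono)
   fix l assume "l \<in> {1..n}"
   then have "(cmod (S x l))^2*((cmod (tt' (real l/n)))^2/n) <= (cmod (S x l))^2*(B^2/n)"
    using tn by (intro mult_left_mono divide_right_mono) auto
   then have "(cmod (cnj (S x l)*(tt' (real l/real n)/sqrt (real n))))^2 <= (B^2/n)*(cmod (S x l))^2"
    by (simp add: norm_mult norm_divide power_mult_distrib power_divide mult.commute)
   then have "2*pi*(cmod (cnj (S x l)*(tt' (real l/real n)/sqrt (real n))))^2 <= 2*pi*((B^2/n)*(cmod (S x l))^2)"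
    by (rule mult_left_mono) simp
   then show "2*pi*(cmod (cnj (S x l)*(tt' (real l/real n)/sqrt (real n))))^2 <= 2*pi*(B^2/n)*(cmod (S x l))^2"
    by (simp only: mult.assoc)
  qed
  also have "ennreal (\<Sum>l=1..n. 2*pi*(B^2/n)*(cmod (S x l))^2) = (\<Sum>l=1..n. ennreal (2*pi*(B^2/n)*(cmod (S x l))^2))"
   by (rule sum_ennreal[symmetric]) simp
  also have "... = (\<Sum>l=1..n. ennreal (2*pi*(B^2/n))*ennreal ((cmod (S x l))^2))"
   by (intro sum.cong refl ennreal_mult) auto
  finally show "ennreal (2*pi*(\<Sum>l=1..n. (cmod (cnj (S x l)*(tt' (real l/real n)/sqrt (real n))))^2)) <= (\<Sum>l=1..n. ennreal (2*pi*(B^2/n))*ennreal ((cmod (S x l))^2))"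
   using ennreal_leI by blast
 qed
 also have "... = (\<Sum>l=1..n. ennreal (2*pi*(B^2/n))*(CN x. ennreal ((cmod (S x l))^2)))"
  by (subst nn_integral_sum) (auto intro!: sum.cong nn_integral_cmult)
 also have "... <= (\<Sum>l=1..n. ennreal (2*pi*(B^2/n))*ennreal (2*pi*(B^2/n*(\<Sum>k=1..n. (r (int k - int l))^2))))"
  by (intro sum_mono mult_left_mono S2) simp
 also have "... = ennreal (\<Sum>l=1..n. 2*pi*(B^2/n)*(2*pi*(B^2/n*(\<Sum>k=1..n. (r (int k - int l))^2))))"
 proof -
  have "(\<Sum>l=1..n. ennreal (2*pi*(B^2/n))*ennreal (2*pi*(B^2/n*(\<Sum>k=1..n. (r (int k - int l))^2)))) =
    (\<Sum>l=1..n. ennreal (2*pi*(B^2/n)*(2*pi*(B^2/n*(\<Sum>k=1..n. (r (int k - int l))^2)))))"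
   by (intro sum.cong refl ennreal_mult[symmetric]) (auto intro!: mult_nonneg_nonneg sum_nonneg divide_nonneg_nonneg)
  also have "... = ennreal (\<Sum>l=1..n. 2*pi*(B^2/n)*(2*pi*(B^2/n*(\<Sum>k=1..n. (r (int k - int l))^2))))"
   by (rule sum_ennreal) (auto intro!: mult_nonneg_nonneg sum_nonneg divide_nonneg_nonneg)
  finally show ?thesis .
 qed
 also have "(\<Sum>l=1..n. 2*pi*(B^2/n)*(2*pi*(B^2/n*(\<Sum>k=1..n. (r (int k - int l))^2)))) = 4*pi^2*B ^ 4*mean_square_corr r n"
 proof -
  have "(\<Sum>l=1..n. 2*pi*(B^2/n)*(2*pi*(B^2/n*(\<Sum>k=1..n. (r (int k - int l))^2)))) =
    (2*pi*(B^2/n)*(2*pi*(B^2/n)))*(\<Sum>l=1..n. \<Sum>k=1..n. (r (int k - int l))^2)"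
   by (simp add: sum_distrib_left mult.assoc)
  also have "(\<Sum>l=1..n. \<Sum>k=1..n. (r (int k - int l))^2) = (\<Sum>k=1..n. \<Sum>l=1..n. (r (int k - int l))^2)" by (rule sum.swap)
  finally show ?thesis using n0 by (simp add: mean_square_corr_def power2_eq_square power4_eq_xxxx)
 qed
 finally show ?thesis .
qed

section \<open>The spectral density\<close>

locale spectral =
 fixes \<psi> :: "real => real" and r :: "int => real"
 assumes psi_meas [measurable]: "\<psi> \<in> bm borel"
  and psi_nonneg: "!!x. 0 <= \<psi> x"
  and psi_per: "!!x. \<psi> (x + 2*pi) = \<psi> x"
  and psi_mass: "(CN x. ennreal (\<psi> x)) = 1"
  and r_fourier: "!!j. (CI u. cpx (\<psi> u)*cis (- (of_int j*u))) = cpx (r j)"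
begin

lemma psi_integrable: "integrable circ \<psi>"
 using psi_mass by (intro integrableI_bounded measurable_circ psi_meas) (simp add: psi_nonneg)

lemma psi_integral: "(CI x. \<psi> x) = 1"
 using nn_integral_eq_integral[OF psi_integrable] psi_mass psi_nonneg by (simp add: Bochner_Integration.integral_nonneg)

lemma psi_shift: "integrable circ (%x. \<psi> (x + v))" "(CI x. \<psi> (x + v)) = 1"
proof -
 have T: "(%x. x + v) \<in> measurable circ borel" by (rule measurable_circ) measurable
 note * = integral_periodic_transfer[OF psi_meas psi_per T nn_integral_circ_shift]
 show "integrable circ (%x. \<psi> (x + v))" using *(2) psi_integrable by blast
 show "(CI x. \<psi> (x + v)) = 1" using *(1) psi_integral by simp
qed

lemma psi_reflect: "integrable circ (%x. \<psi> (v - x))" "(CI x. \<psi> (v - x)) = 1"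
proof -
 have T: "(%x. v - x) \<in> measurable circ borel" by (rule measurable_circ) measurable
 note * = integral_periodic_transfer[OF psi_meas psi_per T nn_integral_circ_reflect]
 show "integrable circ (%x. \<psi> (v - x))" using *(2) psi_integrable by blast
 show "(CI x. \<psi> (v - x)) = 1" using *(1) psi_integral by simp
qed

lemma psi_cis_integrable: "integrable circ (%u. cpx (\<psi> u)*cis (c*u))"
proof (rule Bochner_Integration.integrable_bound[OF psi_integrable])
 show "(%u. cpx (\<psi> u)*cis (c*u)) \<in> bm circ"
  by (rule measurable_circ) measurable
qed (simp add: norm_mult)

lemma psi_cis_integrable': "integrable circ (%u. cpx (\<psi> u)*cis (- (c*u)))"
 using psi_cis_integrable[of "- c"] by simp

lemma r_abs_le_1: "\<bar>r j\<bar> <= 1"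
proof -
 have "cmod (cpx (r j)) <= (CI u. cmod (cpx (\<psi> u)*cis (- (of_int j*u))))"
  unfolding r_fourier[symmetric] by (rule integral_norm_bound)
 also have "... = 1" using psi_integral psi_nonneg by (simp add: norm_mult)
 finally show ?thesis by simp
qed

lemma r_0: "r 0 = 1"
proof -
 have "cpx (r 0) = cpx (CI u. \<psi> u)"
  unfolding r_fourier[symmetric] integral_complex_of_real[symmetric] by simp
 then show ?thesis by (simp add: psi_integral)
qed

lemma r_symmetric: "r (- j) = r j"
proof -
 have "cpx (r (-j)) = (CI u. cnj (cpx (\<psi> u)*cis (- (of_int j*u))))"
  unfolding r_fourier[symmetric] by (simp add: cis_cnj)
 also have "... = cpx (r j)" by (subst Bochner_Integration.integral_cnj) (simp add: r_fourier)
 finally show ?thesis by simp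
qed

lemma cov_form_spectral:
 "cov_form r n z z = (CI u. (cmod (\<Sum>k=1..n. z k*cis (- (real k*u))))^2*\<psi> u)"
proof -
 have "cpx (CI u. (cmod (\<Sum>k=1..n. z k*cis (- (real k*u))))^2*\<psi> u) =
   (CI u. (\<Sum>k=1..n. \<Sum>l=1..n. (z k*cnj (z l))*(cpx (\<psi> u)*cis (- (of_int (int k - int l)*u)))))"
  unfolding integral_complex_of_real[symmetric]
 proof (intro Bochner_Integration.integral_cong refl)
  fix u
  have *: "z k*cis (- (real k*u))*cnj (z l*cis (- (real l*u))) = z k*cnj (z l)*cis (- (of_int (int k - int l)*u))" for k l
  proof -
   have "cis (- (real k*u))*cnj (cis (- (real l*u))) = cis (- (of_int (int k - int l)*u))"
    by (simp add: cis_cnj cis_mult algebra_simps)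
   then show ?thesis by (metis (no_types, opaque_lifting) complex_cnj_mult mult.assoc mult.left_commute)
  qed
  have rot: "c*d*e = c*(e*d)" for c d e :: complex by (simp add: mult_ac)
  have "cpx ((cmod (\<Sum>k=1..n. z k*cis (- (real k*u))))^2*\<psi> u) =
   (\<Sum>k=1..n. z k*cis (- (real k*u)))*cnj (\<Sum>k=1..n. z k*cis (- (real k*u)))*cpx (\<psi> u)"
   by (simp only: of_real_mult complex_norm_square)
  also have "... = (\<Sum>k=1..n. \<Sum>l=1..n. (z k*cnj (z l))*(cpx (\<psi> u)*cis (- (of_int (int k - int l)*u))))"
   unfolding cnj_sum sum_product * unfolding sum_distrib_right by (intro sum.cong refl) (rule rot)
  finally show "cpx ((cmod (\<Sum>k=1..n. z k*cis (- (real k*u))))^2*\<psi> u) = ..." .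
 qed
 also have "... = (\<Sum>k=1..n. \<Sum>l=1..n. (z k*cnj (z l))*(CI u. cpx (\<psi> u)*cis (- (of_int (int k - int l)*u))))"
 proof -
  have i: "integrable circ (%u. (z k*cnj (z l))*(cpx (\<psi> u)*cis (- (of_int (int k - int l)*u))))" for k l
   by (intro integrable_mult_right psi_cis_integrable')
  show ?thesis
   by (subst Bochner_Integration.integral_sum, intro Bochner_Integration.integrable_sum i,
     intro sum.cong refl, subst Bochner_Integration.integral_sum, intro i, intro sum.cong refl integral_mult_right_zero)
 qed
 finally have "Re (cpx (CI u. (cmod (\<Sum>k=1..n. z k*cis (- (real k*u))))^2*\<psi> u)) =
   Re (\<Sum>k=1..n. \<Sum>l=1..n. (z k*cnj (z l))*cpx (r (int k - int l)))"
  unfolding r_fourier by (rule arg_cong)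
 then show ?thesis by (simp add: cov_form_def mult.commute)
qed

definition var :: "nat => (real => complex) => real => real" where
 "var n tt x = cov_form r n (wave n tt x) (wave n tt x)"

lemma kernel_psi_integrable: "integrable circ (%v. kernel n tt v * \<psi> (x - v))"
proof -
 obtain K where K: "!!v. kernel n tt v <= K" using kernel_bounded by blast
 show ?thesis
 proof (rule Bochner_Integration.integrable_bound)
  show "integrable circ (%v. K*\<psi> (x - v))" using psi_reflect(1) by simp
  show "(%v. kernel n tt v * \<psi> (x - v)) \<in> bm circ" by (rule measurable_circ) measurable
  show "AE v in circ. norm (kernel n tt v * \<psi> (x - v)) <= norm (K*\<psi> (x - v))"
  proof (intro AE_I2)
   fix v
   have "\<bar>kernel n tt v\<bar> <= \<bar>K\<bar>" using K[of v] kernel_nonneg[of n tt v] by linarith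
   then show "norm (kernel n tt v * \<psi> (x - v)) <= norm (K*\<psi> (x - v))" by (simp add: abs_mult mult_right_mono)
  qed
 qed
qed

text \<open>The variance is the convolution of the density with a nonnegative kernel of mass \<open>2 pi * symbol_mass\<close>.\<close>

lemma var_eq: "var n tt x = (CI v. kernel n tt v * \<psi> (x - v))"
proof -
 have w: "(\<Sum>k=1..n. wave n tt x k*cis (- (real k*u))) = (\<Sum>k=1..n. wave n tt (x - u) k)" for u
  by (intro sum.cong refl) (simp add: wave_def cis_mult algebra_simps)
 have "var n tt x = (CI u. kernel n tt (x - u)*\<psi> u)"
  unfolding var_def cov_form_spectral w kernel_def ..
 also have "... = (CI v. kernel n tt (x - (x - v))*\<psi> (x - v))"
 proof (rule integral_periodic_transfer(1)[symmetric, where g = "%u. kernel n tt (x - u)*\<psi> u"])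
  show "(%u. kernel n tt (x - u)*\<psi> u) \<in> bm borel" by measurable
  show "(%v. x - v) \<in> measurable circ borel" by (rule measurable_circ) measurable
  show "kernel n tt (x - (y + 2*pi))*\<psi> (y + 2*pi) = kernel n tt (x - y)*\<psi> y" for y
   using kernel_periodic[of n tt "x - y - 2*pi"] psi_per[of y] by (simp add: algebra_simps)
 qed (rule nn_integral_circ_reflect)
 finally show ?thesis by simp
qed

lemma var_nonneg: "0 <= var n tt x"
 unfolding var_eq by (intro Bochner_Integration.integral_nonneg) (simp add: kernel_nonneg psi_nonneg)

definition om :: "real => real" where
 "om h = (CI x. \<bar>\<psi> (x - h) - \<psi> x\<bar>)"

definition om2 :: "real => real" where
 "om2 h = (CI x. \<bar>\<psi> (x + h) + \<psi> (x - h) - 2*\<psi> x\<bar>)"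

lemma psi_shift': "integrable circ (%x. \<psi> (x - v))" "(CI x. \<psi> (x - v)) = 1"
 using psi_shift[of "- v"] by simp_all

lemma om_integrable: "integrable circ (%x. \<bar>\<psi> (x - h) - \<psi> x\<bar>)"
 using psi_shift' psi_integrable by (intro integrable_abs Bochner_Integration.integrable_diff)

lemma om2_integrable: "integrable circ (%x. \<bar>\<psi> (x + h) + \<psi> (x - h) - 2*\<psi> x\<bar>)"
 using psi_shift' psi_shift psi_integrable by (intro integrable_abs Bochner_Integration.integrable_diff Bochner_Integration.integrable_add integrable_mult_right)

lemma om_nonneg: "0 <= om h" unfolding om_def by simp

lemma om_le_2: "om h <= 2"
proof -
 have "om h <= (CI x. \<psi> (x - h) + \<psi> x)"
  unfolding om_def using psi_nonneg psi_shift' psi_integrable om_integrable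
  by (intro integral_mono) (auto simp: abs_le_iff)
 also have "... = 2" using psi_shift' psi_integrable psi_integral by simp
 finally show ?thesis .
qed

lemma om2_le_4: "om2 h <= 4"
proof -
 have "om2 h <= (CI x. \<psi> (x + h) + \<psi> (x - h) + 2*\<psi> x)"
  unfolding om2_def using psi_shift' psi_shift psi_integrable om2_integrable
 proof (intro integral_mono)
  fix x show "\<bar>\<psi> (x + h) + \<psi> (x - h) - 2*\<psi> x\<bar> <= \<psi> (x + h) + \<psi> (x - h) + 2*\<psi> x"
   using psi_nonneg[of "x+h"] psi_nonneg[of "x-h"] psi_nonneg[of x] by linarith
 qed simp_all
 also have "... = 4" using psi_shift' psi_shift psi_integrable psi_integral by simp
 finally show ?thesis .
qed

lemma om_periodic: "om (h - 2*pi) = om h"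
proof -
 have "\<psi> (x - (h - 2*pi)) = \<psi> (x - h)" for x using psi_per[of "x - h"] by (simp add: algebra_simps)
 then show ?thesis by (simp add: om_def)
qed

lemma integral_shift_periodic:
 fixes g :: "real => real"
 assumes "g \<in> bm borel" "!!x. g (x + 2*pi) = g x"
 shows "(CI x. g (x + v)) = (CI x. g x)"
proof -
 have T: "(%x. x + v) \<in> measurable circ borel" by (rule measurable_circ) measurable
 show ?thesis by (rule integral_periodic_transfer(1)[OF assms T nn_integral_circ_shift])
qed

text \<open>Writes a first difference of step \<open>2h\<close> as twice one of step \<open>h\<close> plus a second difference.\<close>

lemma om_halving: "2 * om h <= om (2*h) + om2 h"
proof -
 let ?s = "%x. \<bar>\<psi> (x + h) + \<psi> (x - h) - 2*\<psi> x\<bar>"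
 have p: "\<psi> (x + 2*pi + h) = \<psi> (x + h)" "\<psi> (x + 2*pi - h) = \<psi> (x - h)" for x
  using psi_per[of "x + h"] psi_per[of "x - h"] by (simp_all add: algebra_simps)
 have s: "om2 h = (CI x. ?s (x + (-h)))"
  unfolding om2_def by (rule integral_shift_periodic[symmetric]) (measurable, simp add: p psi_per)
 have i: "integrable circ (%x. ?s (x + (- h)))"
  using psi_shift'(1)[of h] psi_shift'(1)[of "2*h"] psi_integrable by simp
 have "2 * om h = (CI x. 2*\<bar>\<psi> (x - h) - \<psi> x\<bar>)" by (simp add: om_def)
 also have "... <= (CI x. \<bar>\<psi> (x - 2*h) - \<psi> x\<bar> + ?s (x + (-h)))"
 proof (rule integral_mono)
  show "integrable circ (%x. 2*\<bar>\<psi> (x - h) - \<psi> x\<bar>)" using om_integrable by simp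
  show "integrable circ (%x. \<bar>\<psi> (x - 2*h) - \<psi> x\<bar> + ?s (x + (-h)))"
   using om_integrable i by (rule Bochner_Integration.integrable_add)
  fix x
  have "x + - h - h = x - 2*h" by simp
  moreover have "2*\<bar>u - v\<bar> <= \<bar>w - v\<bar> + \<bar>v + w - 2*u\<bar>" for u v w :: real by (simp add: abs_if)
  ultimately show "2*\<bar>\<psi> (x - h) - \<psi> x\<bar> <= \<bar>\<psi> (x - 2*h) - \<psi> x\<bar> + ?s (x + (-h))" by simp
 qed
 also have "... = om (2*h) + om2 h" unfolding s unfolding om_def using om_integrable i by (rule Bochner_Integration.integral_add)
 finally show ?thesis .
qed

text \<open>Iterating \<open>om_halving\<close> gives \<open>om (h/2^m) <= om h/2^m + sup om2\<close>, so control of second differences alone yields continuity of translation in \<open>L1\<close>.\<close>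

lemma om_small:
 assumes om2: "!!e. 0 < e ==> \<exists>d>0. \<forall>h. \<bar>h\<bar> <= d --> om2 h <= e" and e: "0 < e"
 shows "\<exists>d>0. \<forall>h. \<bar>h\<bar> <= d --> om h <= e"
proof -
 obtain d where d: "d > 0" "!!h. \<bar>h\<bar> <= d ==> om2 h <= e/2" using om2[of "e/2"] e by auto
 have *: "om h <= 2*(1/2) ^ m + e/2" if "\<bar>h\<bar> <= d*(1/2) ^ m" for h m
  using that
 proof (induction m arbitrary: h)
  case 0 then show ?case using om_le_2[of h] e by simp
 next
  case (Suc m)
  have "om (2*h) <= 2*(1/2) ^ m + e/2" using Suc.prems by (intro Suc.IH) simp
  moreover have "om2 h <= e/2"
  proof (rule d(2))
   have "d*(1/2) ^ Suc m <= d*1" using d(1) by (intro mult_left_mono power_le_one) auto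
   then show "\<bar>h\<bar> <= d" using Suc.prems by linarith
  qed
  ultimately have "2 * om h <= 2*(1/2) ^ m + e/2 + e/2" using om_halving[of h] by linarith
  then show ?case by simp
 qed
 obtain m :: nat where m: "(1/2) ^ m < e/4" using real_arch_pow_inv[of "e/4" "1/2"] e by auto
 have "om h <= e" if "\<bar>h\<bar> <= d*(1/2) ^ m" for h using *[OF that] m by linarith
 then show ?thesis using d(1) by (intro exI[of _ "d*(1/2) ^ m"]) auto
qed

lemma smooth_bound:
 assumes A1: "L1_second_difference_smooth \<psi> al" and al: "0 < al"
 shows "\<exists>C d. 0 <= C \<and> 0 < d \<and> (\<forall>h. 0 < h --> h <= d --> om2 h <= C*h powr al)"
proof -
 let ?L = "%h. LBINT x:{0..2*pi}. \<bar>\<psi> (x + h) + \<psi> (x - h) - 2*\<psi> x\<bar>"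
 have L: "?L h = om2 h" for h
  unfolding om2_def circ_def set_lebesgue_integral_def by (subst integral_restrict_space) auto
 from A1[unfolded L1_second_difference_smooth_def]
 obtain c where c: "c > 0" and ev: "eventually (%de. norm (SUP h\<in>{h. \<bar>h\<bar> <= de}. ?L h) <= c*norm (de powr al)) (at_right 0)"
  by (rule landau_o.bigE)
 then obtain d where d: "d > 0" "!!de. 0 < de ==> de < d ==> norm (SUP h\<in>{h. \<bar>h\<bar> <= de}. ?L h) <= c*norm (de powr al)"
  unfolding eventually_at_right_field by auto
 have "om2 h <= c*h powr al" if "0 < h" "h <= d/2" for h
 proof -
  have "om2 h <= (SUP h\<in>{h'. \<bar>h'\<bar> <= h}. ?L h)"
   unfolding L using that by (intro cSUP_upper bdd_aboveI[of _ 4]) (auto intro: om2_le_4)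
  also have "... <= c*h powr al" using d(2)[of h] that by auto
  finally show ?thesis .
 qed
 then show ?thesis using c d(1) by (intro exI[of _ c] exI[of _ "d/2"]) auto
qed

lemma om2_even: "om2 (- h) = om2 h" by (simp add: om2_def add.commute)

lemma om2_0: "om2 0 = 0" by (simp add: om2_def)

lemma smooth_om2_small:
 assumes "0 < al" "0 <= C" "0 < d" "\<forall>h. 0 < h --> h <= d --> om2 h <= C*h powr al" and e: "0 < e"
 shows "\<exists>d>0. \<forall>h. \<bar>h\<bar> <= d --> om2 h <= e"
proof -
 define d' where "d' = min d ((e/(C + 1)) powr (1/al))"
 have d': "0 < d'" using assms by (simp add: d'_def)
 have *: "om2 h <= e" if "0 < h" "h <= d'" for h
 proof -
  have "h powr al <= ((e/(C + 1)) powr (1/al)) powr al"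
   using that assms by (intro powr_mono2) (auto simp: d'_def)
  also have "... = e/(C + 1)" using assms by (simp add: powr_powr)
  finally have "(C + 1)*h powr al <= e" using assms by (simp add: field_simps)
  moreover have "C*h powr al <= (C + 1)*h powr al" by (intro mult_right_mono) auto
  moreover have "om2 h <= C*h powr al" using assms(4) that by (simp add: d'_def)
  ultimately show ?thesis by linarith
 qed
 have "om2 h <= e" if "\<bar>h\<bar> <= d'" for h
  using *[of h] *[of "-h"] that om2_even[of h] om2_0 e by (cases "h > 0"; cases "h = 0") auto
 then show ?thesis using d' by blast
qed

text \<open>A shift by \<open>pi/j\<close> reverses the sign of the \<open>j\<close>-th character, so the second difference with this step has \<open>j\<close>-th coefficient \<open>-4 r(j)\<close>.\<close>

lemma r_om2: "4*\<bar>r (int j)\<bar> <= om2 (pi/j)" if j: "1 <= j"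
proof -
 let ?h = "pi/j"
 let ?e = "%x. cis (- (of_int (int j)*x))"
 have sh: "(CI x. cpx (\<psi> (x + v))*?e x) = cis (real j * v)*cpx (r (int j))"
  and shi: "integrable circ (%x. cpx (\<psi> (x + v))*?e x)" for v
 proof -
  have T: "(%x. x + v) \<in> measurable circ borel" by (rule measurable_circ) measurable
  have m: "(%u. cpx (\<psi> u)*?e u) \<in> bm borel" by measurable
  have per: "cpx (\<psi> (x + 2*pi))*?e (x + 2*pi) = cpx (\<psi> x)*?e x" for x
  proof -
   have "?e (x + 2*pi) = ?e x*cnj (cis (2*pi*real j))"
    by (simp add: cis_mult cis_cnj algebra_simps)
   also have "cis (2*pi*real j) = 1" using cis_multiple_2pi[of "real j"] by simp
   finally show ?thesis by (simp add: psi_per)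
  qed
  note * = integral_periodic_transfer[OF m per T nn_integral_circ_shift]
  have e: "?e x = cis (real j * v)*?e (x + v)" for x by (simp add: cis_mult algebra_simps)
  have e': "cpx (\<psi> (x + v))*?e x = cis (real j * v)*(cpx (\<psi> (x + v))*?e (x + v))" for x
   by (subst e) (simp only: mult_ac)
  show "(CI x. cpx (\<psi> (x + v))*?e x) = cis (real j * v)*cpx (r (int j))"
  proof -
   have "(CI x. cpx (\<psi> (x + v))*?e x) = cis (real j * v)*(CI x. cpx (\<psi> (x + v))*?e (x + v))"
    by (subst e') (rule integral_mult_right_zero)
   also have "(CI x. cpx (\<psi> (x + v))*?e (x + v)) = (CI u. cpx (\<psi> u)*cis (- (of_int (int j)*u)))"
    using *(1) by simp
   finally show ?thesis unfolding r_fourier .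
  qed
  have "integrable circ (%x. cpx (\<psi> (x + v))*?e (x + v))"
   using *(2) psi_cis_integrable[of "- of_int (int j)"] by simp
  then show "integrable circ (%x. cpx (\<psi> (x + v))*?e x)" unfolding e' by (rule integrable_mult_right)
 qed
 have c: "cis (real j*?h) = -1" "cis (real j*(- ?h)) = -1" using j by (simp_all add: cis_pi cis_cnj[symmetric])
 have eq: "cpx (\<psi> (x + ?h) + \<psi> (x - ?h) - 2*\<psi> x)*?e x =
   cpx (\<psi> (x + ?h))*?e x + cpx (\<psi> (x + (- ?h)))*?e x - 2*(cpx (\<psi> (x + 0))*?e x)" for x
  by (simp add: algebra_simps)
 have "(CI x. cpx (\<psi> (x + ?h) + \<psi> (x - ?h) - 2*\<psi> x)*?e x) =
   (CI x. cpx (\<psi> (x + ?h))*?e x) + (CI x. cpx (\<psi> (x + (- ?h)))*?e x)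
    - 2*(CI x. cpx (\<psi> (x + 0))*?e x)"
  unfolding eq
  by (subst Bochner_Integration.integral_diff, intro Bochner_Integration.integrable_add shi, intro integrable_mult_right shi,
    subst Bochner_Integration.integral_add, intro shi, intro shi, simp only: integral_mult_right_zero)
 also have "... = - 4*cpx (r (int j))" unfolding sh c by simp
 finally have "4*\<bar>r (int j)\<bar> = cmod (CI x. cpx (\<psi> (x + ?h) + \<psi> (x - ?h) - 2*\<psi> x)*?e x)"
  by (simp add: norm_mult)
 also have "... <= (CI x. cmod (cpx (\<psi> (x + ?h) + \<psi> (x - ?h) - 2*\<psi> x)*?e x))"
  by (rule integral_norm_bound)
 also have "... = om2 ?h" unfolding om2_def norm_mult norm_of_real by simp
 finally show ?thesis .
qed

lemma r_decay:
 assumes "0 < al" "0 <= C" "0 < d" "\<forall>h. 0 < h --> h <= d --> om2 h <= C*h powr al"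
 shows "\<exists>K\<ge>0. \<forall>j\<ge>1. \<bar>r (int j)\<bar> <= K*real j powr (- al)"
proof -
 define K where "K = max (C*pi powr al) ((pi/d) powr al)"
 have "\<bar>r (int j)\<bar> <= K*real j powr (- al)" if j: "1 <= j" for j
 proof (cases "pi/j <= d")
  case True
  have "\<bar>r (int j)\<bar> <= om2 (pi/j)" using r_om2[OF j] by linarith
  also have "... <= C*(pi/j) powr al" using assms(4) True j by simp
  also have "... = (C*pi powr al)*real j powr (- al)" using j by (simp add: powr_divide powr_minus field_simps)
  also have "... <= K*real j powr (- al)" unfolding K_def by (intro mult_right_mono) auto
  finally show ?thesis .
 next
  case False
  then have "real j <= pi/d" using assms(3) j by (simp add: field_simps)
  then have "1 <= (pi/d/j) powr al" using assms j by (intro ge_one_powr_ge_zero) (auto simp: field_simps)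
  also have "... = (pi/d) powr al*real j powr (- al)"
   using j assms powr_divide[of "pi/d" "real j" al] by (simp only: powr_minus divide_inverse[symmetric])
  also have "... <= K*real j powr (- al)" unfolding K_def by (intro mult_right_mono) auto
  finally show ?thesis using r_abs_le_1[of "int j"] by linarith
 qed
 then show ?thesis by (intro exI[of _ K]) (auto simp: K_def intro: max.coboundedI2)
qed

end

lemma powr_minus_half: "0 < c ==> c powr (- (1/2)) = 1/sqrt c" for c :: real
 using powr_half_sqrt[of c] powr_minus[of c "1/2"] by (simp only: inverse_eq_divide)

lemma measurable_circ_circ:
 assumes "(%p. f (fst p) (snd p)) \<in> bm (borel \<Otimes>\<^sub>M borel)"
 shows "(%p. f (fst p) (snd p)) \<in> bm (circ \<Otimes>\<^sub>M circ)"
proof -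
 have "(%p. (fst p, snd p)) \<in> measurable (circ \<Otimes>\<^sub>M circ) (borel \<Otimes>\<^sub>M borel)"
  by (intro measurable_Pair measurable_compose[OF measurable_fst measurable_circ_id] measurable_compose[OF measurable_snd measurable_circ_id])
 from measurable_compose[OF this assms] show ?thesis by simp
qed

interpretation cc: pair_sigma_finite circ circ ..

lemma tonelli_circ:
 fixes f :: "real => real => ennreal"
 assumes "(%p. f (fst p) (snd p)) \<in> bm (borel \<Otimes>\<^sub>M borel)"
 shows "(CN x. (CN y. f x y)) = (CN y. (CN x. f x y))"
 using cc.Fubini'[of f] measurable_circ_circ[OF assms] by (simp add: case_prod_unfold)

lemma symbol_mass_le:
 assumes "1 <= n" "!!t. 0 <= t ==> t <= 1 ==> cmod (tt t) <= B"
 shows "symbol_mass n tt <= B^2"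
proof -
 have "(\<Sum>k=1..n. (cmod (tt (real k/real n)))^2) <= real (card {1..n})*B^2"
  using assms by (intro sum_bounded_above power_mono) auto
 then show ?thesis using assms(1) by (simp add: symbol_mass_def field_simps)
qed

lemma symbol_mass_nonneg: "0 <= symbol_mass n tt"
 by (simp add: symbol_mass_def sum_nonneg)

lemma symbol_mass_1: "1 <= n ==> symbol_mass n (%_. 1) = 1"
 by (simp add: symbol_mass_def)

lemma cos_le_off_origin:
 assumes "0 < d" "d <= 1" "d <= v" "v <= 2*pi - d"
 shows "cos v <= cos d"
proof (cases "v <= pi")
 case True
 then show ?thesis using assms by (intro cos_monotone_0_pi_le) auto
next
 case False
 have "cos v = cos (2*pi - v)" by (simp add: cos_diff)
 also have "... <= cos d" using assms False by (intro cos_monotone_0_pi_le) auto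
 finally show ?thesis .
qed

lemma nn_gauss_exp:
 assumes c: "0 < c"
 shows "(\<integral>\<^sup>+xi. ennreal (exp (- (c*xi^2/2))) \<partial>std_gauss) <= ennreal (c powr (- (1/2)))"
proof -
 define si where "si = 1/sqrt c"
 have si: "0 < si" "si^2 = 1/c" using c by (auto simp: si_def power_divide)
 have pt: "std_normal_density xi*exp (- (c*xi^2/2)) <= si*normal_density 0 si xi" for xi
 proof -
  have "si*normal_density 0 si xi = 1/sqrt (2*pi)*exp (- (c*xi^2/2))"
   using c si by (simp add: normal_density_def real_sqrt_mult) (simp add: si_def real_sqrt_divide real_sqrt_mult field_simps)
  moreover have "std_normal_density xi <= 1/sqrt (2*pi)"
   by (simp add: std_normal_density_def divide_right_mono)
  ultimately show ?thesis using mult_right_mono[of "std_normal_density xi" "1/sqrt (2*pi)" "exp (- (c*xi^2/2))"] by simp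
 qed
 have "(\<integral>\<^sup>+xi. ennreal (exp (- (c*xi^2/2))) \<partial>std_gauss) = (\<integral>\<^sup>+xi. ennreal (std_normal_density xi)*ennreal (exp (- (c*xi^2/2))) \<partial>lborel)"
  unfolding std_gauss_def by (subst nn_integral_density) auto
 also have "... = (\<integral>\<^sup>+xi. ennreal (std_normal_density xi*exp (- (c*xi^2/2))) \<partial>lborel)"
  by (simp add: ennreal_mult)
 also have "... <= (\<integral>\<^sup>+xi. ennreal (si*normal_density 0 si xi) \<partial>lborel)"
  by (intro nn_integral_mono ennreal_leI pt)
 also have "... = ennreal si*(\<integral>\<^sup>+xi. ennreal (normal_density 0 si xi) \<partial>lborel)"
  using si by (subst nn_integral_cmult[symmetric]) (auto simp: ennreal_mult)
 also have "(\<integral>\<^sup>+xi. ennreal (normal_density 0 si xi) \<partial>lborel) = 1"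
  using integrable_normal_density[OF si(1), of 0] integral_normal_density[OF si(1), of 0]
  by (subst nn_integral_eq_integral) auto
 finally have "(\<integral>\<^sup>+xi. ennreal (exp (- (c*xi^2/2))) \<partial>std_gauss) <= ennreal si" by simp
 moreover have "si = c powr (- (1/2))" using powr_minus_half[OF c] by (simp only: si_def)
 ultimately show ?thesis by simp
qed

lemma nn_gauss_exp_powr:
 assumes c: "0 < c" and be: "0 < be" "be <= 1/2"
 shows "(\<integral>\<^sup>+xi. ennreal (exp (- (c*xi^2/2))) \<partial>std_gauss) <= ennreal (c powr (- be))"
proof (cases "c \<ge> 1")
 case True
 have "c powr (- (1/2)) <= c powr (- be)" using True be by (intro powr_mono) auto
 then show ?thesis using nn_gauss_exp[OF c] order_trans ennreal_leI by blast
next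
 case False
 have "(\<integral>\<^sup>+xi. ennreal (exp (- (c*xi^2/2))) \<partial>std_gauss) <= (\<integral>\<^sup>+xi. 1 \<partial>std_gauss)"
  using c by (intro nn_integral_mono) (simp add: ennreal_le_1)
 also have "... = ennreal 1" using std_gauss.emeasure_space_1 by simp
 also have "... <= ennreal (c powr (- be))"
 proof (rule ennreal_leI)
  have "(1/c) powr 0 <= (1/c) powr be" using False c be by (intro powr_mono) auto
  then show "1 <= c powr (- be)" using c powr_divide[of 1 c be] by (simp add: powr_minus_divide)
 qed
 finally show ?thesis .
qed

context spectral begin

text \<open>Lags below \<open>sqrt n\<close> make up a fraction of order \<open>n^(-1/2)\<close> of all pairs; the others are bounded by the decay at lag \<open>sqrt n\<close>.\<close>

lemma mean_square_corr_decay: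
 assumes al: "0 < al" and K: "0 <= K" "!!j. 1 <= j ==> \<bar>r (int j)\<bar> <= K*real j powr (- al)"
  and n: "1 <= n"
 shows "mean_square_corr r n <= (3 + K)*real n powr (- min (1/2) (al/2))"
proof -
 define s where "s = \<lfloor>sqrt (real n)\<rfloor>"
 define q where "q = real n powr (- (al/2))"
 have n1: "1 <= real n" using n by simp
 have s0: "0 <= s" "of_int s <= sqrt n" by (auto simp: s_def)
 have pt: "(r j)^2 <= (if \<bar>j\<bar> <= s then 1 else 0) + K*q" for j :: int
 proof (cases "\<bar>j\<bar> <= s")
  case True
  have "(r j)^2 <= 1" using r_abs_le_1[of j] by (simp add: abs_square_le_1)
  then show ?thesis using True K by (auto simp: q_def intro: order_trans[of _ "1"])
 next
  case False
  define m where "m = nat \<bar>j\<bar>"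
  have m: "1 <= m" "sqrt n <= real m" "r j = r (int m)"
  proof -
   show "1 <= m" using False s0 by (auto simp: m_def)
   have "s + 1 <= \<bar>j\<bar>" using False by simp
   then have "of_int (s + 1) <= real m" unfolding m_def by simp
   moreover have "sqrt n < of_int s + 1" unfolding s_def by linarith
   ultimately show "sqrt n <= real m" by simp
   show "r j = r (int m)" unfolding m_def using r_symmetric[of j] by (cases "j \<ge> 0") auto
  qed
  have "(r j)^2 = \<bar>r j\<bar>*\<bar>r j\<bar>" by (simp add: power2_eq_square)
  also have "... <= 1*\<bar>r j\<bar>" by (intro mult_right_mono r_abs_le_1) simp
  also have "... <= K*real m powr (- al)" using K(2)[OF m(1)] m(3) by simp
  also have "real m powr (- al) <= sqrt n powr (- al)" using m n al by (intro powr_mono2') auto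
  also have "sqrt n powr (- al) = q" using n by (simp add: q_def powr_half_sqrt[symmetric] powr_powr)
  finally show ?thesis using False K by (simp add: mult_left_mono)
 qed
 have row: "(\<Sum>l=1..n. (r (int k - int l))^2) <= 3 * sqrt n + n*(K*q)" for k
 proof -
  have "(\<Sum>l=1..n. (r (int k - int l))^2) <= (\<Sum>l=1..n. (if \<bar>int k - int l\<bar> <= s then 1 else 0) + K*q)"
   by (intro sum_mono pt)
  also have "... = real (card {l\<in>{1..n}. \<bar>int k - int l\<bar> <= s}) + n*(K*q)"
   by (simp add: sum.distrib sum.If_cases Int_def)
  also have "card {l\<in>{1..n}. \<bar>int k - int l\<bar> <= s} <= card {int k - s..int k + s}"
   by (rule card_inj_on_le[of int]) auto
  also have "real (card {int k - s..int k + s}) = 2 * of_int s + 1" using s0 by simp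
  also have "... <= 3 * sqrt n" using s0 real_sqrt_ge_1_iff[of n] n1 by linarith
  finally show ?thesis by simp
 qed
 have "(\<Sum>k=1..n. \<Sum>l=1..n. (r (int k - int l))^2) <= real (card {1..n})*(3 * sqrt n + n*(K*q))"
  by (rule sum_bounded_above[OF row])
 then have "mean_square_corr r n <= n*(3 * sqrt n + n*(K*q))/(real n)^2"
  unfolding mean_square_corr_def by (intro divide_right_mono) auto
 also have "... = 3*(sqrt n/n) + K*q" using n1 by (simp add: field_simps power2_eq_square)
 also have "sqrt n/n = real n powr (- (1/2))"
 proof -
  have "sqrt n/n = 1/sqrt n" using n1 by (simp add: field_simps)
  then show ?thesis using n1 powr_minus_half[of "real n"] by simp
 qed
 also have "3*real n powr (- (1/2)) + K*q <= 3*real n powr (- min (1/2) (al/2)) + K*real n powr (- min (1/2) (al/2))"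
  unfolding q_def using K n1 by (intro add_mono mult_left_mono powr_mono) auto
 finally show ?thesis by (simp add: algebra_simps)
qed

lemma var_deviation:
 "(CN x. ennreal \<bar>var n tt x - symbol_mass n tt*(2*pi*\<psi> x)\<bar>) <= (CN v. ennreal (kernel n tt v * om v))"
proof -
 obtain K where K: "!!v. kernel n tt v <= K" using kernel_bounded by blast
 have ki: "integrable circ (kernel n tt)"
  using K kernel_nonneg[of n tt] by (intro integrable_circ_bounded[of _ K] measurable_circ measurable_kernel) auto
 have pt: "ennreal \<bar>var n tt x - symbol_mass n tt*(2*pi*\<psi> x)\<bar> <= (CN v. ennreal (kernel n tt v * \<bar>\<psi> (x - v) - \<psi> x\<bar>))" for x
 proof -
  have "symbol_mass n tt*(2*pi*\<psi> x) = (CI v. kernel n tt v * \<psi> x)"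
   by (simp add: integral_kernel)
  then have "var n tt x - symbol_mass n tt*(2*pi*\<psi> x) = (CI v. kernel n tt v * \<psi> (x - v) - kernel n tt v * \<psi> x)"
   using kernel_psi_integrable ki by (simp add: var_eq)
  also have "... = (CI v. kernel n tt v * (\<psi> (x - v) - \<psi> x))" by (simp add: algebra_simps)
  finally have eq: "var n tt x - symbol_mass n tt*(2*pi*\<psi> x) = ..." .
  have "integrable circ (%v. kernel n tt v * (\<psi> (x - v) - \<psi> x))"
   using Bochner_Integration.integrable_diff[OF kernel_psi_integrable[of n tt x] integrable_mult_left[OF ki, of "\<psi> x"]]
   by (simp add: algebra_simps)
  then have "ennreal (norm (CI v. kernel n tt v * (\<psi> (x - v) - \<psi> x))) <= (CN v. ennreal (norm (kernel n tt v * (\<psi> (x - v) - \<psi> x))))"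
   by (rule integral_norm_bound_ennreal)
  then show ?thesis unfolding eq by (simp add: abs_mult kernel_nonneg)
 qed
 have "(CN x. ennreal \<bar>var n tt x - symbol_mass n tt*(2*pi*\<psi> x)\<bar>) <=
   (CN x. (CN v. ennreal (kernel n tt v * \<bar>\<psi> (x - v) - \<psi> x\<bar>)))"
  by (intro nn_integral_mono pt)
 also have "... = (CN v. (CN x. ennreal (kernel n tt v * \<bar>\<psi> (x - v) - \<psi> x\<bar>)))"
  by (rule tonelli_circ) measurable
 also have "... = (CN v. ennreal (kernel n tt v * om v))"
 proof (rule nn_integral_cong)
  fix v
  have m: "(%x. \<bar>\<psi> (x - v) - \<psi> x\<bar>) \<in> bm circ" by (rule measurable_circ) measurable
  have "(CN x. ennreal (kernel n tt v * \<bar>\<psi> (x - v) - \<psi> x\<bar>)) = (CN x. ennreal (kernel n tt v)*ennreal \<bar>\<psi> (x - v) - \<psi> x\<bar>)"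
   by (simp add: ennreal_mult kernel_nonneg)
  also have "... = ennreal (kernel n tt v)*(CN x. ennreal \<bar>\<psi> (x - v) - \<psi> x\<bar>)"
   by (intro nn_integral_cmult measurable_compose[OF m measurable_ennreal])
  also have "(CN x. ennreal \<bar>\<psi> (x - v) - \<psi> x\<bar>) = ennreal (om v)"
   unfolding om_def by (intro nn_integral_eq_integral om_integrable) simp
  finally show "(CN x. ennreal (kernel n tt v * \<bar>\<psi> (x - v) - \<psi> x\<bar>)) = ennreal (kernel n tt v * om v)"
   by (simp add: ennreal_mult kernel_nonneg om_nonneg)
 qed
 finally show ?thesis .
qed

text \<open>The kernel concentrates near \<open>0\<close> at a rate that depends on the symbol only through its bound and Lipschitz constant (\<open>kernel_tail\<close>); hence the uniformity in \<open>tt\<close>.\<close>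

lemma var_L1_limit:
 assumes small: "!!e. 0 < e ==> \<exists>d>0. \<forall>h. \<bar>h\<bar> <= d --> om h <= e" and e: "0 < e"
 shows "\<exists>N\<ge>1. \<forall>n\<ge>N. \<forall>tt. (\<forall>t. 0 <= t --> t <= 1 --> cmod (tt t) <= B) -->
   (\<forall>s t. 0 <= s --> s <= 1 --> 0 <= t --> t <= 1 --> cmod (tt s - tt t) <= L*\<bar>s - t\<bar>) -->
   (CN x. ennreal \<bar>var n tt x - symbol_mass n tt*(2*pi*\<psi> x)\<bar>) <= ennreal e"
proof -
 define e' where "e' = e/(2*(2*pi*B^2 + 1))"
 have den: "0 < 2*pi*B^2 + 1" by (simp add: add_nonneg_pos)
 have e': "0 < e'" using e den by (simp add: e'_def)
 obtain d0 where d0: "0 < d0" "!!h. \<bar>h\<bar> <= d0 ==> om h <= e'" using small[OF e'] by blast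
 define d where "d = min d0 1"
 have d: "0 < d" "d <= 1" "!!h. \<bar>h\<bar> <= d ==> om h <= e'" using d0 by (auto simp: d_def)
 define D where "D = 2 - 2*cos d"
 have D: "0 < D" using cos_monotone_0_pi[of 0 d] d pi_gt3 by (simp add: D_def)
 have om: "om v <= e' + 2/D*(2 - 2*cos v)" if "v \<in> {0..2*pi}" for v
 proof -
  have c2: "0 <= 2/D*(2 - 2*cos v)" using D by simp
  consider "v <= d" | "2*pi - d <= v" | "d <= v" "v <= 2*pi - d" by linarith
  then show ?thesis
  proof cases
   case 1 then show ?thesis using d(3)[of v] that c2 by auto
  next
   case 2
   then have "\<bar>v - 2*pi\<bar> <= d" using that by auto
   then show ?thesis using d(3)[of "v - 2*pi"] om_periodic[of v] c2 by linarith
  next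
   case 3
   then have "D <= 2 - 2*cos v" using cos_le_off_origin[OF d(1,2)] by (simp add: D_def)
   then have "2 <= 2/D*(2 - 2*cos v)" using D by (simp add: field_simps)
   then show ?thesis using om_le_2[of v] e' by linarith
  qed
 qed
 define N where "N = max 1 (nat \<lceil>2*(2/D*(2*pi*(2*B^2 + L^2)))/e\<rceil>)"
 show ?thesis
 proof (intro exI[of _ N] conjI allI impI)
  show "N \<ge> 1" by (simp add: N_def)
  fix n tt assume n: "N <= n"
   and B: "\<forall>t. 0 <= t --> t <= 1 --> cmod (tt t) <= B"
   and L: "\<forall>s t. 0 <= s --> s <= 1 --> 0 <= t --> t <= 1 --> cmod (tt s - tt t) <= L*\<bar>s - t\<bar>"
  have n1: "1 <= n" using n by (simp add: N_def)
  have km: "(%v. kernel n tt v) \<in> bm circ" by (rule measurable_circ) measurable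
  have km': "(%v. kernel n tt v * (2 - 2*cos v)) \<in> bm circ" by (rule measurable_circ) measurable
  have "(CN x. ennreal \<bar>var n tt x - symbol_mass n tt*(2*pi*\<psi> x)\<bar>) <= (CN v. ennreal (kernel n tt v * om v))"
   by (rule var_deviation)
  also have "... <= (CN v. ennreal e'*ennreal (kernel n tt v) + ennreal (2/D)*ennreal (kernel n tt v * (2 - 2*cos v)))"
  proof (rule nn_integral_mono)
   fix v assume "v \<in> space circ"
   then have "kernel n tt v * om v <= kernel n tt v * (e' + 2/D*(2 - 2*cos v))"
    using om by (intro mult_left_mono kernel_nonneg) (auto simp: space_circ)
   also have "... = e'*kernel n tt v + 2/D*(kernel n tt v * (2 - 2*cos v))" by (simp add: algebra_simps)
   finally have "ennreal (kernel n tt v * om v) <= ennreal (e'*kernel n tt v + 2/D*(kernel n tt v * (2 - 2*cos v)))"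
    by (rule ennreal_leI)
   also have "... = ennreal e'*ennreal (kernel n tt v) + ennreal (2/D)*ennreal (kernel n tt v * (2 - 2*cos v))"
   proof -
    have "ennreal (e'*kernel n tt v + 2/D*(kernel n tt v * (2 - 2*cos v))) =
      ennreal (e'*kernel n tt v) + ennreal (2/D*(kernel n tt v * (2 - 2*cos v)))"
     using e' D kernel_nonneg[of n tt v] by (intro ennreal_plus mult_nonneg_nonneg) auto
    also have "... = ennreal e'*ennreal (kernel n tt v) + ennreal (2/D)*ennreal (kernel n tt v * (2 - 2*cos v))"
     using e' D by (intro arg_cong2[where f = "(+)"] ennreal_mult') auto
    finally show ?thesis .
   qed
   finally show "ennreal (kernel n tt v * om v) <= ..." .
  qed
  also have "... = ennreal e'*(CN v. ennreal (kernel n tt v)) + ennreal (2/D)*(CN v. ennreal (kernel n tt v * (2 - 2*cos v)))"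
   using km km' by (subst nn_integral_add) (auto simp: nn_integral_cmult)
  also have "... <= ennreal e'*ennreal (2*pi*B^2) + ennreal (2/D)*ennreal (2*pi*(2*B^2 + L^2)/n)"
  proof (intro add_mono mult_left_mono)
   show "(CN v. ennreal (kernel n tt v)) <= ennreal (2*pi*B^2)"
    unfolding nn_integral_kernel using symbol_mass_le[OF n1, of tt B] B by (intro ennreal_leI) simp
   show "(CN v. ennreal (kernel n tt v * (2 - 2*cos v))) <= ennreal (2*pi*(2*B^2 + L^2)/n)"
    using kernel_tail[OF n1, of tt B L] B L by blast
  qed simp_all
  also have "... = ennreal (e'*(2*pi*B^2) + 2/D*(2*pi*(2*B^2 + L^2)/n))"
  proof -
   have "ennreal (e'*(2*pi*B^2) + 2/D*(2*pi*(2*B^2 + L^2)/n)) =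
     ennreal (e'*(2*pi*B^2)) + ennreal (2/D*(2*pi*(2*B^2 + L^2)/n))"
    using e' D by (intro ennreal_plus mult_nonneg_nonneg divide_nonneg_nonneg add_nonneg_nonneg) auto
   also have "... = ennreal e'*ennreal (2*pi*B^2) + ennreal (2/D)*ennreal (2*pi*(2*B^2 + L^2)/n)"
    using e' D by (intro arg_cong2[where f = "(+)"] ennreal_mult') auto
   finally show ?thesis by simp
  qed
  also have "... <= ennreal e"
  proof (rule ennreal_leI)
   have "e'*(2*pi*B^2) <= e'*(2*pi*B^2 + 1)" using e' by (intro mult_left_mono) auto
   also have "... = e/2"
   proof -
    have "e/(2*y)*y = e/2" if "0 < y" for y :: real using that by simp
    from this[OF den] show ?thesis unfolding e'_def .
   qed
   finally have 1: "e'*(2*pi*B^2) <= e/2" .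
   have "2*(2/D*(2*pi*(2*B^2 + L^2)))/e <= real N" unfolding N_def by linarith
   also have "... <= real n" using n by simp
   finally have *: "2*(2/D*(2*pi*(2*B^2 + L^2)))/e <= real n" .
   have "X <= e/2*m" if "2*X/e <= m" for X m :: real using that e by (simp add: field_simps)
   from this[OF *] have "2/D*(2*pi*(2*B^2 + L^2)) <= e/2*n" .
   note st = this
   have aux: "q*(p/m) <= e/2" if "q*p <= e/2*m" "0 < m" for q p m :: real
    using that by (simp add: field_simps)
   have 2: "2/D*(2*pi*(2*B^2 + L^2)/n) <= e/2" by (rule aux[OF st]) (use n1 in simp)
   from 1 2 show "e'*(2*pi*B^2) + 2/D*(2*pi*(2*B^2 + L^2)/n) <= e" by linarith
  qed
  finally show "(CN x. ennreal \<bar>var n tt x - symbol_mass n tt*(2*pi*\<psi> x)\<bar>) <= ennreal e" .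
 qed
qed

text \<open>Jensen: the variance is an average of \<open>2 pi \<psi>\<close> and \<open>exp(- ka t)\<close> is convex in \<open>t\<close>.\<close>

lemma exp_var_le:
 assumes n: "1 <= n" and ka: "0 <= ka"
 shows "(CN x. ennreal (exp (- (ka * var n (%_. 1) x)))) <= (CN x. ennreal (exp (- (ka*(2*pi*\<psi> x)))))"
proof -
 define k where "k = (%v. kernel n (%_. 1) v/(2*pi))"
 obtain K where K: "!!v. kernel n (%_. 1) v <= K" using kernel_bounded by blast
 have k0: "0 <= k v" for v by (simp add: k_def kernel_nonneg)
 have kK: "k v <= K/(2*pi)" for v unfolding k_def by (intro divide_right_mono K) simp
 have km [measurable]: "k \<in> bm borel" unfolding k_def by measurable
 have ki: "integrable circ k" using k0 kK by (intro integrable_circ_bounded[of _ "K/(2*pi)"] measurable_circ km) auto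
 have k1: "(CI v. k v) = 1" unfolding k_def by (simp add: integral_kernel symbol_mass_1[OF n])
 have k1': "(CN v. ennreal (k v)) = 1" using ki k1 k0 by (subst nn_integral_eq_integral) auto
 have kpi: "integrable circ (%v. k v * \<psi> (x - v))" for x
  unfolding k_def using integrable_divide[OF kernel_psi_integrable[of n "%_. 1" x], of "2*pi"] by simp
 have V: "(CI v. k v * \<psi> (x - v)) = var n (%_. 1) x/(2*pi)" for x
  unfolding k_def var_eq by simp
 have pt: "ennreal (exp (- (ka * var n (%_. 1) x))) <= (CN v. ennreal (k v * exp (- (ka*(2*pi*\<psi> (x - v))))))" for x
 proof -
  let ?V = "var n (%_. 1) x"
  have ei: "integrable circ (%v. k v * exp (- (ka*(2*pi*\<psi> (x - v)))))"
  proof (rule integrable_circ_bounded)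
   show "(%v. k v * exp (- (ka*(2*pi*\<psi> (x - v))))) \<in> bm circ" by (rule measurable_circ) measurable
   fix v
   have "k v * exp (- (ka*(2*pi*\<psi> (x - v)))) <= K/(2*pi)*1"
    using k0 kK ka psi_nonneg by (intro mult_mono) (auto intro: order_trans[OF k0 kK])
   then show "norm (k v * exp (- (ka*(2*pi*\<psi> (x - v))))) <= K/(2*pi)*1" using k0 by simp
  qed
  have "exp (- (ka*?V)) = exp (- (ka*?V))*((1 + ka*?V)*(CI v. k v) - ka*(2*pi)*(CI v. k v * \<psi> (x - v)))"
   unfolding V k1 by simp
  also have "... = (CI v. exp (- (ka*?V))*((1 + ka*?V)*k v - ka*(2*pi)*(k v * \<psi> (x - v))))"
   using ki kpi by simp
  also have "... <= (CI v. k v * exp (- (ka*(2*pi*\<psi> (x - v)))))"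
  proof (rule integral_mono)
   show "integrable circ (%v. exp (- (ka*?V))*((1 + ka*?V)*k v - ka*(2*pi)*(k v * \<psi> (x - v))))"
    using ki kpi by (intro integrable_mult_right Bochner_Integration.integrable_diff)
   show "integrable circ (%v. k v * exp (- (ka*(2*pi*\<psi> (x - v)))))" by (rule ei)
   fix v
   let ?w = "ka*(2*pi*\<psi> (x - v))"
   have "exp (- (ka*?V))*(1 + (ka*?V - ?w)) <= exp (- (ka*?V))*exp (ka*?V - ?w)"
    by (intro mult_left_mono exp_ge_add_one_self) simp
   also have "... = exp (- ?w)" by (simp add: exp_add[symmetric])
   finally have "k v * (exp (- (ka*?V))*(1 + (ka*?V - ?w))) <= k v * exp (- ?w)" using k0 by (rule mult_left_mono)
   moreover have "k v * (exp (- (ka*?V))*(1 + (ka*?V - ?w))) = exp (- (ka*?V))*((1 + ka*?V)*k v - ka*(2*pi)*(k v * \<psi> (x - v)))"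
    by (simp add: algebra_simps)
   ultimately show "exp (- (ka*?V))*((1 + ka*?V)*k v - ka*(2*pi)*(k v * \<psi> (x - v))) <= k v * exp (- ?w)" by linarith
  qed
  finally have "ennreal (exp (- (ka*?V))) <= ennreal (CI v. k v * exp (- (ka*(2*pi*\<psi> (x - v)))))"
   by (rule ennreal_leI)
  also have "... = (CN v. ennreal (k v * exp (- (ka*(2*pi*\<psi> (x - v))))))"
   using ei k0 by (intro nn_integral_eq_integral[symmetric]) auto
  finally show ?thesis .
 qed
 have "(CN x. ennreal (exp (- (ka * var n (%_. 1) x)))) <=
   (CN x. (CN v. ennreal (k v * exp (- (ka*(2*pi*\<psi> (x - v)))))))"
  by (intro nn_integral_mono pt)
 also have "... = (CN v. (CN x. ennreal (k v * exp (- (ka*(2*pi*\<psi> (x - v)))))))"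
  by (rule tonelli_circ) measurable
 also have "... = (CN v. ennreal (k v)*(CN x. ennreal (exp (- (ka*(2*pi*\<psi> x))))))"
 proof (rule nn_integral_cong)
  fix v
  have m: "(%x. exp (- (ka*(2*pi*\<psi> (x - v))))) \<in> bm circ" by (rule measurable_circ) measurable
  have "(CN x. ennreal (k v * exp (- (ka*(2*pi*\<psi> (x - v)))))) = (CN x. ennreal (k v)*ennreal (exp (- (ka*(2*pi*\<psi> (x - v))))))"
   using k0 by (simp add: ennreal_mult)
  also have "... = ennreal (k v)*(CN x. ennreal (exp (- (ka*(2*pi*\<psi> (x - v))))))"
   by (intro nn_integral_cmult measurable_compose[OF m measurable_ennreal])
  also have "(CN x. ennreal (exp (- (ka*(2*pi*\<psi> (x - v)))))) = (CN x. ennreal (exp (- (ka*(2*pi*\<psi> x)))))"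
   using nn_integral_circ_shift[of "%x. ennreal (exp (- (ka*(2*pi*\<psi> x))))" "- v"] by (simp add: psi_per)
  finally show "(CN x. ennreal (k v * exp (- (ka*(2*pi*\<psi> (x - v)))))) = ennreal (k v)*(CN x. ennreal (exp (- (ka*(2*pi*\<psi> x)))))" .
 qed
 also have "... = (CN v. ennreal (k v))*(CN x. ennreal (exp (- (ka*(2*pi*\<psi> x)))))"
  by (rule nn_integral_multc) (simp add: measurable_circ)
 finally show ?thesis by (simp add: k1')
qed

lemma inverse_Lp_consequences:
 assumes A2: "inverse_in_Lp \<psi> \<gamma>" and \<gamma>: "0 < \<gamma>" and be: "0 < be" "be <= \<gamma>"
 shows "AE x in circ. 0 < \<psi> x" "(CN x. ennreal (\<psi> x powr (- be))) < \<infinity>"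
proof -
 let ?I = "%x. inverse (ennreal (\<psi> x powr \<gamma>))"
 have fin: "(CN x. ?I x) < \<infinity>" using A2 unfolding inverse_in_Lp_def nn_integral_circ by simp
 have m: "?I \<in> bm circ" by (rule measurable_circ) measurable
 have "AE x in circ. ?I x \<noteq> \<infinity>" using fin by (intro nn_integral_noteq_infinite m) auto
 then show pos: "AE x in circ. 0 < \<psi> x"
 proof eventually_elim
  case (elim x)
  then have "\<psi> x \<noteq> 0" by (auto simp: ennreal_inverse_eq_top_iff)
  then show ?case using psi_nonneg[of x] by linarith
 qed
 have "(CN x. ennreal (\<psi> x powr (- be))) <= (CN x. 1 + ?I x)"
 proof (rule nn_integral_mono_AE)
  show "AE x in circ. ennreal (\<psi> x powr (- be)) <= 1 + ?I x"
   using pos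
  proof eventually_elim
   case (elim x)
   have "\<psi> x powr (- be) <= 1 + \<psi> x powr (- \<gamma>)"
   proof (cases "\<psi> x <= 1")
    case True
    have "(1/\<psi> x) powr be <= (1/\<psi> x) powr \<gamma>" using elim True be by (intro powr_mono) auto
    then have "\<psi> x powr (- be) <= \<psi> x powr (- \<gamma>)"
     using elim powr_divide[of 1 "\<psi> x" be] powr_divide[of 1 "\<psi> x" \<gamma>] by (simp add: powr_minus_divide)
    then show ?thesis by linarith
   next
    case False
    have "\<psi> x powr (- be) <= \<psi> x powr 0" using False be by (intro powr_mono) auto
    then show ?thesis using elim by (simp add: add_increasing2)
   qed
   then have "ennreal (\<psi> x powr (- be)) <= ennreal (1 + \<psi> x powr (- \<gamma>))" by (rule ennreal_leI)
   also have "... = 1 + ?I x" using elim by (simp add: ennreal_plus inverse_ennreal powr_minus)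
   finally show ?case .
  qed
 qed
 also have "... = emeasure circ (space circ) + (CN x. ?I x)" using m by (subst nn_integral_add) auto
 also have "... < \<infinity>" using fin by (simp add: emeasure_circ_space)
 finally show "(CN x. ennreal (\<psi> x powr (- be))) < \<infinity>" .
qed

text \<open>Integrating \<open>exp(- ka s^2 t^2/2)\<close> over a standard normal \<open>t\<close> gives \<open>(1 + ka s^2)^(-1/2) <= (ka s^2)^(- be)\<close>, which needs \<open>be <= 1/2\<close>.\<close>

lemma gauss_average_bound:
 assumes A2: "inverse_in_Lp \<psi> \<gamma>" and \<gamma>: "0 < \<gamma>" and be: "0 < be" "be <= \<gamma>" "be <= 1/2"
 shows "\<exists>C\<ge>0. \<forall>ka>0. (CN x. \<integral>\<^sup>+xi. ennreal (exp (- (ka*(2*pi*\<psi> x)*xi^2/2))) \<partial>std_gauss) <= ennreal (C*ka powr (- be))"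
proof -
 note c = inverse_Lp_consequences[OF A2 \<gamma> be(1,2)]
 define C where "C = (2*pi) powr (- be)*enn2real (CN x. ennreal (\<psi> x powr (- be)))"
 have C0: "0 <= C" by (simp add: C_def)
 show ?thesis
 proof (intro exI[of _ C] conjI allI impI C0)
  fix ka :: real assume ka: "0 < ka"
  have m: "(%x. \<psi> x powr (- be)) \<in> bm circ" by (rule measurable_circ) measurable
  have "(CN x. \<integral>\<^sup>+xi. ennreal (exp (- (ka*(2*pi*\<psi> x)*xi^2/2))) \<partial>std_gauss)
    <= (CN x. ennreal ((ka*(2*pi)) powr (- be))*ennreal (\<psi> x powr (- be)))"
  proof (rule nn_integral_mono_AE)
   show "AE x in circ. (\<integral>\<^sup>+xi. ennreal (exp (- (ka*(2*pi*\<psi> x)*xi^2/2))) \<partial>std_gauss) <= ennreal ((ka*(2*pi)) powr (- be))*ennreal (\<psi> x powr (- be))"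
    using c(1)
   proof eventually_elim
    case (elim x)
    have "(\<integral>\<^sup>+xi. ennreal (exp (- (ka*(2*pi*\<psi> x)*xi^2/2))) \<partial>std_gauss) <= ennreal ((ka*(2*pi*\<psi> x)) powr (- be))"
     using elim ka be by (intro nn_gauss_exp_powr) auto
    also have "... = ennreal ((ka*(2*pi)) powr (- be)*\<psi> x powr (- be))"
     using elim ka by (subst powr_mult[symmetric]) (auto simp: mult.assoc)
    finally show ?case by (simp add: ennreal_mult)
   qed
  qed
  also have "... = ennreal ((ka*(2*pi)) powr (- be))*(CN x. ennreal (\<psi> x powr (- be)))"
   by (intro nn_integral_cmult measurable_compose[OF m measurable_ennreal])
  also have "(CN x. ennreal (\<psi> x powr (- be))) = ennreal (enn2real (CN x. ennreal (\<psi> x powr (- be))))"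
   using c(2) by simp
  also have "ennreal ((ka*(2*pi)) powr (- be)) * ... = ennreal (C*ka powr (- be))"
   using ka by (subst ennreal_mult[symmetric]) (auto simp: C_def powr_mult mult_ac)
  finally show "(CN x. \<integral>\<^sup>+xi. ennreal (exp (- (ka*(2*pi*\<psi> x)*xi^2/2))) \<partial>std_gauss) <= ennreal (C*ka powr (- be))" .
 qed
qed

end

section \<open>Deterministic trigonometric sums and interpolation between indices\<close>

definition trig_field :: "(nat => real) => (nat => real) => nat => (real => complex) => real => real" where
 "trig_field al be n tt x = pairing al be n (wave n tt x)"

definition energy :: "(nat => real) => (nat => real) => nat => real" where
 "energy al be n = (\<Sum>k=1..n. (al k)^2 + (be k)^2)"

definition lip_symbol :: "real => real => (real => complex) => bool" where
 "lip_symbol B L tt \<longleftrightarrow> (\<forall>t. 0 <= t --> t <= 1 --> cmod (tt t) <= B) \<and>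
   (\<forall>s t. 0 <= s --> s <= 1 --> 0 <= t --> t <= 1 --> cmod (tt s - tt t) <= L*\<bar>s - t\<bar>)"

lemma lip_symbolD:
 assumes "lip_symbol B L tt"
 shows "0 <= t ==> t <= 1 ==> cmod (tt t) <= B"
  and "0 <= s ==> s <= 1 ==> 0 <= t ==> t <= 1 ==> cmod (tt s - tt t) <= L*\<bar>s - t\<bar>"
  and "0 <= B" "0 <= L"
proof -
 show "0 <= t ==> t <= 1 ==> cmod (tt t) <= B"
  and *: "0 <= s ==> s <= 1 ==> 0 <= t ==> t <= 1 ==> cmod (tt s - tt t) <= L*\<bar>s - t\<bar>" for s t
  using assms unfolding lip_symbol_def by blast+
 have "cmod (tt 0) <= B" using assms unfolding lip_symbol_def by simp
 then show "0 <= B" using norm_ge_zero[of "tt 0"] by linarith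
 show "0 <= L" using order_trans[OF norm_ge_zero *[of 0 1]] by simp
qed

lemma measurable_trig_field [measurable]: "trig_field al be n tt \<in> bm borel"
 unfolding trig_field_def[abs_def] pairing_def
 by (intro borel_measurable_sum borel_measurable_add borel_measurable_times) (auto intro!: measurable_compose[OF measurable_wave])

lemma trig_field_periodic: "trig_field al be n tt (x + 2*pi) = trig_field al be n tt x"
 unfolding trig_field_def wave_periodic[abs_def] pairing_def by (simp add: wave_periodic)

lemma pairing_Re:
 "pairing al be n z = Re (\<Sum>k=1..n. z k*Complex (al k) (- be k))"
 by (simp add: pairing_def)

lemma cmod_Complex_sq: "(cmod (Complex p q))^2 = p^2 + q^2"
 by (simp add: cmod_def)

lemma integral_sq_le_parseval:
 assumes g: "!!x. g x = Re (\<Sum>k=1..n. z k*cis (real k*x))"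
 shows "integrable circ (%x. (g x)^2)" "(CI x. (g x)^2) <= 2*pi*(\<Sum>k=1..n. (cmod (z k))^2)"
proof -
 have m: "(%x. (cmod (\<Sum>k=1..n. z k*cis (real k*x)))^2) \<in> bm circ"
  by (rule measurable_circ) measurable
 have mg: "(%x. (g x)^2) \<in> bm circ"
  unfolding g by (rule measurable_circ) measurable
 have b: "cmod (\<Sum>k=1..n. z k*cis (real k*x)) <= (\<Sum>k=1..n. cmod (z k))" for x
  by (rule order_trans[OF norm_sum]) (simp add: norm_mult)
 have pt: "(g x)^2 <= (cmod (\<Sum>k=1..n. z k*cis (real k*x)))^2" for x
  unfolding g using power_mono[OF abs_Re_le_cmod, of "\<Sum>k=1..n. z k*cis (real k*x)" 2] by simp
 have i1: "integrable circ (%x. (cmod (\<Sum>k=1..n. z k*cis (real k*x)))^2)"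
 proof (rule integrable_circ_bounded[OF m])
  fix x show "norm ((cmod (\<Sum>k=1..n. z k*cis (real k*x)))^2) <= (\<Sum>k=1..n. cmod (z k))^2"
   using power_mono[OF b[of x] norm_ge_zero, of 2] by simp
 qed
 show i2: "integrable circ (%x. (g x)^2)"
  using pt by (intro Bochner_Integration.integrable_bound[OF i1 mg] AE_I2) simp
 have "(CI x. (g x)^2) <= (CI x. (cmod (\<Sum>k=1..n. z k*cis (real k*x)))^2)"
  by (rule integral_mono[OF i2 i1 pt])
 then show "(CI x. (g x)^2) <= 2*pi*(\<Sum>k=1..n. (cmod (z k))^2)" by (simp only: integral_circ_parseval)
qed

lemma trig_field_Re:
 "trig_field al be n tt x = Re (\<Sum>k=1..n. (tt (real k/real n)/cpx (sqrt (real n))*Complex (al k) (- be k))*cis (real k*x))"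
proof -
 have "(\<Sum>k=1..n. wave n tt x k*Complex (al k) (- be k)) = (\<Sum>k=1..n. (tt (real k/real n)/cpx (sqrt (real n))*Complex (al k) (- be k))*cis (real k*x))"
  by (intro sum.cong refl) (simp only: wave_def mult_ac)
 then show ?thesis unfolding trig_field_def pairing_Re by (rule arg_cong)
qed

lemma trig_field_L2:
 assumes n: "1 <= n" and B: "!!t. 0 <= t ==> t <= 1 ==> cmod (tt t) <= B"
 shows "integrable circ (%x. (trig_field al be n tt x)^2)"
  "(CI x. (trig_field al be n tt x)^2) <= 2*pi*B^2*(energy al be n/n)"
proof -
 let ?z = "%k. tt (real k/real n)/cpx (sqrt (real n))*Complex (al k) (- be k)"
 note * = integral_sq_le_parseval[where g = "trig_field al be n tt" and n = n and z = ?z, OF trig_field_Re]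
 show "integrable circ (%x. (trig_field al be n tt x)^2)" by (rule *(1))
 have "(\<Sum>k=1..n. (cmod (?z k))^2) <= (\<Sum>k=1..n. (B^2/n)*((al k)^2 + (be k)^2))"
 proof (rule sum_mono)
  fix k assume k: "k \<in> {1..n}"
  have "(cmod (tt (real k/real n)))^2 <= B^2" using k by (intro power_mono B) auto
  then have "(cmod (tt (real k/real n)))^2/n*((al k)^2 + (be k)^2) <= (B^2/n)*((al k)^2 + (be k)^2)"
   by (intro mult_right_mono divide_right_mono) auto
  then show "(cmod (?z k))^2 <= (B^2/n)*((al k)^2 + (be k)^2)"
   by (simp add: norm_mult norm_divide power_mult_distrib power_divide cmod_Complex_sq)
 qed
 also have "... = B^2*(energy al be n/n)" unfolding sum_distrib_left[symmetric] energy_def by simp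
 finally have "2*pi*(\<Sum>k=1..n. (cmod (?z k))^2) <= 2*pi*(B^2*(energy al be n/n))" by (rule mult_left_mono) simp
 then show "(CI x. (trig_field al be n tt x)^2) <= 2*pi*B^2*(energy al be n/n)"
  using *(2) by (simp only: mult.assoc)
qed

lemma energy_mono: "m <= n ==> energy al be m <= energy al be n"
 unfolding energy_def by (intro sum_mono2) auto

lemma energy_nonneg: "0 <= energy al be n"
 unfolding energy_def by (intro sum_nonneg) auto

text \<open>Both sums have the same frequencies, so Parseval compares coefficients: those up to \<open>m\<close> differ by the change of scale in the symbol, the others are new.\<close>

lemma trig_field_diff_L2:
 assumes m: "1 <= m" "m <= n" and tt: "lip_symbol B L tt"
 shows "integrable circ (%x. (trig_field al be n tt x - trig_field al be m tt x)^2)"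
  "(CI x. (trig_field al be n tt x - trig_field al be m tt x)^2) <=
   2*pi*(((B + L)*((real n - real m)/n))^2*(energy al be m/m) + B^2*((energy al be n - energy al be m)/n))"
proof -
 define e where "e = (%k. tt (real k/real n)/cpx (sqrt (real n)) -
   (if k <= m then tt (real k/real m)/cpx (sqrt (real m)) else 0))"
 define c where "c = (%k. Complex (al k) (- be k))"
 have m0: "0 < real m" "0 < real n" using m by auto
 have B0: "0 <= B" "0 <= L" using lip_symbolD(3,4)[OF tt] .
 have rep: "trig_field al be n tt x - trig_field al be m tt x = Re (\<Sum>k=1..n. (e k*c k)*cis (real k*x))" for x
 proof -
  have "(\<Sum>k=1..m. (tt (real k/real m)/cpx (sqrt (real m))*c k)*cis (real k*x)) =
    (\<Sum>k=1..n. ((if k <= m then tt (real k/real m)/cpx (sqrt (real m)) else 0)*c k)*cis (real k*x))"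
   using m by (intro sum.mono_neutral_cong_left) auto
  moreover have "Complex (al k) (- be k) = c k" for k by (simp add: c_def)
  ultimately show ?thesis unfolding trig_field_Re e_def
   by (simp only: minus_complex.simps(1)[symmetric] sum_subtractf[symmetric] left_diff_distrib)
 qed
 note * = integral_sq_le_parseval[where n = n and z = "%k. e k*c k", OF rep]
 show "integrable circ (%x. (trig_field al be n tt x - trig_field al be m tt x)^2)" by (rule *(1))
 define q where "q = (B + L)*((real n - real m)/n)"
 have q0: "0 <= q" unfolding q_def using B0 m m0 by (intro mult_nonneg_nonneg divide_nonneg_nonneg) auto
 have low: "(cmod (e k))^2 <= q^2/m" if k: "k \<in> {1..m}" for k
 proof -
  have kn: "0 <= real k/real n" "real k/real n <= 1" "0 <= real k/real m" "real k/real m <= 1" using k m by auto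
  have s: "0 < sqrt (real m)" "sqrt (real m) <= sqrt (real n)" using m by auto
  have ek: "e k = tt (real k/real n)*cpx (1/sqrt n - 1/sqrt m) + (tt (real k/real n) - tt (real k/real m))/cpx (sqrt m)"
   using k by (simp add: e_def field_simps)
  have "\<bar>1/sqrt n - 1/sqrt m\<bar> = 1/sqrt m - 1/sqrt n"
  proof -
   have "1/sqrt n <= 1/sqrt m" using s by (intro divide_left_mono) auto
   then show ?thesis by simp
  qed
  also have "... = (1 - sqrt (real m/real n))/sqrt m" using s by (simp add: real_sqrt_divide field_simps)
  also have "... <= (1 - real m/real n)/sqrt m"
  proof -
   have r: "0 <= real m/real n" "real m/real n <= 1" using m by auto
   have "real m/real n = sqrt (real m/real n) * sqrt (real m/real n)" using r by simp
   also have "... <= 1 * sqrt (real m/real n)" using r by (intro mult_right_mono) auto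
   finally show ?thesis using s by (intro divide_right_mono) auto
  qed
  also have "1 - real m/real n = (real n - real m)/n" using m0 by (simp add: field_simps)
  finally have h1: "\<bar>1/sqrt n - 1/sqrt m\<bar> <= (real n - real m)/n/sqrt m" .
  have "cmod (tt (real k/real n) - tt (real k/real m)) <= L*\<bar>real k/real n - real k/real m\<bar>"
   by (rule lip_symbolD(2)[OF tt kn])
  also have "\<bar>real k/real n - real k/real m\<bar> = real k/real m*((real n - real m)/n)"
  proof -
   have "real k/real n <= real k/real m" using m m0 by (intro divide_left_mono) auto
   then have "\<bar>real k/real n - real k/real m\<bar> = real k/real m - real k/real n" by simp
   also have "... = real k/real m*((real n - real m)/n)" using m0 by (simp add: field_simps)
   finally show ?thesis .
  qed
  also have "L*(real k/real m*((real n - real m)/n)) <= L*(1*((real n - real m)/n))"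
   using B0 kn m by (intro mult_left_mono mult_right_mono) auto
  finally have h2: "cmod (tt (real k/real n) - tt (real k/real m)) <= L*((real n - real m)/n)" by simp
  have "cmod (e k) <= cmod (tt (real k/real n))*\<bar>1/sqrt n - 1/sqrt m\<bar> + cmod (tt (real k/real n) - tt (real k/real m))/sqrt m"
   unfolding ek by (rule order_trans[OF norm_triangle_ineq]) (simp only: norm_mult norm_divide norm_of_real, simp)
  also have "... <= B*((real n - real m)/n/sqrt m) + L*((real n - real m)/n)/sqrt m"
   using lip_symbolD(1)[OF tt kn(1,2)] h1 h2 B0 s by (intro add_mono mult_mono divide_right_mono) auto
  also have "... = q/sqrt m" by (simp add: q_def add_divide_distrib[symmetric] algebra_simps)
  finally have "(cmod (e k))^2 <= (q/sqrt m)^2" by (intro power_mono) auto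
  then show ?thesis using m0 by (simp add: power_divide)
 qed
 have high: "(cmod (e k))^2 <= B^2/n" if k: "k \<in> {m+1..n}" for k
 proof -
  have "cmod (tt (real k/real n)) <= B" using k by (intro lip_symbolD(1)[OF tt]) auto
  then have "(cmod (tt (real k/real n)))^2 <= B^2" by (intro power_mono) auto
  then show ?thesis using k m0 by (simp add: e_def norm_divide power_divide divide_right_mono)
 qed
 have sp: "{1..n} = {1..m} \<union> {m+1..n}" "{1..m} \<inter> {m+1..n} = {}" using m by auto
 have sp2: "(\<Sum>k=1..n. f k) = (\<Sum>k=1..m. f k) + (\<Sum>k=m+1..n. f k)" for f :: "nat => real"
  unfolding sp(1) by (rule sum.union_disjoint) (use sp(2) in auto)
 have c2: "(cmod (c k))^2 = (al k)^2 + (be k)^2" for k by (simp add: c_def cmod_Complex_sq)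
 have "(\<Sum>k=1..n. (cmod (e k*c k))^2) = (\<Sum>k=1..m. (cmod (e k))^2*(cmod (c k))^2) + (\<Sum>k=m+1..n. (cmod (e k))^2*(cmod (c k))^2)"
  unfolding norm_mult power_mult_distrib by (rule sp2)
 also have "... <= (\<Sum>k=1..m. q^2/m*(cmod (c k))^2) + (\<Sum>k=m+1..n. B^2/n*(cmod (c k))^2)"
  using low high by (intro add_mono sum_mono mult_right_mono) auto
 also have "... = q^2/m*energy al be m + B^2/n*(energy al be n - energy al be m)"
  unfolding energy_def sp2[of "%k. (al k)^2 + (be k)^2"] c2 by (simp add: sum_distrib_left)
 finally have "2*pi*(\<Sum>k=1..n. (cmod (e k*c k))^2) <= 2*pi*(q^2*(energy al be m/m) + B^2*((energy al be n - energy al be m)/n))"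
  by (intro mult_left_mono) (simp_all add: )
 then show "(CI x. (trig_field al be n tt x - trig_field al be m tt x)^2) <=
   2*pi*(((B + L)*((real n - real m)/n))^2*(energy al be m/m) + B^2*((energy al be n - energy al be m)/n))"
  using *(2) unfolding q_def by linarith
qed

text \<open>The index \<open>n\<close> lies in the block \<open>[(j+1)^Q, (j+2)^Q)\<close>, \<open>j = blk Q n\<close>.\<close>

definition blk :: "nat => nat => nat" where
 "blk Q n = (LEAST j. n < (j + 2) ^ Q)"

definition base :: "nat => nat => nat" where
 "base Q j = (j + 1) ^ Q"

lemma blk_bounds:
 assumes Q: "1 <= Q" and n: "1 <= n"
 shows "base Q (blk Q n) <= n" "n < base Q (blk Q n + 1)"
proof -
 have "n < (n + 2) ^ 1" by simp
 also have "... <= (n + 2) ^ Q" using Q by (intro power_increasing) auto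
 finally have ex: "n < (n + 2) ^ Q" .
 show lt: "n < base Q (blk Q n + 1)"
  using LeastI[of "%j. n < (j + 2) ^ Q", OF ex] by (simp add: blk_def base_def)
 show "base Q (blk Q n) <= n"
 proof (cases "blk Q n")
  case 0 then show ?thesis using n by (simp add: base_def)
 next
  case (Suc j)
  then have "\<not> n < (j + 2) ^ Q" using not_less_Least[of j "%j. n < (j + 2) ^ Q"] by (simp add: blk_def)
  then show ?thesis using Suc by (simp add: base_def)
 qed
qed

lemma base_pos: "1 <= base Q j" by (simp add: base_def)

lemma blk_at_top: "1 <= Q ==> filterlim (blk Q) at_top sequentially"
 unfolding filterlim_at_top
proof
 fix Z assume Q: "1 <= Q"
 show "eventually (%n. Z <= blk Q n) sequentially"
  unfolding eventually_sequentially
 proof (intro exI[of _ "base Q Z + 1"] allI impI)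
  fix n assume n: "base Q Z + 1 <= n"
  show "Z <= blk Q n"
  proof (rule ccontr)
   assume "\<not> Z <= blk Q n"
   then have "base Q (blk Q n + 1) <= base Q Z" unfolding base_def by (intro power_mono) auto
   then show False using blk_bounds(2)[OF Q, of n] n by simp
  qed
 qed
qed

lemma base_ratio: "real (base Q (j + 1)) <= (1 + 2 ^ Q/(real j + 1))*real (base Q j)"
proof -
 have key: "(1 + x) ^ q <= 1 + 2 ^ q*x" if x: "0 <= x" "x <= 1" for x :: real and q
 proof -
  have "(1 + x) ^ q <= 1 + (2 ^ q - 1)*x"
  proof (induction q)
   case (Suc k)
   have "(1 + x) ^ Suc k <= (1 + x)*(1 + (2 ^ k - 1)*x)" using Suc x by (simp add: mult_left_mono)
   also have "... = 1 + 2 ^ k*x + (2 ^ k - 1)*(x*x)" by (simp add: algebra_simps)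
   also have "(2 ^ k - 1)*(x*x) <= (2 ^ k - 1)*(x*1)" using x by (intro mult_left_mono) auto
   finally show ?case by (simp add: algebra_simps)
  qed simp
  then show ?thesis using x by (simp add: algebra_simps)
 qed
 have "real (base Q (j + 1)) = (1 + 1/(real j + 1)) ^ Q*real (base Q j)"
 proof -
  have "1 + 1/(real j + 1) = (real j + 2)/(real j + 1)" by (simp add: field_simps)
  then show ?thesis by (simp add: base_def power_divide add.commute)
 qed
 also have "... <= (1 + 2 ^ Q*(1/(real j + 1)))*real (base Q j)"
  by (intro mult_right_mono key) auto
 finally show ?thesis by simp
qed

text \<open>A law of large numbers with rate for the coefficients along the indices \<open>base Q j\<close>. The rate makes the energy that is added within one block small compared with \<open>n\<close>.\<close>

definition regular_energy :: "nat => (nat => real) => (nat => real) => bool" where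
 "regular_energy Q al be \<longleftrightarrow>
   (\<exists>C. \<forall>j. \<bar>energy al be (base Q j) - 2*real (base Q j)\<bar> <= C*real (base Q j)/(real j + 1))"

lemma regular_energy_consequences:
 assumes Q: "1 <= Q" and reg: "regular_energy Q al be"
 shows "\<exists>B\<ge>0. \<forall>n\<ge>1. energy al be n/n <= B"
  and "\<exists>K\<ge>0. \<forall>n\<ge>1. (energy al be n - energy al be (base Q (blk Q n)))/n <= K/(real (blk Q n) + 1)"
proof -
 obtain C where C: "!!j. \<bar>energy al be (base Q j) - 2*real (base Q j)\<bar> <= C*real (base Q j)/(real j + 1)"
  using reg unfolding regular_energy_def by blast
 have C0: "0 <= C"
 proof -
  have "0 <= C*real (base Q 0)/(real 0 + 1)" using C[of 0] by linarith
  then show ?thesis by (simp add: base_def)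
 qed
 define P where "P = (2::real) ^ Q"
 have P: "1 <= P" by (simp add: P_def)
 have ratio: "real (base Q (j + 1)) <= (1 + P/(real j + 1))*real (base Q j)" for j
  using base_ratio[of Q j] by (simp add: P_def)
 have ratio2: "real (base Q (j + 1)) <= (1 + P)*real (base Q j)" for j
 proof -
  have "P/(real j + 1) <= P/1" using P by (intro divide_left_mono) auto
  then have "(1 + P/(real j + 1))*real (base Q j) <= (1 + P)*real (base Q j)" by (intro mult_right_mono) auto
  then show ?thesis using ratio[of j] by linarith
 qed
 have up: "energy al be n <= 2*real (base Q (j+1)) + C*real (base Q (j+1))/(real j + 1)"
  if "n <= base Q (j + 1)" for n j
 proof -
  have "C*real (base Q (j+1))/(real (j+1) + 1) <= C*real (base Q (j+1))/(real j + 1)"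
   using C0 by (intro divide_left_mono) auto
  then show ?thesis using energy_mono[OF that, of al be] C[of "j+1"] by linarith
 qed
 show "\<exists>B\<ge>0. \<forall>n\<ge>1. energy al be n/n <= B"
 proof (intro exI[of _ "(2 + C)*(1 + P)"] conjI allI impI)
  show "0 <= (2 + C)*(1 + P)" using C0 P by simp
  fix n :: nat assume n: "1 <= n"
  define j where "j = blk Q n"
  have b: "base Q j <= n" "n <= base Q (j+1)" using blk_bounds[OF Q n] by (auto simp: j_def)
  have "C*real (base Q (j+1))/(real j + 1) <= C*real (base Q (j+1))/1"
   using C0 by (intro divide_left_mono) auto
  then have "energy al be n <= (2 + C)*real (base Q (j+1))" using up[OF b(2)] by (simp add: algebra_simps)
  also have "... <= (2 + C)*((1 + P)*real (base Q j))" using ratio2 C0 by (intro mult_left_mono) auto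
  also have "... <= (2 + C)*((1 + P)*real n)" using b C0 P by (intro mult_left_mono) auto
  finally show "energy al be n/n <= (2 + C)*(1 + P)" using n by (simp add: field_simps)
 qed
 show "\<exists>K\<ge>0. \<forall>n\<ge>1. (energy al be n - energy al be (base Q (blk Q n)))/n <= K/(real (blk Q n) + 1)"
 proof (intro exI[of _ "2*P + C*(1 + P) + C"] conjI allI impI)
  show "0 <= 2*P + C*(1 + P) + C" using C0 P by simp
  fix n :: nat assume n: "1 <= n"
  define j where "j = blk Q n"
  define y where "y = real j + 1"
  have y: "0 < y" by (simp add: y_def)
  have b: "base Q j <= n" "n <= base Q (j+1)" using blk_bounds[OF Q n] by (auto simp: j_def)
  have "2*real (base Q (j+1)) + C*real (base Q (j+1))/y <=
    2*((1 + P/y)*real (base Q j)) + C*((1 + P)*real (base Q j))/y"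
   using ratio[of j] ratio2[of j] C0 y unfolding y_def[symmetric]
   by (intro add_mono mult_left_mono divide_right_mono) auto
  then have "energy al be n <= 2*((1 + P/y)*real (base Q j)) + C*((1 + P)*real (base Q j))/y"
   using up[OF b(2)] unfolding y_def[symmetric] by linarith
  moreover have "energy al be (base Q j) \<ge> 2*real (base Q j) - C*real (base Q j)/y" using C[of j] unfolding y_def by linarith
  ultimately have "energy al be n - energy al be (base Q j) <= 2*((1 + P/y)*real (base Q j)) + C*((1 + P)*real (base Q j))/y - 2*real (base Q j) + C*real (base Q j)/y"
   by linarith
  also have "... = (2*P + C*(1 + P) + C)/y*real (base Q j)" using y by (simp add: field_simps)
  also have "... <= (2*P + C*(1 + P) + C)/y*real n" using b C0 P y by (intro mult_left_mono) auto
  finally show "(energy al be n - energy al be (base Q (blk Q n)))/n <= (2*P + C*(1 + P) + C)/(real (blk Q n) + 1)"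
   using n by (simp add: j_def[symmetric] y_def[symmetric] pos_divide_le_eq)
 qed
qed

lemma trig_field_block_L2:
 assumes Q: "1 <= Q" and reg: "regular_energy Q al be"
 shows "\<exists>K\<ge>0. \<forall>n\<ge>1. \<forall>tt. lip_symbol B L tt -->
  (CI x. (trig_field al be n tt x - trig_field al be (base Q (blk Q n)) tt x)^2) <= K/(real (blk Q n) + 1)"
proof -
 obtain E where E: "0 <= E" "!!n. 1 <= n ==> energy al be n/n <= E"
  using regular_energy_consequences(1)[OF Q reg] by blast
 obtain K where K: "0 <= K" "!!n. 1 <= n ==> (energy al be n - energy al be (base Q (blk Q n)))/n <= K/(real (blk Q n) + 1)"
  using regular_energy_consequences(2)[OF Q reg] by blast
 define P where "P = (2::real) ^ Q"
 define T where "T = 2*pi*((B + L)^2*P^2*E + B^2*K)"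
 show ?thesis
 proof (intro exI[of _ T] conjI allI impI)
  show "0 <= T" unfolding T_def using E K by simp
  fix n :: nat and tt assume n: "1 <= n" and tt: "lip_symbol B L tt"
  define j where "j = blk Q n"
  define m where "m = base Q j"
  define y where "y = real j + 1"
  have y: "1 <= y" by (simp add: y_def)
  have b: "m <= n" "n <= base Q (j+1)" "1 <= m" using blk_bounds[OF Q n] base_pos by (auto simp: j_def m_def)
  have r: "(real n - real m)/n <= P/y"
  proof -
   have "real n <= real (base Q (j+1))" using b by simp
   also have "... <= (1 + P/y)*real m" using base_ratio[of Q j] unfolding P_def y_def m_def .
   also have "... = real m + P/y*real m" by (simp add: algebra_simps)
   also have "... <= real m + P/y*real n" using b y by (intro add_left_mono mult_left_mono) (auto simp: P_def)
   finally show ?thesis using n by (simp add: pos_divide_le_eq)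
  qed
  have r0: "0 <= (real n - real m)/n" using b by simp
  have B0: "0 <= B" "0 <= L" using lip_symbolD(3,4)[OF tt] .
  have "((B + L)*((real n - real m)/n))^2 <= ((B + L)*(P/y))^2"
   using r r0 B0 by (intro power_mono mult_left_mono mult_nonneg_nonneg) auto
  also have "... = (B + L)^2*P^2/y^2" by (simp add: power_mult_distrib power_divide)
  also have "... <= (B + L)^2*P^2/y" using y by (intro divide_left_mono) (auto simp: power2_eq_square)
  finally have 1: "((B + L)*((real n - real m)/n))^2 <= (B + L)^2*P^2/y" .
  have "((B + L)*((real n - real m)/n))^2*(energy al be m/m) + B^2*((energy al be n - energy al be m)/n)
    <= (B + L)^2*P^2/y*E + B^2*(K/y)"
  proof (rule add_mono)
   show "((B + L)*((real n - real m)/n))^2*(energy al be m/m) <= (B + L)^2*P^2/y*E"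
    using 1 E(2)[OF b(3)] y energy_nonneg[of al be m] by (intro mult_mono) auto
   show "B^2*((energy al be n - energy al be m)/n) <= B^2*(K/y)"
    using K(2)[OF n] unfolding y_def j_def[symmetric] m_def[symmetric] by (intro mult_left_mono) auto
  qed
  also have "... = ((B + L)^2*P^2*E + B^2*K)/y" using y by (simp add: field_simps)
  finally have "2*pi*(((B + L)*((real n - real m)/n))^2*(energy al be m/m) + B^2*((energy al be n - energy al be m)/n)) <= 2*pi*(((B + L)^2*P^2*E + B^2*K)/y)"
   by (rule mult_left_mono) simp
  also have "... = T/y" by (simp add: T_def)
  finally show "(CI x. (trig_field al be n tt x - trig_field al be (base Q (blk Q n)) tt x)^2) <= T/(real (blk Q n) + 1)"
   using trig_field_diff_L2(2)[OF b(3) b(1) tt, of al be] unfolding j_def[symmetric] m_def[symmetric] y_def[symmetric] by linarith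
 qed
qed

lemma circ_cauchy_schwarz:
 fixes g :: "real => real"
 assumes g: "g \<in> bm circ" and i: "integrable circ (%x. (g x)^2)"
 shows "integrable circ (%x. \<bar>g x\<bar>)" "(CI x. \<bar>g x\<bar>) <= sqrt (2*pi*(CI x. (g x)^2))"
proof -
 have p: "2*(s*\<bar>u\<bar>) <= s^2 + u^2" for u s :: real
  using sum_squares_bound[of s "\<bar>u\<bar>"] by (simp add: mult.assoc)
 show gi: "integrable circ (%x. \<bar>g x\<bar>)"
 proof (rule Bochner_Integration.integrable_bound)
  show "integrable circ (%x. 1 + (g x)^2)" using i by simp
  show "(%x. \<bar>g x\<bar>) \<in> bm circ" using g by measurable
  show "AE x in circ. norm \<bar>g x\<bar> <= norm (1 + (g x)^2)"
  proof (intro AE_I2)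
   fix x show "norm \<bar>g x\<bar> <= norm (1 + (g x)^2)" using p[of 1 "g x"] by (simp add: abs_of_nonneg[of "1 + (g x)^2"]) 
  qed
 qed
 let ?A = "(CI x. \<bar>g x\<bar>)" and ?B = "(CI x. (g x)^2)"
 have A0: "0 <= ?A" by simp
 have "2*(s*?A) <= s^2*(2*pi) + ?B" for s
 proof -
  have "2*(s*?A) = (CI x. 2*(s*\<bar>g x\<bar>))" by simp
  also have "... <= (CI x. s^2 + (g x)^2)" using gi i p by (intro integral_mono) auto
  also have "... = s^2*(2*pi) + ?B" using i by (simp add: measure_circ_space)
  finally show ?thesis .
 qed
 from this[of "?A/(2*pi)"] have "?A^2 <= 2*pi*?B" by (simp add: power2_eq_square field_simps)
 then show "?A <= sqrt (2*pi*?B)" by (rule real_le_rsqrt)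
qed

lemma base_ge: "1 <= Q ==> j + 1 <= base Q j"
 unfolding base_def using power_increasing[of 1 Q "j + 1"] by simp

lemma base_at_top: "1 <= Q ==> filterlim (base Q) at_top sequentially"
 by (rule filterlim_at_top_mono[OF filterlim_ident, OF always_eventually])
  (use base_ge in \<open>auto intro: Suc_leD\<close>)

section \<open>Almost sure statements\<close>

text \<open>Borel-Cantelli in quantitative form: two powers of \<open>j\<close> pay for summability.\<close>

lemma (in prob_space) AE_rate:
 fixes X :: "nat => 'a => ennreal"
 assumes m [measurable]: "!!j. X j \<in> bm M"
  and le: "!!j. (\<integral>\<^sup>+w. X j w \<partial>M) <= ennreal (c/(real j + 1) ^ (p + 2))" and c: "0 <= c"
 shows "AE w in M. \<exists>C\<ge>0. \<forall>j. X j w <= ennreal (C/(real j + 1) ^ p)"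
proof -
 let ?Y = "%j w. ennreal ((real j + 1) ^ p)*X j w"
 have s: "summable (%j. c/(real j + 1) ^ 2)"
 proof -
  have "summable (%j. inverse (real (Suc j) ^ 2))"
   using inverse_power_summable[of 2, where 'a = real] by (subst summable_Suc_iff) simp
  then have "summable (%j. c*inverse (real (Suc j) ^ 2))" by (rule summable_mult)
  then show ?thesis by (simp add: divide_inverse add.commute)
 qed
 have "(\<integral>\<^sup>+w. (\<Sum>j. ?Y j w) \<partial>M) = (\<Sum>j. \<integral>\<^sup>+w. ?Y j w \<partial>M)" by (rule nn_integral_suminf) measurable
 also have "... <= (\<Sum>j. ennreal (c/(real j + 1) ^ 2))"
 proof (intro suminf_le)
  fix j
  have "(\<integral>\<^sup>+w. ?Y j w \<partial>M) = ennreal ((real j + 1) ^ p)*(\<integral>\<^sup>+w. X j w \<partial>M)" by (rule nn_integral_cmult) measurable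
  also have "... <= ennreal ((real j + 1) ^ p)*ennreal (c/(real j + 1) ^ (p + 2))" by (intro mult_left_mono le) simp
  also have "... = ennreal ((real j + 1) ^ p*(c/(real j + 1) ^ (p + 2)))" by (rule ennreal_mult'[symmetric]) simp
  also have "(real j + 1) ^ p*(c/(real j + 1) ^ (p + 2)) = c/(real j + 1) ^ 2"
  proof -
   have "(real j + 1) ^ p \<noteq> 0" by simp
   then show ?thesis unfolding power_add by simp
  qed
  finally show "(\<integral>\<^sup>+w. ?Y j w \<partial>M) <= ennreal (c/(real j + 1) ^ 2)" .
 qed (auto intro: summableI)
 also have "... = ennreal (\<Sum>j. c/(real j + 1) ^ 2)" using c by (intro suminf_ennreal2 s) auto
 also have "... < \<infinity>" by simp
 finally have fin: "(\<integral>\<^sup>+w. (\<Sum>j. ?Y j w) \<partial>M) < \<infinity>" .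
 have "AE w in M. (\<Sum>j. ?Y j w) \<noteq> \<infinity>" using fin by (intro nn_integral_noteq_infinite) auto
 then show ?thesis
 proof eventually_elim
  case (elim w)
  define C where "C = enn2real (\<Sum>j. ?Y j w)"
  have C: "ennreal C = (\<Sum>j. ?Y j w)" unfolding C_def using elim by (simp add: less_top)
  show ?case
  proof (intro exI[of _ C] conjI allI)
   show "0 <= C" by (simp add: C_def)
   fix j
   have "?Y j w = (\<Sum>i\<in>{j}. ?Y i w)" by simp
   also have "... <= (\<Sum>i. ?Y i w)" by (intro sum_le_suminf) (auto intro: summableI)
   finally have y: "?Y j w <= ennreal C" unfolding C .
   have "X j w = ennreal (1/(real j + 1) ^ p)*?Y j w"
    by (simp add: mult.assoc[symmetric] ennreal_mult''[symmetric])
   also have "... <= ennreal (1/(real j + 1) ^ p)*ennreal C" by (intro mult_left_mono y) simp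
   also have "... = ennreal (C/(real j + 1) ^ p)" by (subst ennreal_mult[symmetric]) (auto simp: C_def)
   finally show "X j w <= ennreal (C/(real j + 1) ^ p)" .
  qed
 qed
qed

lemma cmod_exp_i_diff: "cmod (iexp u - iexp v) <= \<bar>u - v\<bar>"
proof -
 have "iexp u - iexp v = iexp v * (iexp (u - v) - 1)"
  by (simp add: algebra_simps exp_add[symmetric])
 then show ?thesis using iexp_approx1[of "u - v" 0] by (simp add: norm_mult)
qed

text \<open>\<open>Q\<close> is the exponent of the blocks, chosen so large that the mean square correlation decays like the power \<open>-16\<close> of the block number. The last assumption bounds the mean over the circle of the Laplace-type transform that controls small values.\<close>

locale gauss_spectral = gauss_pair M a b r + spectral \<psi> r
 for M :: "'w measure" and a b :: "nat => 'w => real" and r :: "int => real" and \<psi> :: "real => real" +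
 fixes Q :: nat and D0 CU be :: real
 assumes Q1: "1 <= Q" and D0: "0 <= D0"
  and corr_decay: "!!j. mean_square_corr r (base Q j) <= D0/(real j + 1) ^ 16"
  and om_limit: "!!e. 0 < e ==> \<exists>d>0. \<forall>h. \<bar>h\<bar> <= d --> om h <= e"
  and psi_pos: "AE x in circ. 0 < \<psi> x"
  and beta: "0 < be" and CU: "0 <= CU"
  and gauss_avg: "!!ka. 0 < ka ==>
   (CN x. \<integral>\<^sup>+xi. ennreal (exp (- (ka*(2*pi*\<psi> x)*xi^2/2))) \<partial>std_gauss) <= ennreal (CU*ka powr (- be))"
begin

abbreviation F :: "'w => nat => (real => complex) => real => real" where
 "F wo \<equiv> trig_field (%k. a k wo) (%k. b k wo)"

lemma F_lin: "F w n tt x = lin n (wave n tt x) w"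
 by (simp add: trig_field_def lin_def)

lemma lin_scale: "lin n (%k. cpx c*z k) w = c*lin n z w"
 unfolding lin_def pairing_def by (simp add: sum_distrib_left algebra_simps)

lemma cov_scale: "cov_form r n (%k. cpx c*z k) (%k. cpx d*w k) = c*d*cov_form r n z w"
 unfolding cov_form_def by (simp add: sum_distrib_left algebra_simps)

lemma diag_square_sum:
 assumes u: "cmod u = 1"
 shows "(\<integral>\<^sup>+w. ennreal (((\<Sum>p=1..n. (Re u*a p w + Im u*b p w)^2) - real n)^2) \<partial>M)
   <= ennreal (2*(real n)^2*mean_square_corr r n)"
proof (cases "n = 0")
 case True then show ?thesis by simp
next
 case False
 let ?mz = "count_space {1..n}"
 define z where "z = (%(p::nat) k. if k = p then u else (0::complex))"
 have fin: "finite_measure ?mz" by (rule finite_measure_count_space) simp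
 have linz: "lin n (z p) w = Re u*a p w + Im u*b p w" if "p \<in> {1..n}" for p w
 proof -
  have "lin n (z p) w = (\<Sum>k=1..n. if k = p then Re u*a p w + Im u*b p w else 0)"
   unfolding lin_def pairing_def z_def by (intro sum.cong) auto
  then show ?thesis using that by simp
 qed
 have uu: "Re (u*cnj u) = 1" using u by (simp add: complex_mult_cnj cmod_def)
 have covz: "cov_form r n (z p) (z q) = r (int p - int q)" if "p \<in> {1..n}" "q \<in> {1..n}" for p q
 proof -
  have "r (int k - int l)*Re (z p k*cnj (z q l)) = (if k = p then (if l = q then r (int p - int q) else 0) else 0)" for k l
  proof (cases "k = p \<and> l = q")
   case True
   then have "Re (z p k*cnj (z q l)) = 1" unfolding z_def using uu by simp
   then show ?thesis using True by simp
  qed (auto simp: z_def)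
  then have "cov_form r n (z p) (z q) = (\<Sum>k=1..n. \<Sum>l=1..n. if k = p then (if l = q then r (int p - int q) else 0) else 0)"
   unfolding cov_form_def by simp
  also have "... = (\<Sum>k=1..n. if k = p then (\<Sum>l=1..n. if l = q then r (int p - int q) else 0) else 0)"
   by (intro sum.cong refl) auto
  finally show ?thesis using that by simp
 qed
 have "(\<integral>\<^sup>+w. ennreal (((\<Sum>p=1..n. (Re u*a p w + Im u*b p w)^2) - real n)^2) \<partial>M) =
   (\<integral>\<^sup>+w. ennreal (((\<integral>p. (lin n (z p) w)^2 \<partial>?mz) - (\<integral>p. cov_form r n (z p) (z p) \<partial>?mz))^2) \<partial>M)"
 proof (intro nn_integral_cong)
  fix w
  have "(\<integral>p. (lin n (z p) w)^2 \<partial>?mz) = (\<Sum>p=1..n. (Re u*a p w + Im u*b p w)^2)"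
   by (subst lebesgue_integral_count_space_finite) (auto simp: linz)
  moreover have "(\<integral>p. cov_form r n (z p) (z p) \<partial>?mz) = real n"
   by (subst lebesgue_integral_count_space_finite) (auto simp: covz r_0)
  ultimately show "ennreal (((\<Sum>p=1..n. (Re u*a p w + Im u*b p w)^2) - real n)^2) =
    ennreal (((\<integral>p. (lin n (z p) w)^2 \<partial>?mz) - (\<integral>p. cov_form r n (z p) (z p) \<partial>?mz))^2)" by simp
 qed
 also have "... <= (\<integral>\<^sup>+p. \<integral>\<^sup>+q. ennreal (2*(cov_form r n (z p) (z q))^2) \<partial>?mz \<partial>?mz)"
  by (rule concentration_square[OF fin, where B = 1]) (auto simp: z_def u)
 also have "... = (\<Sum>p=1..n. \<Sum>q=1..n. ennreal (2*(r (int p - int q))^2))"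
  by (simp add: nn_integral_count_space_finite covz)
 also have "... = ennreal (\<Sum>p=1..n. \<Sum>q=1..n. 2*(r (int p - int q))^2)"
  by (simp add: sum_ennreal sum_nonneg)
 also have "(\<Sum>p=1..n. \<Sum>q=1..n. 2*(r (int p - int q))^2) = 2*(real n)^2*mean_square_corr r n"
  using False unfolding mean_square_corr_def sum_distrib_left[symmetric] by simp
 finally show ?thesis .
qed

text \<open>The diagonal energy is tested with a unimodular \<open>u\<close>; the choices \<open>1\<close> and \<open>\<i>\<close> give the energies of the two sequences.\<close>

lemma AE_diag:
 assumes u: "cmod u = 1"
 shows "AE w in M. \<exists>C\<ge>0. \<forall>j. \<bar>(\<Sum>p=1..base Q j. (Re u*a p w + Im u*b p w)^2) - real (base Q j)\<bar> <= C*real (base Q j)/(real j + 1)"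
proof -
 define S where "S = (%j w. ((\<Sum>p=1..base Q j. (Re u*a p w + Im u*b p w)^2) - real (base Q j))/real (base Q j))"
 have Sm [measurable]: "S j \<in> bm M" for j
 proof -
  have "(%w. Re u*a p w + Im u*b p w) \<in> bm M" if "p \<in> {1..base Q j}" for p
   using that by (intro borel_measurable_add borel_measurable_times) auto
  then show ?thesis unfolding S_def
   by (intro borel_measurable_divide borel_measurable_diff borel_measurable_sum borel_measurable_power) auto
 qed
 have "AE w in M. \<exists>C\<ge>0. \<forall>j. ennreal ((S j w)^2) <= ennreal (C/(real j + 1) ^ 14)"
 proof (rule AE_rate[where c = "2*D0"])
  fix j
  let ?n = "base Q j"
  have n0: "0 < real ?n" using base_pos[of Q j] by simp
  have "(\<integral>\<^sup>+w. ennreal ((S j w)^2) \<partial>M) = (\<integral>\<^sup>+w. ennreal (1/(real ?n)^2)*ennreal (((\<Sum>p=1..?n. (Re u*a p w + Im u*b p w)^2) - real ?n)^2) \<partial>M)"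
   by (intro nn_integral_cong) (simp add: S_def power_divide ennreal_mult[symmetric])
  also have "... = ennreal (1/(real ?n)^2)*(\<integral>\<^sup>+w. ennreal (((\<Sum>p=1..?n. (Re u*a p w + Im u*b p w)^2) - real ?n)^2) \<partial>M)"
  proof (rule nn_integral_cmult)
   have "(%w. S j w*real ?n) \<in> bm M" by measurable
   moreover have "(%w. S j w*real ?n) = (%w. (\<Sum>p=1..?n. (Re u*a p w + Im u*b p w)^2) - real ?n)"
    using n0 by (simp add: S_def)
   ultimately have "(%w. (\<Sum>p=1..?n. (Re u*a p w + Im u*b p w)^2) - real ?n) \<in> bm M" by simp
   then show "(%w. ennreal (((\<Sum>p=1..?n. (Re u*a p w + Im u*b p w)^2) - real ?n)^2)) \<in> bm M"
    by (intro measurable_compose[OF _ measurable_ennreal] borel_measurable_power)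
  qed
  also have "... <= ennreal (1/(real ?n)^2)*ennreal (2*(real ?n)^2*mean_square_corr r ?n)"
   by (intro mult_left_mono diag_square_sum u) simp
  also have "... = ennreal (1/(real ?n)^2*(2*(real ?n)^2*mean_square_corr r ?n))"
   by (rule ennreal_mult'[symmetric]) simp
  also have "1/(real ?n)^2*(2*(real ?n)^2*mean_square_corr r ?n) = 2*mean_square_corr r ?n"
   using n0 by simp
  also have "ennreal ... <= ennreal (2*D0/(real j + 1) ^ (14 + 2))" using corr_decay[of j] by (intro ennreal_leI) simp
  finally show "(\<integral>\<^sup>+w. ennreal ((S j w)^2) \<partial>M) <= ennreal (2*D0/(real j + 1) ^ (14 + 2))" .
 qed (use D0 in simp_all)
 then show ?thesis
 proof eventually_elim
  case (elim w)
  then obtain C where C: "C \<ge> 0" "!!j. ennreal ((S j w)^2) <= ennreal (C/(real j + 1) ^ 14)" by blast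
  show ?case
  proof (intro exI[of _ "sqrt C"] conjI allI)
   show "0 <= sqrt C" using C by simp
   fix j
   have n0: "0 < real (base Q j)" using base_pos[of Q j] by simp
   have "(S j w)^2 <= C/(real j + 1) ^ 14" using C(2)[of j] C(1) by (simp add: ennreal_le_iff)
   also have "... <= C/(real j + 1) ^ 2" using C(1) by (intro divide_left_mono power_increasing) auto
   also have "... = (sqrt C/(real j + 1))^2" using C(1) by (simp add: power_divide)
   finally have "\<bar>S j w\<bar> <= sqrt C/(real j + 1)" using C(1) by (simp add: abs_le_square_iff[symmetric])
   then have "\<bar>S j w\<bar>*real (base Q j) <= sqrt C/(real j + 1)*real (base Q j)" using n0 by (intro mult_right_mono) auto
   then show "\<bar>(\<Sum>p=1..base Q j. (Re u*a p w + Im u*b p w)^2) - real (base Q j)\<bar> <= sqrt C*real (base Q j)/(real j + 1)"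
    using n0 by (simp add: S_def abs_divide)
  qed
 qed
qed

lemma AE_regular_energy: "AE w in M. regular_energy Q (%k. a k w) (%k. b k w)"
 using AE_diag[of 1, simplified] AE_diag[of \<i>, simplified]
proof eventually_elim
 case (elim w)
 then obtain C C' where
  C: "!!j. \<bar>(\<Sum>p=1..base Q j. (a p w)^2) - real (base Q j)\<bar> <= C*real (base Q j)/(real j + 1)" and
  C': "!!j. \<bar>(\<Sum>p=1..base Q j. (b p w)^2) - real (base Q j)\<bar> <= C'*real (base Q j)/(real j + 1)"
  by force
 show ?case unfolding regular_energy_def
 proof (intro exI[of _ "C + C'"] allI)
  fix j
  have "energy (%k. a k w) (%k. b k w) (base Q j) = (\<Sum>p=1..base Q j. (a p w)^2) + (\<Sum>p=1..base Q j. (b p w)^2)"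
   by (simp add: energy_def sum.distrib)
  then show "\<bar>energy (%k. a k w) (%k. b k w) (base Q j) - 2*real (base Q j)\<bar> <= (C + C')*real (base Q j)/(real j + 1)"
   using C[of j] C'[of j] by (simp add: distrib_right add_divide_distrib abs_le_iff)
 qed
qed

lemma cov_abs_integral:
 assumes tt: "!!t. 0 <= t ==> t <= 1 ==> cmod (tt t) <= B"
 shows "(CN x. (CN y. ennreal \<bar>cov_form r (base Q j) (wave (base Q j) tt x) (wave (base Q j) tt y)\<bar>))
  <= ennreal (2*pi^2*(1 + B ^ 4*D0)/(real j + 1) ^ 8)"
proof -
 let ?n = "base Q j"
 let ?c = "%x y. cov_form r ?n (wave ?n tt x) (wave ?n tt y)"
 define de where "de = 1/(real j + 1) ^ 8"
 have de: "0 < de" by (simp add: de_def)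
 have pt: "\<bar>c\<bar> <= de/2 + 1/(2*de)*c^2" for c :: real
 proof -
  have "2*de*\<bar>c\<bar> <= de^2 + c^2" using sum_squares_bound[of de "\<bar>c\<bar>"] by simp
  then have "\<bar>c\<bar> <= (de^2 + c^2)/(2*de)" using de by (simp add: field_simps)
  also have "... = de/2 + 1/(2*de)*c^2" using de by (simp add: field_simps power2_eq_square)
  finally show ?thesis .
 qed
 have cm: "(%y. ?c x y) \<in> bm circ" for x
  by (rule measurable_circ, rule cov_measurable) (auto)
 have cm2: "(%p. ?c (fst p) (snd p)) \<in> bm (circ \<Otimes>\<^sub>M circ)"
  by (rule measurable_circ_circ, rule cov_measurable) (measurable)
 have cm3 [measurable]: "(%x. (CN y. ennreal ((?c x y)^2))) \<in> bm circ"
  using cm2 by (intro circ.borel_measurable_nn_integral) (simp add: case_prod_unfold)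
 have "(CN x. (CN y. ennreal \<bar>?c x y\<bar>)) <= (CN x. (CN y. ennreal (de/2) + ennreal (1/(2*de))*ennreal ((?c x y)^2)))"
 proof (intro nn_integral_mono)
  fix x y
  have "ennreal \<bar>?c x y\<bar> <= ennreal (de/2 + 1/(2*de)*(?c x y)^2)" by (intro ennreal_leI pt)
  also have "... = ennreal (de/2) + ennreal (1/(2*de)*(?c x y)^2)" using de by (intro ennreal_plus) auto
  also have "ennreal (1/(2*de)*(?c x y)^2) = ennreal (1/(2*de))*ennreal ((?c x y)^2)" by (rule ennreal_mult'') simp
  finally show "ennreal \<bar>?c x y\<bar> <= ennreal (de/2) + ennreal (1/(2*de))*ennreal ((?c x y)^2)" .
 qed
 also have "... = (CN x. ennreal (de/2)*ennreal (2*pi) + ennreal (1/(2*de))*(CN y. ennreal ((?c x y)^2)))"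
  using cm by (subst nn_integral_add) (auto simp: nn_integral_cmult emeasure_circ_space)
 also have "... = ennreal (de/2)*ennreal (2*pi)*ennreal (2*pi) + ennreal (1/(2*de))*(CN x. (CN y. ennreal ((?c x y)^2)))"
  by (subst nn_integral_add) (auto simp: nn_integral_cmult emeasure_circ_space)
 also have "... <= ennreal (de/2)*ennreal (2*pi)*ennreal (2*pi) + ennreal (1/(2*de))*ennreal (4*pi^2*B ^ 4*mean_square_corr r ?n)"
  by (intro add_left_mono mult_left_mono cov_form_square_integral base_pos tt) auto
 also have "... = ennreal (de/2*(2*pi)*(2*pi) + 1/(2*de)*(4*pi^2*B ^ 4*mean_square_corr r ?n))"
 proof -
  have mn: "0 <= mean_square_corr r ?n" unfolding mean_square_corr_def by (intro divide_nonneg_nonneg sum_nonneg) auto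
  have "ennreal (de/2)*ennreal (2*pi)*ennreal (2*pi) = ennreal (de/2*(2*pi)*(2*pi))"
   using de by (simp only: ennreal_mult'' pi_ge_zero mult_nonneg_nonneg zero_le_numeral)
  moreover have "ennreal (1/(2*de))*ennreal (4*pi^2*B ^ 4*mean_square_corr r ?n) = ennreal (1/(2*de)*(4*pi^2*B ^ 4*mean_square_corr r ?n))"
   using de by (intro ennreal_mult'[symmetric]) simp
  ultimately show ?thesis using de mn by (simp only:) (intro ennreal_plus[symmetric] mult_nonneg_nonneg divide_nonneg_nonneg; simp)
 qed
 also have "... <= ennreal (2*pi^2*(1 + B ^ 4*D0)/(real j + 1) ^ 8)"
 proof (rule ennreal_leI)
  have "1/(2*de)*(4*pi^2*B ^ 4*mean_square_corr r ?n) <= 1/(2*de)*(4*pi^2*B ^ 4*(D0/(real j + 1) ^ 16))"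
   using de by (intro mult_left_mono corr_decay) auto
  also have "D0/(real j + 1) ^ 16 = D0*de*de"
  proof -
   have "(real j + 1) ^ 16 = (real j + 1) ^ 8*(real j + 1) ^ 8" by (simp add: power_add[symmetric])
   then show ?thesis by (simp add: de_def)
  qed
  also have "1/(2*de)*(4*pi^2*B ^ 4*(D0*de*de)) = 2*pi^2*B ^ 4*D0*de" using de by (simp add: field_simps)
  finally have "de/2*(2*pi)*(2*pi) + 1/(2*de)*(4*pi^2*B ^ 4*mean_square_corr r ?n) <= 2*pi^2*(1 + B ^ 4*D0)*de"
   by (simp add: power2_eq_square algebra_simps)
  then show "de/2*(2*pi)*(2*pi) + 1/(2*de)*(4*pi^2*B ^ 4*mean_square_corr r ?n) <= 2*pi^2*(1 + B ^ 4*D0)/(real j + 1) ^ 8"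
   by (simp add: de_def)
 qed
 finally show ?thesis .
qed

end

definition unit_interval :: "real measure" where
 "unit_interval = restrict_space lborel {0..1}"

lemma space_unit_interval: "space unit_interval = {0..1}"
 by (simp add: unit_interval_def space_restrict_space)

lemma prob_space_unit_interval: "prob_space unit_interval"
 by (rule prob_spaceI) (simp add: unit_interval_def space_restrict_space emeasure_restrict_space)

interpretation unit_interval: prob_space unit_interval by (rule prob_space_unit_interval)

lemma measurable_unit_interval: "f \<in> bm borel ==> f \<in> bm unit_interval"
 unfolding unit_interval_def by (simp add: measurable_restrict_space1)

interpretation uc: pair_sigma_finite unit_interval circ ..

lemma measurable_unit_circ:
 assumes "(%p. f (fst p) (snd p)) \<in> bm (borel \<Otimes>\<^sub>M borel)"
 shows "(%p. f (fst p) (snd p)) \<in> bm (unit_interval \<Otimes>\<^sub>M circ)"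
proof -
 have i: "(%x. x) \<in> measurable unit_interval borel" by (rule measurable_unit_interval) measurable
 have "(%p. (fst p, snd p)) \<in> measurable (unit_interval \<Otimes>\<^sub>M circ) (borel \<Otimes>\<^sub>M borel)"
  by (intro measurable_Pair measurable_compose[OF measurable_fst i] measurable_compose[OF measurable_snd measurable_circ_id])
 from measurable_compose[OF this assms] show ?thesis by simp
qed

lemma tonelli_unit_circ:
 fixes f :: "real => real => ennreal"
 assumes "(%p. f (fst p) (snd p)) \<in> bm (borel \<Otimes>\<^sub>M borel)"
 shows "(\<integral>\<^sup>+u. (CN x. f u x) \<partial>unit_interval) = (CN x. \<integral>\<^sup>+u. f u x \<partial>unit_interval)"
 using uc.Fubini'[of f] measurable_unit_circ[OF assms] by (simp add: case_prod_unfold)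

context gauss_spectral begin

lemma cov_wave_measurable:
 "(%y. cov_form r n (wave n tt x) (wave n tt' y)) \<in> bm circ"
 "(%p. cov_form r n (wave n tt (fst p)) (wave n tt' (snd p))) \<in> bm (circ \<Otimes>\<^sub>M circ)"
proof -
 show "(%y. cov_form r n (wave n tt x) (wave n tt' y)) \<in> bm circ"
  by (rule measurable_circ, rule cov_measurable) auto
 show "(%p. cov_form r n (wave n tt (fst p)) (wave n tt' (snd p))) \<in> bm (circ \<Otimes>\<^sub>M circ)"
  by (rule measurable_circ_circ, rule cov_measurable) measurable
qed

lemma measurable_var [measurable]: "var n tt \<in> bm borel"
 unfolding var_def[abs_def] by (rule cov_measurable) auto

text \<open>Along the block indices \<open>concentration_char\<close> gives a summable rate; within a block the integrand moves by at most the \<open>L2\<close> distance of the sums.\<close>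

lemma AE_phi:
 assumes W [measurable]: "W \<in> bm borel" and W0: "!!x. 0 <= W x" "!!x. W x <= Wb"
  and tt: "lip_symbol B L tt"
  and lim: "(%n. (CI x. exp (- ((W x)^2 * var n tt x/2)))) \<longlonglongrightarrow> l"
 shows "AE w in M. (%n. (CI x. iexp (W x*F w n tt x))) \<longlonglongrightarrow> cpx l"
proof -
 define z where "z = (%n x k. cpx (W x)*wave n tt x k)"
 define ph where "ph = (%n w. (CI x. iexp (W x*F w n tt x)))"
 define m where "m = (%n. (CI x. exp (- ((W x)^2 * var n tt x/2))))"
 have zm: "(%x. z n x k) \<in> bm circ" for n k
  by (rule measurable_circ) (unfold z_def, measurable)
 have linz: "lin n (z n x) w = W x*F w n tt x" for n x w unfolding z_def lin_scale F_lin ..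
 have covz: "cov_form r n (z n x) (z n y) = W x*W y*cov_form r n (wave n tt x) (wave n tt y)" for n x y
  unfolding z_def by (rule cov_scale)
 have Wb0: "0 <= Wb" using W0[of 0] by linarith
 have ph_eq: "ph n w = (CI x. iexp (lin n (z n x) w))" for n w
  unfolding ph_def linz ..
 have m_eq: "m n = (CI x. exp (- cov_form r n (z n x) (z n x)/2))" for n
  unfolding m_def covz var_def by (simp add: power2_eq_square)
 have phm [measurable]: "ph n \<in> bm M" for n
 proof -
  have [measurable]: "(%p. lin n (z n (snd p)) (fst p)) \<in> bm (M \<Otimes>\<^sub>M circ)"
   by (rule lin_measurable_pair[OF zm])
  have "(%p. iexp (lin n (z n (snd p)) (fst p))) \<in> bm (M \<Otimes>\<^sub>M circ)"
   by measurable
  then show ?thesis unfolding ph_eq[abs_def] by (intro circ.borel_measurable_lebesgue_integral) (simp add: case_prod_unfold)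
 qed
 define X where "X = (%j w. ennreal ((cmod (ph (base Q j) w - cpx (m (base Q j))))^2))"
 define K where "K = 2*pi^2*(1 + B ^ 4*D0)"
 have K0: "0 <= K" using D0 by (simp add: K_def)
 have "AE w in M. \<exists>C\<ge>0. \<forall>j. X j w <= ennreal (C/(real j + 1) ^ 6)"
 proof (rule AE_rate[where c = "Wb^2*K"])
  show "X j \<in> bm M" for j unfolding X_def by measurable
  show "0 <= Wb^2*K" using K0 by simp
  fix j
  let ?n = "base Q j"
  have "(\<integral>\<^sup>+w. X j w \<partial>M) <= (CN x. (CN y. ennreal \<bar>cov_form r ?n (z ?n x) (z ?n y)\<bar>))"
   unfolding X_def ph_eq m_eq by (rule concentration_char[OF finite_measure_circ zm])
  also have "... <= (CN x. (CN y. ennreal (Wb^2)*ennreal \<bar>cov_form r ?n (wave ?n tt x) (wave ?n tt y)\<bar>))"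
  proof (intro nn_integral_mono)
   fix x y
   have "W x*W y <= Wb*Wb" by (intro mult_mono W0 Wb0)
   then have "\<bar>cov_form r ?n (z ?n x) (z ?n y)\<bar> <= Wb^2*\<bar>cov_form r ?n (wave ?n tt x) (wave ?n tt y)\<bar>"
    unfolding covz abs_mult[of "W x*W y"] using W0(1) by (intro mult_right_mono) (auto simp: power2_eq_square)
   then show "ennreal \<bar>cov_form r ?n (z ?n x) (z ?n y)\<bar> <= ennreal (Wb^2)*ennreal \<bar>cov_form r ?n (wave ?n tt x) (wave ?n tt y)\<bar>"
    by (simp add: ennreal_mult''[symmetric] ennreal_leI)
  qed
  also have "... = ennreal (Wb^2)*(CN x. (CN y. ennreal \<bar>cov_form r ?n (wave ?n tt x) (wave ?n tt y)\<bar>))"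
  proof -
   note [measurable] = cov_wave_measurable
   have "(%x. (CN y. ennreal \<bar>cov_form r ?n (wave ?n tt x) (wave ?n tt y)\<bar>)) \<in> bm circ"
    by (intro circ.borel_measurable_nn_integral) (simp add: case_prod_unfold)
   then show ?thesis by (simp add: nn_integral_cmult)
  qed
  also have "... <= ennreal (Wb^2)*ennreal (K/(real j + 1) ^ 8)"
   unfolding K_def using lip_symbolD(1)[OF tt] by (intro mult_left_mono cov_abs_integral) auto
  also have "... = ennreal (Wb^2*K/(real j + 1) ^ (6 + 2))" using K0 by (simp add: ennreal_mult'[symmetric])
  finally show "(\<integral>\<^sup>+w. X j w \<partial>M) <= ennreal (Wb^2*K/(real j + 1) ^ (6 + 2))" .
 qed
 with AE_regular_energy show ?thesis
 proof eventually_elim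
  case (elim w)
  then obtain C where C: "C \<ge> 0" "!!j. X j w <= ennreal (C/(real j + 1) ^ 6)" by blast
  obtain T where T: "T \<ge> 0" "!!n. 1 <= n ==> (CI x. (F w n tt x - F w (base Q (blk Q n)) tt x)^2) <= T/(real (blk Q n) + 1)"
   using trig_field_block_L2[OF Q1 elim(1), of B L] tt by blast
  have lim1: "(%j. ph (base Q j) w - cpx (m (base Q j))) \<longlonglongrightarrow> 0"
  proof (rule tendsto_norm_zero_cancel, rule real_tendsto_sandwich[OF always_eventually always_eventually tendsto_const])
   show "\<forall>j. 0 <= cmod (ph (base Q j) w - cpx (m (base Q j)))" by simp
   show "\<forall>j. cmod (ph (base Q j) w - cpx (m (base Q j))) <= sqrt C/(real j + 1)"
   proof
    fix j
    have "(cmod (ph (base Q j) w - cpx (m (base Q j))))^2 <= C/(real j + 1) ^ 6"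
     using C(2)[of j] C(1) unfolding X_def by (simp add: ennreal_le_iff)
    also have "... <= C/(real j + 1) ^ 2" using C(1) by (intro divide_left_mono power_increasing) auto
    also have "... = (sqrt C/(real j + 1))^2" using C(1) by (simp add: power_divide)
    finally show "cmod (ph (base Q j) w - cpx (m (base Q j))) <= sqrt C/(real j + 1)"
     by (rule power2_le_imp_le) (use C in simp)
   qed
   show "(%j. sqrt C/(real j + 1)) \<longlonglongrightarrow> 0" by real_asymp
  qed
  have blk_lim: "filterlim (blk Q) at_top sequentially" by (rule blk_at_top[OF Q1])
  have lim2: "(%n. ph (base Q (blk Q n)) w - cpx (m (base Q (blk Q n)))) \<longlonglongrightarrow> 0"
   by (rule filterlim_compose[OF lim1 blk_lim])
  have lim3: "(%n. cpx (m (base Q (blk Q n)))) \<longlonglongrightarrow> cpx l"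
   using filterlim_compose[OF lim filterlim_compose[OF base_at_top[OF Q1] blk_lim]] unfolding m_def by (rule tendsto_of_real)
  have lim4: "(%n. ph n w - ph (base Q (blk Q n)) w) \<longlonglongrightarrow> 0"
  proof (rule tendsto_norm_zero_cancel, rule real_tendsto_sandwich[OF always_eventually _ tendsto_const])
   show "\<forall>n. 0 <= cmod (ph n w - ph (base Q (blk Q n)) w)" by simp
   have "(%j. Wb * sqrt (2*pi*(T/(real j + 1)))) \<longlonglongrightarrow> Wb * sqrt (2*pi*0)"
    by (intro tendsto_intros) real_asymp
   then show "(%n. Wb * sqrt (2*pi*(T/(real (blk Q n) + 1)))) \<longlonglongrightarrow> 0"
    using filterlim_compose[OF _ blk_lim] by simp
   show "eventually (%n. cmod (ph n w - ph (base Q (blk Q n)) w) <= Wb * sqrt (2*pi*(T/(real (blk Q n) + 1)))) sequentially"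
    using eventually_ge_at_top[of 1]
   proof eventually_elim
    case (elim n)
    let ?n' = "base Q (blk Q n)"
    define g where "g = (%x. F w n tt x - F w ?n' tt x)"
    have gi2: "integrable circ (%x. (g x)^2)"
     unfolding g_def using trig_field_diff_L2(1)[OF base_pos blk_bounds(1)[OF Q1 elim] tt] .
    have gm: "g \<in> bm circ" unfolding g_def by (rule measurable_circ) measurable
    note cs = circ_cauchy_schwarz[OF gm gi2]
    have em: "(%x. iexp (W x*F w n tt x)) \<in> bm circ" for n
     by (rule measurable_circ) measurable
    have ei: "integrable circ (%x. iexp (W x*F w n tt x))" for n
     by (rule integrable_circ_bounded[OF em, where B = 1]) (simp add: norm_exp_i_times del: of_real_mult)
    have eq: "ph n w - ph ?n' w = (CI x. iexp (W x*F w n tt x) - iexp (W x*F w ?n' tt x))"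
     unfolding ph_def by (rule Bochner_Integration.integral_diff[symmetric, OF ei ei])
    have "cmod (ph n w - ph ?n' w) <= (CI x. cmod (iexp (W x*F w n tt x) - iexp (W x*F w ?n' tt x)))"
     unfolding eq by (rule integral_norm_bound)
    also have "... <= (CI x. Wb*\<bar>g x\<bar>)"
    proof (rule integral_mono)
     show "integrable circ (%x. cmod (iexp (W x*F w n tt x) - iexp (W x*F w ?n' tt x)))"
      by (intro integrable_norm Bochner_Integration.integrable_diff ei)
     show "integrable circ (%x. Wb*\<bar>g x\<bar>)" using cs(1) by simp
     fix x
     have "cmod (iexp (W x*F w n tt x) - iexp (W x*F w ?n' tt x)) <= \<bar>W x*F w n tt x - W x*F w ?n' tt x\<bar>"
      by (rule cmod_exp_i_diff)
     also have "... = W x*\<bar>g x\<bar>" using W0(1)[of x] by (simp add: g_def right_diff_distrib[symmetric] abs_mult)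
     also have "... <= Wb*\<bar>g x\<bar>" by (intro mult_right_mono W0) simp
     finally show "cmod (iexp (W x*F w n tt x) - iexp (W x*F w ?n' tt x)) <= Wb*\<bar>g x\<bar>" .
    qed
    also have "... = Wb*(CI x. \<bar>g x\<bar>)" by simp
    also have "... <= Wb * sqrt (2*pi*(CI x. (g x)^2))" by (intro mult_left_mono cs(2) Wb0)
    also have "... <= Wb * sqrt (2*pi*(T/(real (blk Q n) + 1)))"
     using T(2)[OF elim] Wb0 unfolding g_def by (intro mult_left_mono real_sqrt_le_mono) auto
    finally show ?case .
   qed
  qed
  have "(%n. (ph n w - ph (base Q (blk Q n)) w) + (ph (base Q (blk Q n)) w - cpx (m (base Q (blk Q n)))) + cpx (m (base Q (blk Q n)))) \<longlonglongrightarrow> 0 + 0 + cpx l"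
   by (intro tendsto_add lim4 lim2 lim3)
  then show ?case by (simp add: ph_def)
 qed
qed

text \<open>The weighted energy concentrates around its mean by \<open>concentration_square\<close>. The extra parameter \<open>u\<close> is averaged as well, because later the energy is needed over a whole window.\<close>

lemma AE_local_energy:
 assumes W [measurable]: "W \<in> bm borel" and W0: "!!x. 0 <= W x" "!!x. W x <= Wb"
  and ttm: "!!t. (%u. tt u t) \<in> bm borel"
  and ttB: "!!u t. 0 <= t ==> t <= 1 ==> cmod (tt u t) <= B"
  and ttL: "!!u. 0 <= u ==> u <= 1 ==> lip_symbol B L (tt u)"
  and R: "0 <= R" "!!n u. N0 <= n ==> 0 <= u ==> u <= 1 ==> (CN x. ennreal ((W x)^2 * var n (tt u) x)) <= ennreal R"
 shows "AE wo in M. eventually (%n. (\<integral>\<^sup>+u. (CN x. ennreal ((W x*F wo n (tt u) x)^2)) \<partial>unit_interval) <= ennreal (2*R + 3)) sequentially"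
proof -
 define mz where "mz = unit_interval \<Otimes>\<^sub>M circ"
 define z where "z = (%n p k. cpx (W (snd p))*wave n (tt (fst p)) (snd p) k)"
 have Wb0: "0 <= Wb" using W0[of 0] by linarith
 have B0: "0 <= B" using ttB[of 0 0] norm_ge_zero[of "tt 0 0"] by linarith
 have fin: "finite_measure mz" unfolding mz_def
  by (rule finite_measure_pair_measure[OF finite_measure_circ unit_interval.finite_measure_axioms])
 interpret mz: finite_measure mz by (rule fin)
 note [measurable] = ttm
 have wm [measurable]: "(%p. wave n (tt (fst p)) (snd p) k) \<in> bm (borel \<Otimes>\<^sub>M borel)" for n k
  unfolding wave_def by measurable
 have zm: "(%p. z n p k) \<in> bm mz" for n k
  unfolding z_def mz_def by (rule measurable_unit_circ) measurable
 have zB: "cmod (z n p k) <= Wb*B" if "k \<in> {1..n}" for n p k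
 proof -
  have "cmod (tt (fst p) (real k/real n))/sqrt (real n) <= B/1"
   using that by (intro frac_le ttB B0) auto
  then show ?thesis unfolding z_def norm_mult cmod_wave using W0[of "snd p"] by (intro mult_mono) (auto simp: Wb0)
 qed
 have linz: "lin n (z n p) wo = W (snd p)*F wo n (tt (fst p)) (snd p)" for n p wo
  unfolding z_def lin_scale F_lin ..
 have covz: "cov_form r n (z n p) (z n q) = W (snd p)*W (snd q)*cov_form r n (wave n (tt (fst p)) (snd p)) (wave n (tt (fst q)) (snd q))" for n p q
  unfolding z_def by (rule cov_scale)
 define T where "T = (%n wo. \<integral>p. (lin n (z n p) wo)^2 \<partial>mz)"
 define m where "m = (%n. \<integral>p. cov_form r n (z n p) (z n p) \<partial>mz)"
 have linm: "(%p. lin n (z n (snd p)) (fst p)) \<in> bm (M \<Otimes>\<^sub>M mz)" for n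
  by (rule lin_measurable_pair[OF zm])
 have Tm [measurable]: "T n \<in> bm M" for n
  unfolding T_def using linm[of n] by (intro mz.borel_measurable_lebesgue_integral) (simp add: case_prod_unfold)
 have Ti: "integrable mz (%p. (lin n (z n p) wo)^2)" if "wo \<in> space M" for n wo
 proof (rule mz.integrable_const_bound[where B = "(Wb*B*(\<Sum>k=1..n. \<bar>a k wo\<bar> + \<bar>b k wo\<bar>))^2"])
  show "(%p. (lin n (z n p) wo)^2) \<in> bm mz"
   using measurable_Pair2[OF linm[of n] that] by simp
  show "AE p in mz. norm ((lin n (z n p) wo)^2) <= (Wb*B*(\<Sum>k=1..n. \<bar>a k wo\<bar> + \<bar>b k wo\<bar>))^2"
  proof (intro AE_I2)
   fix p
   have "\<bar>lin n (z n p) wo\<bar> <= Wb*B*(\<Sum>k=1..n. \<bar>a k wo\<bar> + \<bar>b k wo\<bar>)" by (rule lin_bound[OF zB])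
   from power_mono[OF this, of 2] show "norm ((lin n (z n p) wo)^2) <= (Wb*B*(\<Sum>k=1..n. \<bar>a k wo\<bar> + \<bar>b k wo\<bar>))^2" by simp
  qed
 qed
 have nnT: "(\<integral>\<^sup>+u. (CN x. ennreal ((W x*F wo n (tt u) x)^2)) \<partial>unit_interval) = ennreal (T n wo)" if w: "wo \<in> space M" for n wo
 proof -
  have "ennreal (T n wo) = (\<integral>\<^sup>+p. ennreal ((lin n (z n p) wo)^2) \<partial>mz)"
   unfolding T_def by (rule nn_integral_eq_integral[symmetric, OF Ti[OF w]]) simp
  also have "... = (\<integral>\<^sup>+u. (CN x. ennreal ((lin n (z n (u, x)) wo)^2)) \<partial>unit_interval)"
   unfolding mz_def
   by (rule circ.nn_integral_fst[symmetric])
    (use measurable_compose[OF borel_measurable_integrable[OF Ti[OF w], of n] measurable_ennreal] in \<open>simp add: mz_def\<close>)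
  finally show ?thesis by (simp add: linz)
 qed
 define K where "K = 2*Wb ^ 4*(4*pi^2*B ^ 4*D0)"
 have K0: "0 <= K" using D0 by (simp add: K_def)
 define X where "X = (%j wo. ennreal ((T (base Q j) wo - m (base Q j))^2))"
 have "AE wo in M. \<exists>C\<ge>0. \<forall>j. X j wo <= ennreal (C/(real j + 1) ^ 14)"
 proof (rule AE_rate[where c = K])
  show "X j \<in> bm M" for j unfolding X_def by measurable
  show "0 <= K" by (rule K0)
  fix j
  let ?n = "base Q j"
  let ?c = "%u x v y. ennreal ((cov_form r ?n (wave ?n (tt u) x) (wave ?n (tt v) y))^2)"
  let ?H = "%p q. ennreal (2*Wb ^ 4)*?c (fst p) (snd p) (fst q) (snd q)"
  have "(\<integral>\<^sup>+wo. X j wo \<partial>M) <= (\<integral>\<^sup>+p. \<integral>\<^sup>+q. ennreal (2*(cov_form r ?n (z ?n p) (z ?n q))^2) \<partial>mz \<partial>mz)"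
   unfolding X_def T_def m_def by (rule concentration_square[OF fin zm zB])
  also have "... <= (\<integral>\<^sup>+p. \<integral>\<^sup>+q. ?H p q \<partial>mz \<partial>mz)"
  proof (intro nn_integral_mono)
   fix p q :: "real \<times> real"
   have "W (snd p)*W (snd q) <= Wb*Wb" by (intro mult_mono W0 Wb0)
   then have "(W (snd p)*W (snd q))^2 <= (Wb*Wb)^2" using W0(1) by (intro power_mono) auto
   then have "(W (snd p)*W (snd q))^2 <= Wb ^ 4" by (simp add: power4_eq_xxxx power2_eq_square mult.assoc)
   then have "(cov_form r ?n (z ?n p) (z ?n q))^2 <= Wb ^ 4*(cov_form r ?n (wave ?n (tt (fst p)) (snd p)) (wave ?n (tt (fst q)) (snd q)))^2"
    unfolding covz power_mult_distrib[of "W (snd p)*W (snd q)"] by (rule mult_right_mono) simp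
   then have "2*(cov_form r ?n (z ?n p) (z ?n q))^2 <= 2*Wb ^ 4*(cov_form r ?n (wave ?n (tt (fst p)) (snd p)) (wave ?n (tt (fst q)) (snd q)))^2"
    by linarith
   then show "ennreal (2*(cov_form r ?n (z ?n p) (z ?n q))^2) <= ?H p q"
    by (simp add: ennreal_mult''[symmetric] ennreal_leI)
  qed
  also have "... = (\<integral>\<^sup>+p. \<integral>\<^sup>+v. (CN y. ?H p (v, y)) \<partial>unit_interval \<partial>mz)"
  proof (intro nn_integral_cong)
   fix p
   have "(%q. cov_form r ?n (wave ?n (tt (fst p)) (snd p)) (wave ?n (tt (fst q)) (snd q))) \<in> bm (unit_interval \<Otimes>\<^sub>M circ)"
    by (rule measurable_unit_circ, rule cov_measurable) measurable
   then show "(\<integral>\<^sup>+q. ?H p q \<partial>mz) = (\<integral>\<^sup>+v. (CN y. ?H p (v, y)) \<partial>unit_interval)"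
    unfolding mz_def by (intro circ.nn_integral_fst[symmetric]) measurable
  qed
  also have "... = (\<integral>\<^sup>+v. \<integral>\<^sup>+p. (CN y. ?H p (v, y)) \<partial>mz \<partial>unit_interval)"
  proof -
   interpret un: pair_sigma_finite unit_interval mz ..
   have i1: "(%w. ((fst (snd (fst w)), snd (snd (fst w))), fst (fst w), snd w)) \<in> measurable ((unit_interval \<Otimes>\<^sub>M (unit_interval \<Otimes>\<^sub>M circ)) \<Otimes>\<^sub>M circ) ((borel \<Otimes>\<^sub>M borel) \<Otimes>\<^sub>M (borel \<Otimes>\<^sub>M borel))"
   proof -
    have i: "(%x. x) \<in> measurable unit_interval borel" by (rule measurable_unit_interval) measurable
    show ?thesis
     by (intro measurable_Pair measurable_compose[OF _ i] measurable_compose[OF _ measurable_circ_id]) measurable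
   qed
   have i2: "(%w. cov_form r ?n (wave ?n (tt (fst (fst w))) (snd (fst w))) (wave ?n (tt (fst (snd w))) (snd (snd w)))) \<in> bm ((borel \<Otimes>\<^sub>M borel) \<Otimes>\<^sub>M (borel \<Otimes>\<^sub>M borel))"
    by (rule cov_measurable) measurable
   have "(%w. cov_form r ?n (wave ?n (tt (fst (snd (fst w)))) (snd (snd (fst w)))) (wave ?n (tt (fst (fst w))) (snd w))) \<in> bm ((unit_interval \<Otimes>\<^sub>M mz) \<Otimes>\<^sub>M circ)"
    unfolding mz_def using measurable_compose[OF i1 i2] by simp
   then have "(%w. (CN y. ?H (snd w) (fst w, y))) \<in> bm (unit_interval \<Otimes>\<^sub>M mz)"
    by (intro circ.borel_measurable_nn_integral) (simp add: case_prod_unfold)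
   then show ?thesis
    using un.Fubini'[of "%v p. (CN y. ?H p (v, y))"] by (simp add: case_prod_unfold)
  qed
  also have "... = (\<integral>\<^sup>+v. \<integral>\<^sup>+u. (CN x. (CN y. ?H (u, x) (v, y))) \<partial>unit_interval \<partial>unit_interval)"
  proof (intro nn_integral_cong)
   fix v
   have i1: "(%w. ((fst (fst w), snd (fst w)), snd w)) \<in> measurable ((unit_interval \<Otimes>\<^sub>M circ) \<Otimes>\<^sub>M circ) ((borel \<Otimes>\<^sub>M borel) \<Otimes>\<^sub>M borel)"
   proof -
    have i: "(%x. x) \<in> measurable unit_interval borel" by (rule measurable_unit_interval) measurable
    show ?thesis
     by (intro measurable_Pair measurable_compose[OF _ i] measurable_compose[OF _ measurable_circ_id]) measurable
   qed
   have i2: "(%w. cov_form r ?n (wave ?n (tt (fst (fst w))) (snd (fst w))) (wave ?n (tt v) (snd w))) \<in> bm ((borel \<Otimes>\<^sub>M borel) \<Otimes>\<^sub>M borel)"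
    by (rule cov_measurable) measurable
   have "(%w. cov_form r ?n (wave ?n (tt (fst (fst w))) (snd (fst w))) (wave ?n (tt v) (snd w))) \<in> bm (mz \<Otimes>\<^sub>M circ)"
    unfolding mz_def using measurable_compose[OF i1 i2] by simp
   then have "(%p. (CN y. ?H p (v, y))) \<in> bm mz"
    by (intro circ.borel_measurable_nn_integral) (simp add: case_prod_unfold)
   then show "(\<integral>\<^sup>+p. (CN y. ?H p (v, y)) \<partial>mz) = (\<integral>\<^sup>+u. (CN x. (CN y. ?H (u, x) (v, y))) \<partial>unit_interval)"
    unfolding mz_def by (rule circ.nn_integral_fst[symmetric])
  qed
  also have "... <= (\<integral>\<^sup>+v. \<integral>\<^sup>+u. ennreal (2*Wb ^ 4)*ennreal (4*pi^2*B ^ 4*mean_square_corr r ?n) \<partial>unit_interval \<partial>unit_interval)"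
  proof (intro nn_integral_mono)
   fix v u
   note [measurable] = cov_wave_measurable
   have "(%x. (CN y. ?c u x v y)) \<in> bm circ"
    by (intro circ.borel_measurable_nn_integral) (simp add: case_prod_unfold)
   then have "(CN x. (CN y. ?H (u, x) (v, y))) = ennreal (2*Wb ^ 4)*(CN x. (CN y. ?c u x v y))"
    by (simp add: nn_integral_cmult)
   also have "... <= ennreal (2*Wb ^ 4)*ennreal (4*pi^2*B ^ 4*mean_square_corr r ?n)"
    by (intro mult_left_mono cov_form_square_integral base_pos ttB) auto
   finally show "(CN x. (CN y. ?H (u, x) (v, y))) <= ennreal (2*Wb ^ 4)*ennreal (4*pi^2*B ^ 4*mean_square_corr r ?n)" .
  qed
  also have "... = ennreal (2*Wb ^ 4*(4*pi^2*B ^ 4*mean_square_corr r ?n))"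
   by (simp add: unit_interval.emeasure_space_1 ennreal_mult'[symmetric])
  also have "... <= ennreal (K/(real j + 1) ^ (14 + 2))"
  proof (rule ennreal_leI)
   have "2*Wb ^ 4*(4*pi^2*B ^ 4*mean_square_corr r ?n) <= 2*Wb ^ 4*(4*pi^2*B ^ 4*(D0/(real j + 1) ^ 16))"
    by (intro mult_left_mono corr_decay) auto
   then show "2*Wb ^ 4*(4*pi^2*B ^ 4*mean_square_corr r ?n) <= K/(real j + 1) ^ (14 + 2)" by (simp add: K_def)
  qed
  finally show "(\<integral>\<^sup>+wo. X j wo \<partial>M) <= ennreal (K/(real j + 1) ^ (14 + 2))" .
 qed
 with AE_regular_energy AE_space show ?thesis
 proof eventually_elim
  case (elim wo)
  then have w: "wo \<in> space M" and reg: "regular_energy Q (%k. a k wo) (%k. b k wo)" by auto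
  from elim obtain C where C: "C \<ge> 0" "!!j. X j wo <= ennreal (C/(real j + 1) ^ 14)" by blast
  obtain E where E: "E \<ge> 0" "!!n tt. 1 <= n ==> lip_symbol B L tt ==> (CI x. (F wo n tt x - F wo (base Q (blk Q n)) tt x)^2) <= E/(real (blk Q n) + 1)"
   using trig_field_block_L2[OF Q1 reg, of B L] by blast
  have mR: "m n <= R" if "N0 <= n" for n
  proof -
   have vz: "cov_form r n (z n p) (z n p) = (W (snd p))^2 * var n (tt (fst p)) (snd p)" for p
    unfolding covz var_def by (simp add: power2_eq_square)
   have vm: "(%p. (W (snd p))^2 * var n (tt (fst p)) (snd p)) \<in> bm mz"
    using cov_measurable[of "%p. z n p" mz "%p. z n p" n, OF zm zm] unfolding vz .
   have mn: "m n = enn2real (\<integral>\<^sup>+p. ennreal ((W (snd p))^2 * var n (tt (fst p)) (snd p)) \<partial>mz)"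
    unfolding m_def vz using vm by (intro integral_eq_nn_integral) (auto simp: var_nonneg)
   have "(\<integral>\<^sup>+p. ennreal ((W (snd p))^2 * var n (tt (fst p)) (snd p)) \<partial>mz)
     = (\<integral>\<^sup>+u. (CN x. ennreal ((W x)^2 * var n (tt u) x)) \<partial>unit_interval)"
    using vm unfolding mz_def by (subst circ.nn_integral_fst[symmetric]) auto
   also have "... <= (\<integral>\<^sup>+u. ennreal R \<partial>unit_interval)"
    using R(2)[OF that] by (intro nn_integral_mono) (auto simp: space_unit_interval)
   also have "... = ennreal R" by (simp add: unit_interval.emeasure_space_1)
   finally show ?thesis unfolding mn by (rule enn2real_leI[OF R(1)])
  qed
  have blk_lim: "filterlim (blk Q) at_top sequentially" by (rule blk_at_top[OF Q1])
  have ev1: "eventually (%j. sqrt C/(real j + 1) <= 1) sequentially" by real_asymp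
  have ev2: "eventually (%j. 2*Wb^2*(E/(real j + 1)) <= 1) sequentially" by real_asymp
  have ev3: "eventually (%j. N0 <= base Q j) sequentially"
   using base_at_top[OF Q1] by (simp add: filterlim_at_top)
  have evb: "eventually (%n. sqrt C/(real (blk Q n) + 1) <= 1 \<and> 2*Wb^2*(E/(real (blk Q n) + 1)) <= 1 \<and> N0 <= base Q (blk Q n)) sequentially"
   using eventually_compose_filterlim[OF eventually_conj[OF ev1 eventually_conj[OF ev2 ev3]] blk_lim] by simp
  show ?case
   using evb eventually_ge_at_top[of 1]
  proof eventually_elim
   case (elim n)
   let ?n' = "base Q (blk Q n)"
   have "(T ?n' wo - m ?n')^2 <= C/(real (blk Q n) + 1) ^ 14"
    using C(2)[of "blk Q n"] C(1) unfolding X_def by (simp add: ennreal_le_iff)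
   also have "... <= C/(real (blk Q n) + 1) ^ 2" using C(1) by (intro divide_left_mono power_increasing) auto
   also have "... = (sqrt C/(real (blk Q n) + 1))^2" using C(1) by (simp add: power_divide)
   finally have "\<bar>T ?n' wo - m ?n'\<bar> <= sqrt C/(real (blk Q n) + 1)" using C(1) by (simp add: abs_le_square_iff[symmetric])
   then have T1: "T ?n' wo <= R + 1" using elim mR[of ?n'] by linarith
   have dm: "(CN x. ennreal ((F wo n (tt u) x - F wo ?n' (tt u) x)^2)) <= ennreal (E/(real (blk Q n) + 1))"
    if "u \<in> space unit_interval" for u
   proof -
    have ls: "lip_symbol B L (tt u)" using that ttL by (simp add: space_unit_interval)
    show ?thesis
     using trig_field_diff_L2(1)[OF base_pos blk_bounds(1)[OF Q1 elim(2)] ls] E(2)[OF elim(2) ls]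
     by (subst nn_integral_eq_integral) (auto intro: ennreal_leI)
   qed
   have Fm: "(%x. ennreal ((W x*F wo n (tt u) x)^2)) \<in> bm circ"
    "(%x. ennreal ((F wo n (tt u) x - F wo n' (tt u) x)^2)) \<in> bm circ" for n n' u
    by (rule measurable_circ, measurable)+
   have Fm2: "(%u. (CN x. ennreal ((W x*F wo n (tt u) x)^2))) \<in> bm unit_interval" for n
   proof -
    have "(%p. ennreal ((lin n (z n p) wo)^2)) \<in> bm (unit_interval \<Otimes>\<^sub>M circ)"
     using borel_measurable_integrable[OF Ti[OF w], of n] unfolding mz_def by measurable
    then show ?thesis by (intro circ.borel_measurable_nn_integral) (simp add: linz case_prod_unfold)
   qed
   have "(\<integral>\<^sup>+u. (CN x. ennreal ((W x*F wo n (tt u) x)^2)) \<partial>unit_interval) <=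
     (\<integral>\<^sup>+u. 2*(CN x. ennreal ((W x*F wo ?n' (tt u) x)^2)) + ennreal (2*Wb^2*(E/(real (blk Q n) + 1))) \<partial>unit_interval)"
   proof (rule nn_integral_mono)
    fix u assume u: "u \<in> space unit_interval"
    have "(CN x. ennreal ((W x*F wo n (tt u) x)^2)) <=
      (CN x. 2*ennreal ((W x*F wo ?n' (tt u) x)^2) + ennreal (2*Wb^2)*ennreal ((F wo n (tt u) x - F wo ?n' (tt u) x)^2))"
    proof (rule nn_integral_mono)
     fix x
     have s: "(p + q)^2 <= 2*p^2 + 2*q^2" for p q :: real
      using sum_squares_bound[of p q] by (simp add: power2_sum)
     have "(W x*F wo n (tt u) x)^2 <= 2*(W x*F wo ?n' (tt u) x)^2 + 2*(W x*(F wo n (tt u) x - F wo ?n' (tt u) x))^2"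
      using s[of "W x*F wo ?n' (tt u) x" "W x*(F wo n (tt u) x - F wo ?n' (tt u) x)"] by (simp add: algebra_simps)
     also have "(W x*(F wo n (tt u) x - F wo ?n' (tt u) x))^2 <= Wb^2*(F wo n (tt u) x - F wo ?n' (tt u) x)^2"
      unfolding power_mult_distrib using W0 by (intro mult_right_mono power_mono) auto
     finally have "ennreal ((W x*F wo n (tt u) x)^2) <= ennreal (2*(W x*F wo ?n' (tt u) x)^2 + 2*Wb^2*(F wo n (tt u) x - F wo ?n' (tt u) x)^2)"
      by (intro ennreal_leI) simp
     also have "... = ennreal (2*(W x*F wo ?n' (tt u) x)^2) + ennreal (2*Wb^2*(F wo n (tt u) x - F wo ?n' (tt u) x)^2)"
      by (rule ennreal_plus) auto
     also have "... = 2*ennreal ((W x*F wo ?n' (tt u) x)^2) + ennreal (2*Wb^2)*ennreal ((F wo n (tt u) x - F wo ?n' (tt u) x)^2)"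
      by (simp add: ennreal_mult'')
     finally show "ennreal ((W x*F wo n (tt u) x)^2) <= 2*ennreal ((W x*F wo ?n' (tt u) x)^2) + ennreal (2*Wb^2)*ennreal ((F wo n (tt u) x - F wo ?n' (tt u) x)^2)" .
    qed
    also have "... = 2*(CN x. ennreal ((W x*F wo ?n' (tt u) x)^2)) + ennreal (2*Wb^2)*(CN x. ennreal ((F wo n (tt u) x - F wo ?n' (tt u) x)^2))"
     using Fm by (subst nn_integral_add) (auto simp: nn_integral_cmult)
    also have "... <= 2*(CN x. ennreal ((W x*F wo ?n' (tt u) x)^2)) + ennreal (2*Wb^2)*ennreal (E/(real (blk Q n) + 1))"
     by (intro add_left_mono mult_left_mono dm[OF u]) simp
    finally show "(CN x. ennreal ((W x*F wo n (tt u) x)^2)) <= 2*(CN x. ennreal ((W x*F wo ?n' (tt u) x)^2)) + ennreal (2*Wb^2*(E/(real (blk Q n) + 1)))"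
     by (simp only: ennreal_mult'[symmetric] mult_nonneg_nonneg zero_le_numeral zero_le_power2)
   qed
   also have "... = 2*ennreal (T ?n' wo) + ennreal (2*Wb^2*(E/(real (blk Q n) + 1)))"
    using Fm2 by (subst nn_integral_add) (auto simp: nn_integral_cmult nnT[OF w] unit_interval.emeasure_space_1)
   also have "... <= 2*ennreal (R + 1) + ennreal 1"
    using T1 elim by (intro add_mono mult_left_mono ennreal_leI) auto
   also have "... = ennreal (2*R + 3)"
   proof -
    have "2*R + 3 = 2*(R + 1) + 1" by simp
    moreover have "ennreal (2*(R + 1) + 1) = ennreal (2*(R + 1)) + ennreal 1" using R(1) by (intro ennreal_plus) auto
    moreover have "ennreal (2*(R + 1)) = ennreal 2*ennreal (R + 1)" by (rule ennreal_mult') simp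
    ultimately show ?thesis by (simp only: ennreal_numeral)
   qed
   finally show ?case .
  qed
 qed
qed

end

lemma abs_gauss_le_1: "(\<integral>\<^sup>+xi. ennreal \<bar>xi\<bar> \<partial>std_gauss) <= 1"
proof -
 have p: "\<bar>xi\<bar> <= 1/2 + xi^2/2" for xi :: real using sum_squares_bound[of 1 "\<bar>xi\<bar>"] by simp
 have "(\<integral>\<^sup>+xi. ennreal \<bar>xi\<bar> \<partial>std_gauss) <= (\<integral>\<^sup>+xi. ennreal (1/2 + xi^2/2) \<partial>std_gauss)"
  by (intro nn_integral_mono ennreal_leI p)
 also have "... = ennreal (\<integral>xi. 1/2 + xi^2/2 \<partial>std_gauss)"
  using std_gauss_moments(5)[of 2] by (intro nn_integral_eq_integral) auto
 also have "(\<integral>xi. 1/2 + xi^2/2 \<partial>std_gauss) = 1"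
  using std_gauss_moments(5)[of 2] std_gauss_moments(2) std_gauss.prob_space by simp
 finally show ?thesis by simp
qed

lemma gauss_exp_lipschitz: "\<bar>exp (- (s^2/2)) - exp (- (t^2/2))\<bar> <= \<bar>s - t\<bar>" for s t :: real
proof -
 have i: "integrable std_gauss (%xi. iexp (s*xi))" for s
  by (rule std_gauss.integrable_iexp) measurable
 have c: "cpx (exp (- (s^2/2))) = (\<integral>xi. iexp (s*xi) \<partial>std_gauss)" for s
  using char_std_gauss[of s] by (simp add: char_def)
 have ai: "integrable std_gauss (%xi. \<bar>xi\<bar>)" using std_gauss_moments(4) by (rule integrable_abs)
 have a1: "(\<integral>xi. \<bar>xi\<bar> \<partial>std_gauss) <= 1"
  using abs_gauss_le_1 nn_integral_eq_integral[OF ai] by simp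
 have "\<bar>exp (- (s^2/2)) - exp (- (t^2/2))\<bar> = cmod (cpx (exp (- (s^2/2))) - cpx (exp (- (t^2/2))))"
  by (simp only: of_real_diff[symmetric] norm_of_real)
 also have "... = cmod (\<integral>xi. iexp (s*xi) - iexp (t*xi) \<partial>std_gauss)"
  unfolding c using i by simp
 also have "... <= (\<integral>xi. cmod (iexp (s*xi) - iexp (t*xi)) \<partial>std_gauss)" by (rule integral_norm_bound)
 also have "... <= (\<integral>xi. \<bar>s - t\<bar>*\<bar>xi\<bar> \<partial>std_gauss)"
 proof (rule integral_mono)
  show "integrable std_gauss (%xi. cmod (iexp (s*xi) - iexp (t*xi)))" using i by simp
  show "integrable std_gauss (%xi. \<bar>s - t\<bar>*\<bar>xi\<bar>)" using ai by simp
  fix xi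
  have "cmod (iexp (s*xi) - iexp (t*xi)) <= \<bar>s*xi - t*xi\<bar>" by (rule cmod_exp_i_diff)
  then show "cmod (iexp (s*xi) - iexp (t*xi)) <= \<bar>s - t\<bar>*\<bar>xi\<bar>" by (simp add: left_diff_distrib[symmetric] abs_mult)
 qed
 also have "... = \<bar>s - t\<bar>*(\<integral>xi. \<bar>xi\<bar> \<partial>std_gauss)" by simp
 also have "... <= \<bar>s - t\<bar>*1" by (intro mult_left_mono a1) simp
 finally show ?thesis by simp
qed

interpretation cg: pair_sigma_finite circ std_gauss ..

lemma measurable_circ_gauss:
 assumes "(%p. f (fst p) (snd p)) \<in> bm (borel \<Otimes>\<^sub>M borel)"
 shows "(%p. f (fst p) (snd p)) \<in> bm (circ \<Otimes>\<^sub>M std_gauss)"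
proof -
 have "(%p. (fst p, snd p)) \<in> measurable (circ \<Otimes>\<^sub>M std_gauss) (borel \<Otimes>\<^sub>M borel)"
  by (intro measurable_Pair measurable_compose[OF measurable_fst measurable_circ_id]) measurable
 from measurable_compose[OF this assms] show ?thesis by simp
qed

abbreviation one :: "real => complex" where "one \<equiv> (%_. 1)"

section \<open>Small values of the sum\<close>

text \<open>A smooth substitute for the measure of \<open>{|f| <= 2^-i}\<close>. Writing the Gaussian as a characteristic function of an additional standard normal variable \<open>xi\<close> makes it an average of \<open>exp(i 2^i xi f(x))\<close>, to which \<open>concentration_char\<close> applies.\<close>

definition gauss_mass :: "(real => real) => nat => real" where
 "gauss_mass f i = (CI x. exp (- ((2 ^ i*f x)^2/2)))"

lemma gauss_mass_integrable:
 fixes f :: "real => real"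
 assumes [measurable]: "f \<in> bm borel"
 shows "integrable circ (%x. exp (- ((2 ^ i*f x)^2/2)))"
proof (rule integrable_circ_bounded[where B = 1])
 show "(%x. exp (- ((2 ^ i*f x)^2/2))) \<in> bm circ" by (rule measurable_circ) measurable
qed simp

lemma gauss_mass_nonneg: "0 <= gauss_mass f i"
 unfolding gauss_mass_def by simp

lemma gauss_mass_antimono:
 assumes f [measurable]: "f \<in> bm borel" and "i <= j"
 shows "gauss_mass f j <= gauss_mass f i"
 unfolding gauss_mass_def
proof (rule integral_mono[OF gauss_mass_integrable[OF f] gauss_mass_integrable[OF f]])
 fix x
 have "\<bar>2 ^ i*f x\<bar> <= \<bar>2 ^ j*f x\<bar>" using assms(2) by (simp add: abs_mult mult_right_mono power_increasing)
 then have "(2 ^ i*f x)^2 <= (2 ^ j*f x)^2" by (simp only: abs_le_square_iff)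
 then show "exp (- ((2 ^ j*f x)^2/2)) <= exp (- ((2 ^ i*f x)^2/2))" by simp
qed

lemma small_ball_le_gauss_mass:
 assumes f [measurable]: "f \<in> bm borel"
 shows "emeasure circ {x \<in> space circ. \<bar>f x\<bar> <= (1/2) ^ i} <= ennreal (2*gauss_mass f i)"
proof -
 have [measurable]: "f \<in> bm circ" by (rule measurable_circ) measurable
 have S [measurable]: "{x \<in> space circ. \<bar>f x\<bar> <= (1/2) ^ i} \<in> sets circ" by measurable
 have e: "exp (-(1/2)) \<ge> (1/2 :: real)" using exp_ge_add_one_self[of "-(1/2)"] by simp
 have "emeasure circ {x \<in> space circ. \<bar>f x\<bar> <= (1/2) ^ i} = (CN x. indicator {x \<in> space circ. \<bar>f x\<bar> <= (1/2) ^ i} x)"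
  by simp
 also have "... <= (CN x. ennreal (2*exp (- ((2 ^ i*f x)^2/2))))"
 proof (rule nn_integral_mono)
  fix x
  show "indicator {x \<in> space circ. \<bar>f x\<bar> <= (1/2) ^ i} x <= ennreal (2*exp (- ((2 ^ i*f x)^2/2)))"
  proof (cases "\<bar>f x\<bar> <= (1/2) ^ i")
   case True
   then have "2 ^ i*\<bar>f x\<bar> <= 2 ^ i*(1/2) ^ i" by (intro mult_left_mono) auto
   also have "... = 1" by (simp add: power_mult_distrib[symmetric])
   finally have "\<bar>2 ^ i*f x\<bar> <= \<bar>1\<bar>" by (simp add: abs_mult)
   then have "(2 ^ i*f x)^2 <= 1" using abs_le_square_iff[of "2 ^ i*f x" 1] by simp
   then have "exp (-(1/2)) <= exp (- ((2 ^ i*f x)^2/2))" by simp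
   then have "1 <= 2*exp (- ((2 ^ i*f x)^2/2))" using e by linarith
   then have "(1::ennreal) <= ennreal (2*exp (- ((2 ^ i*f x)^2/2)))" using ennreal_leI by fastforce
   then show ?thesis by (auto simp: indicator_def)
  qed (simp add: indicator_def)
 qed
 also have "... = ennreal (CI x. 2*exp (- ((2 ^ i*f x)^2/2)))"
  using gauss_mass_integrable[OF f, of i] by (intro nn_integral_eq_integral) auto
 also have "... = ennreal (2*gauss_mass f i)" by (simp add: gauss_mass_def)
 finally show ?thesis .
qed

lemma gauss_mass_lipschitz:
 assumes f [measurable]: "f \<in> bm borel" and g [measurable]: "g \<in> bm borel"
  and i2: "integrable circ (%x. (f x - g x)^2)"
 shows "\<bar>gauss_mass f i - gauss_mass g i\<bar> <= 2 ^ i * sqrt (2*pi*(CI x. (f x - g x)^2))"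
proof -
 have dm: "(%x. f x - g x) \<in> bm circ" by (rule measurable_circ) measurable
 note cs = circ_cauchy_schwarz[OF dm i2]
 have "\<bar>gauss_mass f i - gauss_mass g i\<bar> = \<bar>(CI x. exp (- ((2 ^ i*f x)^2/2)) - exp (- ((2 ^ i*g x)^2/2)))\<bar>"
  unfolding gauss_mass_def using gauss_mass_integrable[OF f] gauss_mass_integrable[OF g] by simp
 also have "... <= (CI x. \<bar>exp (- ((2 ^ i*f x)^2/2)) - exp (- ((2 ^ i*g x)^2/2))\<bar>)"
  by (rule integral_abs_bound)
 also have "... <= (CI x. 2 ^ i*\<bar>f x - g x\<bar>)"
 proof (rule integral_mono)
  show "integrable circ (%x. \<bar>exp (- ((2 ^ i*f x)^2/2)) - exp (- ((2 ^ i*g x)^2/2))\<bar>)"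
   using gauss_mass_integrable[OF f] gauss_mass_integrable[OF g] by simp
  show "integrable circ (%x. 2 ^ i*\<bar>f x - g x\<bar>)" using cs(1) by simp
  fix x
  have "\<bar>2 ^ i*f x - 2 ^ i*g x\<bar> = 2 ^ i*\<bar>f x - g x\<bar>" by (simp add: right_diff_distrib[symmetric] abs_mult)
  then show "\<bar>exp (- ((2 ^ i*f x)^2/2)) - exp (- ((2 ^ i*g x)^2/2))\<bar> <= 2 ^ i*\<bar>f x - g x\<bar>"
   using gauss_exp_lipschitz[of "2 ^ i*f x" "2 ^ i*g x"] by simp
 qed
 also have "... = 2 ^ i*(CI x. \<bar>f x - g x\<bar>)" by simp
 also have "... <= 2 ^ i * sqrt (2*pi*(CI x. (f x - g x)^2))" by (intro mult_left_mono cs(2)) simp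
 finally show ?thesis .
qed

context gauss_spectral begin

definition gz :: "nat => nat => real \<times> real => nat => complex" where
 "gz n i p k = cpx (2 ^ i * snd p)*wave n one (fst p) k"

lemma gz_measurable: "(%p. gz n i p k) \<in> bm (circ \<Otimes>\<^sub>M std_gauss)"
 unfolding gz_def by (rule measurable_circ_gauss) measurable

lemma finite_circ_gauss: "finite_measure (circ \<Otimes>\<^sub>M std_gauss)"
 by (rule finite_measure_pair_measure[OF std_gauss.finite_measure_axioms finite_measure_circ])

lemma lin_gz: "lin n (gz n i p) w = 2 ^ i*F w n one (fst p) * snd p"
proof -
 have "lin n (gz n i p) w = lin n (%k. cpx (2 ^ i * snd p)*wave n one (fst p) k) w"
  by (simp add: gz_def[abs_def])
 then show ?thesis unfolding lin_scale F_lin by simp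
qed

lemma cov_gz: "cov_form r n (gz n i p) (gz n i q) = 4 ^ i*(snd p * snd q)*cov_form r n (wave n one (fst p)) (wave n one (fst q))"
proof -
 have "cov_form r n (gz n i p) (gz n i q) = (2 ^ i * snd p)*(2 ^ i * snd q)*cov_form r n (wave n one (fst p)) (wave n one (fst q))"
  unfolding gz_def[abs_def] by (rule cov_scale)
 moreover have "(4::real) ^ i = 2 ^ i*2 ^ i" by (simp add: power_mult_distrib[symmetric])
 ultimately show ?thesis by simp
qed

definition mean_mass :: "nat => nat => real" where
 "mean_mass n i = (\<integral>p. exp (- cov_form r n (gz n i p) (gz n i p)/2) \<partial>(circ \<Otimes>\<^sub>M std_gauss))"

lemma gauss_mass_char:
 assumes w: "wo \<in> space M"
 shows "(\<integral>p. iexp (lin n (gz n i p) wo) \<partial>(circ \<Otimes>\<^sub>M std_gauss)) = cpx (gauss_mass (F wo n one) i)"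
proof -
 interpret P: finite_measure "circ \<Otimes>\<^sub>M std_gauss" by (rule finite_circ_gauss)
 have lm: "(%x. lin n (gz n i (snd x)) (fst x)) \<in> bm (M \<Otimes>\<^sub>M (circ \<Otimes>\<^sub>M std_gauss))"
  by (rule lin_measurable_pair[OF gz_measurable])
 have lm1 [measurable]: "(%p. lin n (gz n i p) wo) \<in> bm (circ \<Otimes>\<^sub>M std_gauss)"
  using measurable_Pair2[OF lm w] by simp
 have ei: "integrable (circ \<Otimes>\<^sub>M std_gauss) (%p. iexp (lin n (gz n i p) wo))"
  by (rule P.integrable_const_bound[where B = 1]) (auto simp: norm_exp_i_times)
 have "(\<integral>p. iexp (lin n (gz n i p) wo) \<partial>(circ \<Otimes>\<^sub>M std_gauss)) =
   (CI x. \<integral>xi. iexp (lin n (gz n i (x, xi)) wo) \<partial>std_gauss)"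
  by (rule cg.integral_fst'[OF ei, symmetric])
 also have "... = (CI x. char std_gauss (2 ^ i*F wo n one x))"
  unfolding lin_gz char_def by simp
 also have "... = (CI x. cpx (exp (- ((2 ^ i*F wo n one x)^2/2))))"
  unfolding char_std_gauss by simp
 also have "... = cpx (gauss_mass (F wo n one) i)"
  unfolding gauss_mass_def by (rule integral_complex_of_real)
 finally show ?thesis .
qed

lemma gauss_mass_measurable [measurable]: "(%w. gauss_mass (F w n one) i) \<in> bm M"
proof -
 have z: "(%x. wave n one x k) \<in> bm circ" for k by (rule measurable_circ) measurable
 have [measurable]: "(%p. F (fst p) n one (snd p)) \<in> bm (M \<Otimes>\<^sub>M circ)"
  unfolding F_lin by (rule lin_measurable_pair[OF z])
 have "(%p. exp (- ((2 ^ i*F (fst p) n one (snd p))^2/2))) \<in> bm (M \<Otimes>\<^sub>M circ)" by measurable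
 then show ?thesis unfolding gauss_mass_def
  by (intro circ.borel_measurable_lebesgue_integral) (simp add: case_prod_unfold)
qed

lemma mean_mass_bound: "mean_mass n i <= CU*(4 ^ i) powr (- be)" "0 <= mean_mass n i" if n: "1 <= n"
proof -
 let ?f = "%p. exp (- cov_form r n (gz n i p) (gz n i p)/2)"
 have fm: "?f \<in> bm (circ \<Otimes>\<^sub>M std_gauss)"
  using cov_measurable[OF gz_measurable[of n i] gz_measurable[of n i], of n] by measurable
 have pm: "(%p. ennreal (exp (- (4 ^ i*(2*pi*\<psi> (fst p))*(snd p)^2/2)))) \<in> bm (circ \<Otimes>\<^sub>M std_gauss)"
  by (rule measurable_circ_gauss) measurable
 show "0 <= mean_mass n i" unfolding mean_mass_def by simp
 have "(\<integral>\<^sup>+p. ennreal (?f p) \<partial>(circ \<Otimes>\<^sub>M std_gauss)) = (\<integral>\<^sup>+xi. (CN x. ennreal (?f (x, xi))) \<partial>std_gauss)"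
  by (rule cg.nn_integral_snd[symmetric]) (rule measurable_compose[OF fm measurable_ennreal])
 also have "... <= (\<integral>\<^sup>+xi. (CN x. ennreal (exp (- (4 ^ i*(2*pi*\<psi> x)*xi^2/2)))) \<partial>std_gauss)"
 proof (rule nn_integral_mono)
  fix xi
  have "?f (x, xi) = exp (- (4 ^ i*xi^2/2 * var n one x))" for x
   unfolding cov_gz var_def by (simp add: power2_eq_square mult_ac)
  then have "(CN x. ennreal (?f (x, xi))) = (CN x. ennreal (exp (- (4 ^ i*xi^2/2 * var n one x))))" by simp
  also have "... <= (CN x. ennreal (exp (- (4 ^ i*xi^2/2*(2*pi*\<psi> x)))))"
   by (rule exp_var_le[OF n]) simp
  also have "... = (CN x. ennreal (exp (- (4 ^ i*(2*pi*\<psi> x)*xi^2/2))))" by (simp add: mult_ac)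
  finally show "(CN x. ennreal (?f (x, xi))) <= (CN x. ennreal (exp (- (4 ^ i*(2*pi*\<psi> x)*xi^2/2))))" .
 qed
 also have "... = (CN x. \<integral>\<^sup>+xi. ennreal (exp (- (4 ^ i*(2*pi*\<psi> x)*xi^2/2))) \<partial>std_gauss)"
  using cg.Fubini'[of "%x xi. ennreal (exp (- (4 ^ i*(2*pi*\<psi> x)*xi^2/2)))"] pm by (simp add: case_prod_unfold)
 also have "... <= ennreal (CU*(4 ^ i) powr (- be))" by (rule gauss_avg) simp
 finally have b: "(\<integral>\<^sup>+p. ennreal (?f p) \<partial>(circ \<Otimes>\<^sub>M std_gauss)) <= ennreal (CU*(4 ^ i) powr (- be))" .
 have "mean_mass n i = enn2real (\<integral>\<^sup>+p. ennreal (?f p) \<partial>(circ \<Otimes>\<^sub>M std_gauss))"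
  unfolding mean_mass_def by (rule integral_eq_nn_integral[OF fm]) simp
 also have "... <= CU*(4 ^ i) powr (- be)" using CU by (intro enn2real_leI b) simp
 finally show "mean_mass n i <= CU*(4 ^ i) powr (- be)" .
qed

lemma mean_mass_expectation: "(\<integral>\<^sup>+w. ennreal (gauss_mass (F w n one) i) \<partial>M) = ennreal (mean_mass n i)"
proof -
 let ?mz = "circ \<Otimes>\<^sub>M std_gauss"
 interpret mz: finite_measure ?mz by (rule finite_circ_gauss)
 interpret P: pair_sigma_finite M ?mz ..
 interpret Pf: finite_measure "M \<Otimes>\<^sub>M ?mz" by (rule finite_measure_pair_measure[OF finite_circ_gauss finite_measure_axioms])
 have lm [measurable]: "(%x. lin n (gz n i (snd x)) (fst x)) \<in> bm (M \<Otimes>\<^sub>M ?mz)"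
  by (rule lin_measurable_pair[OF gz_measurable])
 have ei: "integrable (M \<Otimes>\<^sub>M ?mz) (%(w, p). iexp (lin n (gz n i p) w))"
 proof (rule Pf.integrable_const_bound[where B = 1])
  show "(%(w, p). iexp (lin n (gz n i p) w)) \<in> bm (M \<Otimes>\<^sub>M ?mz)"
   unfolding case_prod_unfold by measurable
 qed (auto simp: norm_exp_i_times case_prod_unfold)
 have gi: "integrable M (%w. gauss_mass (F w n one) i)"
 proof (rule integrable_const_bound[where B = "2*pi"])
  show "AE w in M. norm (gauss_mass (F w n one) i) <= 2*pi"
  proof (intro AE_I2)
   fix w
   have "gauss_mass (F w n one) i <= (CI x. 1)"
    unfolding gauss_mass_def by (rule integral_mono) (auto intro: gauss_mass_integrable)
   then show "norm (gauss_mass (F w n one) i) <= 2*pi" using gauss_mass_nonneg[of "F w n one" i] by (simp add: measure_circ_space)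
  qed
 qed measurable
 have "cpx (\<integral>w. gauss_mass (F w n one) i \<partial>M) = (\<integral>w. \<integral>p. iexp (lin n (gz n i p) w) \<partial>?mz \<partial>M)"
  unfolding integral_complex_of_real[symmetric] by (intro Bochner_Integration.integral_cong refl gauss_mass_char[symmetric])
 also have "... = (\<integral>p. \<integral>w. iexp (lin n (gz n i p) w) \<partial>M \<partial>?mz)"
  by (rule P.Fubini_integral[OF ei, symmetric])
 also have "... = cpx (mean_mass n i)"
  unfolding lin_char mean_mass_def integral_complex_of_real ..
 finally have "(\<integral>w. gauss_mass (F w n one) i \<partial>M) = mean_mass n i" by (simp only: of_real_eq_iff)
 then show ?thesis using nn_integral_eq_integral[OF gi] gauss_mass_nonneg by simp
qed

lemma gauss_mass_concentration:
 "(\<integral>\<^sup>+wo. ennreal ((gauss_mass (F wo (base Q j) one) i - mean_mass (base Q j) i)^2) \<partial>M)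
  <= ennreal (4 ^ i*(2*pi^2*(1 + D0))/(real j + 1) ^ 8)"
proof -
 let ?n = "base Q j"
 let ?mz = "circ \<Otimes>\<^sub>M std_gauss"
 let ?c = "%x y. ennreal \<bar>cov_form r ?n (wave ?n one x) (wave ?n one y)\<bar>"
 let ?H = "%p q. ennreal (4 ^ i)*ennreal \<bar>snd p\<bar>*ennreal \<bar>snd q\<bar>*?c (fst p) (fst q)"
 interpret mz: finite_measure ?mz by (rule finite_circ_gauss)
 note [measurable] = cov_wave_measurable
 have cm: "(%p. cov_form r ?n (wave ?n one x) (wave ?n one (fst p))) \<in> bm ?mz" for x
  by (rule measurable_circ_gauss, rule cov_measurable) measurable
 have cm2: "(%x. (CN y. ?c x y)) \<in> bm circ"
  by (intro circ.borel_measurable_nn_integral) (simp add: case_prod_unfold)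
 have sm: "(%x. x) \<in> bm std_gauss" by (rule measurable_std_gauss) measurable
 have "(\<integral>\<^sup>+wo. ennreal ((gauss_mass (F wo ?n one) i - mean_mass ?n i)^2) \<partial>M) =
   (\<integral>\<^sup>+wo. ennreal ((cmod ((\<integral>p. iexp (lin ?n (gz ?n i p) wo) \<partial>?mz) - cpx (mean_mass ?n i)))^2) \<partial>M)"
 proof (rule nn_integral_cong)
  fix wo assume w: "wo \<in> space M"
  have "cmod ((\<integral>p. iexp (lin ?n (gz ?n i p) wo) \<partial>?mz) - cpx (mean_mass ?n i)) = \<bar>gauss_mass (F wo ?n one) i - mean_mass ?n i\<bar>"
   unfolding gauss_mass_char[OF w] by (simp only: of_real_diff[symmetric] norm_of_real)
  then show "ennreal ((gauss_mass (F wo ?n one) i - mean_mass ?n i)^2) = ennreal ((cmod ((\<integral>p. iexp (lin ?n (gz ?n i p) wo) \<partial>?mz) - cpx (mean_mass ?n i)))^2)"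
   by simp
 qed
 also have "... <= (\<integral>\<^sup>+p. \<integral>\<^sup>+q. ennreal \<bar>cov_form r ?n (gz ?n i p) (gz ?n i q)\<bar> \<partial>?mz \<partial>?mz)"
  unfolding mean_mass_def by (rule concentration_char[OF finite_circ_gauss gz_measurable])
 also have "... = (\<integral>\<^sup>+p. \<integral>\<^sup>+q. ?H p q \<partial>?mz \<partial>?mz)"
  unfolding cov_gz by (simp add: abs_mult ennreal_mult mult.assoc)
 also have "... <= (\<integral>\<^sup>+p. ennreal (4 ^ i)*ennreal \<bar>snd p\<bar>*(CN y. ?c (fst p) y) \<partial>?mz)"
 proof (rule nn_integral_mono)
  fix p :: "real \<times> real"
  have m0: "(%q. ennreal \<bar>snd q\<bar>*?c (fst p) (fst q)) \<in> bm ?mz"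
   using cm[of "fst p"] by measurable
  have "(\<integral>\<^sup>+q. ?H p q \<partial>?mz) = ennreal (4 ^ i)*ennreal \<bar>snd p\<bar>*(\<integral>\<^sup>+q. ennreal \<bar>snd q\<bar>*?c (fst p) (fst q) \<partial>?mz)"
   using nn_integral_cmult[OF m0, of "ennreal (4 ^ i)*ennreal \<bar>snd p\<bar>"] by (simp only: mult.assoc)
  also have "(\<integral>\<^sup>+q. ennreal \<bar>snd q\<bar>*?c (fst p) (fst q) \<partial>?mz) = (CN y. \<integral>\<^sup>+et. ennreal \<bar>et\<bar>*?c (fst p) y \<partial>std_gauss)"
   using std_gauss.nn_integral_fst[OF m0] by simp
  also have "... = (CN y. (\<integral>\<^sup>+et. ennreal \<bar>et\<bar> \<partial>std_gauss)*?c (fst p) y)"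
   using sm by (intro nn_integral_cong nn_integral_multc) measurable
  also have "... <= (CN y. 1*?c (fst p) y)"
   by (intro nn_integral_mono mult_right_mono abs_gauss_le_1) simp
  finally show "(\<integral>\<^sup>+q. ?H p q \<partial>?mz) <= ennreal (4 ^ i)*ennreal \<bar>snd p\<bar>*(CN y. ?c (fst p) y)"
   by (simp add: mult_left_mono)
 qed
 also have "... = (CN x. \<integral>\<^sup>+xi. ennreal (4 ^ i)*ennreal \<bar>xi\<bar>*(CN y. ?c x y) \<partial>std_gauss)"
 proof -
  have "(%p. ennreal (4 ^ i)*ennreal \<bar>snd p\<bar>*(CN y. ?c (fst p) y)) \<in> bm ?mz"
  proof -
   have [measurable]: "(%p. (CN y. ?c (fst p) y)) \<in> bm ?mz"
    by (rule measurable_compose[OF measurable_fst cm2])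
   have [measurable]: "(%p. snd p) \<in> bm ?mz"
    using measurable_compose[OF measurable_snd sm] by simp
   show ?thesis by (intro borel_measurable_times_ennreal borel_measurable_const measurable_compose[OF _ measurable_ennreal] borel_measurable_abs) fact+
  qed
  from std_gauss.nn_integral_fst[OF this] show ?thesis by (simp only: fst_conv snd_conv)
 qed
 also have "... = (CN x. ennreal (4 ^ i)*(\<integral>\<^sup>+xi. ennreal \<bar>xi\<bar> \<partial>std_gauss)*(CN y. ?c x y))"
 proof (rule nn_integral_cong)
  fix x
  have am: "(%xi. ennreal \<bar>xi\<bar>) \<in> bm std_gauss"
   by (rule measurable_compose[OF _ measurable_ennreal]) (rule borel_measurable_abs[OF sm])
  have am2: "(%xi. ennreal (4 ^ i)*ennreal \<bar>xi\<bar>) \<in> bm std_gauss"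
   by (rule borel_measurable_times_ennreal[OF borel_measurable_const am])
  show "(\<integral>\<^sup>+xi. ennreal (4 ^ i)*ennreal \<bar>xi\<bar>*(CN y. ?c x y) \<partial>std_gauss) = ennreal (4 ^ i)*(\<integral>\<^sup>+xi. ennreal \<bar>xi\<bar> \<partial>std_gauss)*(CN y. ?c x y)"
   by (simp only: nn_integral_multc[OF am2] nn_integral_cmult[OF am])
 qed
 also have "... <= (CN x. ennreal (4 ^ i)*1*(CN y. ?c x y))"
  by (intro nn_integral_mono mult_right_mono mult_left_mono abs_gauss_le_1) simp_all
 also have "... = ennreal (4 ^ i)*(CN x. (CN y. ?c x y))"
  using cm2 by (simp add: nn_integral_cmult)
 also have "... <= ennreal (4 ^ i)*ennreal (2*pi^2*(1 + 1 ^ 4*D0)/(real j + 1) ^ 8)"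
  by (intro mult_left_mono cov_abs_integral) auto
 also have "... = ennreal (4 ^ i*(2*pi^2*(1 + D0))/(real j + 1) ^ 8)"
  by (subst ennreal_mult'[symmetric]) (auto simp: field_simps)
 finally show ?thesis .
qed

lemma AE_gauss_mass_blocks:
 "AE w in M. \<exists>C\<ge>0. \<forall>i j. gauss_mass (F w (base Q j) one) i <= CU*(4 ^ i) powr (- be) + C*4 ^ i/(real j + 1)"
proof -
 define K where "K = 2*pi^2*(1 + D0)"
 have K0: "0 <= K" using D0 by (simp add: K_def)
 define Y where "Y = (%i j w. ennreal ((gauss_mass (F w (base Q j) one) i - mean_mass (base Q j) i)^2))"
 have [measurable]: "Y i j \<in> bm M" for i j unfolding Y_def by measurable
 \<comment> \<open>The weights \<open>16^(- i)\<close> make the rate uniform in the level at the price of the factor \<open>4^i\<close>.\<close>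
 define X where "X = (%j w. \<Sum>i. ennreal ((1/16) ^ i)*Y i j w)"
 have "AE w in M. \<exists>C\<ge>0. \<forall>j. X j w <= ennreal (C/(real j + 1) ^ 6)"
 proof (rule AE_rate[where c = "K*(4/3)"])
  show "X j \<in> bm M" for j unfolding X_def by measurable
  show "0 <= K*(4/3)" using K0 by simp
  fix j
  have "(\<integral>\<^sup>+w. X j w \<partial>M) = (\<Sum>i. \<integral>\<^sup>+w. ennreal ((1/16) ^ i)*Y i j w \<partial>M)"
   unfolding X_def by (rule nn_integral_suminf) measurable
  also have "... <= (\<Sum>i. ennreal (K/(real j + 1) ^ 8*(1/4) ^ i))"
  proof (intro suminf_le)
   fix i
   have "(\<integral>\<^sup>+w. ennreal ((1/16) ^ i)*Y i j w \<partial>M) = ennreal ((1/16) ^ i)*(\<integral>\<^sup>+w. Y i j w \<partial>M)" by (rule nn_integral_cmult) measurable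
   also have "... <= ennreal ((1/16) ^ i)*ennreal (4 ^ i*K/(real j + 1) ^ 8)"
    unfolding Y_def K_def by (intro mult_left_mono gauss_mass_concentration) simp
   also have "... = ennreal ((1/16) ^ i*(4 ^ i*K/(real j + 1) ^ 8))" by (rule ennreal_mult'[symmetric]) simp
   also have "(1/16) ^ i*(4 ^ i*K/(real j + 1) ^ 8) = K/(real j + 1) ^ 8*(1/4) ^ i"
   proof -
    have "(1/16) ^ i*4 ^ i = ((1/4) ^ i :: real)" by (simp add: power_mult_distrib[symmetric])
    then show ?thesis by (simp add: field_simps)
   qed
   finally show "(\<integral>\<^sup>+w. ennreal ((1/16) ^ i)*Y i j w \<partial>M) <= ennreal (K/(real j + 1) ^ 8*(1/4) ^ i)" .
  qed (auto intro: summableI)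
  also have "... = ennreal (\<Sum>i. K/(real j + 1) ^ 8*(1/4) ^ i)"
   using K0 by (intro suminf_ennreal2 summable_mult summable_geometric) auto
  also have "(\<Sum>i. K/(real j + 1) ^ 8*(1/4) ^ i) = K/(real j + 1) ^ 8*(1/(1 - 1/4))"
   by (subst suminf_mult) (auto simp: suminf_geometric summable_geometric)
  also have "... = K*(4/3)/(real j + 1) ^ (6 + 2)" by simp
  finally show "(\<integral>\<^sup>+w. X j w \<partial>M) <= ennreal (K*(4/3)/(real j + 1) ^ (6 + 2))" .
 qed
 then show ?thesis
 proof eventually_elim
  case (elim w)
  then obtain C where C: "C \<ge> 0" "!!j. X j w <= ennreal (C/(real j + 1) ^ 6)" by blast
  show ?case
  proof (intro exI[of _ "sqrt C"] conjI allI)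
   show "0 <= sqrt C" using C by simp
   fix i j
   let ?d = "gauss_mass (F w (base Q j) one) i - mean_mass (base Q j) i"
   have "ennreal ((1/16) ^ i*?d^2) = ennreal ((1/16) ^ i)*Y i j w"
    unfolding Y_def by (rule ennreal_mult) auto
   also have "... = (\<Sum>i\<in>{i}. ennreal ((1/16) ^ i)*Y i j w)" by simp
   also have "... <= X j w" unfolding X_def by (intro sum_le_suminf) (auto intro: summableI)
   also have "... <= ennreal (C/(real j + 1) ^ 6)" by (rule C(2))
   finally have "(1/16) ^ i*?d^2 <= C/(real j + 1) ^ 6" using C(1) by (simp add: ennreal_le_iff)
   also have "... <= C/(real j + 1) ^ 2" using C(1) by (intro divide_left_mono power_increasing) auto
   finally have "?d^2 <= 16 ^ i*(C/(real j + 1) ^ 2)" by (simp add: power_one_over field_simps)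
   also have "... = (sqrt C*4 ^ i/(real j + 1))^2"
   proof -
    have "(16::real) ^ i = 4 ^ i*4 ^ i" by (simp add: power_mult_distrib[symmetric])
    then show ?thesis using C(1) by (simp add: power_divide power_mult_distrib power2_eq_square)
   qed
   finally have "\<bar>?d\<bar> <= sqrt C*4 ^ i/(real j + 1)" using C(1) by (simp add: abs_le_square_iff[symmetric])
   then show "gauss_mass (F w (base Q j) one) i <= CU*(4 ^ i) powr (- be) + sqrt C*4 ^ i/(real j + 1)"
    using mean_mass_bound(1)[OF base_pos, of Q j i] by linarith
  qed
 qed
qed

text \<open>For levels \<open>i\<close> beyond logarithmic size in \<open>n\<close> concentration is useless; there a first moment bound with a loss of \<open>n^2\<close> suffices, since \<open>n^2\<close> is absorbed by the geometric factor.\<close>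

lemma AE_gauss_mass_crude:
 "AE w in M. \<exists>C\<ge>0. \<forall>n\<ge>1. \<forall>i. gauss_mass (F w n one) i <= C*(real n)^2*(2 powr (- be)) ^ i"
proof -
 define q where "q = 2 powr (- be)"
 have q: "0 < q" "q < 1" using beta by (auto simp: q_def powr_less_one)
 have q4: "(4 ^ i) powr (- be) = q ^ i*q ^ i" for i
 proof -
  have "(2 ^ i) powr (- be) = q ^ i"
  proof -
   have "(2 ^ i) powr (- be) = (2 powr real i) powr (- be)" by (simp add: powr_realpow)
   also have "... = q powr real i" unfolding q_def powr_powr by (simp only: mult.commute)
   finally show ?thesis using q by (simp add: powr_realpow)
  qed
  moreover have "(4::real) ^ i = 2 ^ i*2 ^ i" by (simp add: power_mult_distrib[symmetric])
  ultimately show ?thesis by (simp add: powr_mult)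
 qed
 \<comment> \<open>The weighted sum over all \<open>n\<close> and \<open>i\<close> is almost surely finite, and then each of its terms is bounded.\<close>
 define X where "X = (%j w. ennreal (1/(real j + 1) ^ 2)*(\<Sum>i. ennreal ((1/q) ^ i)*ennreal (gauss_mass (F w (j + 1) one) i)))"
 have "AE w in M. \<exists>C\<ge>0. \<forall>j. X j w <= ennreal (C/(real j + 1) ^ 0)"
 proof (rule AE_rate[where c = "CU*(1/(1 - q))"])
  show "X j \<in> bm M" for j unfolding X_def by measurable
  show "0 <= CU*(1/(1 - q))" using CU q by simp
  fix j
  have "(\<integral>\<^sup>+w. (\<Sum>i. ennreal ((1/q) ^ i)*ennreal (gauss_mass (F w (j + 1) one) i)) \<partial>M) = (\<Sum>i. \<integral>\<^sup>+w. ennreal ((1/q) ^ i)*ennreal (gauss_mass (F w (j + 1) one) i) \<partial>M)"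
   by (rule nn_integral_suminf) measurable
  also have "... <= (\<Sum>i. ennreal (CU*q ^ i))"
  proof (intro suminf_le)
   fix i
   have "(\<integral>\<^sup>+w. ennreal ((1/q) ^ i)*ennreal (gauss_mass (F w (j + 1) one) i) \<partial>M) = ennreal ((1/q) ^ i)*ennreal (mean_mass (j + 1) i)"
    by (subst nn_integral_cmult, measurable) (simp only: mean_mass_expectation)
   also have "... <= ennreal ((1/q) ^ i)*ennreal (CU*(q ^ i*q ^ i))"
    unfolding q4[symmetric] by (intro mult_left_mono ennreal_leI mean_mass_bound) auto
   also have "... = ennreal ((1/q) ^ i*(CU*(q ^ i*q ^ i)))" using q by (intro ennreal_mult'[symmetric]) simp
   also have "(1/q) ^ i*(CU*(q ^ i*q ^ i)) = CU*q ^ i" using q by (simp add: power_one_over)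
   finally show "(\<integral>\<^sup>+w. ennreal ((1/q) ^ i)*ennreal (gauss_mass (F w (j + 1) one) i) \<partial>M) <= ennreal (CU*q ^ i)" .
  qed (auto intro: summableI)
  also have "... = ennreal (\<Sum>i. CU*q ^ i)" using q CU by (intro suminf_ennreal2 summable_mult summable_geometric) auto
  also have "(\<Sum>i. CU*q ^ i) = CU*(1/(1 - q))" using q by (subst suminf_mult) (auto simp: suminf_geometric summable_geometric)
  finally have S: "(\<integral>\<^sup>+w. (\<Sum>i. ennreal ((1/q) ^ i)*ennreal (gauss_mass (F w (j + 1) one) i)) \<partial>M) <= ennreal (CU*(1/(1 - q)))" .
  have "(\<integral>\<^sup>+w. X j w \<partial>M) = ennreal (1/(real j + 1) ^ 2)*(\<integral>\<^sup>+w. (\<Sum>i. ennreal ((1/q) ^ i)*ennreal (gauss_mass (F w (j + 1) one) i)) \<partial>M)"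
   unfolding X_def by (rule nn_integral_cmult) measurable
  also have "... <= ennreal (1/(real j + 1) ^ 2)*ennreal (CU*(1/(1 - q)))" by (intro mult_left_mono S) simp
  also have "... = ennreal (CU*(1/(1 - q))/(real j + 1) ^ (0 + 2))" by (subst ennreal_mult'[symmetric]) (simp, simp add: power2_eq_square mult_ac)
  finally show "(\<integral>\<^sup>+w. X j w \<partial>M) <= ennreal (CU*(1/(1 - q))/(real j + 1) ^ (0 + 2))" .
 qed
 then show ?thesis
 proof eventually_elim
  case (elim w)
  then obtain C where C: "C \<ge> 0" "!!j. X j w <= ennreal C" by auto
  show ?case
  proof (intro exI[of _ C] conjI allI impI)
   show "0 <= C" by fact
   fix n i :: nat assume n: "1 <= n"
   define j where "j = n - 1"
   have nj: "n = j + 1" "real n = real j + 1" using n by (auto simp: j_def)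
   let ?g = "gauss_mass (F w n one) i"
   have "ennreal (1/(real n)^2*((1/q) ^ i*?g)) = ennreal (1/(real n)^2)*(ennreal ((1/q) ^ i)*ennreal ?g)"
   proof -
    have "ennreal (1/(real n)^2*((1/q) ^ i*?g)) = ennreal (1/(real n)^2)*ennreal ((1/q) ^ i*?g)"
     by (rule ennreal_mult') simp
    also have "ennreal ((1/q) ^ i*?g) = ennreal ((1/q) ^ i)*ennreal ?g" using q by (intro ennreal_mult') simp
    finally show ?thesis .
   qed
   also have "ennreal ((1/q) ^ i)*ennreal ?g = (\<Sum>i\<in>{i}. ennreal ((1/q) ^ i)*ennreal (gauss_mass (F w n one) i))" by simp
   also have "... <= (\<Sum>i. ennreal ((1/q) ^ i)*ennreal (gauss_mass (F w n one) i))" by (intro sum_le_suminf) (auto intro: summableI)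
   finally have "ennreal (1/(real n)^2*((1/q) ^ i*?g)) <= X j w"
    unfolding X_def nj(2)[symmetric] nj(1)[symmetric] by (simp add: mult_left_mono)
   also have "... <= ennreal C" by (rule C(2))
   finally have "1/(real n)^2*((1/q) ^ i*?g) <= C" using C(1) by (simp add: ennreal_le_iff)
   then show "?g <= C*(real n)^2*(2 powr (- be)) ^ i"
    using n q unfolding q_def[symmetric] by (simp add: power_one_over field_simps)
  qed
 qed
qed

end

text \<open>Up to level \<open>J\<close> the concentration bound is summed. From \<open>J\<close> to \<open>P\<close> monotonicity gives \<open>P\<close> copies of the value at \<open>J\<close>, and beyond \<open>P\<close> the crude geometric bound takes over.\<close>

lemma tail_sum_bound:
 fixes G :: "nat => real"
 assumes mono: "!!i j. i <= j ==> G j <= G i"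
  and A: "0 <= A" "0 <= A'" "0 <= D" and p: "0 < p" "p < 1"
  and a: "!!i. G i <= A*(p\<^sup>2 ^ i*p\<^sup>2 ^ i) + A'*4 ^ i"
  and b: "!!i. G i <= D*p\<^sup>2 ^ i"
  and e: "e = A*(p\<^sup>2 ^ J*p\<^sup>2 ^ J) + A'*4 ^ J" and JP: "J <= P"
 shows "(\<Sum>i. ennreal (G (i + I))) <= ennreal (A*p\<^sup>2 ^ I/(1 - p\<^sup>2) + ((real P + 1)*e + D*p ^ P/(1 - p)))"
proof -
 have q: "0 < p^2" "p^2 < 1" using p by (simp_all add: abs_square_less_1)
 have e0: "0 <= e" unfolding e using A p by simp
 define h where "h = (%i. A*p\<^sup>2 ^ I*p\<^sup>2 ^ i + ((if i <= P then e else 0) + D*p ^ P*p ^ i))"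
 have G: "G (i + I) <= h i" for i
 proof -
  let ?i = "i + I"
  have t1: "0 <= A*p\<^sup>2 ^ I*p\<^sup>2 ^ i" "0 <= D*p ^ P*p ^ i" using A p by simp_all
  consider "?i <= J" | "J < ?i" "?i <= P" | "P < ?i" by linarith
  then show ?thesis
  proof cases
   case 1
   have "p\<^sup>2 ^ ?i*p\<^sup>2 ^ ?i <= p\<^sup>2 ^ ?i*1" using p q by (intro mult_left_mono power_le_one) auto
   then have "A*(p\<^sup>2 ^ ?i*p\<^sup>2 ^ ?i) <= A*(p\<^sup>2 ^ ?i*1)" using A(1) by (rule mult_left_mono)
   then have "A*(p\<^sup>2 ^ ?i*p\<^sup>2 ^ ?i) <= A*p\<^sup>2 ^ I*p\<^sup>2 ^ i" by (simp add: power_add mult_ac)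
   moreover have "A'*4 ^ ?i <= e"
   proof -
    have "A'*4 ^ ?i <= A'*4 ^ J" using A 1 by (intro mult_left_mono power_increasing) auto
    also have "... <= e" unfolding e using A p by simp
    finally show ?thesis .
   qed
   ultimately show ?thesis using a[of ?i] t1 1 JP unfolding h_def by auto
  next
   case 2
   have "G ?i <= G J" using 2 by (intro mono) simp
   also have "... <= e" unfolding e by (rule a)
   finally show ?thesis using t1 2 unfolding h_def by auto
  next
   case 3
   have "p\<^sup>2 ^ ?i = p ^ ?i*p ^ ?i" by (simp add: power_mult_distrib power2_eq_square)
   also have "... <= p ^ P*p ^ i" using p 3 by (intro mult_mono power_decreasing) auto
   finally have "D*p\<^sup>2 ^ ?i <= D*(p ^ P*p ^ i)" using A by (intro mult_left_mono) auto
   then show ?thesis using b[of ?i] t1 e0 unfolding h_def by (auto simp: mult.assoc)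
  qed
 qed
 have s1: "(%i. A*p\<^sup>2 ^ I*p\<^sup>2 ^ i) sums (A*p\<^sup>2 ^ I*(1/(1 - p\<^sup>2)))"
  using q by (intro sums_mult geometric_sums) auto
 have s2: "(%i. if i <= P then e else 0) sums ((real P + 1)*e)"
 proof -
  have "(%i. if i \<in> {..P} then e else 0) sums (\<Sum>i\<in>{..P}. e)" by (rule sums_If_finite_set) simp
  then show ?thesis by (simp add: add.commute)
 qed
 have s3: "(%i. D*p ^ P*p ^ i) sums (D*p ^ P*(1/(1 - p)))"
  using p by (intro sums_mult geometric_sums) auto
 have S: "h sums (A*p\<^sup>2 ^ I*(1/(1 - p\<^sup>2)) + ((real P + 1)*e + D*p ^ P*(1/(1 - p))))"
  unfolding h_def by (intro sums_add s1 s2 s3)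
 have h0: "0 <= h i" for i unfolding h_def using A p e0 by (intro add_nonneg_nonneg) auto
 have "(\<Sum>i. ennreal (G (i + I))) <= (\<Sum>i. ennreal (h i))"
  by (intro suminf_le ennreal_leI G) (auto intro: summableI)
 also have "... = ennreal (\<Sum>i. h i)" using h0 sums_summable[OF S] by (intro suminf_ennreal2) auto
 also have "(\<Sum>i. h i) = A*p\<^sup>2 ^ I/(1 - p\<^sup>2) + ((real P + 1)*e + D*p ^ P/(1 - p))"
  using sums_unique[OF S] by simp
 finally show ?thesis .
qed

lemma lip_symbol_one: "lip_symbol 1 0 one"
 by (simp add: lip_symbol_def)

context gauss_spectral begin

definition qb :: real where "qb = 2 powr (- be)"

lemma qb: "0 < qb" "qb < 1"
 using beta by (auto simp: qb_def powr_less_one)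

lemma four_powr: "(4 ^ i) powr (- be) = qb ^ i*qb ^ i"
proof -
 have "(2 ^ i) powr (- be) = qb ^ i"
 proof -
  have "(2 ^ i) powr (- be) = (2 powr real i) powr (- be)" by (simp add: powr_realpow)
  also have "... = qb powr real i" unfolding qb_def powr_powr by (simp only: mult.commute)
  finally show ?thesis using qb by (simp add: powr_realpow)
 qed
 moreover have "(4::real) ^ i = 2 ^ i*2 ^ i" by (simp add: power_mult_distrib[symmetric])
 ultimately show ?thesis by (simp add: powr_mult)
qed

lemma AE_small_ball_tail:
 "AE w in M. \<exists>C\<ge>0. \<forall>I. eventually (%n. (\<Sum>i. ennreal (gauss_mass (F w n one) (i + I))) <= ennreal (C*qb ^ I)) sequentially"
 using AE_regular_energy AE_gauss_mass_blocks AE_gauss_mass_crude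
proof eventually_elim
 case (elim w)
 obtain C where C: "C \<ge> 0" "!!i j. gauss_mass (F w (base Q j) one) i <= CU*(4 ^ i) powr (- be) + C*4 ^ i/(real j + 1)"
  using elim(2) by blast
 obtain C' where C': "C' \<ge> 0" "!!n i. 1 <= n ==> gauss_mass (F w n one) i <= C'*(real n)^2*(2 powr (- be)) ^ i"
  using elim(3) by blast
 obtain T where T: "T \<ge> 0" "!!n. 1 <= n ==> (CI x. (F w n one x - F w (base Q (blk Q n)) one x)^2) <= T/(real (blk Q n) + 1)"
  using trig_field_block_L2[OF Q1 elim(1), of 1 0] lip_symbol_one by blast
 define A' where "A' = C + sqrt (2*pi*T)"
 have A'0: "0 <= A'" using C(1) T(1) by (simp add: A'_def)
 define p where "p = sqrt qb"
 have p: "0 < p" "p < 1" "p^2 = qb" using qb by (auto simp: p_def)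
 define c where "c = 2*(2*real Q + 1)/be"
 have c0: "0 < c" using beta by (simp add: c_def)
 \<comment> \<open>The remainder as a function of \<open>y = j + 1\<close>, where \<open>j\<close> is the block number; it tends to \<open>0\<close>.\<close>
 define H where "H = (%y. (c*log 2 (y + 1) + log 2 y/8 + 2)*(CU*(y powr (1/8)/2) powr (- (2*be)) + A'*(y powr (1/4)/sqrt y)) + C'/(1 - p)*(1/(y + 1)))"
 have Hlim: "(H \<longlongrightarrow> 0) at_top"
 proof -
  have 1: "((%y. (c*log 2 (y + 1) + log 2 y/8 + 2)*(y powr (1/8)/2) powr (- (2*be))) \<longlongrightarrow> 0) at_top"
   using c0 beta by real_asymp
  have 2: "((%y. (c*log 2 (y + 1) + log 2 y/8 + 2)*(y powr (1/4)/sqrt y)) \<longlongrightarrow> 0) at_top"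
   using c0 by real_asymp
  have 3: "((%y::real. 1/(y + 1)) \<longlongrightarrow> 0) at_top" by real_asymp
  have "((%y. CU*((c*log 2 (y + 1) + log 2 y/8 + 2)*(y powr (1/8)/2) powr (- (2*be))) +
    A'*((c*log 2 (y + 1) + log 2 y/8 + 2)*(y powr (1/4)/sqrt y)) + C'/(1 - p)*(1/(y + 1))) \<longlongrightarrow> CU*0 + A'*0 + C'/(1 - p)*0) at_top"
   by (intro tendsto_add tendsto_mult_left 1 2 3)
  then show ?thesis unfolding H_def by (simp add: algebra_simps)
 qed
 have ylim: "filterlim (%n. real (blk Q n) + 1) at_top sequentially"
  by (rule filterlim_compose[OF _ blk_at_top[OF Q1]]) real_asymp
 define K where "K = CU/(1 - qb) + 1"
 have K0: "0 <= K" using CU qb by (simp add: K_def)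
 show ?case
 proof (intro exI[of _ K] conjI allI K0)
  fix I
  have "eventually (%n. H (real (blk Q n) + 1) < qb ^ I) sequentially"
   using order_tendstoD(2)[OF filterlim_compose[OF Hlim ylim], of "qb ^ I"] qb by simp
  then show "eventually (%n. (\<Sum>i. ennreal (gauss_mass (F w n one) (i + I))) <= ennreal (K*qb ^ I)) sequentially"
   using eventually_ge_at_top[of 1]
  proof eventually_elim
   case (elim n)
   \<comment> \<open>\<open>2^J\<close> is about \<open>y^(1/8)\<close>, so \<open>4^J/sqrt y\<close> tends to \<open>0\<close>; and \<open>p^P <= (y + 1)^(- (2 Q + 1))\<close> beats \<open>n^2 <= (y + 1)^(2 Q)\<close>.\<close>
   define y where "y = real (blk Q n) + 1"
   have y: "1 <= y" by (simp add: y_def)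
   define J where "J = nat \<lfloor>log 2 y/8\<rfloor>"
   define P where "P = nat \<lceil>c*log 2 (y + 1)\<rceil> + J"
   have ly: "0 <= log 2 y" using y by simp
   have Jl: "real J <= log 2 y/8" "log 2 y/8 - 1 <= real J" using ly unfolding J_def by linarith+
   have "2 powr (log 2 y/8) = (2 powr (log 2 y)) powr (1/8)" by (simp add: powr_powr)
   then have y8: "2 powr (log 2 y/8) = y powr (1/8)" using y by simp
   have J1: "2 ^ J <= y powr (1/8)"
   proof -
    have "2 ^ J = 2 powr (real J)" by (simp add: powr_realpow)
    also have "... <= 2 powr (log 2 y/8)" using Jl by (intro powr_mono) auto
    finally show ?thesis unfolding y8 .
   qed
   have J2: "y powr (1/8)/2 <= 2 ^ J"
   proof -
    have "2 powr (log 2 y/8 - 1) <= 2 powr (real J)" using Jl by (intro powr_mono) auto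
    then show ?thesis by (simp add: powr_diff y8 powr_realpow)
   qed
   define e where "e = CU*(p\<^sup>2 ^ J*p\<^sup>2 ^ J) + A'/sqrt y*4 ^ J"
   let ?G = "gauss_mass (F w n one)"
   have a: "?G i <= CU*(p\<^sup>2 ^ i*p\<^sup>2 ^ i) + A'/sqrt y*4 ^ i" for i
   proof -
    let ?n' = "base Q (blk Q n)"
    have i2: "integrable circ (%x. (F w n one x - F w ?n' one x)^2)"
     by (rule trig_field_diff_L2(1)[OF base_pos blk_bounds(1)[OF Q1 elim(2)] lip_symbol_one])
    have "\<bar>?G i - gauss_mass (F w ?n' one) i\<bar> <= 2 ^ i * sqrt (2*pi*(CI x. (F w n one x - F w ?n' one x)^2))"
     by (rule gauss_mass_lipschitz[OF _ _ i2]) measurable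
    also have "... <= 4 ^ i * sqrt (2*pi*(T/y))"
     using T(2)[OF elim(2)] unfolding y_def by (intro mult_mono real_sqrt_le_mono mult_left_mono power_mono) auto
    also have "... = sqrt (2*pi*T)/sqrt y*4 ^ i" by (simp add: real_sqrt_divide[symmetric])
    finally have "?G i <= gauss_mass (F w ?n' one) i + sqrt (2*pi*T)/sqrt y*4 ^ i" by linarith
    moreover have "gauss_mass (F w ?n' one) i <= CU*(p\<^sup>2 ^ i*p\<^sup>2 ^ i) + C*4 ^ i/y"
     using C(2)[of "blk Q n" i] unfolding four_powr p(3) y_def by simp
    moreover have "C*4 ^ i/y <= C/sqrt y*4 ^ i"
    proof -
     have "sqrt y*1 <= sqrt y * sqrt y" using y by (intro mult_left_mono) auto
     then have "sqrt y <= y" using y by simp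
     then have "C/y <= C/sqrt y" using C(1) y by (intro divide_left_mono) auto
     then have "C/y*4 ^ i <= C/sqrt y*4 ^ i" by (intro mult_right_mono) auto
     then show ?thesis by simp
    qed
    moreover have "A'/sqrt y*4 ^ i = C/sqrt y*4 ^ i + sqrt (2*pi*T)/sqrt y*4 ^ i"
     by (simp add: A'_def add_divide_distrib distrib_right)
    ultimately show ?thesis by linarith
   qed
   have "(\<Sum>i. ennreal (?G (i + I))) <= ennreal (CU*p\<^sup>2 ^ I/(1 - p\<^sup>2) + ((real P + 1)*e + C'*(real n)^2*p ^ P/(1 - p)))"
   proof (rule tail_sum_bound[OF _ CU _ _ p(1,2) a _ e_def])
    show "?G j <= ?G i" if "i <= j" for i j by (rule gauss_mass_antimono[OF _ that]) measurable
    show "0 <= A'/sqrt y" "0 <= C'*(real n)^2" using A'0 C'(1) y by simp_all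
    show "?G i <= C'*(real n)^2*p\<^sup>2 ^ i" for i using C'(2)[OF elim(2), of i] unfolding p(3) qb_def .
    show "J <= P" by (simp add: P_def)
   qed
   also have "... <= ennreal (K*qb ^ I)"
   proof (rule ennreal_leI)
    have ly1: "0 <= log 2 (y + 1)" using y by simp
    have P1: "real P + 1 <= c*log 2 (y + 1) + log 2 y/8 + 2"
    proof -
     have "0 <= c*log 2 (y + 1)" using c0 ly1 by simp
     then have "real (nat \<lceil>c*log 2 (y + 1)\<rceil>) <= c*log 2 (y + 1) + 1" by linarith
     then show ?thesis using Jl unfolding P_def by simp
    qed
    have qJ: "p\<^sup>2 ^ J*p\<^sup>2 ^ J <= (y powr (1/8)/2) powr (- (2*be))"
    proof -
     have "p\<^sup>2 ^ J*p\<^sup>2 ^ J = (4 ^ J) powr (- be)" unfolding p(3) four_powr ..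
     also have "(4::real) ^ J = (2 ^ J) powr 2" by (simp add: power_mult_distrib[symmetric] power2_eq_square)
     also have "((2 ^ J) powr 2) powr (- be) = (2 ^ J :: real) powr (- (2*be))" unfolding powr_powr by (simp only: mult_minus_right)
     also have "... <= (y powr (1/8)/2) powr (- (2*be))" using J2 y beta by (intro powr_mono2') auto
     finally show ?thesis .
    qed
    have J4: "4 ^ J <= y powr (1/4)"
    proof -
     have "(4::real) ^ J = 2 ^ J*2 ^ J" by (simp add: power_mult_distrib[symmetric])
     also have "... <= y powr (1/8)*y powr (1/8)" using J1 by (intro mult_mono) auto
     also have "... = y powr (1/4)" by (simp add: powr_add[symmetric])
     finally show ?thesis .
    qed
    have eH: "e <= CU*(y powr (1/8)/2) powr (- (2*be)) + A'*(y powr (1/4)/sqrt y)"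
    proof -
     have "A'/sqrt y*4 ^ J <= A'/sqrt y*y powr (1/4)" using A'0 y J4 by (intro mult_left_mono) auto
     then show ?thesis unfolding e_def using qJ CU by (intro add_mono mult_left_mono) auto
    qed
    have e0: "0 <= e" unfolding e_def using CU A'0 p y by simp
    have t1: "(real P + 1)*e <= (c*log 2 (y + 1) + log 2 y/8 + 2)*(CU*(y powr (1/8)/2) powr (- (2*be)) + A'*(y powr (1/4)/sqrt y))"
     using P1 eH e0 c0 ly ly1 by (intro mult_mono) auto
    have nb: "real n <= (y + 1) ^ Q"
    proof -
     have "n <= base Q (blk Q n + 1)" using blk_bounds(2)[OF Q1 elim(2)] by simp
     then have "real n <= real (base Q (blk Q n + 1))" by (rule of_nat_mono)
     then show ?thesis by (simp add: base_def y_def add.commute)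
    qed
    have pP: "p ^ P <= 1/(y + 1) ^ (2*Q + 1)"
    proof -
     have "c*log 2 (y + 1) <= real P" unfolding P_def by linarith
     then have "p powr (real P) <= p powr (c*log 2 (y + 1))" using p by (intro powr_mono') auto
     note le = this
     have p2: "p = 2 powr (- be/2)" unfolding p_def qb_def by (simp add: powr_half_sqrt[symmetric] powr_powr)
     have "p powr (c*log 2 (y + 1)) = (2 powr (log 2 (y + 1))) powr (- (2*real Q + 1))"
     proof -
      have cb: "c*be = 2*(2*real Q + 1)" using beta by (simp add: c_def)
      have "- be/2*(c*l) = - (c*be)/2*l" for l by simp
      then have "- be/2*(c*l) = l * - (2*real Q + 1)" for l unfolding cb by (simp add: algebra_simps)
      then show ?thesis unfolding p2 powr_powr by simp
     qed
     also have "... = (y + 1) powr (- real (2*Q + 1))" using y by (simp add: algebra_simps)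
     also have "... = 1/(y + 1) ^ (2*Q + 1)" using y by (simp add: powr_minus powr_realpow divide_inverse del: of_nat_add of_nat_mult of_nat_Suc power_Suc)
     finally show ?thesis using p le by (simp add: powr_realpow)
    qed
    have t2: "C'*(real n)^2*p ^ P/(1 - p) <= C'/(1 - p)*(1/(y + 1))"
    proof -
     have "(real n)^2 <= ((y + 1) ^ Q)^2" using nb by (intro power_mono) auto
     then have "(real n)^2*p ^ P <= ((y + 1) ^ Q)^2*(1/(y + 1) ^ (2*Q + 1))" using pP p by (intro mult_mono) auto
     also have "... = 1/(y + 1)"
     proof -
      have "(y + 1) ^ (2*Q + 1) = ((y + 1) ^ Q)^2*(y + 1)" by (simp add: power_mult[symmetric] mult.commute)
      then show ?thesis using y by simp
     qed
     finally have "C'/(1 - p)*((real n)^2*p ^ P) <= C'/(1 - p)*(1/(y + 1))" using C'(1) p by (intro mult_left_mono) auto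
     then show ?thesis by (simp add: mult_ac)
    qed
    have "(real P + 1)*e + C'*(real n)^2*p ^ P/(1 - p) <= H y" unfolding H_def by (intro add_mono t1 t2)
    also have "... <= qb ^ I" using elim(1) unfolding y_def by simp
    finally show "CU*p\<^sup>2 ^ I/(1 - p\<^sup>2) + ((real P + 1)*e + C'*(real n)^2*p ^ P/(1 - p)) <= K*qb ^ I"
     unfolding p(3) K_def by (simp add: distrib_right)
   qed
   finally show ?case .
  qed
 qed
qed

end

section \<open>Gaussian limits in law\<close>

lemma weighted_law:
 fixes V w :: "'x => real"
 assumes N: "prob_space N" and V [measurable]: "V \<in> bm N" and w [measurable]: "w \<in> bm N"
  and w0: "!!x. 0 <= w x" "!!x. w x <= B" and m: "0 < (\<integral>x. w x \<partial>N)"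
 defines "D \<equiv> distr (density N (%x. ennreal (w x/(\<integral>x. w x \<partial>N)))) borel V"
 shows "real_distribution D"
  and "char D t = (\<integral>x. cpx (w x)*iexp (t*V x) \<partial>N)/cpx (\<integral>x. w x \<partial>N)"
  and "S \<in> sets borel ==> measure D S = (\<integral>x. w x*indicator S (V x) \<partial>N)/(\<integral>x. w x \<partial>N)"
proof -
 interpret N: prob_space N by fact
 let ?m = "\<integral>x. w x \<partial>N"
 let ?d = "%x. w x/?m"
 have wi: "integrable N w" using w0 by (intro N.integrable_const_bound[where B = B]) auto
 have d0: "0 <= ?d x" for x using w0 m by simp
 have pd: "prob_space (density N (%x. ennreal (?d x)))"
 proof (rule prob_spaceI)
  have "emeasure (density N (%x. ennreal (?d x))) (space (density N (%x. ennreal (?d x)))) = (\<integral>\<^sup>+x. ennreal (?d x) \<partial>N)"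
   by (subst emeasure_density) (auto intro!: nn_integral_cong simp: indicator_def)
  also have "... = ennreal (\<integral>x. ?d x \<partial>N)" using wi d0 by (intro nn_integral_eq_integral) auto
  also have "(\<integral>x. ?d x \<partial>N) = 1" using m by simp
  finally show "emeasure (density N (%x. ennreal (?d x))) (space (density N (%x. ennreal (?d x)))) = 1" by simp
 qed
 interpret P: prob_space "density N (%x. ennreal (?d x))" by (rule pd)
 show rd: "real_distribution D" unfolding D_def by (rule P.real_distribution_distr) simp
 have "char D t = (\<integral>x. iexp (t*V x) \<partial>density N (%x. ennreal (?d x)))"
  unfolding D_def char_def by (subst integral_distr) auto
 also have "... = (\<integral>x. ?d x *\<^sub>R iexp (t*V x) \<partial>N)" using d0 by (subst integral_density) auto
 also have "... = (\<integral>x. (cpx (w x)*iexp (t*V x))/cpx ?m \<partial>N)"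
  by (simp add: scaleR_conv_of_real)
 also have "... = (\<integral>x. cpx (w x)*iexp (t*V x) \<partial>N)/cpx ?m" by (rule integral_divide_zero)
 finally show "char D t = (\<integral>x. cpx (w x)*iexp (t*V x) \<partial>N)/cpx ?m" .
 assume S [measurable]: "S \<in> sets borel"
 interpret D: real_distribution D by (rule rd)
 have "measure D S = (\<integral>x. indicator S x \<partial>D)" by (simp add: S)
 also have "... = (\<integral>x. indicator S (V x) \<partial>density N (%x. ennreal (?d x)))" unfolding D_def by (subst integral_distr) auto
 also have "... = (\<integral>x. ?d x *\<^sub>R indicator S (V x) \<partial>N)" using d0 by (subst integral_density) auto
 also have "... = (\<integral>x. (w x*indicator S (V x))/?m \<partial>N)" by simp
 finally show "measure D S = (\<integral>x. w x*indicator S (V x) \<partial>N)/?m" by simp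
qed

text \<open>Levy continuity for the law of \<open>V\<close> under the probability with density proportional to \<open>w\<close>.\<close>

lemma levy_weighted:
 fixes Vn wn :: "nat => 'x => real" and V w :: "'y => real"
 assumes N: "prob_space N" "prob_space N'"
  and Vn: "!!n. Vn n \<in> bm N" and wn: "!!n. wn n \<in> bm N" "!!n x. 0 <= wn n x" "!!n x. wn n x <= B"
  and V: "V \<in> bm N'" and w: "w \<in> bm N'" "!!x. 0 <= w x" "!!x. w x <= B"
  and lim: "!!t. (%n. \<integral>x. cpx (wn n x)*iexp (t*Vn n x) \<partial>N) \<longlonglongrightarrow> (\<integral>y. cpx (w y)*iexp (t*V y) \<partial>N')"
  and pos: "0 < (\<integral>y. w y \<partial>N')" and V0: "AE y in N'. V y \<noteq> 0"
 shows "(%n. \<integral>x. wn n x*indicator {..0} (Vn n x) \<partial>N) \<longlonglongrightarrow> (\<integral>y. w y*indicator {..0} (V y) \<partial>N')"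
proof -
 define m where "m = (%n. \<integral>x. wn n x \<partial>N)"
 define m' where "m' = (\<integral>y. w y \<partial>N')"
 have "(%n. cpx (m n)) \<longlonglongrightarrow> cpx m'"
  using lim[of 0] by (simp add: m_def m'_def)
 then have mlim: "m \<longlonglongrightarrow> m'" by (simp only: tendsto_of_real_iff)
 have m'0: "0 < m'" using pos by (simp add: m'_def)
 have ev: "eventually (%n. 0 < m n) sequentially" using order_tendstoD(1)[OF mlim m'0] .
 define D where "D = (%n. if 0 < m n then distr (density N (%x. ennreal (wn n x/m n))) borel (Vn n) else return borel 0)"
 define D' where "D' = distr (density N' (%x. ennreal (w x/m'))) borel V"
 note LN = weighted_law[OF N(1) Vn wn]
 note L' = weighted_law[OF N(2) V w pos, folded m'_def, folded D'_def]
 have rd: "real_distribution (D n)" for n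
 proof (cases "0 < m n")
  case True then show ?thesis using LN(1)[of n n] by (simp add: D_def m_def)
 next
  case False
  interpret R: prob_space "return borel (0::real)" by (rule prob_space_return) simp
  have "real_distribution (return borel (0::real))"
   unfolding real_distribution_def real_distribution_axioms_def using R.prob_space_axioms by simp
  then show ?thesis using False by (simp add: D_def)
 qed
 have "weak_conv_m D D'"
 proof (rule levy_continuity[OF rd L'(1)])
  fix t
  have "(%n. (\<integral>x. cpx (wn n x)*iexp (t*Vn n x) \<partial>N)/cpx (m n)) \<longlonglongrightarrow> char D' t"
   unfolding L'(2) using mlim m'0 lim[of t] by (intro tendsto_divide tendsto_of_real) auto
  moreover have "eventually (%n. (\<integral>x. cpx (wn n x)*iexp (t*Vn n x) \<partial>N)/cpx (m n) = char (D n) t) sequentially"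
   using ev by eventually_elim (simp add: D_def m_def LN(2))
  ultimately show "(%n. char (D n) t) \<longlonglongrightarrow> char D' t" by (rule Lim_transform_eventually)
 qed
 moreover have "isCont (cdf D') 0"
 proof -
  interpret D': real_distribution D' by (rule L'(1))
  have "(\<integral>y. w y*indicator {0} (V y) \<partial>N') = (\<integral>y. 0 \<partial>N')"
   using V0 w V by (intro integral_cong_AE) (auto elim!: eventually_mono)
  then have "measure D' {0} = 0" by (subst L'(3)) auto
  then show ?thesis by (simp add: D'.isCont_cdf)
 qed
 ultimately have cl: "(%n. cdf (D n) 0) \<longlonglongrightarrow> cdf D' 0" by (simp add: weak_conv_m_def weak_conv_def)
 have "(%n. m n*cdf (D n) 0) \<longlonglongrightarrow> m'*cdf D' 0" by (intro tendsto_mult mlim cl)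
 moreover have "m'*cdf D' 0 = (\<integral>y. w y*indicator {..0} (V y) \<partial>N')"
  unfolding cdf_def by (subst L'(3)) (use m'0 in auto)
 moreover have "eventually (%n. m n*cdf (D n) 0 = (\<integral>x. wn n x*indicator {..0} (Vn n x) \<partial>N)) sequentially"
  using ev by eventually_elim (simp add: D_def m_def LN(3) cdf_def)
 ultimately show ?thesis using Lim_transform_eventually by force
qed

lemma integral_eq_measure:
 fixes f :: "'x => real"
 assumes "S \<in> sets N" "!!x. x \<in> space N ==> f x = indicator S x"
 shows "(\<integral>x. f x \<partial>N) = measure N S"
proof -
 have "(\<integral>x. f x \<partial>N) = (\<integral>x. indicator S x \<partial>N)" by (rule Bochner_Integration.integral_cong[OF refl assms(2)])
 then show ?thesis using sets.sets_into_space[OF assms(1)] by (simp add: Int_absorb2)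
qed

text \<open>Two-dimensional continuity from the one-dimensional theorem: the weights \<open>2 + cos(s X)\<close> and \<open>2 + sin(s X)\<close> transfer convergence to the conditional characteristic function of \<open>X\<close> given \<open>V <= 0\<close>, and a second application handles \<open>X\<close>. The shift by \<open>2\<close> keeps the weights positive.\<close>

lemma levy_quadrant:
 fixes Xn Vn :: "nat => 'x => real" and U V :: "'y => real"
 assumes N: "prob_space N" "prob_space N'"
  and Xn [measurable]: "!!n. Xn n \<in> bm N" and Vn [measurable]: "!!n. Vn n \<in> bm N"
  and U [measurable]: "U \<in> bm N'" and V [measurable]: "V \<in> bm N'"
  and lim: "!!s t. (%n. \<integral>x. iexp (s*Xn n x + t*Vn n x) \<partial>N) \<longlonglongrightarrow> (\<integral>y. iexp (s*U y + t*V y) \<partial>N')"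
  and U0: "AE y in N'. U y \<noteq> 0" and V0: "AE y in N'. V y \<noteq> 0"
  and pos: "0 < measure N' {y \<in> space N'. V y <= 0}"
 shows "(%n. measure N {x \<in> space N. Xn n x <= 0 \<and> Vn n x <= 0}) \<longlonglongrightarrow> measure N' {y \<in> space N'. U y <= 0 \<and> V y <= 0}"
proof -
 interpret N: prob_space N by fact
 interpret N': prob_space N' by (rule N(2))
 have iN: "integrable N (%x. iexp (s*Xn n x + t*Vn n x))" for s t n by (rule N.integrable_iexp) measurable
 have iN': "integrable N' (%x. iexp (s*U x + t*V x))" for s t by (rule N'.integrable_iexp) measurable
 have cosexp: "cpx (2 + cos u)*iexp v = 2*iexp v + (iexp (u + v) + iexp (- u + v))/2" for u v
  by (simp add: cos_of_real[symmetric] cos_exp_eq exp_add[symmetric] algebra_simps)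
 have sinexp: "cpx (2 + sin u)*iexp v = 2*iexp v + (iexp (u + v) - iexp (- u + v))/(2*\<i>)" for u v
  by (simp add: sin_of_real[symmetric] sin_exp_eq exp_add[symmetric] algebra_simps)
 let ?I = "%x::real. indicator {..0} x :: real"
 have bcos: "\<bar>2 + cos u\<bar> <= 3" "1 <= 2 + cos u" "0 <= 2 + cos u" "2 + cos u <= 3" for u :: real
  using cos_ge_minus_one[of u] cos_le_one[of u] by (simp_all only: abs_le_iff) linarith+
 have bsin: "\<bar>2 + sin u\<bar> <= 3" "1 <= 2 + sin u" "0 <= 2 + sin u" "2 + sin u <= 3" for u :: real
  using sin_ge_minus_one[of u] sin_le_one[of u] by (simp_all only: abs_le_iff) linarith+
 have c2: "(%n. \<integral>x. (2 + cos (s*Xn n x))*?I (Vn n x) \<partial>N) \<longlonglongrightarrow> (\<integral>y. (2 + cos (s*U y))*?I (V y) \<partial>N')" for s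
 proof (rule levy_weighted[OF N, where B = 3])
  show "0 < (\<integral>y. 2 + cos (s*U y) \<partial>N')"
  proof -
   have "(\<integral>y. 1 \<partial>N') <= (\<integral>y. 2 + cos (s*U y) \<partial>N')"
    using bcos by (intro integral_mono N'.integrable_const_bound[where B = 3]) auto
   then show ?thesis by (simp add: N'.prob_space)
  qed
  fix t
  have "(%n. 2*(\<integral>x. iexp (0*Xn n x + t*Vn n x) \<partial>N) + ((\<integral>x. iexp (s*Xn n x + t*Vn n x) \<partial>N) + (\<integral>x. iexp (- s*Xn n x + t*Vn n x) \<partial>N))/2) \<longlonglongrightarrow>
    2*(\<integral>x. iexp (0*U x + t*V x) \<partial>N') + ((\<integral>x. iexp (s*U x + t*V x) \<partial>N') + (\<integral>x. iexp (- s*U x + t*V x) \<partial>N'))/2"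
   by (intro tendsto_intros lim) auto
  then show "(%n. \<integral>x. cpx (2 + cos (s*Xn n x))*iexp (t*Vn n x) \<partial>N) \<longlonglongrightarrow> (\<integral>y. cpx (2 + cos (s*U y))*iexp (t*V y) \<partial>N')"
   unfolding cosexp using iN[of 0 _ t] iN[of s _ t] iN[of "-s" _ t] iN'[of 0 t] iN'[of s t] iN'[of "-s" t] by simp
 qed (use V0 bcos in auto)
 have s2: "(%n. \<integral>x. (2 + sin (s*Xn n x))*?I (Vn n x) \<partial>N) \<longlonglongrightarrow> (\<integral>y. (2 + sin (s*U y))*?I (V y) \<partial>N')" for s
 proof (rule levy_weighted[OF N, where B = 3])
  show "0 < (\<integral>y. 2 + sin (s*U y) \<partial>N')"
  proof -
   have "(\<integral>y. 1 \<partial>N') <= (\<integral>y. 2 + sin (s*U y) \<partial>N')"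
    using bsin by (intro integral_mono N'.integrable_const_bound[where B = 3]) auto
   then show ?thesis by (simp add: N'.prob_space)
  qed
  fix t
  have "(%n. 2*(\<integral>x. iexp (0*Xn n x + t*Vn n x) \<partial>N) + ((\<integral>x. iexp (s*Xn n x + t*Vn n x) \<partial>N) - (\<integral>x. iexp (- s*Xn n x + t*Vn n x) \<partial>N))/(2*\<i>)) \<longlonglongrightarrow>
    2*(\<integral>x. iexp (0*U x + t*V x) \<partial>N') + ((\<integral>x. iexp (s*U x + t*V x) \<partial>N') - (\<integral>x. iexp (- s*U x + t*V x) \<partial>N'))/(2*\<i>)"
   by (intro tendsto_intros lim) auto
  then show "(%n. \<integral>x. cpx (2 + sin (s*Xn n x))*iexp (t*Vn n x) \<partial>N) \<longlonglongrightarrow> (\<integral>y. cpx (2 + sin (s*U y))*iexp (t*V y) \<partial>N')"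
   unfolding sinexp using iN[of 0 _ t] iN[of s _ t] iN[of "-s" _ t] iN'[of 0 t] iN'[of s t] iN'[of "-s" t] by simp
 qed (use V0 bsin in auto)
 have Ib: "integrable N (%x. h x*?I (Vn n x))" if "h \<in> bm N" "!!x. \<bar>h x\<bar> <= 1" for h n
  using that by (intro N.integrable_const_bound[where B = 1]) (auto simp: indicator_def)
 have Ib': "integrable N' (%x. h x*?I (V x))" if "h \<in> bm N'" "!!x. \<bar>h x\<bar> <= 1" for h
  using that by (intro N'.integrable_const_bound[where B = 1]) (auto simp: indicator_def)
 have one: "(%n. \<integral>x. ?I (Vn n x) \<partial>N) \<longlonglongrightarrow> (\<integral>y. ?I (V y) \<partial>N')"
  using tendsto_divide[OF c2[of 0] tendsto_const[of 3]] by simp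
 have ibI: "integrable N (%x. ?I (Vn n x))" for n using Ib[of "%_. 1"] by simp
 have ibI': "integrable N' (%x. ?I (V x))" using Ib'[of "%_. 1"] by simp
 have c1: "(%n. \<integral>x. cos (s*Xn n x)*?I (Vn n x) \<partial>N) \<longlonglongrightarrow> (\<integral>y. cos (s*U y)*?I (V y) \<partial>N')" for s
  using tendsto_diff[OF c2[of s] tendsto_mult[OF tendsto_const[of 2] one]] Ib[of "%x. cos (s*Xn _ x)"] Ib'[of "%x. cos (s*U x)"] ibI ibI'
  by (simp add: distrib_right)
 have s1: "(%n. \<integral>x. sin (s*Xn n x)*?I (Vn n x) \<partial>N) \<longlonglongrightarrow> (\<integral>y. sin (s*U y)*?I (V y) \<partial>N')" for s
  using tendsto_diff[OF s2[of s] tendsto_mult[OF tendsto_const[of 2] one]] Ib[of "%x. sin (s*Xn _ x)"] Ib'[of "%x. sin (s*U x)"] ibI ibI'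
  by (simp add: distrib_right)
 have ex: "cpx i*iexp u = cpx (cos u*i) + \<i>*cpx (sin u*i)" for i u
  by (simp add: cis_conv_exp[symmetric] complex_eq_iff)
 have "(%n. \<integral>x. ?I (Vn n x)*indicator {..0} (Xn n x) \<partial>N) \<longlonglongrightarrow> (\<integral>y. ?I (V y)*indicator {..0} (U y) \<partial>N')"
 proof (rule levy_weighted[OF N, where B = 1])
  have "{y \<in> space N'. V y <= 0} \<in> sets N'" by measurable
  then have "(\<integral>y. ?I (V y) \<partial>N') = measure N' {y \<in> space N'. V y <= 0}"
   by (rule integral_eq_measure) (auto simp: indicator_def)
  then show "0 < (\<integral>y. ?I (V y) \<partial>N')" using pos by simp
  fix t
  have "(%n. cpx (\<integral>x. cos (t*Xn n x)*?I (Vn n x) \<partial>N) + \<i>*cpx (\<integral>x. sin (t*Xn n x)*?I (Vn n x) \<partial>N)) \<longlonglongrightarrow>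
    cpx (\<integral>y. cos (t*U y)*?I (V y) \<partial>N') + \<i>*cpx (\<integral>y. sin (t*U y)*?I (V y) \<partial>N')"
   by (intro tendsto_intros c1 s1)
  moreover have "(\<integral>x. cpx (?I (Vn n x))*iexp (t*Xn n x) \<partial>N) = cpx (\<integral>x. cos (t*Xn n x)*?I (Vn n x) \<partial>N) + \<i>*cpx (\<integral>x. sin (t*Xn n x)*?I (Vn n x) \<partial>N)" for n
   unfolding ex integral_complex_of_real[symmetric]
   by (subst Bochner_Integration.integral_add) (auto intro!: integrable_of_real integrable_mult_right Ib simp del: of_real_mult)
  moreover have "(\<integral>x. cpx (?I (V x))*iexp (t*U x) \<partial>N') = cpx (\<integral>x. cos (t*U x)*?I (V x) \<partial>N') + \<i>*cpx (\<integral>x. sin (t*U x)*?I (V x) \<partial>N')"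
   unfolding ex integral_complex_of_real[symmetric]
   by (subst Bochner_Integration.integral_add) (auto intro!: integrable_of_real integrable_mult_right Ib' simp del: of_real_mult)
  ultimately show "(%n. \<integral>x. cpx (?I (Vn n x))*iexp (t*Xn n x) \<partial>N) \<longlonglongrightarrow> (\<integral>y. cpx (?I (V y))*iexp (t*U y) \<partial>N')"
   by simp
 qed (use U0 in \<open>auto simp: indicator_def\<close>)
 moreover have "(\<integral>x. ?I (Vn n x)*indicator {..0} (Xn n x) \<partial>N) = measure N {x \<in> space N. Xn n x <= 0 \<and> Vn n x <= 0}" for n
 proof -
  have "{x \<in> space N. Xn n x <= 0 \<and> Vn n x <= 0} \<in> sets N" by measurable
  then show ?thesis by (rule integral_eq_measure) (auto simp: indicator_def)
 qed
 moreover have "(\<integral>x. ?I (V x)*indicator {..0} (U x) \<partial>N') = measure N' {x \<in> space N'. U x <= 0 \<and> V x <= 0}"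
 proof -
  have "{x \<in> space N'. U x <= 0 \<and> V x <= 0} \<in> sets N'" by measurable
  then show ?thesis by (rule integral_eq_measure) (auto simp: indicator_def)
 qed
 ultimately show ?thesis by simp
qed

definition gauss2 :: "(real \<times> real) measure" where "gauss2 = std_gauss \<Otimes>\<^sub>M std_gauss"

interpretation gg: pair_sigma_finite std_gauss std_gauss ..

lemma prob_space_gauss2: "prob_space gauss2"
proof -
 interpret pair_prob_space std_gauss std_gauss ..
 show ?thesis unfolding gauss2_def by (rule P.prob_space_axioms)
qed

lemma measurable_gauss2: "f \<in> bm (borel \<Otimes>\<^sub>M borel) ==> f \<in> bm gauss2"
 unfolding gauss2_def by (simp cong: measurable_cong_sets add: sets_pair_measure_cong[OF sets_std_gauss sets_std_gauss])

lemma char_gauss2: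
 assumes rc: "rh^2 + c^2 = 1"
 shows "(\<integral>y. iexp (s*fst y + t*(rh*fst y + c * snd y)) \<partial>gauss2) = cpx (exp (- (s^2 + t^2 + 2*rh * s*t)/2))"
proof -
 interpret P: prob_space gauss2 by (rule prob_space_gauss2)
 have i: "integrable gauss2 (%y. iexp (s*fst y + t*(rh*fst y + c * snd y)))"
  by (rule P.integrable_iexp) (rule measurable_gauss2, measurable)
 have sp: "iexp (s*x + t*(rh*x + c*y)) = iexp ((s + t*rh)*x)*iexp ((t*c)*y)" for x y :: real
  by (simp add: exp_add[symmetric] algebra_simps)
 have "(\<integral>y. iexp (s*fst y + t*(rh*fst y + c * snd y)) \<partial>gauss2) = (\<integral>x. \<integral>y. iexp (s*x + t*(rh*x + c*y)) \<partial>std_gauss \<partial>std_gauss)"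
  using gg.integral_fst'[OF i[unfolded gauss2_def]] by (simp add: gauss2_def)
 also have "... = (\<integral>x. iexp ((s + t*rh)*x)*char std_gauss (t*c) \<partial>std_gauss)"
  unfolding sp by (simp add: char_def)
 also have "... = char std_gauss (s + t*rh)*char std_gauss (t*c)"
  by (simp only: integral_mult_left_zero char_def)
 also have "... = cpx (exp (- ((s + t*rh)^2)/2 + (- ((t*c)^2)/2)))"
  unfolding char_std_gauss exp_add of_real_mult ..
 also have "- ((s + t*rh)^2)/2 + (- ((t*c)^2)/2) = - (s^2 + t^2*(rh^2 + c^2) + 2*rh * s*t)/2"
  by (simp add: power2_eq_square field_simps)
 finally show ?thesis unfolding rc by simp
qed

lemma nn_std_gauss: "f \<in> bm borel ==> (\<integral>\<^sup>+x. f x \<partial>std_gauss) = (\<integral>\<^sup>+x. ennreal (std_normal_density x)*f x \<partial>lborel)"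
 unfolding std_gauss_def by (subst nn_integral_density) auto

lemma gauss_AE_neq: "AE x in std_gauss. x \<noteq> c"
proof -
 have "AE x in lborel. x \<noteq> c" by (rule AE_lborel_singleton)
 then show ?thesis unfolding std_gauss_def by (subst AE_density) (auto elim: eventually_mono)
qed

text \<open>In polar-like coordinates \<open>w = - u t\<close> the quadrant becomes \<open>t \<le> rh/c\<close>, and integrating
 out \<open>u\<close> leaves the Cauchy density.\<close>

lemma gauss_quadrant:
 assumes c: "0 < c"
 shows "measure gauss2 {y \<in> space gauss2. fst y <= 0 \<and> rh*fst y + c * snd y <= 0} = 1/4 + arctan (rh/c)/(2*pi)"
proof -
 interpret P: prob_space gauss2 by (rule prob_space_gauss2)
 let ?S = "{y. fst y <= 0 \<and> rh*fst y + c * snd y <= 0} :: (real \<times> real) set"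
 let ?ph = std_normal_density
 have sp: "space gauss2 = UNIV" by (simp add: gauss2_def space_pair_measure)
 have S [measurable]: "?S \<in> sets (borel \<Otimes>\<^sub>M borel)"
 proof -
  have "{y \<in> space (borel \<Otimes>\<^sub>M borel). fst y <= 0 \<and> rh*fst y + c * snd y <= 0} \<in> sets (borel \<Otimes>\<^sub>M borel)" by measurable
  then show ?thesis by (simp add: space_pair_measure)
 qed
 have Sm: "?S \<in> sets gauss2" unfolding gauss2_def using S by (simp add: sets_pair_measure_cong[OF sets_std_gauss sets_std_gauss])
 have im: "(indicator ?S :: _ => ennreal) \<in> bm (std_gauss \<Otimes>\<^sub>M std_gauss)" using Sm unfolding gauss2_def by simp
 have "emeasure gauss2 ?S = (\<integral>\<^sup>+y. indicator ?S y \<partial>gauss2)" using Sm by simp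
 also have "... = (\<integral>\<^sup>+u. \<integral>\<^sup>+w. indicator ?S (u, w) \<partial>std_gauss \<partial>std_gauss)"
  unfolding gauss2_def by (rule std_gauss.nn_integral_fst[symmetric, OF im])
 also have "... = (\<integral>\<^sup>+u. ennreal (?ph u)*(\<integral>\<^sup>+w. ennreal (?ph w)*indicator ?S (u, w) \<partial>lborel) \<partial>lborel)"
 proof -
  have m: "(%w. indicator ?S (u, w) :: ennreal) \<in> bm borel" for u by measurable
  have m2: "(%u. \<integral>\<^sup>+w. ennreal (?ph w)*indicator ?S (u, w) \<partial>lborel) \<in> bm borel" by measurable
  show ?thesis by (simp only: nn_std_gauss[OF m] nn_std_gauss[OF m2])
 qed
 also have "... = (\<integral>\<^sup>+u. \<integral>\<^sup>+t. ennreal (- u*?ph u*?ph (u*t))*(indicator {..0} u*indicator {..rh/c} t) \<partial>lborel \<partial>lborel)"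
 proof (rule nn_integral_cong_AE, rule AE_mp[OF AE_lborel_singleton[of 0]], intro AE_I2 impI)
  fix u :: real assume u: "u \<noteq> 0"
  show "ennreal (?ph u)*(\<integral>\<^sup>+w. ennreal (?ph w)*indicator ?S (u, w) \<partial>lborel) =
    (\<integral>\<^sup>+t. ennreal (- u*?ph u*?ph (u*t))*(indicator {..0} u*indicator {..rh/c} t) \<partial>lborel)"
  proof (cases "u < 0")
   case False
   then show ?thesis using u by (simp add: indicator_def)
  next
   case True
   have "(\<integral>\<^sup>+w. ennreal (?ph w)*indicator ?S (u, w) \<partial>lborel) = ennreal \<bar>- u\<bar>*(\<integral>\<^sup>+t. ennreal (?ph (0 + (- u)*t))*indicator ?S (u, 0 + (- u)*t) \<partial>lborel)"
    using True by (intro nn_integral_real_affine) auto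
   also have "... = ennreal (- u)*(\<integral>\<^sup>+t. ennreal (?ph (u*t))*indicator {..rh/c} t \<partial>lborel)"
   proof -
    have "?ph (0 + (- u)*t) = ?ph (u*t)" for t by (simp add: std_normal_density_def)
    moreover have "(u, 0 + (- u)*t) \<in> ?S \<longleftrightarrow> t \<in> {..rh/c}" for t
    proof -
     have "rh*u + c*(- u*t) = - u*(c*t - rh)" by (simp add: algebra_simps)
     then have "rh*u + c*(- u*t) <= 0 \<longleftrightarrow> c*t - rh <= 0" using True by (simp add: mult_le_0_iff zero_le_mult_iff)
     also have "... \<longleftrightarrow> t <= rh/c" using c by (simp add: field_simps)
     finally show ?thesis using True by simp
    qed
    then have "indicator ?S (u, 0 + (- u)*t) = (indicator {..rh/c} t :: ennreal)" for t by (simp add: indicator_def)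
    ultimately show ?thesis using True by simp
   qed
   finally have "ennreal (?ph u)*(\<integral>\<^sup>+w. ennreal (?ph w)*indicator ?S (u, w) \<partial>lborel) =
     (ennreal (?ph u)*ennreal (- u))*(\<integral>\<^sup>+t. ennreal (?ph (u*t))*indicator {..rh/c} t \<partial>lborel)" by (simp add: mult.assoc)
   also have "... = (\<integral>\<^sup>+t. (ennreal (?ph u)*ennreal (- u))*(ennreal (?ph (u*t))*indicator {..rh/c} t) \<partial>lborel)"
    by (rule nn_integral_cmult[symmetric]) measurable
   also have "... = (\<integral>\<^sup>+t. ennreal (- u*?ph u*?ph (u*t))*(indicator {..0} u*indicator {..rh/c} t) \<partial>lborel)"
   proof (rule nn_integral_cong)
    fix t
    have "ennreal (- u*?ph u*?ph (u*t)) = ennreal (?ph u)*ennreal (- u)*ennreal (?ph (u*t))"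
    proof -
     have "- u*?ph u*?ph (u*t) = (?ph u*(- u))*?ph (u*t)" by simp
     moreover have "ennreal ((?ph u*(- u))*?ph (u*t)) = ennreal (?ph u*(- u))*ennreal (?ph (u*t))"
      by (rule ennreal_mult'') simp
     moreover have "ennreal (?ph u*(- u)) = ennreal (?ph u)*ennreal (- u)" by (rule ennreal_mult') simp
     ultimately show ?thesis by (simp only:)
    qed
    then show "(ennreal (?ph u)*ennreal (- u))*(ennreal (?ph (u*t))*indicator {..rh/c} t) = ennreal (- u*?ph u*?ph (u*t))*(indicator {..0} u*indicator {..rh/c} t)"
     using True by (simp add: mult.assoc)
   qed
   finally show ?thesis .
  qed
 qed
 also have "... = (\<integral>\<^sup>+t. \<integral>\<^sup>+u. ennreal (- u*?ph u*?ph (u*t))*(indicator {..0} u*indicator {..rh/c} t) \<partial>lborel \<partial>lborel)"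
  by (rule lborel_pair.Fubini'[symmetric]) measurable
 also have "... = (\<integral>\<^sup>+t. ennreal (1/(2*pi)/(1 + t^2))*indicator {..rh/c} t \<partial>lborel)"
 proof (rule nn_integral_cong)
  fix t :: real
  let ?k = "1 + t^2"
  have k: "0 < ?k" by (simp add: add_pos_nonneg)
  have "(\<integral>\<^sup>+u. ennreal (- u*?ph u*?ph (u*t))*(indicator {..0} u*indicator {..rh/c} t) \<partial>lborel) =
    (\<integral>\<^sup>+u. (ennreal (- u*?ph u*?ph (u*t))*indicator {..0} u)*indicator {..rh/c} t \<partial>lborel)" by (simp add: mult.assoc)
  also have "... = (\<integral>\<^sup>+u. ennreal (- u*?ph u*?ph (u*t))*indicator {..0} u \<partial>lborel)*indicator {..rh/c} t"
   by (rule nn_integral_multc) measurable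
  also have "(\<integral>\<^sup>+u. ennreal (- u*?ph u*?ph (u*t))*indicator {..0} u \<partial>lborel) =
    ennreal \<bar>-1\<bar>*(\<integral>\<^sup>+u. ennreal (- (0 + (-1)*u)*?ph (0 + (-1)*u)*?ph ((0 + (-1)*u)*t))*indicator {..0} (0 + (-1)*u) \<partial>lborel)"
   by (rule nn_integral_real_affine) auto
  also have "... = (\<integral>\<^sup>+u. ennreal (u*(1/(2*pi))*exp (- (u^2*?k/2)))*indicator {0..} u \<partial>lborel)"
  proof -
   have "- (0 + (-1)*u)*?ph (0 + (-1)*u)*?ph ((0 + (-1)*u)*t) = u*(1/(2*pi))*exp (- (u^2*?k/2))" for u
   proof -
    have "?ph u*?ph (u*t) = 1/(2*pi)*(exp (- u\<^sup>2/2)*exp (- (u*t)\<^sup>2/2))"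
     by (simp add: std_normal_density_def)
    also have "exp (- u\<^sup>2/2)*exp (- (u*t)\<^sup>2/2) = exp (- (u^2*?k/2))"
     by (simp add: exp_add[symmetric] power_mult_distrib field_simps)
    finally have "u*(?ph u*?ph (u*t)) = u*(1/(2*pi))*exp (- (u^2*?k/2))" by simp
    then show ?thesis by (simp add: std_normal_density_def)
   qed
   moreover have "indicator {..0} (0 + (-1)*u) = (indicator {0..} u :: ennreal)" for u :: real by (simp add: indicator_def)
   ultimately show ?thesis by simp
  qed
  also have "... = ennreal (0 - (- (1/(2*pi)/?k)*exp (- (0^2*?k/2))))"
  proof (rule nn_integral_FTC_atLeast)
   show "((%u. - (1/(2*pi)/?k)*exp (- (u^2*?k/2))) has_real_derivative x*(1/(2*pi))*exp (- (x^2*?k/2))) (at x)" for x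
   proof -
    have "((%u. - (1/(2*pi)/k)*exp (- (u^2*k/2))) has_real_derivative x*(1/(2*pi))*exp (- (x^2*k/2))) (at x)" if "0 < k" for k :: real
     using that by (auto intro!: derivative_eq_intros simp: field_simps)
    from this[OF k] show ?thesis .
   qed
   have "((%u. - (1/(2*pi)/k)*exp (- (u^2*k/2))) \<longlongrightarrow> 0) at_top" if "0 < k" for k :: real
    using that by real_asymp
   from this[OF k] show "((%u. - (1/(2*pi)/?k)*exp (- (u^2*?k/2))) \<longlongrightarrow> 0) at_top" .
  qed auto
  finally show "(\<integral>\<^sup>+u. ennreal (- u*?ph u*?ph (u*t))*(indicator {..0} u*indicator {..rh/c} t) \<partial>lborel) = ennreal (1/(2*pi)/?k)*indicator {..rh/c} t"
   by simp
 qed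
 also have "... = ennreal \<bar>-1\<bar>*(\<integral>\<^sup>+t. ennreal (1/(2*pi)/(1 + (0 + (-1)*t)^2))*indicator {..rh/c} (0 + (-1)*t) \<partial>lborel)"
  by (rule nn_integral_real_affine) auto
 also have "... = (\<integral>\<^sup>+t. ennreal (1/(2*pi)/(1 + t^2))*indicator {- (rh/c)..} t \<partial>lborel)"
 proof -
  have "indicator {..rh/c} (0 + (-1)*t) = (indicator {- (rh/c)..} t :: ennreal)" for t :: real by (auto simp: indicator_def)
  then show ?thesis by simp
 qed
 also have "... = ennreal (1/4 - arctan (- (rh/c))/(2*pi))"
 proof (rule nn_integral_FTC_atLeast)
  show "((%t. arctan t/(2*pi)) has_real_derivative 1/(2*pi)/(1 + x^2)) (at x)" for x
  proof -
   have "inverse (1 + x^2)/(2*pi) = 1/(2*pi)/(1 + x^2)"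
    by (simp only: divide_inverse mult_1 mult.commute[of "inverse (2*pi)"])
   then show ?thesis using DERIV_cdivide[OF DERIV_arctan[of x], of "2*pi"] by (simp only:)
  qed
  show "((%t. arctan t/(2*pi)) \<longlongrightarrow> 1/4) at_top" by real_asymp
 qed (auto simp: add_nonneg_nonneg)
 finally have E: "emeasure gauss2 ?S = ennreal (1/4 + arctan (rh/c)/(2*pi))" by (simp add: arctan_minus)
 have "0 <= 1/4 + arctan (rh/c)/(2*pi)" using arctan_lbound[of "rh/c"] pi_gt_zero by (simp add: field_simps)
 then show ?thesis using E by (simp add: sp measure_def)
qed

text \<open>With \<open>rh = sin ep/ep = 1 - ep^2/6 + ...\<close> the angle \<open>pi/2 - arctan(rh/sqrt(1 - rh^2)) = arccos rh\<close> is asymptotic to \<open>ep/sqrt 3\<close>.\<close>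

lemma sinc_asymptotics:
 "((%ep. 2*pi/ep*(1/2 - arctan ((sin ep/ep)/sqrt (1 - (sin ep/ep)\<^sup>2))/pi)) \<longlongrightarrow> 2/sqrt 3) (at_right 0)"
 by (real_asymp, simp add: powr_half_sqrt real_sqrt_divide)

section \<open>Counting zeros through windows\<close>

text \<open>The symbol of the \<open>p\<close>-th derivative divided by \<open>n^p\<close>.\<close>

definition dsym :: "nat => real => complex" where
 "dsym p t = (\<i>*cpx t) ^ p"

lemma trig_field_deriv:
 assumes n: "1 <= n"
 shows "((trig_field al be n tt) has_real_derivative real n*trig_field al be n (%t. \<i>*cpx t*tt t) x) (at x)"
proof -
 have w: "wave n tt y k = (tt (real k/real n)/cpx (sqrt (real n)))*cis (real k*y)" for y k by (simp add: wave_def)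
 have d: "((%y. Re (wave n tt y k)*al k + Im (wave n tt y k)*be k) has_real_derivative
   real n*(Re (wave n (%t. \<i>*cpx t*tt t) x k)*al k + Im (wave n (%t. \<i>*cpx t*tt t) x k)*be k)) (at x)" for k
 proof -
  define c where "c = tt (real k/real n)/cpx (sqrt (real n))"
  have w': "wave n (%t. \<i>*cpx t*tt t) x k = cpx (real k/real n)*(\<i>*(c*cis (real k*x)))"
   by (simp add: wave_def c_def field_simps)
  have "((%y. (Re c*cos (real k*y) - Im c * sin (real k*y))*al k + (Re c * sin (real k*y) + Im c*cos (real k*y))*be k) has_real_derivative
    (real k*(- Re c * sin (real k*x) - Im c*cos (real k*x))*al k + real k*(Re c*cos (real k*x) - Im c * sin (real k*x))*be k)) (at x)"
   by (auto intro!: derivative_eq_intros simp: algebra_simps)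
  moreover have "real n*(Re (wave n (%t. \<i>*cpx t*tt t) x k)*al k + Im (wave n (%t. \<i>*cpx t*tt t) x k)*be k) =
    real k*(- Re c * sin (real k*x) - Im c*cos (real k*x))*al k + real k*(Re c*cos (real k*x) - Im c * sin (real k*x))*be k"
  proof -
   have "real n*(real k/real n) = real k" using n by simp
   then have nk: "real n*(real k/real n*p*u + real k/real n*q * v) = real k*p*u + real k*q * v" for p q u v
    by (simp only: distrib_left mult.assoc[symmetric])
   have R: "Re (cpx s*w) = s*Re w" "Im (cpx s*w) = s*Im w" for s w by simp_all
   show ?thesis unfolding w' R nk by simp
  qed
  ultimately show ?thesis unfolding w c_def[symmetric] by simp
 qed
 have "((%y. \<Sum>k=1..n. Re (wave n tt y k)*al k + Im (wave n tt y k)*be k) has_real_derivative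
   (\<Sum>k=1..n. real n*(Re (wave n (%t. \<i>*cpx t*tt t) x k)*al k + Im (wave n (%t. \<i>*cpx t*tt t) x k)*be k))) (at x)"
  by (intro DERIV_sum d)
 then show ?thesis unfolding trig_field_def[abs_def] pairing_def sum_distrib_left .
qed

lemma dsym_Suc: "(%t. \<i>*cpx t*dsym p t) = dsym (Suc p)"
 by (simp add: dsym_def[abs_def])

lemma trig_field_shift:
 assumes n: "1 <= n"
 shows "trig_field al be n tt (x + v) = trig_field al be n (%t. tt t*cis (real n * v * t)) x"
proof -
 have "wave n tt (x + v) k = wave n (%t. tt t*cis (real n * v * t)) x k" for k
 proof -
  have "real n * v * (real k/real n) = real k * v" using n by simp
  then have "cis (real k*(x + v)) = cis (real n * v * (real k/real n))*cis (real k*x)"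
   by (simp add: cis_mult algebra_simps)
  then show ?thesis by (simp add: wave_def)
 qed
 then show ?thesis by (simp add: trig_field_def pairing_def)
qed

lemma rolle_count:
 fixes f f' :: "real => real"
 assumes d: "!!y. (f has_real_derivative f' y) (at y)"
 shows "finite Z ==> card Z = Suc p ==> (!!z. z \<in> Z ==> f z = 0) ==>
  \<exists>Z'. finite Z' \<and> card Z' = p \<and> Z' \<subseteq> {Min Z<..<Max Z} \<and> (\<forall>z\<in>Z'. f' z = 0)"
proof (induction p arbitrary: Z)
 case 0
 then show ?case by (intro exI[of _ "{}"]) auto
next
 case (Suc p)
 define m where "m = Max Z"
 define Z1 where "Z1 = Z - {m}"
 have Zne: "Z \<noteq> {}" using Suc.prems by auto
 have mZ: "m \<in> Z" unfolding m_def using Suc.prems(1) Zne by (rule Max_in)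
 have Z1: "finite Z1" "card Z1 = Suc p" using Suc.prems mZ by (auto simp: Z1_def)
 have Z1ne: "Z1 \<noteq> {}" using Z1 by auto
 obtain Z' where Z': "finite Z'" "card Z' = p" "Z' \<subseteq> {Min Z1<..<Max Z1}" "\<forall>z\<in>Z'. f' z = 0"
  using Suc.IH[OF Z1] Suc.prems(3) by (auto simp: Z1_def)
 have m1: "Max Z1 \<in> Z1" using Z1(1) Z1ne by (rule Max_in)
 have lt: "Max Z1 < m" using m1 Max_ge[OF Suc.prems(1), of "Max Z1"] by (auto simp: Z1_def m_def)
 have f0: "f (Max Z1) = 0" "f m = 0" using m1 mZ Suc.prems(3) by (auto simp: Z1_def)
 obtain z where z1: "Max Z1 < z" "z < m" "f m - f (Max Z1) = (m - Max Z1)*f' z"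
  using MVT2[OF lt, of f f'] d by blast
 have "f' z = 0" using z1(3) f0 lt by simp
 note z = z1(1,2) this
 have mn: "Min Z <= Min Z1" using Z1ne Suc.prems(1) by (intro Min_antimono) (auto simp: Z1_def)
 show ?case
 proof (intro exI[of _ "insert z Z'"] conjI)
  show "card (insert z Z') = Suc p" using Z' z by (subst card_insert_disjoint) auto
  have "Min Z1 <= Max Z1" using Z1(1) m1 by (rule Min_le)
  then show "insert z Z' \<subseteq> {Min Z<..<Max Z}" using Z'(3) z mn lt unfolding m_def[symmetric] by auto
 qed (use Z' z in auto)
qed

definition mean_abs :: "(real => real) => real => real => real" where
 "mean_abs g x h = (\<integral>u. \<bar>g (x + h*u)\<bar> \<partial>unit_interval)"

lemma unit_integrable:
 fixes g :: "real => real"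
 assumes "continuous_on UNIV g"
 shows "integrable unit_interval g"
proof -
 have "set_integrable lborel {0..1} g"
  using assms by (intro borel_integrable_atLeastAtMost') (auto intro: continuous_on_subset)
 then show ?thesis unfolding unit_interval_def set_integrable_def
  by (subst integrable_restrict_space) auto
qed

lemma mean_abs_le:
 assumes "continuous_on UNIV g" "!!y. x <= y ==> y <= x + h ==> \<bar>g y\<bar> <= C" "0 <= h"
 shows "mean_abs g x h <= C"
proof -
 have "mean_abs g x h <= (\<integral>u. C \<partial>unit_interval)"
  unfolding mean_abs_def
 proof (rule integral_mono)
  show "integrable unit_interval (%u. \<bar>g (x + h*u)\<bar>)"
   by (intro unit_integrable continuous_intros continuous_on_compose2[OF assms(1)]) auto
  fix u assume "u \<in> space unit_interval"
  then show "\<bar>g (x + h*u)\<bar> <= C" using assms(3) by (intro assms(2)) (auto simp: space_unit_interval mult_left_le)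
 qed auto
 then show ?thesis using unit_interval.prob_space by simp
qed

lemma ftc_mean_abs:
 assumes d: "!!y. (f has_real_derivative c*g y) (at y)" and g: "continuous_on UNIV g" and c: "0 <= c" and h: "0 < h"
  and z: "x <= z" "z <= x + h" "f z = 0" and y: "x <= y" "y <= x + h"
 shows "\<bar>f y\<bar> <= (c*h)*mean_abs g x h"
proof -
 have gi: "set_integrable lborel {s..t} g" for s t
  using g by (intro borel_integrable_atLeastAtMost') (auto intro: continuous_on_subset)
 have gi': "set_integrable lborel {s..t} (%u. \<bar>g u\<bar>)" for s t
  using g by (intro borel_integrable_atLeastAtMost' continuous_intros) (auto intro: continuous_on_subset)
 have key: "\<bar>f t - f s\<bar> <= c*(LBINT u:{x..x+h}. \<bar>g u\<bar>)" if st: "s <= t" "x <= s" "t <= x + h" for s t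
 proof -
  have "(\<integral>u. indicator {s..t} u *\<^sub>R (c*g u) \<partial>lborel) = f t - f s"
   by (rule integral_FTC_Icc[OF st(1)])
    (auto intro!: has_vector_derivative_at_within d[unfolded has_real_derivative_iff_has_vector_derivative] continuous_intros continuous_on_subset[OF g])
  then have "f t - f s = (LBINT u:{s..t}. c*g u)" by (simp only: set_lebesgue_integral_def)
  also have "... = c*(LBINT u:{s..t}. g u)"
  proof -
   have e: "(%u. indicator {s..t} u *\<^sub>R (c*g u)) = (%u. c*(indicator {s..t} u *\<^sub>R g u))" by (simp add: fun_eq_iff)
   show ?thesis unfolding set_lebesgue_integral_def e by (rule integral_mult_right_zero)
  qed
  finally have "\<bar>f t - f s\<bar> = c*\<bar>LBINT u:{s..t}. g u\<bar>" using c by (simp add: abs_mult)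
  also have "\<bar>LBINT u:{s..t}. g u\<bar> <= (LBINT u:{s..t}. \<bar>g u\<bar>)"
   using set_integral_norm_bound[OF gi[of s t]] by simp
  also have "... <= (LBINT u:{x..x+h}. \<bar>g u\<bar>)"
   unfolding set_lebesgue_integral_def
   using gi'[of s t] gi'[of x "x+h"] st unfolding set_integrable_def by (intro integral_mono) (auto simp: indicator_def)
  finally show ?thesis using c by (simp add: mult_left_mono)
 qed
 have "(LBINT u:{x..x+h}. \<bar>g u\<bar>) = h*mean_abs g x h"
 proof -
  have "(LBINT u:{x..x+h}. \<bar>g u\<bar>) = (\<integral>u. indicator {x..x+h} u*\<bar>g u\<bar> \<partial>lborel)" by (simp add: set_lebesgue_integral_def)
  also have "... = \<bar>h\<bar> *\<^sub>R (\<integral>u. indicator {x..x+h} (x + h*u)*\<bar>g (x + h*u)\<bar> \<partial>lborel)"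
   using h by (intro lborel_integral_real_affine) simp
  also have "(%u. indicator {x..x+h} (x + h*u)*\<bar>g (x + h*u)\<bar>) = (%u. indicator {0..1} u *\<^sub>R \<bar>g (x + h*u)\<bar>)"
  proof
   fix u
   have "x + h*u <= x + h \<longleftrightarrow> u <= 1" using h by (simp add: mult_le_cancel_left1)
   moreover have "0 <= h*u \<longleftrightarrow> 0 <= u" using h by (simp add: zero_le_mult_iff)
   ultimately show "indicator {x..x+h} (x + h*u)*\<bar>g (x + h*u)\<bar> = indicator {0..1} u *\<^sub>R \<bar>g (x + h*u)\<bar>"
    by (simp add: indicator_def)
  qed
  also have "(\<integral>u. indicator {0..1} u *\<^sub>R \<bar>g (x + h*u)\<bar> \<partial>lborel) = mean_abs g x h"
   unfolding mean_abs_def unit_interval_def by (subst integral_restrict_space) auto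
  finally show ?thesis using h by simp
 qed
 moreover have "\<bar>f y\<bar> <= c*(LBINT u:{x..x+h}. \<bar>g u\<bar>)"
 proof (cases "z <= y")
  case True then show ?thesis using key[of z y] z y by simp
 next
  case False then show ?thesis using key[of y z] z y by simp
 qed
 ultimately show ?thesis by simp
qed

text \<open>Rolle passes from \<open>p + 1\<close> zeros of a function to \<open>p\<close> of its derivative, and each integration over the window from a zero gains a factor \<open>c h\<close>.\<close>

lemma many_zeros_small:
 assumes d: "!!p y. (g p has_real_derivative c*g (Suc p) y) (at y)" and c: "0 <= c" and h: "0 < h"
  and Z: "finite Z" "Suc p <= card Z" "Z \<subseteq> {x<..<x+h}" "!!z. z \<in> Z ==> g q z = 0" and y: "x <= y" "y <= x + h"
 shows "\<bar>g q y\<bar> <= (c*h) ^ Suc p*mean_abs (g (q + Suc p)) x h"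
 using Z y
proof (induction p arbitrary: q Z y)
 case 0
 then obtain z where z: "z \<in> Z" by (metis card.empty ex_in_conv not_less_eq_eq le0)
 have g: "continuous_on UNIV (g r)" for r using DERIV_continuous[OF d] by (simp add: continuous_on_eq_continuous_within)
 have "x < z" "z < x + h" using z 0 by auto
 then show ?case using ftc_mean_abs[OF d g c h, of x z q y] 0 z by simp
next
 case (Suc p)
 have g: "continuous_on UNIV (g r)" for r using DERIV_continuous[OF d] by (simp add: continuous_on_eq_continuous_within)
 obtain Z1 where Z1: "Z1 \<subseteq> Z" "card Z1 = Suc (Suc p)" "finite Z1"
  using Suc.prems(2) by (rule obtain_subset_with_card_n) auto
 show ?case
 proof (cases "c = 0")
  case True
  obtain z where z: "z \<in> Z" using Z1 by (metis card.empty ex_in_conv nat.distinct(1) subset_empty equals0I)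
  have "x < z" "z < x + h" using z Suc.prems by auto
  then have "\<bar>g q y\<bar> <= (c*h)*mean_abs (g (Suc q)) x h" using ftc_mean_abs[OF d g c h, of x z q y] Suc.prems z by simp
  then show ?thesis using True by simp
 next
  case False
  have "\<exists>Z'. finite Z' \<and> card Z' = Suc p \<and> Z' \<subseteq> {Min Z1<..<Max Z1} \<and> (\<forall>z\<in>Z'. c*g (Suc q) z = 0)"
   using Z1 Suc.prems(4) by (intro rolle_count[OF d]) auto
  then obtain Z' where Z': "finite Z'" "card Z' = Suc p" "Z' \<subseteq> {Min Z1<..<Max Z1}" "!!z. z \<in> Z' ==> g (Suc q) z = 0"
   using False by auto
  have Zne: "Z1 \<noteq> {}" using Z1 by auto
  have "Min Z1 \<in> Z1" "Max Z1 \<in> Z1" using Z1 Zne by auto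
  then have sub: "Z' \<subseteq> {x<..<x+h}" using Z'(3) Z1(1) Suc.prems(3) by force
  have IH: "\<bar>g (Suc q) t\<bar> <= (c*h) ^ Suc p*mean_abs (g (Suc q + Suc p)) x h" if "x <= t" "t <= x + h" for t
   using Z' sub that by (intro Suc.IH) auto
  obtain z where z: "z \<in> Z" using Zne Z1(1) by blast
  have "x < z" "z < x + h" using z Suc.prems by auto
  then have "\<bar>g q y\<bar> <= (c*h)*mean_abs (g (Suc q)) x h" using ftc_mean_abs[OF d g c h, of x z q y] Suc.prems z by simp
  also have "... <= (c*h)*((c*h) ^ Suc p*mean_abs (g (Suc q + Suc p)) x h)"
   using c h IH by (intro mult_left_mono mean_abs_le[OF g]) auto
  finally show ?thesis by simp
 qed
qed

text \<open>A zero inside the window with equal signs at its ends forces a critical point inside the window, so the value at the end is of second order although only one zero is known.\<close>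

lemma even_zero_small:
 assumes d: "!!p y. (g p has_real_derivative c*g (Suc p) y) (at y)" and c: "0 < c" and h: "0 < h"
  and z: "x < z" "z < x + h" "g 0 z = 0" and s: "0 < g 0 x*g 0 (x + h)"
 shows "\<bar>g 0 x\<bar> <= (c*h)^2*mean_abs (g 2) x h"
proof -
 have g: "continuous_on UNIV (g r)" for r using DERIV_continuous[OF d] by (simp add: continuous_on_eq_continuous_within)
 obtain t1 where t1: "x < t1" "t1 < z" "g 0 z - g 0 x = (z - x)*(c*g 1 t1)"
  using MVT2[OF z(1), of "g 0" "%y. c*g 1 y"] d[of 0] by auto
 obtain t2 where t2: "z < t2" "t2 < x + h" "g 0 (x + h) - g 0 z = (x + h - z)*(c*g 1 t2)"
  using MVT2[OF z(2), of "g 0" "%y. c*g 1 y"] d[of 0] by auto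
 have p1: "0 < (z - x)*c" and p2: "0 < (x + h - z)*c" using z(1,2) c by simp_all
 have "\<exists>w. t1 <= w \<and> w <= t2 \<and> g 1 w = 0"
 proof (cases "0 < g 0 x")
  case True
  then have "0 < g 0 (x + h)" using s by (simp add: zero_less_mult_iff)
  have "((z - x)*c)*g 1 t1 < 0" using t1(3) z(3) True by simp
  then have 1: "g 1 t1 <= 0" using mult_nonneg_nonneg[OF less_imp_le[OF p1], of "g 1 t1"] by linarith
  have "0 < ((x + h - z)*c)*g 1 t2" using t2(3) z(3) \<open>0 < g 0 (x + h)\<close> by simp
  then have 2: "0 <= g 1 t2" using zero_less_mult_pos[OF _ p2] less_imp_le by blast
  show ?thesis using IVT'[of "g 1" t1 0 t2, OF 1 2] t1 t2 continuous_on_subset[OF g] by auto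
 next
  case False
  then have n: "g 0 x < 0" "g 0 (x + h) < 0" using s by (auto simp: zero_less_mult_iff)
  have "0 < ((z - x)*c)*g 1 t1" using t1(3) z(3) n by simp
  then have 1: "0 <= g 1 t1" using zero_less_mult_pos[OF _ p1] less_imp_le by blast
  have "((x + h - z)*c)*g 1 t2 < 0" using t2(3) z(3) n by simp
  then have 2: "g 1 t2 <= 0" using mult_nonneg_nonneg[OF less_imp_le[OF p2], of "g 1 t2"] by linarith
  show ?thesis using IVT2'[of "g 1" t2 0 t1, OF 2 1] t1 t2 continuous_on_subset[OF g] by auto
 qed
 then obtain w where w0: "t1 <= w" "w <= t2" "g 1 w = 0" by blast
 have w: "x <= w" "w <= x + h" "g 1 w = 0" using w0 t1(1) t2(2) by auto
 have d1: "(g 1 has_real_derivative c*g 2 y) (at y)" for y using d[of 1 y] by (simp add: numeral_2_eq_2)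
 have 1: "\<bar>g 1 y\<bar> <= (c*h)*mean_abs (g 2) x h" if "x <= y" "y <= x + h" for y
  using ftc_mean_abs[OF d1 g _ h w that] c by simp
 have "\<bar>g 0 x\<bar> <= (c*h)*mean_abs (g 1) x h"
  using ftc_mean_abs[OF d[of 0] g _ h, of x z x] z c h by simp
 also have "... <= (c*h)*((c*h)*mean_abs (g 2) x h)"
  using c h 1 by (intro mult_left_mono mean_abs_le[OF g]) auto
 finally show ?thesis by (simp add: power2_eq_square)
qed

text \<open>Averaging over the left endpoint \<open>x\<close> turns the number of zeros into the mean number of
 zeros in a window \<open>(x, x+h)\<close>.\<close>

lemma window_average:
 assumes h: "0 < h" "h <= 1" and Z: "finite Z" "Z \<subseteq> {0..<2*pi}"
 shows "ennreal (h*real (card Z)) <= (CN x. ennreal (real (card ((Z \<union> (%t. t + 2*pi) ` Z) \<inter> {x<..<x+h}))))"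
proof -
 let ?J = "%t. {t-h<..<t}"
 have hp: "h < 2*pi" using h pi_gt3 by linarith
 have "ennreal h <= (CN x. indicator (?J t) x + indicator (?J (t + 2*pi)) x)" if t: "t \<in> Z" for t
 proof -
  have t2: "0 <= t" "t < 2*pi" using t Z by auto
  have m: "?J s \<inter> {0..2*pi} \<in> sets lborel" for s by simp
  have Jm: "(indicator (?J s) :: real => ennreal) \<in> bm circ" for s by (rule measurable_circ) measurable
  have e: "(CN x. indicator (?J s) x) = emeasure lborel (?J s \<inter> {0..2*pi})" for s
   unfolding nn_integral_circ by (subst nn_integral_indicator[OF m, symmetric], intro nn_integral_cong) (auto simp: indicator_def)
  have "(CN x. indicator (?J t) x + indicator (?J (t + 2*pi)) x) = emeasure lborel (?J t \<inter> {0..2*pi}) + emeasure lborel (?J (t + 2*pi) \<inter> {0..2*pi})"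
   using Jm by (subst nn_integral_add) (simp_all only: e)
  moreover have "ennreal h <= emeasure lborel (?J t \<inter> {0..2*pi}) + emeasure lborel (?J (t + 2*pi) \<inter> {0..2*pi})"
  proof (cases "h <= t")
   case True
   then have "?J t \<inter> {0..2*pi} = {t-h<..<t}" using t2 by auto
   then show ?thesis using h by (simp add: add_increasing2)
  next
   case False
   have "{0<..<t} \<subseteq> ?J t \<inter> {0..2*pi}" using False t2 by auto
   then have 1: "ennreal t <= emeasure lborel (?J t \<inter> {0..2*pi})" using emeasure_mono[OF _ sets.Int, of "{0<..<t}" "?J t" "{0..2*pi}" lborel] t2 by simp
   have "{t + 2*pi - h<..<2*pi} \<subseteq> ?J (t + 2*pi) \<inter> {0..2*pi}" using False t2 hp by auto
   then have 2: "ennreal (h - t) <= emeasure lborel (?J (t + 2*pi) \<inter> {0..2*pi})"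
    using emeasure_mono[OF _ sets.Int, of "{t + 2*pi - h<..<2*pi}" "?J (t + 2*pi)" "{0..2*pi}" lborel] False by simp
   have "ennreal h = ennreal t + ennreal (h - t)" using False t2 by (subst ennreal_plus[symmetric]) auto
   then show ?thesis using add_mono[OF 1 2] by simp
  qed
  ultimately show ?thesis by simp
 qed
 then have "(\<Sum>t\<in>Z. ennreal h) <= (\<Sum>t\<in>Z. (CN x. indicator (?J t) x + indicator (?J (t + 2*pi)) x))" by (rule sum_mono)
 also have "... = (CN x. (\<Sum>t\<in>Z. indicator (?J t) x + indicator (?J (t + 2*pi)) x))"
 proof (rule nn_integral_sum[symmetric])
  fix t
  show "(%x. indicator (?J t) x + indicator (?J (t + 2*pi)) x :: ennreal) \<in> bm circ" by (rule measurable_circ) measurable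
 qed
 also have "... = (CN x. ennreal (real (card ((Z \<union> (%t. t + 2*pi) ` Z) \<inter> {x<..<x+h}))))"
 proof (rule nn_integral_cong)
  fix x
  let ?Z' = "(%t. t + 2*pi) ` Z"
  have disj: "Z \<inter> ?Z' = {}"
  proof -
   have "t + 2*pi \<notin> Z" if "t \<in> Z" for t using subsetD[OF Z(2) that] subsetD[OF Z(2), of "t + 2*pi"] by auto
   then show ?thesis by auto
  qed
  have ind: "indicator (?J t) x = (if t \<in> {x<..<x+h} then 1 else 0 :: ennreal)" for t by (auto simp: indicator_def)
  have "(\<Sum>t\<in>Z. indicator (?J t) x + indicator (?J (t + 2*pi)) x) = (\<Sum>t\<in>Z. indicator (?J t) x) + (\<Sum>t\<in>?Z'. indicator (?J t) x :: ennreal)"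
   by (simp add: sum.distrib sum.reindex inj_on_def)
  also have "... = (\<Sum>t\<in>Z \<union> ?Z'. indicator (?J t) x)" using Z disj by (intro sum.union_disjoint[symmetric]) auto
  also have "... = (\<Sum>t\<in>(Z \<union> ?Z') \<inter> {x<..<x+h}. 1)" unfolding ind using Z by (subst sum.inter_restrict) auto
  finally show "(\<Sum>t\<in>Z. indicator (?J t) x + indicator (?J (t + 2*pi)) x) = ennreal (real (card ((Z \<union> ?Z') \<inter> {x<..<x+h})))"
   by (simp add: ennreal_of_nat_eq_real_of_nat)
 qed
 finally show ?thesis using h by (simp add: ennreal_of_nat_eq_real_of_nat ennreal_mult mult.commute)
qed

text \<open>The number \<open>N\<close> of zeros in a window is at most \<open>p0 + (N - p0)\<close>, and \<open>N - p0\<close> is at most the number of events \<open>E p\<close> with \<open>p > p0\<close> that occur. A single zero without a sign change falls under \<open>E 2\<close>.\<close>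

lemma zeros_upper:
 assumes d: "!!p y. (g p has_real_derivative c*g (Suc p) y) (at y)" and c: "0 < c" and h: "0 < h" "h <= 1"
  and per: "!!x. g 0 (x + 2*pi) = g 0 x"
  and Z: "finite Z" "Z \<subseteq> {0..<2*pi}" "!!z. z \<in> Z ==> g 0 z = 0" and p0: "1 <= p0"
  and mm: "!!p. (%x. mean_abs (g p) x h) \<in> bm borel"
 defines "E \<equiv> %p. {x \<in> space circ. \<bar>g 0 x\<bar> <= (c*h) ^ p*mean_abs (g p) x h}"
 shows "ennreal (h*real (card Z)) <= emeasure circ {x \<in> space circ. g 0 x*g 0 (x + h) <= 0} + ennreal (real p0)*emeasure circ (E 2)
   + (\<Sum>p. emeasure circ (E (p + Suc p0)))"
proof -
 have gc: "continuous_on UNIV (g r)" for r using DERIV_continuous[OF d] by (simp add: continuous_on_eq_continuous_within)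
 have gm [measurable]: "g p \<in> bm borel" for p by (rule borel_measurable_continuous_onI[OF gc])
 let ?S = "{x \<in> space circ. g 0 x*g 0 (x + h) <= 0}"
 have Sm [measurable]: "?S \<in> sets circ"
 proof -
  have [measurable]: "(%x. g 0 x*g 0 (x + h)) \<in> bm circ" by (rule measurable_circ) measurable
  show ?thesis by measurable
 qed
 have Em [measurable]: "E p \<in> sets circ" for p
 proof -
  have [measurable]: "(%x. \<bar>g 0 x\<bar>) \<in> bm circ" "(%x. (c*h) ^ p*mean_abs (g p) x h) \<in> bm circ"
   using mm[of p] by (auto intro!: measurable_circ)
  show ?thesis unfolding E_def by measurable
 qed
 let ?Zp = "Z \<union> (%t. t + 2*pi) ` Z"
 have "ennreal (h*real (card Z)) <= (CN x. ennreal (real (card (?Zp \<inter> {x<..<x+h}))))"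
  by (rule window_average[OF h Z(1,2)])
 also have "... <= (CN x. indicator ?S x + ennreal (real p0)*indicator (E 2) x + (\<Sum>p. indicator (E (p + Suc p0)) x))"
 proof (rule nn_integral_mono)
  fix x assume x: "x \<in> space circ"
  define K where "K = ?Zp \<inter> {x<..<x+h}"
  define N where "N = card K"
  have K: "finite K" "K \<subseteq> {x<..<x+h}" "!!z. z \<in> K ==> g 0 z = 0" using Z per by (auto simp: K_def)
  have Ep: "x \<in> E (Suc p)" if "Suc p <= N" for p
   using many_zeros_small[where g=g and c=c and h=h and Z=K and p=p and x=x and q=0 and y=x] d c h K that x unfolding E_def N_def by simp
  let ?T = "\<Sum>p. indicator (E (p + Suc p0)) x :: ennreal"
  have tail: "ennreal (real (N - p0)) <= ?T"
  proof -
   have "ennreal (real (N - p0)) = (\<Sum>p<N - p0. indicator (E (p + Suc p0)) x)"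
   proof -
    have "(\<Sum>p<N - p0. indicator (E (p + Suc p0)) x :: ennreal) = (\<Sum>p<N - p0. 1)"
     using Ep by (intro sum.cong refl) (auto simp: indicator_def)
    then show ?thesis by (simp add: ennreal_of_nat_eq_real_of_nat)
   qed
   also have "... <= ?T" by (intro sum_le_suminf) (auto intro: summableI)
   finally show ?thesis .
  qed
  have "ennreal (real N) <= indicator ?S x + ennreal (real p0)*indicator (E 2) x + ?T"
  proof (cases "N = 0")
   case False
   then obtain z where z: "z \<in> K" unfolding N_def by (metis card.empty ex_in_conv)
   show ?thesis
   proof (cases "x \<in> E 2")
    case True
    have "ennreal (real N) <= ennreal (real p0 + real (N - p0))" by (intro ennreal_leI) linarith
    also have "... = ennreal (real p0) + ennreal (real (N - p0))" by (rule ennreal_plus) auto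
    also have "... <= ennreal (real p0)*indicator (E 2) x + ?T" using True tail by (simp add: add_left_mono)
    finally show ?thesis by (simp add: add_increasing add.assoc)
   next
    case nE: False
    have "N < 2" using Ep[of 1] nE by (force simp: numeral_2_eq_2)
    then have N1: "N = 1" using False by simp
    have "\<not> 0 < g 0 x*g 0 (x + h)"
     using even_zero_small[where g=g and c=c and h=h and x=x and z=z] d c h K z nE x unfolding E_def by auto
    then have "x \<in> ?S" using x by simp
    then show ?thesis using N1 by (simp add: add_increasing2)
   qed
  qed simp
  then show "ennreal (real (card (?Zp \<inter> {x<..<x+h}))) <= indicator ?S x + ennreal (real p0)*indicator (E 2) x + ?T"
   unfolding N_def K_def .
 qed
 also have "... = emeasure circ ?S + ennreal (real p0)*emeasure circ (E 2) + (\<Sum>p. emeasure circ (E (p + Suc p0)))"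
  by (subst nn_integral_add, measurable, subst nn_integral_add, measurable, subst nn_integral_suminf, measurable)
   (simp add: nn_integral_cmult nn_integral_suminf)
 finally show ?thesis .
qed

text \<open>Each sign change pushes a zero into the window; the extra \<open>1\<close> accounts for the windows that stick out of \<open>[0, 2 pi]\<close>.\<close>

lemma zeros_lower:
 fixes g :: "real => real"
 assumes g: "continuous_on UNIV g" and h: "0 < h" "h <= 1" and Z: "finite {t \<in> {0..2*pi}. g t = 0}"
 shows "emeasure circ {x \<in> space circ. g x*g (x + h) < 0} <= ennreal (h*(real (card {t \<in> {0..2*pi}. g t = 0}) + 1))"
proof -
 let ?Z = "{t \<in> {0..2*pi}. g t = 0}"
 have "{x \<in> space circ. g x*g (x + h) < 0} \<subseteq> (\<Union>t\<in>?Z. {t - h..t}) \<union> {2*pi - h..2*pi}"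
 proof
  fix x assume x: "x \<in> {x \<in> space circ. g x*g (x + h) < 0}"
  then have x2: "0 <= x" "x <= 2*pi" "g x*g (x + h) < 0" by (auto simp: space_circ)
  show "x \<in> (\<Union>t\<in>?Z. {t - h..t}) \<union> {2*pi - h..2*pi}"
  proof (cases "x + h <= 2*pi")
   case True
   have "\<exists>t. x <= t \<and> t <= x + h \<and> g t = 0"
   proof (cases "g x <= 0")
    case True
    then show ?thesis using IVT'[of g x 0 "x + h"] x2 h continuous_on_subset[OF g] by (auto simp: mult_less_0_iff)
   next
    case False
    then show ?thesis using IVT2'[of g "x + h" 0 x] x2 h continuous_on_subset[OF g] by (auto simp: mult_less_0_iff)
   qed
   then obtain t where t: "x <= t" "t <= x + h" "g t = 0" by blast
   then have "t \<in> ?Z" "x \<in> {t - h..t}" using x2 True by auto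
   then show ?thesis by blast
  qed (use x2 in auto)
 qed
 then have "emeasure lborel {x \<in> space circ. g x*g (x + h) < 0} <= emeasure lborel ((\<Union>t\<in>?Z. {t - h..t}) \<union> {2*pi - h..2*pi})"
  using sets.finite_UN[OF Z, of "%t. {t - h..t}" borel] by (intro emeasure_mono) auto
 also have "... <= emeasure lborel (\<Union>t\<in>?Z. {t - h..t}) + emeasure lborel {2*pi - h..2*pi}"
  using sets.finite_UN[OF Z, of "%t. {t - h..t}" borel] by (intro emeasure_subadditive) auto
 also have "... <= (\<Sum>t\<in>?Z. emeasure lborel {t - h..t}) + emeasure lborel {2*pi - h..2*pi}"
  using Z by (intro add_right_mono emeasure_subadditive_finite) auto
 also have "... = ennreal (h*(real (card ?Z) + 1))"
  using h by (simp add: ennreal_of_nat_eq_real_of_nat ennreal_mult ennreal_plus distrib_left mult.commute)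
 also have "emeasure lborel {x \<in> space circ. g x*g (x + h) < 0} = emeasure circ {x \<in> space circ. g x*g (x + h) < 0}"
  unfolding circ_def by (subst emeasure_restrict_space) (auto simp: space_restrict_space)
 finally show ?thesis .
qed

lemma AE_gauss2_neq:
 assumes c: "0 < c"
 shows "AE y in gauss2. fst y \<noteq> 0" "AE y in gauss2. rh*fst y + c * snd y \<noteq> 0"
proof -
 have m: "{y \<in> space gauss2. f y \<noteq> 0} \<in> sets gauss2" if "f \<in> bm (borel \<Otimes>\<^sub>M borel)" for f :: "real \<times> real => real"
 proof -
  have [measurable]: "f \<in> bm gauss2" using that by (rule measurable_gauss2)
  show ?thesis by measurable
 qed
 show "AE y in gauss2. fst y \<noteq> 0"
  unfolding gauss2_def
 proof (rule gg.AE_pair_measure)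
  show "{y \<in> space (std_gauss \<Otimes>\<^sub>M std_gauss). fst y \<noteq> 0} \<in> sets (std_gauss \<Otimes>\<^sub>M std_gauss)"
   by (rule m[unfolded gauss2_def]) measurable
  show "AE x in std_gauss. AE y in std_gauss. fst (x, y) \<noteq> 0"
   using gauss_AE_neq[of 0] by eventually_elim simp
 qed
 show "AE y in gauss2. rh*fst y + c * snd y \<noteq> 0"
  unfolding gauss2_def
 proof (rule gg.AE_pair_measure)
  show "{y \<in> space (std_gauss \<Otimes>\<^sub>M std_gauss). rh*fst y + c * snd y \<noteq> 0} \<in> sets (std_gauss \<Otimes>\<^sub>M std_gauss)"
   by (rule m[unfolded gauss2_def]) measurable
  have "AE y in std_gauss. rh*x + c*y \<noteq> 0" for x
   using gauss_AE_neq[of "- (rh*x)/c"] by eventually_elim (use c in \<open>auto simp: field_simps\<close>)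
  then show "AE x in std_gauss. AE y in std_gauss. rh*fst (x, y) + c * snd (x, y) \<noteq> 0" by simp
 qed
qed

section \<open>Sign changes on a level set of the density\<close>

lemma quadrant_limit:
 fixes X V :: "nat => 'x => real"
 assumes N: "prob_space N" and X: "!!n. X n \<in> bm N" and V: "!!n. V n \<in> bm N" and rh: "rh^2 < 1"
  and lim: "!!s t. (%n. \<integral>x. iexp (s*X n x + t*V n x) \<partial>N) \<longlonglongrightarrow> cpx (exp (- (s^2 + t^2 + 2*rh * s*t)/2))"
 shows "(%n. measure N {x \<in> space N. X n x <= 0 \<and> V n x <= 0}) \<longlonglongrightarrow> 1/4 + arctan (rh/sqrt (1 - rh\<^sup>2))/(2*pi)"
proof -
 interpret G: prob_space gauss2 by (rule prob_space_gauss2)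
 define c where "c = sqrt (1 - rh\<^sup>2)"
 have c: "0 < c" "rh^2 + c^2 = 1" using rh by (simp_all add: c_def)
 have mU: "fst \<in> bm gauss2" by (rule measurable_gauss2) measurable
 have mV: "(%y. rh*fst y + c * snd y) \<in> bm gauss2" by (rule measurable_gauss2) measurable
 note [measurable] = mU mV
 have "0 < 1/4 + arctan (rh/c)/(2*pi)" using arctan_lbound[of "rh/c"] by (simp add: field_simps)
 also have "... = measure gauss2 {y \<in> space gauss2. fst y <= 0 \<and> rh*fst y + c * snd y <= 0}" by (rule gauss_quadrant[OF c(1), symmetric])
 also have "... <= measure gauss2 {y \<in> space gauss2. rh*fst y + c * snd y <= 0}"
  by (rule G.finite_measure_mono, blast, measurable)
 finally have pos: "0 < measure gauss2 {y \<in> space gauss2. rh*fst y + c * snd y <= 0}" .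
 show ?thesis
  unfolding gauss_quadrant[OF c(1), symmetric] c_def[symmetric]
 proof (rule levy_quadrant[OF N prob_space_gauss2 X V mU mV _ AE_gauss2_neq[OF c(1)] pos])
  show "(%n. \<integral>x. iexp (s*X n x + t*V n x) \<partial>N) \<longlonglongrightarrow> (\<integral>y. iexp (s*fst y + t*(rh*fst y + c * snd y)) \<partial>gauss2)" for s t
   unfolding char_gauss2[OF c(2)] by (rule lim)
 qed
qed

text \<open>\<open>X V <= 0\<close> holds on the union of two closed quadrants only, and \<open>X V < 0\<close> off the union of the other two. The four limits add up to \<open>1\<close>, so the two bounds agree.\<close>

lemma sign_change_limit:
 fixes X V :: "nat => 'x => real"
 assumes N: "prob_space N" and X [measurable]: "!!n. X n \<in> bm N" and V [measurable]: "!!n. V n \<in> bm N" and rh: "rh^2 < 1"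
  and lim: "!!s t. (%n. \<integral>x. iexp (s*X n x + t*V n x) \<partial>N) \<longlonglongrightarrow> cpx (exp (- (s^2 + t^2 + 2*rh * s*t)/2))"
  and e: "0 < e"
 defines "P \<equiv> 1/2 - arctan (rh/sqrt (1 - rh\<^sup>2))/pi"
 shows "eventually (%n. measure N {x \<in> space N. X n x*V n x <= 0} <= P + e) sequentially"
  and "eventually (%n. P - e <= measure N {x \<in> space N. X n x*V n x < 0}) sequentially"
proof -
 interpret N: prob_space N by (rule N)
 have q: "(%n. measure N {x \<in> space N. si*X n x <= 0 \<and> ta*V n x <= 0}) \<longlonglongrightarrow> 1/4 + arctan ((si*ta*rh)/sqrt (1 - rh\<^sup>2))/(2*pi)"
  if st: "si^2 = 1" "ta^2 = 1" for si ta :: real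
 proof -
  have r2: "(si*ta*rh)^2 = rh^2" using st by (simp add: power_mult_distrib)
  have l: "(%n. \<integral>x. iexp (s*(si*X n x) + t*(ta*V n x)) \<partial>N) \<longlonglongrightarrow> cpx (exp (- (s^2 + t^2 + 2*(si*ta*rh) * s*t)/2))" for s t
  proof -
   have e2: "(s * si)^2 + (t*ta)^2 + 2*rh*(s * si)*(t*ta) = s^2 + t^2 + 2*(si*ta*rh) * s*t"
    using st by (simp add: power_mult_distrib mult_ac)
   show ?thesis using lim[of "s * si" "t*ta"] unfolding e2 by (simp only: mult.assoc)
  qed
  show ?thesis using quadrant_limit[OF N, of "%n x. si*X n x" "%n x. ta*V n x" "si*ta*rh"] l rh unfolding r2 by simp
 qed
 have ms [measurable]: "{x \<in> space N. si*X n x <= 0 \<and> ta*V n x <= 0} \<in> sets N" "{x \<in> space N. X n x*V n x <= 0} \<in> sets N" "{x \<in> space N. X n x*V n x < 0} \<in> sets N" for si ta n by measurable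
 have an: "arctan (- rh/sqrt (1 - rh\<^sup>2)) = - arctan (rh/sqrt (1 - rh\<^sup>2))" by (simp add: arctan_minus)
 have "(%n. measure N {x \<in> space N. 1*X n x <= 0 \<and> (-1)*V n x <= 0} + measure N {x \<in> space N. (-1)*X n x <= 0 \<and> 1*V n x <= 0}) \<longlonglongrightarrow> P"
  using tendsto_add[OF q[of 1 "-1"] q[of "-1" 1]] an by (simp add: P_def)
 from order_tendstoD(2)[OF this, of "P + e"] e
 have "eventually (%n. measure N {x \<in> space N. 1*X n x <= 0 \<and> (-1)*V n x <= 0} + measure N {x \<in> space N. (-1)*X n x <= 0 \<and> 1*V n x <= 0} < P + e) sequentially" by simp
 then show "eventually (%n. measure N {x \<in> space N. X n x*V n x <= 0} <= P + e) sequentially"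
 proof eventually_elim
  case (elim n)
  have "measure N {x \<in> space N. X n x*V n x <= 0} <= measure N ({x \<in> space N. 1*X n x <= 0 \<and> (-1)*V n x <= 0} \<union> {x \<in> space N. (-1)*X n x <= 0 \<and> 1*V n x <= 0})"
   by (rule N.finite_measure_mono) (auto simp: mult_le_0_iff)
  also have "... <= measure N {x \<in> space N. 1*X n x <= 0 \<and> (-1)*V n x <= 0} + measure N {x \<in> space N. (-1)*X n x <= 0 \<and> 1*V n x <= 0}"
   by (rule measure_Un_le) measurable
  finally show ?case using elim by linarith
 qed
 have "(%n. measure N {x \<in> space N. 1*X n x <= 0 \<and> 1*V n x <= 0} + measure N {x \<in> space N. (-1)*X n x <= 0 \<and> (-1)*V n x <= 0}) \<longlonglongrightarrow> 1 - P"
  using tendsto_add[OF q[of 1 1] q[of "-1" "-1"]] by (simp add: P_def)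
 from order_tendstoD(2)[OF this, of "1 - P + e"] e
 have "eventually (%n. measure N {x \<in> space N. 1*X n x <= 0 \<and> 1*V n x <= 0} + measure N {x \<in> space N. (-1)*X n x <= 0 \<and> (-1)*V n x <= 0} < 1 - P + e) sequentially" by simp
 then show "eventually (%n. P - e <= measure N {x \<in> space N. X n x*V n x < 0}) sequentially"
 proof eventually_elim
  case (elim n)
  have s: "{x \<in> space N. 1*X n x <= 0 \<and> 1*V n x <= 0} \<union> {x \<in> space N. (-1)*X n x <= 0 \<and> (-1)*V n x <= 0} \<union> {x \<in> space N. X n x*V n x < 0} = space N"
  proof (intro equalityI subsetI)
   fix x assume "x \<in> space N"
   then show "x \<in> {x \<in> space N. 1*X n x <= 0 \<and> 1*V n x <= 0} \<union> {x \<in> space N. (-1)*X n x <= 0 \<and> (-1)*V n x <= 0} \<union> {x \<in> space N. X n x*V n x < 0}"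
    by (cases "X n x <= 0"; cases "V n x <= 0") (auto simp: mult_less_0_iff)
  qed auto
  have "1 = measure N ({x \<in> space N. 1*X n x <= 0 \<and> 1*V n x <= 0} \<union> {x \<in> space N. (-1)*X n x <= 0 \<and> (-1)*V n x <= 0} \<union> {x \<in> space N. X n x*V n x < 0})"
   unfolding s by (rule N.prob_space[symmetric])
  also have "... <= measure N ({x \<in> space N. 1*X n x <= 0 \<and> 1*V n x <= 0} \<union> {x \<in> space N. (-1)*X n x <= 0 \<and> (-1)*V n x <= 0}) + measure N {x \<in> space N. X n x*V n x < 0}"
   by (rule measure_Un_le) measurable
  also have "measure N ({x \<in> space N. 1*X n x <= 0 \<and> 1*V n x <= 0} \<union> {x \<in> space N. (-1)*X n x <= 0 \<and> (-1)*V n x <= 0}) <= measure N {x \<in> space N. 1*X n x <= 0 \<and> 1*V n x <= 0} + measure N {x \<in> space N. (-1)*X n x <= 0 \<and> (-1)*V n x <= 0}"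
   by (rule measure_Un_le) measurable
  finally show ?case using elim by linarith
 qed
qed

text \<open>The normal density is below \<open>1/2\<close>. The half-line \<open>(-\<infinity>, -2 de]\<close> instead of \<open>(-\<infinity>, -de)\<close> keeps the comparison of distribution functions free of boundary points.\<close>

lemma small_ball_limit:
 fixes X :: "nat => 'x => real"
 assumes N: "prob_space N" and X [measurable]: "!!n. X n \<in> bm N"
  and lim: "!!s. (%n. \<integral>x. iexp (s*X n x) \<partial>N) \<longlonglongrightarrow> cpx (exp (- s\<^sup>2/2))" and d: "0 < de"
 shows "eventually (%n. measure N {x \<in> space N. \<bar>X n x\<bar> <= de} <= 2*de) sequentially"
proof -
 interpret N: prob_space N by (rule N)
 have cdf: "(%n. measure N {x \<in> space N. X n x <= c}) \<longlonglongrightarrow> measure std_gauss {..c}" for c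
 proof -
  have sp: "iexp (s*(y - c)) = iexp (- (s*c))*iexp (s*y)" for s y :: real
   by (simp add: exp_add[symmetric] algebra_simps)
  have "(%n. \<integral>x. (1::real)*indicator {..0} (X n x - c) \<partial>N) \<longlonglongrightarrow> (\<integral>y. 1*indicator {..0} (y - c) \<partial>std_gauss)"
  proof (rule levy_weighted[where B = 1 and wn = "%_ _. 1" and w = "%_. 1", OF N prob_space_std_gauss])
   show "(%n. \<integral>x. cpx 1*iexp (t*(X n x - c)) \<partial>N) \<longlonglongrightarrow> (\<integral>y. cpx 1*iexp (t*(y - c)) \<partial>std_gauss)" for t
    using tendsto_mult_left[OF lim[of t], of "iexp (- (t*c))"] unfolding sp char_std_gauss[of t, symmetric] char_def by simp
   show "AE y in std_gauss. y - c \<noteq> 0" using gauss_AE_neq[of c] by eventually_elim simp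
   show "0 < (\<integral>y. (1::real) \<partial>std_gauss)" using std_gauss.prob_space by simp
  qed auto
  moreover have "(\<integral>x. (1::real)*indicator {..0} (X n x - c) \<partial>N) = measure N {x \<in> space N. X n x <= c}" for n
   by (rule integral_eq_measure) (auto simp: indicator_def)
  moreover have "(\<integral>y. (1::real)*indicator {..0} (y - c) \<partial>std_gauss) = measure std_gauss {..c}"
   by (rule integral_eq_measure) (auto simp: indicator_def)
  ultimately show ?thesis by simp
 qed
 have lim2: "(%n. measure N {x \<in> space N. X n x <= de} - measure N {x \<in> space N. X n x <= - 2*de}) \<longlonglongrightarrow> measure std_gauss {..de} - measure std_gauss {..- 2*de}"
  by (intro tendsto_diff cdf)
 have "measure std_gauss {..de} - measure std_gauss {..- 2*de} < 2*de"
 proof -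
  have dens: "std_normal_density x <= 1/2" for x
  proof -
   have "sqrt (2*pi) \<ge> 2" using pi_gt3 by (intro real_le_rsqrt) simp
   then have "1/sqrt (2*pi) <= 1/2" by (intro divide_left_mono) auto
   moreover have "1/sqrt (2*pi)*exp (- x\<^sup>2/2) <= 1/sqrt (2*pi)*1" by (intro mult_left_mono) auto
   ultimately show ?thesis unfolding std_normal_density_def by linarith
  qed
  have "{..de} = {..- 2*de} \<union> {- 2*de<..de}" using d by auto
  then have "measure std_gauss {..de} <= measure std_gauss {..- 2*de} + measure std_gauss {- 2*de<..de}"
   using measure_Un_le[of "{..- 2*de}" std_gauss "{- 2*de<..de}"] by simp
  moreover have "emeasure std_gauss {- 2*de<..de} <= ennreal (3*de/2)"
  proof -
   have "emeasure std_gauss {- 2*de<..de} = (\<integral>\<^sup>+x. ennreal (std_normal_density x)*indicator {- 2*de<..de} x \<partial>lborel)"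
    unfolding std_gauss_def by (rule emeasure_density) auto
   also have "... <= (\<integral>\<^sup>+x. ennreal (1/2)*indicator {- 2*de<..de} x \<partial>lborel)"
    by (intro nn_integral_mono mult_right_mono ennreal_leI dens) simp
   also have "... = ennreal (1/2)*emeasure lborel {- 2*de<..de}" by (rule nn_integral_cmult_indicator) simp
   also have "emeasure lborel {- 2*de<..de} = ennreal (3*de)" using d by simp
   also have "ennreal (1/2)*ennreal (3*de) = ennreal (1/2*(3*de))" by (rule ennreal_mult'[symmetric]) simp
   also have "1/2*(3*de) = 3*de/2" by simp
   finally show ?thesis .
  qed
  then have "measure std_gauss {- 2*de<..de} <= 3*de/2" using d by (simp add: std_gauss.emeasure_eq_measure)
  ultimately show ?thesis using d by linarith
 qed
 from order_tendstoD(2)[OF lim2 this] show ?thesis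
 proof eventually_elim
  case (elim n)
  have "measure N ({x \<in> space N. \<bar>X n x\<bar> <= de} \<union> {x \<in> space N. X n x <= - 2*de}) = measure N {x \<in> space N. \<bar>X n x\<bar> <= de} + measure N {x \<in> space N. X n x <= - 2*de}"
   using d by (intro N.finite_measure_Union) (auto simp: abs_le_iff)
  moreover have "measure N ({x \<in> space N. \<bar>X n x\<bar> <= de} \<union> {x \<in> space N. X n x <= - 2*de}) <= measure N {x \<in> space N. X n x <= de}"
   using d by (intro N.finite_measure_mono) auto
  ultimately show ?case using elim by linarith
 qed
qed

lemma integral_uniform_circ:
 fixes f :: "real => complex"
 assumes A [measurable]: "A \<in> sets circ" and pos: "0 < measure circ A" and f [measurable]: "f \<in> bm circ"
 shows "(\<integral>x. f x \<partial>uniform_measure circ A) = (CI x. indicator A x *\<^sub>R f x)/cpx (measure circ A)"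
proof -
 have "indicator A x/emeasure circ A = ennreal (indicator A x/measure circ A)" for x
  using pos by (simp add: circ.emeasure_eq_measure divide_ennreal[symmetric] indicator_def)
 then have "uniform_measure circ A = density circ (%x. ennreal (indicator A x/measure circ A))"
  by (simp add: uniform_measure_def)
 then have "(\<integral>x. f x \<partial>uniform_measure circ A) = (CI x. (indicator A x/measure circ A) *\<^sub>R f x)"
  by (simp add: integral_density)
 also have "(%x. (indicator A x/measure circ A) *\<^sub>R f x) = (%x. (1/measure circ A) *\<^sub>R (indicator A x *\<^sub>R f x))" by (simp add: fun_eq_iff)
 also have "(CI x. (1/measure circ A) *\<^sub>R (indicator A x *\<^sub>R f x)) = (1/measure circ A) *\<^sub>R (CI x. indicator A x *\<^sub>R f x)"
  by (rule integral_scaleR_right)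
 finally show ?thesis by (simp add: scaleR_conv_of_real)
qed

text \<open>Off \<open>A\<close> both variables vanish and contribute exactly the measure of the complement to the characteristic function; what remains is the law under the uniform distribution on \<open>A\<close>.\<close>

lemma limits_on_subset:
 fixes X V :: "nat => real => real"
 assumes A [measurable]: "A \<in> sets circ" and pos: "0 < measure circ A"
  and X [measurable]: "!!n. X n \<in> bm circ" and V [measurable]: "!!n. V n \<in> bm circ"
  and off: "\<forall>n. \<forall>x\<in>space circ - A. X n x = 0 \<and> V n x = 0" and rh: "rh^2 < 1"
  and lim: "!!s t. (%n. (CI x. iexp (s*X n x + t*V n x))) \<longlonglongrightarrow>
   cpx (measure circ (space circ - A) + measure circ A*exp (- (s^2 + t^2 + 2*rh * s*t)/2))"
  and e: "0 < e"
 defines "P \<equiv> 1/2 - arctan (rh/sqrt (1 - rh\<^sup>2))/pi"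
 shows "eventually (%n. measure circ {x \<in> A. X n x*V n x <= 0} <= measure circ A*(P + e)) sequentially"
  and "eventually (%n. measure circ A*(P - e) <= measure circ {x \<in> A. X n x*V n x < 0}) sequentially"
  and "eventually (%n. measure circ {x \<in> A. \<bar>X n x\<bar> <= e} <= measure circ A*(2*e)) sequentially"
proof -
 define N where "N = uniform_measure circ A"
 have A0: "emeasure circ A \<noteq> 0" "emeasure circ A \<noteq> \<infinity>" using pos by (auto simp: circ.emeasure_eq_measure)
 have Np: "prob_space N" unfolding N_def by (rule prob_space_uniform_measure[OF A0])
 have NX: "X n \<in> bm N" "V n \<in> bm N" for n by (simp_all add: N_def uniform_measure_def)
 have Nl: "(%n. \<integral>x. iexp (s*X n x + t*V n x) \<partial>N) \<longlonglongrightarrow> cpx (exp (- (s^2 + t^2 + 2*rh * s*t)/2))" for s t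
 proof -
  let ?f = "%n x. iexp (s*X n x + t*V n x)"
  have fm [measurable]: "?f n \<in> bm circ" for n by measurable
  have fi: "integrable circ (?f n)" for n by (rule integrable_circ_bounded[where B = 1]) auto
  have "(CI x. indicator A x *\<^sub>R ?f n x) = (CI x. ?f n x) - cpx (measure circ (space circ - A))" for n
  proof -
   have "(CI x. indicator A x *\<^sub>R ?f n x) = (CI x. ?f n x - cpx (indicator (space circ - A) x))"
    using off by (intro Bochner_Integration.integral_cong) (auto simp: indicator_def)
   also have "... = (CI x. ?f n x) - (CI x. cpx (indicator (space circ - A) x))"
    by (intro Bochner_Integration.integral_diff fi integrable_of_real circ.integrable_const_bound[where B = 1]) (auto simp: indicator_def)
   also have "(CI x. cpx (indicator (space circ - A) x)) = cpx (measure circ (space circ - A))"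
    by (simp add: Int_absorb2)
   finally show ?thesis .
  qed
  then have "(\<integral>x. ?f n x \<partial>N) = ((CI x. ?f n x) - cpx (measure circ (space circ - A)))/cpx (measure circ A)" for n
   unfolding N_def by (simp add: integral_uniform_circ[OF A pos])
  moreover have "(%n. ((CI x. ?f n x) - cpx (measure circ (space circ - A)))/cpx (measure circ A)) \<longlonglongrightarrow>
    (cpx (measure circ (space circ - A) + measure circ A*exp (- (s^2 + t^2 + 2*rh * s*t)/2)) - cpx (measure circ (space circ - A)))/cpx (measure circ A)"
   using pos by (intro tendsto_intros lim) auto
  ultimately show ?thesis using pos by simp
 qed
 have Nl1: "(%n. \<integral>x. iexp (s*X n x) \<partial>N) \<longlonglongrightarrow> cpx (exp (- s\<^sup>2/2))" for s
  using Nl[of s 0] by simp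
 have sp: "space N = space circ" by (simp add: N_def)
 have Nm: "measure circ {x \<in> A. Q x} = measure circ A*measure N {x \<in> space N. Q x}" if Q: "{x \<in> space circ. Q x} \<in> sets circ" for Q
 proof -
  have "A \<inter> {x \<in> space circ. Q x} = {x \<in> A. Q x}" using sets.sets_into_space[OF A] by auto
  then show ?thesis unfolding sp using measure_uniform_measure[OF A0 Q] pos by (simp add: N_def)
 qed
 have Q: "{x \<in> space circ. X n x*V n x <= 0} \<in> sets circ" "{x \<in> space circ. X n x*V n x < 0} \<in> sets circ" "{x \<in> space circ. \<bar>X n x\<bar> <= e} \<in> sets circ" for n
  by measurable
 note sc = sign_change_limit[OF Np NX rh Nl e, folded P_def]
 show "eventually (%n. measure circ {x \<in> A. X n x*V n x <= 0} <= measure circ A*(P + e)) sequentially"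
  using sc(1) by eventually_elim (simp only: Nm[OF Q(1)], rule mult_left_mono, auto)
 show "eventually (%n. measure circ A*(P - e) <= measure circ {x \<in> A. X n x*V n x < 0}) sequentially"
  using sc(2) by eventually_elim (simp only: Nm[OF Q(2)], rule mult_left_mono, auto)
 show "eventually (%n. measure circ {x \<in> A. \<bar>X n x\<bar> <= e} <= measure circ A*(2*e)) sequentially"
  using small_ball_limit[OF Np NX(1) Nl1 e] by eventually_elim (simp only: Nm[OF Q(3)], rule mult_left_mono, auto)
qed

text \<open>The symbol whose sum is \<open>s f(x) + t f(x + ep/n)\<close>.\<close>

definition two_point :: "real => real => real => real => complex" where
 "two_point ep s t ta = cpx s + cpx t*cis (ep*ta)"

lemma cis_lipschitz: "cmod (cis u - cis v) <= \<bar>u - v\<bar>"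
 using cmod_exp_i_diff[of u v] by (simp add: cis_conv_exp)

lemma lip_symbol_two_point:
 assumes "0 <= ep"
 shows "lip_symbol (\<bar>s\<bar> + \<bar>t\<bar>) (ep*\<bar>t\<bar>) (two_point ep s t)"
 unfolding lip_symbol_def
proof (intro conjI allI impI)
 fix ta show "cmod (two_point ep s t ta) <= \<bar>s\<bar> + \<bar>t\<bar>"
  unfolding two_point_def by (rule order_trans[OF norm_triangle_ineq]) (simp add: norm_mult)
next
 fix ta ta'
 have "two_point ep s t ta - two_point ep s t ta' = cpx t*(cis (ep*ta) - cis (ep*ta'))"
  by (simp add: two_point_def algebra_simps)
 then have "cmod (two_point ep s t ta - two_point ep s t ta') <= \<bar>t\<bar>*\<bar>ep*ta - ep*ta'\<bar>"
  using mult_left_mono[OF cis_lipschitz[of "ep*ta" "ep*ta'"], of "\<bar>t\<bar>"] by (simp add: norm_mult)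
 also have "ep*ta - ep*ta' = ep*(ta - ta')" by (simp add: algebra_simps)
 finally show "cmod (two_point ep s t ta - two_point ep s t ta') <= ep*\<bar>t\<bar>*\<bar>ta - ta'\<bar>"
  using assms by (simp add: abs_mult mult_ac)
qed

lemma cos_riemann_sum:
 assumes e: "0 < ep"
 shows "(%n. (\<Sum>k=1..n. cos (ep*(real k/real n)))/real n) \<longlonglongrightarrow> sin ep/ep"
proof (rule Lim_transform)
 show "(%n. sin ep/ep) \<longlonglongrightarrow> sin ep/ep" by simp
 have "\<bar>sin ep/ep - (\<Sum>k=1..n. cos (ep*(real k/real n)))/real n\<bar> <= ep*(1/real n)" if n: "1 <= n" for n
 proof -
  define h where "h = ep/real n"
  have h: "0 < h" using e n by (simp add: h_def)
  have step: "\<bar>(sin (h*real k) - sin (h*real (k - 1))) - h*cos (h*real k)\<bar> <= h*h" if k: "1 <= k" for k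
  proof -
   have lt: "h*real (k - 1) < h*real k" using h k by simp
   obtain z where z: "h*real (k - 1) < z" "z < h*real k" "sin (h*real k) - sin (h*real (k - 1)) = (h*real k - h*real (k - 1))*cos z"
    using MVT2[OF lt, of sin cos] DERIV_sin by blast
   have hk: "h*real k - h*real (k - 1) = h" using k by (simp add: of_nat_diff algebra_simps)
   have "\<bar>cos z - cos (h*real k)\<bar> <= cmod (cis z - cis (h*real k))"
    using abs_Re_le_cmod[of "cis z - cis (h*real k)"] by simp
   also have "... <= \<bar>z - h*real k\<bar>" by (rule cis_lipschitz)
   also have "... <= h" using z(1,2) hk by (simp add: abs_if)
   finally have "h*\<bar>cos z - cos (h*real k)\<bar> <= h*h" using h by (intro mult_left_mono) auto
   moreover have "sin (h*real k) - sin (h*real (k - 1)) = h*cos z" using z(3) unfolding hk .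
   ultimately show ?thesis using h by (simp only: right_diff_distrib[symmetric] abs_mult abs_of_pos)
  qed
  have tel: "(\<Sum>k=1..m. sin (h*real k) - sin (h*real (k - 1))) = sin (h*real m)" for m
   by (induction m) simp_all
  have "sin ep - h*(\<Sum>k=1..n. cos (h*real k)) = (\<Sum>k=1..n. (sin (h*real k) - sin (h*real (k - 1))) - h*cos (h*real k))"
   unfolding sum_subtractf[of "%k. sin (h*real k) - sin (h*real (k - 1))"] tel sum_distrib_left[symmetric] using n by (simp add: h_def)
  then have "\<bar>sin ep - h*(\<Sum>k=1..n. cos (h*real k))\<bar> <= (\<Sum>k=1..n. \<bar>(sin (h*real k) - sin (h*real (k - 1))) - h*cos (h*real k)\<bar>)"
   by (simp only: sum_abs)
  also have "... <= (\<Sum>k=1..n. h*h)" using step by (intro sum_mono) auto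
  also have "... = ep*h" using n by (simp add: h_def)
  finally have b: "\<bar>sin ep - h*(\<Sum>k=1..n. cos (h*real k))\<bar>/ep <= h" using e by (simp add: field_simps)
  have "sin ep/ep - (\<Sum>k=1..n. cos (ep*(real k/real n)))/real n = (sin ep - h*(\<Sum>k=1..n. cos (h*real k)))/ep"
   using e by (simp add: h_def diff_divide_distrib)
  then show ?thesis using b e by (simp add: h_def abs_divide)
 qed
 then have "\<forall>\<^sub>F n in sequentially. norm (sin ep/ep - (\<Sum>k=1..n. cos (ep*(real k/real n)))/real n) <= ep*(1/real n)"
  unfolding eventually_sequentially by (intro exI[of _ 1]) auto
 moreover have "(%n. ep*(1/real n)) \<longlonglongrightarrow> 0" using tendsto_mult_left[OF lim_1_over_n, of ep] by simp
 ultimately have "(%n. sin ep/ep - (\<Sum>k=1..n. cos (ep*(real k/real n)))/real n) \<longlonglongrightarrow> 0" by (rule Lim_null_comparison)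
 then show "(%n. (\<Sum>k=1..n. cos (ep*(real k/real n)))/real n - sin ep/ep) \<longlonglongrightarrow> 0"
  using tendsto_minus[of "%n. sin ep/ep - (\<Sum>k=1..n. cos (ep*(real k/real n)))/real n" 0] by simp
qed

lemma symbol_mass_two_point:
 assumes e: "0 < ep"
 shows "(%n. symbol_mass n (two_point ep s t)) \<longlonglongrightarrow> s^2 + t^2 + 2*(sin ep/ep) * s*t"
proof -
 have c: "(cmod (two_point ep s t u))^2 = (s^2 + t^2) + (2 * s*t)*cos (ep*u)" for u
 proof -
  have gen: "(s + t*c)^2 + (t*d)^2 = s^2 + 2 * s*t*c + t^2*(c^2 + d^2)" for c d :: real
   by (simp add: power2_eq_square algebra_simps)
  have "(cmod (two_point ep s t u))^2 = (s + t*cos (ep*u))^2 + (t * sin (ep*u))^2"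
   unfolding cmod_power2 by (simp add: two_point_def)
  also have "... = s^2 + 2 * s*t*cos (ep*u) + t^2*((cos (ep*u))^2 + (sin (ep*u))^2)"
   by (rule gen)
  finally show ?thesis by simp
 qed
 have "(%n. (s^2 + t^2) + (2 * s*t)*((\<Sum>k=1..n. cos (ep*(real k/real n)))/real n)) \<longlonglongrightarrow> (s^2 + t^2) + (2 * s*t)*(sin ep/ep)"
  by (intro tendsto_intros cos_riemann_sum e)
 moreover have "(s^2 + t^2) + (2 * s*t)*((\<Sum>k=1..n. cos (ep*(real k/real n)))/real n) = symbol_mass n (two_point ep s t)" if "1 <= n" for n
  using that unfolding symbol_mass_def c sum.distrib sum_distrib_left[symmetric] by (simp add: add_divide_distrib)
 then have "\<forall>\<^sub>F n in sequentially. (s^2 + t^2) + (2 * s*t)*((\<Sum>k=1..n. cos (ep*(real k/real n)))/real n) = symbol_mass n (two_point ep s t)"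
  unfolding eventually_sequentially by (intro exI[of _ 1]) auto
 ultimately have "(%n. symbol_mass n (two_point ep s t)) \<longlonglongrightarrow> (s^2 + t^2) + (2 * s*t)*(sin ep/ep)"
  by (rule Lim_transform_eventually)
 then show ?thesis by (simp add: mult_ac)
qed

lemma trig_field_two_point:
 assumes n: "1 <= n"
 shows "trig_field al be n (two_point ep s t) x = s*trig_field al be n one x + t*trig_field al be n one (x + ep/real n)"
proof -
 have "trig_field al be n one (x + ep/real n) = trig_field al be n (%ta. 1*cis (ep*ta)) x"
  using trig_field_shift[OF n, of al be one x "ep/real n"] n by simp
 moreover have "wave n (two_point ep s t) x k = cpx s*wave n one x k + cpx t*wave n (%ta. 1*cis (ep*ta)) x k" for k
  by (simp add: wave_def two_point_def add_divide_distrib distrib_right)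
 ultimately show ?thesis
  by (simp add: trig_field_def pairing_def sum_distrib_left sum.distrib[symmetric] algebra_simps)
qed

text \<open>Equicontinuity reduces almost sure convergence for all parameters to countably many.\<close>

lemma limit_from_rationals:
 fixes ph :: "nat => real => real => complex" and l :: "real => real => complex"
 assumes K: "0 <= K" and lip: "!!n s t s' t'. 1 <= n ==> cmod (ph n s t - ph n s' t') <= K*(\<bar>s - s'\<bar> + \<bar>t - t'\<bar>)"
  and lim: "!!p q. (%n. ph n (of_rat p) (of_rat q)) \<longlonglongrightarrow> l (of_rat p) (of_rat q)"
  and cont: "continuous_on UNIV (%z. l (fst z) (snd z))"
 shows "(%n. ph n s t) \<longlonglongrightarrow> l s t"
proof (rule tendstoI)
 fix e :: real assume e: "0 < e"
 obtain d where d: "0 < d" "!!z. dist z (s, t) < d ==> dist (l (fst z) (snd z)) (l s t) < e/3"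
  using cont[unfolded continuous_on_iff, rule_format, of "(s, t)" "e/3"] e by auto
 define d' where "d' = min (d/2) (e/(6*(K + 1)))"
 have d': "0 < d'" using d e K by (simp add: d'_def)
 obtain p where p: "s < of_rat p" "of_rat p < s + d'" using of_rat_dense[of s "s + d'"] d' by auto
 obtain q where q: "t < of_rat q" "of_rat q < t + d'" using of_rat_dense[of t "t + d'"] d' by auto
 have ab: "\<bar>s - of_rat p\<bar> < d'" "\<bar>t - of_rat q\<bar> < d'" using p q by auto
 have "dist (of_rat p, of_rat q) (s, t) <= \<bar>s - of_rat p\<bar> + \<bar>t - of_rat q\<bar>"
  unfolding dist_Pair_Pair by (rule order_trans[OF sqrt_sum_squares_le_sum_abs]) (simp add: dist_real_def)
 also have "... < d" using ab by (simp add: d'_def)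
 finally have 1: "dist (l (of_rat p) (of_rat q)) (l s t) < e/3" using d(2)[of "(of_rat p, of_rat q)"] by simp
 have "K*(\<bar>s - of_rat p\<bar> + \<bar>t - of_rat q\<bar>) <= K*(2*(e/(6*(K + 1))))"
  using ab K by (intro mult_left_mono) (auto simp: d'_def)
 also have "... = (e/3)*(K/(K + 1))" using K by (simp add: field_simps)
 also have "... <= (e/3)*1" using K e by (intro mult_left_mono) auto
 finally have 2: "K*(\<bar>s - of_rat p\<bar> + \<bar>t - of_rat q\<bar>) <= e/3" by simp
 have "eventually (%n. dist (ph n (of_rat p) (of_rat q)) (l (of_rat p) (of_rat q)) < e/3) sequentially"
  using lim[of p q] e by (intro tendstoD) auto
 then show "eventually (%n. dist (ph n s t) (l s t) < e) sequentially"
  using eventually_ge_at_top[of 1]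
 proof eventually_elim
  case (elim n)
  have "dist (ph n s t) (ph n (of_rat p) (of_rat q)) <= e/3" using lip[OF elim(2), of s t "of_rat p" "of_rat q"] 2 by (simp add: dist_norm)
  then show ?case using 1 elim(1) dist_triangle[of "ph n s t" "l s t" "ph n (of_rat p) (of_rat q)"] dist_triangle[of "ph n (of_rat p) (of_rat q)" "l s t" "l (of_rat p) (of_rat q)"]
   by linarith
 qed
qed

context gauss_spectral begin

definition sd :: "real => real" where "sd x = sqrt (2*pi*\<psi> x)"

definition lev :: "real => real set" where "lev et = {x \<in> space circ. et <= sd x}"

definition wgt :: "real => real => real" where "wgt et x = (if et <= sd x then 1/sd x else 0)"

lemma measurable_sd [measurable]: "sd \<in> bm borel"
 using psi_meas unfolding sd_def[abs_def] by measurable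

lemma lev_sets [measurable]: "lev et \<in> sets circ"
proof -
 have [measurable]: "sd \<in> bm circ" by (rule measurable_circ) measurable
 show ?thesis unfolding lev_def by measurable
qed

lemma measurable_wgt [measurable]: "wgt et \<in> bm borel"
 unfolding wgt_def[abs_def] by measurable

lemma wgt:
 assumes "0 < et"
 shows "0 <= wgt et x" "wgt et x <= 1/et" "(wgt et x)^2*(2*pi*\<psi> x) = (if et <= sd x then 1 else 0)"
  "x \<in> lev et ==> 0 < wgt et x" "x \<in> space circ ==> x \<notin> lev et ==> wgt et x = 0"
proof -
 have s: "(sd x)^2 = 2*pi*\<psi> x" unfolding sd_def using psi_nonneg[of x] by (intro real_sqrt_pow2) simp
 show "(wgt et x)^2*(2*pi*\<psi> x) = (if et <= sd x then 1 else 0)"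
  unfolding s[symmetric] using assms by (auto simp: wgt_def power_divide)
qed (use assms in \<open>auto simp: wgt_def lev_def intro!: divide_left_mono mult_pos_pos\<close>)

lemma weighted_L1_limit:
 assumes et: "0 < et" and e: "0 < e"
 shows "\<exists>N\<ge>1. \<forall>n\<ge>N. \<forall>tt. lip_symbol B L tt -->
  (CN x. ennreal ((wgt et x)^2*\<bar>var n tt x - symbol_mass n tt*(2*pi*\<psi> x)\<bar>)) <= ennreal e"
proof -
 have "0 < e*et^2" using e et by simp
 then obtain N where N: "1 <= N" "!!n tt. N <= n ==> lip_symbol B L tt ==> (CN x. ennreal \<bar>var n tt x - symbol_mass n tt*(2*pi*\<psi> x)\<bar>) <= ennreal (e*et^2)"
  using var_L1_limit[OF om_limit, of "e*et^2" B L] unfolding lip_symbol_def by blast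
 show ?thesis
 proof (intro exI[of _ N] conjI allI impI)
  fix n tt assume n: "N <= n" and tt: "lip_symbol B L tt"
  let ?d = "%x. \<bar>var n tt x - symbol_mass n tt*(2*pi*\<psi> x)\<bar>"
  have dm: "(%x. ennreal (?d x)) \<in> bm circ" using psi_meas by (intro measurable_circ) measurable
  have "(CN x. ennreal ((wgt et x)^2*?d x)) <= (CN x. ennreal (1/et^2)*ennreal (?d x))"
  proof (rule nn_integral_mono)
   fix x
   have "(wgt et x)^2 <= (1/et)^2" using wgt(1,2)[OF et] by (intro power_mono) auto
   then have "(wgt et x)^2*?d x <= (1/et^2)*?d x" by (intro mult_right_mono) (auto simp: power_divide)
   then have "ennreal ((wgt et x)^2*?d x) <= ennreal ((1/et^2)*?d x)" by (rule ennreal_leI)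
   also have "... = ennreal (1/et^2)*ennreal (?d x)" by (rule ennreal_mult') simp
   finally show "ennreal ((wgt et x)^2*?d x) <= ennreal (1/et^2)*ennreal (?d x)" .
  qed
  also have "... = ennreal (1/et^2)*(CN x. ennreal (?d x))" by (rule nn_integral_cmult[OF dm])
  also have "... <= ennreal (1/et^2)*ennreal (e*et^2)" by (intro mult_left_mono N(2)[OF n tt]) simp
  also have "... = ennreal (1/et^2*(e*et^2))" by (rule ennreal_mult'[symmetric]) simp
  also have "1/et^2*(e*et^2) = e" using et by simp
  finally show "(CN x. ennreal ((wgt et x)^2*?d x)) <= ennreal e" .
 qed (rule N(1))
qed

lemma mean_limit:
 assumes et: "0 < et" and tt: "lip_symbol B L tt" and S: "(%n. symbol_mass n tt) \<longlonglongrightarrow> S"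
 shows "(%n. (CI x. exp (- ((wgt et x)^2 * var n tt x/2)))) \<longlonglongrightarrow> measure circ (space circ - lev et) + measure circ (lev et)*exp (- S/2)"
proof -
 define J where "J = (%n. measure circ (space circ - lev et) + measure circ (lev et)*exp (- symbol_mass n tt/2))"
 have J: "J \<longlonglongrightarrow> measure circ (space circ - lev et) + measure circ (lev et)*exp (- S/2)"
  unfolding J_def by (intro tendsto_intros S) simp
 have "(%n. (CI x. exp (- ((wgt et x)^2 * var n tt x/2))) - J n) \<longlonglongrightarrow> 0"
 proof (rule tendstoI)
  fix e :: real assume e: "0 < e"
  obtain N where N: "!!n. N <= n ==> (CN x. ennreal ((wgt et x)^2*\<bar>var n tt x - symbol_mass n tt*(2*pi*\<psi> x)\<bar>)) <= ennreal (e/2)"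
   using weighted_L1_limit[OF et, of "e/2" B L] e tt by auto
  have "dist ((CI x. exp (- ((wgt et x)^2 * var n tt x/2))) - J n) 0 < e" if n: "N <= n" for n
  proof -
   let ?f = "%x. exp (- ((wgt et x)^2 * var n tt x/2))"
   let ?g = "%x. exp (- ((wgt et x)^2*(symbol_mass n tt*(2*pi*\<psi> x))/2))"
   have fm: "?f \<in> bm circ" "?g \<in> bm circ"
    using psi_meas by (auto intro!: measurable_circ)
   have pos: "0 <= (wgt et x)^2 * var n tt x/2" "0 <= (wgt et x)^2*(symbol_mass n tt*(2*pi*\<psi> x))/2" for x
    using var_nonneg symbol_mass_nonneg psi_nonneg by simp_all
   have fi: "integrable circ ?f" "integrable circ ?g"
    using fm pos by (auto intro!: integrable_circ_bounded[where B = 1])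
   have gx: "?g x = indicator (space circ - lev et) x + indicator (lev et) x*exp (- symbol_mass n tt/2)" if "x \<in> space circ" for x
   proof -
    have "(wgt et x)^2*(symbol_mass n tt*(2*pi*\<psi> x)) = symbol_mass n tt*((wgt et x)^2*(2*pi*\<psi> x))" by (simp only: mult_ac)
    then have eq: "(wgt et x)^2*(symbol_mass n tt*(2*pi*\<psi> x)) = symbol_mass n tt*(if et <= sd x then 1 else 0)" unfolding wgt(3)[OF et] .
    show ?thesis unfolding eq lev_def using that by (cases "et <= sd x") (simp_all add: indicator_def)
   qed
   have "(CI x. ?g x) = (CI x. indicator (space circ - lev et) x + indicator (lev et) x*exp (- symbol_mass n tt/2))"
    using gx by (intro Bochner_Integration.integral_cong refl) auto
   also have "... = (CI x. indicator (space circ - lev et) x) + (CI x. indicator (lev et) x*exp (- symbol_mass n tt/2))"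
    by (intro Bochner_Integration.integral_add integrable_mult_left circ.integrable_const_bound[where B = 1]) (auto simp: indicator_def)
   also have "... = J n"
    using sets.sets_into_space[OF lev_sets, of et] by (simp add: J_def Int_absorb2)
   finally have gJ: "(CI x. ?g x) = J n" .
   have le: "\<bar>?f x - ?g x\<bar> <= (wgt et x)^2*\<bar>var n tt x - symbol_mass n tt*(2*pi*\<psi> x)\<bar>" for x
   proof -
    have ex: "\<bar>exp (- u) - exp (- v)\<bar> <= \<bar>u - v\<bar>" if uv: "0 <= u" "0 <= v" for u v :: real
    proof -
     have *: "exp (- u) - exp (- v) <= v - u" if "u <= v" "0 <= u" for u v :: real
     proof -
      have "1 - exp (u - v) <= v - u" using exp_ge_add_one_self[of "u - v"] by linarith
      then have "exp (- u)*(1 - exp (u - v)) <= 1*(v - u)" using that by (intro mult_mono) auto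
      then show ?thesis by (simp add: algebra_simps exp_add[symmetric])
     qed
     show ?thesis
     proof (cases "u <= v")
      case True then show ?thesis using *[of u v] uv by simp
     next
      case False then show ?thesis using *[of v u] uv by simp
     qed
    qed
    have half: "\<bar>c*p/2 - c*q/2\<bar> = \<bar>c*(p - q)\<bar>/2" for c p q :: real
     by (simp add: right_diff_distrib diff_divide_distrib[symmetric])
    have "\<bar>?f x - ?g x\<bar> <= \<bar>(wgt et x)^2 * var n tt x/2 - (wgt et x)\<^sup>2*(symbol_mass n tt*(2*pi*\<psi> x))/2\<bar>" by (rule ex[OF pos])
    also have "... = \<bar>(wgt et x)^2*(var n tt x - symbol_mass n tt*(2*pi*\<psi> x))\<bar>/2" by (rule half)
    also have "... <= \<bar>(wgt et x)^2*(var n tt x - symbol_mass n tt*(2*pi*\<psi> x))\<bar>" by simp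
    finally show ?thesis by (simp add: abs_mult)
   qed
   have i: "integrable circ (%x. \<bar>?f x - ?g x\<bar>)" using fi by auto
   have "ennreal (CI x. \<bar>?f x - ?g x\<bar>) = (CN x. ennreal \<bar>?f x - ?g x\<bar>)"
    by (rule nn_integral_eq_integral[OF i, symmetric]) simp
   also have "... <= (CN x. ennreal ((wgt et x)^2*\<bar>var n tt x - symbol_mass n tt*(2*pi*\<psi> x)\<bar>))"
    by (intro nn_integral_mono ennreal_leI le)
   also have "... <= ennreal (e/2)" by (rule N[OF n])
   finally have b: "(CI x. \<bar>?f x - ?g x\<bar>) <= e/2" using e by simp
   have "\<bar>(CI x. ?f x) - J n\<bar> = \<bar>(CI x. ?f x - ?g x)\<bar>" unfolding gJ[symmetric] using fi by simp
   also have "... <= (CI x. \<bar>?f x - ?g x\<bar>)" by (rule integral_abs_bound)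
   finally show ?thesis using b e by (simp add: dist_real_def)
  qed
  then show "eventually (%n. dist ((CI x. exp (- ((wgt et x)^2 * var n tt x/2))) - J n) 0 < e) sequentially"
   unfolding eventually_sequentially by blast
 qed
 from tendsto_add[OF this J] show ?thesis by simp
qed

text \<open>The weight is \<open>1/s\<close> on the level set \<open>s >= et\<close> and \<open>0\<close> elsewhere, so the variance of the weighted sum tends to a constant on the level set.\<close>

lemma AE_two_point_char:
 assumes ep: "0 < ep" and et: "0 < et"
 shows "AE wo in M. \<forall>s t. (%n. (CI x. iexp (s*(wgt et x*F wo n one x) + t*(wgt et x*F wo n one (x + ep/real n))))) \<longlonglongrightarrow>
   cpx (measure circ (space circ - lev et) + measure circ (lev et)*exp (- (s^2 + t^2 + 2*(sin ep/ep) * s*t)/2))"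
proof -
 define ph where "ph = (%wo n s t. (CI x. iexp (s*(wgt et x*F wo n one x) + t*(wgt et x*F wo n one (x + ep/real n)))))"
 define l where "l = (%s t. cpx (measure circ (space circ - lev et) + measure circ (lev et)*exp (- (s^2 + t^2 + 2*(sin ep/ep) * s*t)/2)))"
 have fixed: "AE wo in M. (%n. ph wo n s t) \<longlonglongrightarrow> l s t" for s t
  using AE_phi[OF measurable_wgt wgt(1,2)[OF et] lip_symbol_two_point[OF less_imp_le[OF ep]] mean_limit[OF et lip_symbol_two_point[OF less_imp_le[OF ep]] symbol_mass_two_point[OF ep]], of s t]
 proof eventually_elim
  case (elim wo)
  have e: "\<forall>\<^sub>F n in sequentially. (CI x. iexp (wgt et x*F wo n (two_point ep s t) x)) = ph wo n s t"
   unfolding eventually_sequentially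
  proof (intro exI[of _ 1] allI impI)
   fix n :: nat assume n: "1 <= n"
   show "(CI x. iexp (wgt et x*F wo n (two_point ep s t) x)) = ph wo n s t"
    unfolding ph_def trig_field_two_point[OF n] by (simp add: algebra_simps)
  qed
  from Lim_transform_eventually[OF elim e] show ?case unfolding l_def by simp
 qed
 then have "AE wo in M. \<forall>p q. (%n. ph wo n (of_rat p) (of_rat q)) \<longlonglongrightarrow> l (of_rat p) (of_rat q)"
  by (simp add: AE_all_countable)
 with AE_regular_energy have "AE wo in M. \<forall>s t. (%n. ph wo n s t) \<longlonglongrightarrow> l s t"
 proof eventually_elim
  case (elim wo)
  obtain E where E: "0 <= E" "!!n. 1 <= n ==> energy (%k. a k wo) (%k. b k wo) n/n <= E"
   using regular_energy_consequences(1)[OF Q1 elim(1)] by blast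
  define K where "K = 1/et * sqrt (2*pi*(2*pi*E))"
  have K: "0 <= K" using E et by (simp add: K_def)
  have L1: "integrable circ (%x. \<bar>F wo n tt x\<bar>)" "(CI x. \<bar>F wo n tt x\<bar>) <= sqrt (2*pi*(2*pi*E))"
   if n: "1 <= n" and tt: "!!t. 0 <= t ==> t <= 1 ==> cmod (tt t) <= 1" for n tt
  proof -
   have m: "F wo n tt \<in> bm circ" by (rule measurable_circ) measurable
   note L2 = trig_field_L2[where al = "%k. a k wo" and be = "%k. b k wo" and tt = tt and B = 1, OF n tt]
   show "integrable circ (%x. \<bar>F wo n tt x\<bar>)" by (rule circ_cauchy_schwarz(1)[OF m L2(1)])
   have "(CI x. (F wo n tt x)^2) <= 2*pi*1^2*(energy (%k. a k wo) (%k. b k wo) n/n)" by (rule L2(2))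
   also have "... <= 2*pi*E" using mult_left_mono[OF E(2)[OF n], of "2*pi"] by simp
   finally have "sqrt (2*pi*(CI x. (F wo n tt x)^2)) <= sqrt (2*pi*(2*pi*E))"
    by (intro real_sqrt_le_mono mult_left_mono) auto
   then show "(CI x. \<bar>F wo n tt x\<bar>) <= sqrt (2*pi*(2*pi*E))"
    using circ_cauchy_schwarz(2)[OF m L2(1)] by linarith
  qed
  have lip: "cmod (ph wo n s t - ph wo n s' t') <= K*(\<bar>s - s'\<bar> + \<bar>t - t'\<bar>)" if n: "1 <= n" for n s t s' t'
  proof -
   let ?f = "F wo n one" and ?g = "F wo n (%ta. one ta*cis (ep*ta))"
   have sh: "F wo n one (x + ep/real n) = ?g x" for x
    using trig_field_shift[OF n, of _ _ one x "ep/real n"] n by simp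
   let ?e = "%s t x. iexp (s*(wgt et x*?f x) + t*(wgt et x*?g x))"
   have em: "?e s t \<in> bm circ" for s t by (rule measurable_circ) measurable
   have ei: "integrable circ (?e s t)" for s t by (rule integrable_circ_bounded[OF em, where B = 1]) simp
   have i: "integrable circ (%x. \<bar>s - s'\<bar>*(1/et*\<bar>?f x\<bar>) + \<bar>t - t'\<bar>*(1/et*\<bar>?g x\<bar>))"
    by (intro Bochner_Integration.integrable_add integrable_mult_right L1(1) n) (simp_all add: norm_mult)
   define Y where "Y = (CI x. cmod (?e s t x - ?e s' t' x))"
   have "ph wo n s t - ph wo n s' t' = (CI x. ?e s t x - ?e s' t' x)"
    unfolding ph_def sh using ei by (simp only: Bochner_Integration.integral_diff)
   then have b: "cmod (ph wo n s t - ph wo n s' t') <= Y" unfolding Y_def by (simp only: integral_norm_bound)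
   have "Y <= (CI x. \<bar>s - s'\<bar>*(1/et*\<bar>?f x\<bar>) + \<bar>t - t'\<bar>*(1/et*\<bar>?g x\<bar>))"
    unfolding Y_def
   proof (rule integral_mono[OF _ i])
    show "integrable circ (%x. cmod (?e s t x - ?e s' t' x))" using ei by (intro integrable_norm Bochner_Integration.integrable_diff)
    fix x
    have w: "\<bar>wgt et x*y\<bar> <= 1/et*\<bar>y\<bar>" for y
     unfolding abs_mult using wgt(1,2)[OF et, of x] by (intro mult_right_mono) auto
    have "cmod (?e s t x - ?e s' t' x) <= \<bar>(s*(wgt et x*?f x) + t*(wgt et x*?g x)) - (s'*(wgt et x*?f x) + t'*(wgt et x*?g x))\<bar>"
     by (rule cmod_exp_i_diff)
    also have "... = \<bar>(s - s')*(wgt et x*?f x) + (t - t')*(wgt et x*?g x)\<bar>" by (simp add: algebra_simps)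
    also have "... <= \<bar>s - s'\<bar>*\<bar>wgt et x*?f x\<bar> + \<bar>t - t'\<bar>*\<bar>wgt et x*?g x\<bar>"
     by (rule order_trans[OF abs_triangle_ineq]) (simp only: abs_mult order_refl)
    also have "... <= \<bar>s - s'\<bar>*(1/et*\<bar>?f x\<bar>) + \<bar>t - t'\<bar>*(1/et*\<bar>?g x\<bar>)"
     by (intro add_mono mult_left_mono w) auto
    finally show "cmod (?e s t x - ?e s' t' x) <= \<bar>s - s'\<bar>*(1/et*\<bar>?f x\<bar>) + \<bar>t - t'\<bar>*(1/et*\<bar>?g x\<bar>)" .
   qed
   also have "... = \<bar>s - s'\<bar>*(1/et*(CI x. \<bar>?f x\<bar>)) + \<bar>t - t'\<bar>*(1/et*(CI x. \<bar>?g x\<bar>))"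
    using L1(1)[OF n, of one] L1(1)[OF n, of "%ta. one ta*cis (ep*ta)"]
    by (subst Bochner_Integration.integral_add) (auto simp: norm_mult)
   also have "... <= \<bar>s - s'\<bar>*K + \<bar>t - t'\<bar>*K"
    unfolding K_def using et by (intro add_mono mult_left_mono L1(2) n) (auto simp: norm_mult)
   finally show ?thesis using b by (simp add: algebra_simps)
  qed
  have cont: "continuous_on UNIV (%z. l (fst z) (snd z))"
   unfolding l_def by (intro continuous_intros) auto
  show ?case
  proof (rule allI, rule allI, rule limit_from_rationals[where ph = "ph wo" and l = l and K = K])
   show "cmod (ph wo n s t - ph wo n s' t') <= K*(\<bar>s - s'\<bar> + \<bar>t - t'\<bar>)" if "1 <= n" for n s t s' t'
    using that by (rule lip)
  qed (use K cont elim(2) in auto)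
 qed
 then show ?thesis unfolding ph_def l_def .
qed

text \<open>The symbol of the second derivative, divided by \<open>n^2\<close>, at \<open>x + u ep/n\<close>.\<close>

definition curv :: "real => real => real => complex" where
 "curv ep u t = dsym 2 t*cis (ep*u*t)"

text \<open>The value \<open>21 = 2 * 9 + 3\<close> comes from \<open>2 pi + 1/2 <= 9\<close>; what matters is that it depends neither on \<open>et\<close> nor on \<open>ep\<close>.\<close>

lemma AE_curvature_energy:
 assumes ep: "0 < ep" "ep <= 1" and et: "0 < et"
 shows "AE w in M. eventually (%n. (\<integral>\<^sup>+u. (CN x. ennreal ((wgt et x*F w n (curv ep u) x)^2)) \<partial>unit_interval) <= ennreal 21) sequentially"
proof -
 have lip: "lip_symbol 1 3 (curv ep u)" if u: "0 <= u" "u <= 1" for u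
  unfolding lip_symbol_def
 proof (intro conjI allI impI)
  fix t :: real assume "0 <= t" "t <= 1"
  then show "cmod (curv ep u t) <= 1" by (simp add: curv_def dsym_def norm_mult norm_power power_le_one)
 next
  fix s t :: real assume st: "0 <= s" "s <= 1" "0 <= t" "t <= 1"
  have e: "curv ep u s - curv ep u t = cpx (t^2 - s\<^sup>2)*cis (ep*u * s) - cpx (t^2)*(cis (ep*u * s) - cis (ep*u*t))"
   by (simp add: curv_def dsym_def power_mult_distrib algebra_simps)
  have "cmod (cpx (t^2 - s\<^sup>2)*cis (ep*u * s)) <= 2*\<bar>s - t\<bar>"
  proof -
   have "\<bar>t^2 - s\<^sup>2\<bar> = (s + t)*\<bar>s - t\<bar>" using st by (simp add: power2_eq_square square_diff_square_factored abs_mult abs_minus_commute add.commute)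
   also have "... <= 2*\<bar>s - t\<bar>" using st by (intro mult_right_mono) auto
   finally show ?thesis by (simp only: norm_mult norm_of_real norm_cis mult_1_right)
  qed
  moreover have "cmod (cpx (t^2)*(cis (ep*u * s) - cis (ep*u*t))) <= 1*(1*\<bar>s - t\<bar>)"
   unfolding norm_mult
  proof (intro mult_mono)
   show "cmod (cpx (t^2)) <= 1" using st by (simp add: norm_power power_le_one)
   have "cmod (cis (ep*u * s) - cis (ep*u*t)) <= \<bar>ep*u * s - ep*u*t\<bar>" by (rule cis_lipschitz)
   also have "... = (ep*u)*\<bar>s - t\<bar>" using ep u by (simp add: right_diff_distrib[symmetric] abs_mult)
   also have "... <= 1*\<bar>s - t\<bar>" using ep u by (intro mult_right_mono mult_le_one) auto
   finally show "cmod (cis (ep*u * s) - cis (ep*u*t)) <= 1*\<bar>s - t\<bar>" .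
  qed auto
  ultimately show "cmod (curv ep u s - curv ep u t) <= 3*\<bar>s - t\<bar>" unfolding e using norm_triangle_ineq4 by (smt (verit))
 qed
 obtain N where N: "1 <= N" "!!n tt. N <= n ==> lip_symbol 1 3 tt ==> (CN x. ennreal ((wgt et x)^2*\<bar>var n tt x - symbol_mass n tt*(2*pi*\<psi> x)\<bar>)) <= ennreal (1/2)"
  using weighted_L1_limit[OF et, of "1/2" 1 3] by auto
 have "AE w in M. eventually (%n. (\<integral>\<^sup>+u. (CN x. ennreal ((wgt et x*F w n (curv ep u) x)^2)) \<partial>unit_interval) <= ennreal (2*9 + 3)) sequentially"
 proof (rule AE_local_energy[where B = 1 and L = 3 and ?N0.0 = N, OF measurable_wgt wgt(1,2)[OF et]])
  show "(%u. curv ep u t) \<in> bm borel" for t unfolding curv_def by measurable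
  show "cmod (curv ep u t) <= 1" if "0 <= t" "t <= 1" for u t
   using that by (simp add: curv_def dsym_def norm_mult norm_power power_le_one)
  fix n u assume n: "N <= n" and u: "0 <= u" "u <= (1::real)"
  let ?W = "%x. (wgt et x)^2" and ?tt = "curv ep u"
  let ?d = "%x. \<bar>var n ?tt x - symbol_mass n ?tt*(2*pi*\<psi> x)\<bar>"
  have sm: "symbol_mass n ?tt <= 1" using symbol_mass_le[of n ?tt 1] lip_symbolD(1)[OF lip[OF u]] n N(1) by simp
  have m: "(%x. ennreal (?W x*?d x)) \<in> bm circ" using psi_meas by (intro measurable_circ) measurable
  have "(CN x. ennreal (?W x * var n ?tt x)) <= (CN x. 1 + ennreal (?W x*?d x))"
  proof (rule nn_integral_mono)
   fix x
   have "?W x*(symbol_mass n ?tt*(2*pi*\<psi> x)) = symbol_mass n ?tt*(?W x*(2*pi*\<psi> x))" by (simp only: mult_ac)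
   also have "... <= 1" unfolding wgt(3)[OF et] using sm by simp
   finally have 1: "?W x*(symbol_mass n ?tt*(2*pi*\<psi> x)) <= 1" .
   have "?W x*(var n ?tt x - symbol_mass n ?tt*(2*pi*\<psi> x)) <= ?W x*?d x" by (intro mult_left_mono) auto
   then have "?W x * var n ?tt x <= 1 + ?W x*?d x" using 1 by (simp add: right_diff_distrib)
   then have "ennreal (?W x * var n ?tt x) <= ennreal (1 + ?W x*?d x)" by (rule ennreal_leI)
   then show "ennreal (?W x * var n ?tt x) <= 1 + ennreal (?W x*?d x)" by (simp add: ennreal_plus)
  qed
  also have "... = (CN x. 1) + (CN x. ennreal (?W x*?d x))" by (rule nn_integral_add[OF _ m]) simp
  also have "... <= ennreal (2*pi) + ennreal (1/2)"
   using N(2)[OF n lip[OF u]] emeasure_circ_space by (intro add_mono) auto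
  also have "... = ennreal (2*pi + 1/2)" by (rule ennreal_plus[symmetric]) auto
  also have "... <= ennreal 9" using pi_less_4 by (intro ennreal_leI) linarith
  finally show "(CN x. ennreal (?W x * var n ?tt x)) <= ennreal 9" .
 qed (use lip in auto)
 then show ?thesis by simp
qed

end

lemma measurable_mean_abs:
 assumes g: "continuous_on UNIV g"
 shows "(%x. mean_abs g x h) \<in> bm borel"
proof -
 have gm: "g \<in> bm borel" by (rule borel_measurable_continuous_onI[OF g])
 have i: "(%u. u) \<in> measurable unit_interval borel" by (rule measurable_unit_interval) measurable
 have i2: "(%p. h * snd p) \<in> bm (borel \<Otimes>\<^sub>M unit_interval)"
  by (intro borel_measurable_times borel_measurable_const measurable_compose[OF measurable_snd i])
 have "(%p. fst p + h * snd p) \<in> bm (borel \<Otimes>\<^sub>M unit_interval)"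
  by (intro borel_measurable_add i2) measurable
 from measurable_compose[OF this gm] have "(%p. g (fst p + h * snd p)) \<in> bm (borel \<Otimes>\<^sub>M unit_interval)" .
 then have "(%p. \<bar>g (fst p + h * snd p)\<bar>) \<in> bm (borel \<Otimes>\<^sub>M unit_interval)" by (rule borel_measurable_abs)
 then show ?thesis unfolding mean_abs_def
  by (intro unit_interval.borel_measurable_lebesgue_integral) (simp add: case_prod_unfold)
qed

section \<open>The limiting density of zeros\<close>

lemma mean_abs_markov:
 assumes g: "continuous_on UNIV g" and w [measurable]: "w \<in> bm borel" and w0: "!!x. 0 <= w x" and K: "0 < K"
 shows "emeasure circ {x \<in> space circ. K <= w x*mean_abs g x h} <=
  ennreal (1/K^2)*(\<integral>\<^sup>+u. (CN x. ennreal ((w x*g (x + h*u))^2)) \<partial>unit_interval)"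
proof -
 have gm [measurable]: "g \<in> bm borel" by (rule borel_measurable_continuous_onI[OF g])
 let ?S = "{x \<in> space circ. K <= w x*mean_abs g x h}"
 have S: "?S \<in> sets circ"
 proof -
  have [measurable]: "(%x. w x*mean_abs g x h) \<in> bm circ"
   by (intro measurable_circ borel_measurable_times w measurable_mean_abs[OF g])
  show ?thesis by measurable
 qed
 have jensen: "(w x*mean_abs g x h)^2 <= (\<integral>u. (w x*g (x + h*u))^2 \<partial>unit_interval)" "integrable unit_interval (%u. (w x*g (x + h*u))^2)" for x
 proof -
  let ?X = "%u. \<bar>w x*g (x + h*u)\<bar>"
  have c: "continuous_on UNIV (%u. g (x + h*u))" by (intro continuous_on_compose2[OF g] continuous_intros) auto
  have i: "integrable unit_interval ?X" "integrable unit_interval (%u. (?X u)^2)"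
   by (intro unit_integrable continuous_intros c)+
  then show "integrable unit_interval (%u. (w x*g (x + h*u))^2)" by simp
  have "w x*mean_abs g x h = (\<integral>u. ?X u \<partial>unit_interval)" unfolding mean_abs_def using w0[of x] by (simp add: abs_mult)
  moreover have "0 <= (\<integral>u. (?X u)^2 \<partial>unit_interval) - (\<integral>u. ?X u \<partial>unit_interval)\<^sup>2"
   unfolding unit_interval.variance_eq[OF i, symmetric] by (rule unit_interval.variance_positive)
  ultimately show "(w x*mean_abs g x h)^2 <= (\<integral>u. (w x*g (x + h*u))^2 \<partial>unit_interval)" by simp
 qed
 have pm: "(%p. ennreal ((w (snd p)*g (snd p + h*fst p))^2)) \<in> bm (borel \<Otimes>\<^sub>M borel)" by measurable
 have Im: "(%x. \<integral>\<^sup>+u. ennreal ((w x*g (x + h*u))^2) \<partial>unit_interval) \<in> bm circ"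
 proof -
  have i: "(%u. u) \<in> measurable unit_interval borel" by (rule measurable_unit_interval) measurable
  have "(%p. (snd p, fst p)) \<in> measurable (circ \<Otimes>\<^sub>M unit_interval) (borel \<Otimes>\<^sub>M borel)"
   by (intro measurable_Pair measurable_compose[OF measurable_snd i] measurable_compose[OF measurable_fst measurable_circ_id])
  from measurable_compose[OF this pm] show ?thesis
   by (intro unit_interval.borel_measurable_nn_integral) (simp add: case_prod_unfold)
 qed
 have "emeasure circ ?S = (CN x. indicator ?S x)" using S by simp
 also have "... <= (CN x. ennreal (1/K^2)*(\<integral>\<^sup>+u. ennreal ((w x*g (x + h*u))^2) \<partial>unit_interval))"
 proof (rule nn_integral_mono)
  fix x
  show "indicator ?S x <= ennreal (1/K^2)*(\<integral>\<^sup>+u. ennreal ((w x*g (x + h*u))^2) \<partial>unit_interval)"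
  proof (cases "x \<in> ?S")
   case True
   then have "K^2 <= (w x*mean_abs g x h)^2" using K by (intro power_mono) auto
   also have "... <= (\<integral>u. (w x*g (x + h*u))^2 \<partial>unit_interval)" by (rule jensen(1))
   finally have "1 <= 1/K^2*(\<integral>u. (w x*g (x + h*u))^2 \<partial>unit_interval)" using K by (simp add: field_simps)
   then have "ennreal 1 <= ennreal (1/K^2*(\<integral>u. (w x*g (x + h*u))^2 \<partial>unit_interval))" by (rule ennreal_leI)
   also have "... = ennreal (1/K^2)*ennreal (\<integral>u. (w x*g (x + h*u))^2 \<partial>unit_interval)" by (rule ennreal_mult') simp
   also have "ennreal (\<integral>u. (w x*g (x + h*u))^2 \<partial>unit_interval) = (\<integral>\<^sup>+u. ennreal ((w x*g (x + h*u))^2) \<partial>unit_interval)"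
    by (rule nn_integral_eq_integral[OF jensen(2), symmetric]) simp
   finally show ?thesis using True by simp
  next
   case False
   then have "indicator ?S x = (0::ennreal)" by (rule indicator_simps(2))
   then show ?thesis by (simp only: zero_le)
  qed
 qed
 also have "... = ennreal (1/K^2)*(CN x. \<integral>\<^sup>+u. ennreal ((w x*g (x + h*u))^2) \<partial>unit_interval)" by (rule nn_integral_cmult[OF Im])
 also have "(CN x. \<integral>\<^sup>+u. ennreal ((w x*g (x + h*u))^2) \<partial>unit_interval) = (\<integral>\<^sup>+u. (CN x. ennreal ((w x*g (x + h*u))^2)) \<partial>unit_interval)"
  by (rule tonelli_unit_circ[OF pm, symmetric])
 finally show ?thesis .
qed

lemma sinc_square_less_1:
 fixes ep :: real
 assumes "0 < ep" "ep <= 1"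
 shows "(sin ep/ep)^2 < 1"
proof -
 obtain z where z: "0 < z" "z < ep" "sin ep - sin 0 = (ep - 0)*cos z"
  using MVT2[OF assms(1), of sin cos] DERIV_sin by blast
 have "cos z < cos 0" using z assms pi_gt3 by (intro cos_monotone_0_pi) auto
 moreover have "0 < cos z" using z assms pi_gt3 by (intro cos_gt_zero) auto
 moreover have "sin ep/ep = cos z" using z(3) assms by simp
 ultimately show ?thesis by (simp add: power_less_one_iff abs_square_less_1)
qed

lemma trig_field_continuous: "1 <= n ==> continuous_on UNIV (trig_field al be n tt)"
 using DERIV_continuous[OF trig_field_deriv[of n al be tt]] by (simp add: continuous_on_eq_continuous_within)

lemma dsym_0: "dsym 0 = one"
 by (simp add: dsym_def[abs_def])

text \<open>The derivative average is compared with \<open>4^(q p)\<close>: below it the value is at most \<open>16^(- q p) 4^(q p) = 2^(- 2 q p)\<close>, above it the Markov inequality gains \<open>16^(- q p)\<close>.\<close>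

lemma high_derivative_event:
 fixes al be :: "nat => real"
 assumes n: "1 <= n" and E: "energy al be n/n <= E" and q: "1 <= q"
 defines "ep \<equiv> (1/16::real) ^ q"
 shows "emeasure circ {x \<in> space circ. \<bar>trig_field al be n one x\<bar> <= ep ^ p*mean_abs (trig_field al be n (dsym p)) x (ep/n)}
  <= ennreal (2*gauss_mass (trig_field al be n one) (2*q*p)) + ennreal (2*pi*E*(1/16) ^ (q*p))"
proof -
 let ?f = "trig_field al be n one" and ?g = "trig_field al be n (dsym p)" and ?h = "ep/real n"
 let ?T = "{x \<in> space circ. 4 ^ (q*p) <= 1*mean_abs ?g x ?h}" and ?B = "{x \<in> space circ. \<bar>?f x\<bar> <= (1/2) ^ (2*q*p)}"
 have gc: "continuous_on UNIV ?g" by (rule trig_field_continuous[OF n])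
 have [measurable]: "(%x. 1*mean_abs ?g x ?h) \<in> bm circ" "?f \<in> bm circ"
  using measurable_mean_abs[OF gc] by (auto intro!: measurable_circ)
 have sub: "{x \<in> space circ. \<bar>?f x\<bar> <= ep ^ p*mean_abs ?g x ?h} \<subseteq> ?B \<union> ?T"
 proof
  fix x assume x: "x \<in> {x \<in> space circ. \<bar>?f x\<bar> <= ep ^ p*mean_abs ?g x ?h}"
  show "x \<in> ?B \<union> ?T"
  proof (cases "4 ^ (q*p) <= mean_abs ?g x ?h")
   case False
   have "\<bar>?f x\<bar> <= ep ^ p*mean_abs ?g x ?h" using x by simp
   also have "... <= ep ^ p*4 ^ (q*p)" using False by (intro mult_left_mono) (auto simp: ep_def)
   also have "... = (1/2) ^ (2*q*p)"
   proof -
    have "ep ^ p = (1/16) ^ (q*p)" unfolding ep_def by (rule power_mult[symmetric])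
    then have "ep ^ p*4 ^ (q*p) = (1/16*4) ^ (q*p)" by (simp only: power_mult_distrib)
    moreover have "(1/2::real) ^ (2*q*p) = ((1/2) ^ 2) ^ (q*p)" by (simp only: mult.assoc power_mult[of _ 2 "q*p"])
    ultimately show ?thesis by (simp add: power2_eq_square)
   qed
   finally show ?thesis using x by simp
  qed (use x in auto)
 qed
 have "emeasure circ ?T <= ennreal (1/(4 ^ (q*p))^2)*(\<integral>\<^sup>+u. (CN x. ennreal ((1*?g (x + ?h*u))^2)) \<partial>unit_interval)"
  by (rule mean_abs_markov[OF gc]) auto
 also have "... <= ennreal (1/(4 ^ (q*p))^2)*(\<integral>\<^sup>+u. ennreal (2*pi*E) \<partial>unit_interval)"
 proof (intro mult_left_mono nn_integral_mono)
  fix u :: real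
  let ?tt = "%t. dsym p t*cis (real n*(?h*u)*t)"
  have b: "cmod (?tt t) <= 1" if "0 <= t" "t <= 1" for t
   using that by (simp add: dsym_def norm_mult norm_power power_le_one)
  note L2 = trig_field_L2[where al = al and be = be and tt = ?tt and B = 1, OF n b]
  have "(CN x. ennreal ((1*?g (x + ?h*u))^2)) = (CN x. ennreal ((trig_field al be n ?tt x)^2))"
   unfolding trig_field_shift[OF n] by simp
  also have "... = ennreal (CI x. (trig_field al be n ?tt x)^2)" by (rule nn_integral_eq_integral[OF L2(1)]) auto
  also have "... <= ennreal (2*pi*1^2*(energy al be n/n))" by (rule ennreal_leI[OF L2(2)])
  also have "... <= ennreal (2*pi*E)" using mult_left_mono[OF E, of "2*pi"] by (intro ennreal_leI) simp
  finally show "(CN x. ennreal ((1*?g (x + ?h*u))^2)) <= ennreal (2*pi*E)" .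
 qed simp
 also have "(\<integral>\<^sup>+u. ennreal (2*pi*E) \<partial>unit_interval) = ennreal (2*pi*E)" using unit_interval.emeasure_space_1 by simp
 also have "ennreal (1/(4 ^ (q*p))^2)*ennreal (2*pi*E) = ennreal (1/(4 ^ (q*p))^2*(2*pi*E))" by (rule ennreal_mult'[symmetric]) simp
 also have "1/(4 ^ (q*p))^2*(2*pi*E) = 2*pi*E*(1/16) ^ (q*p)"
 proof -
  have "((4::real) ^ (q*p))^2 = 16 ^ (q*p)" by (simp add: power2_eq_square power_mult_distrib[symmetric])
  then show ?thesis by (simp add: power_one_over field_simps)
 qed
 finally have T: "emeasure circ ?T <= ennreal (2*pi*E*(1/16) ^ (q*p))" .
 have "emeasure circ {x \<in> space circ. \<bar>?f x\<bar> <= ep ^ p*mean_abs ?g x ?h} <= emeasure circ (?B \<union> ?T)"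
  by (rule emeasure_mono[OF sub]) measurable
 also have "... <= emeasure circ ?B + emeasure circ ?T" by (rule emeasure_subadditive) measurable
 also have "... <= ennreal (2*gauss_mass ?f (2*q*p)) + ennreal (2*pi*E*(1/16) ^ (q*p))"
  by (rule add_mono[OF small_ball_le_gauss_mass T]) measurable
 finally show ?thesis .
qed

lemma high_derivative_tail:
 fixes al be :: "nat => real"
 assumes n: "1 <= n" and E: "energy al be n/n <= E" "0 <= E" and q: "1 <= q" and p0: "1 <= p0"
  and tail: "(\<Sum>i. ennreal (gauss_mass (trig_field al be n one) (i + 2*q*Suc p0))) <= ennreal T" and T: "0 <= T"
 defines "ep \<equiv> (1/16::real) ^ q"
 shows "(\<Sum>p. emeasure circ {x \<in> space circ. \<bar>trig_field al be n one x\<bar> <= ep ^ (p + Suc p0)*mean_abs (trig_field al be n (dsym (p + Suc p0))) x (ep/n)})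
  <= ennreal (2*T + 4*pi*E*(1/32) ^ q)"
proof -
 let ?f = "trig_field al be n one"
 let ?G = "%p. ennreal (gauss_mass ?f (p + 2*q*Suc p0))" and ?H = "%p. 2*pi*E*(1/32) ^ q*(1/2) ^ p"
 have fm: "?f \<in> bm borel" by measurable
 have "(\<Sum>p. emeasure circ {x \<in> space circ. \<bar>?f x\<bar> <= ep ^ (p + Suc p0)*mean_abs (trig_field al be n (dsym (p + Suc p0))) x (ep/n)})
  <= (\<Sum>p. ennreal 2*?G p + ennreal (?H p))"
 proof (rule suminf_le)
  fix p
  have "emeasure circ {x \<in> space circ. \<bar>?f x\<bar> <= ep ^ (p + Suc p0)*mean_abs (trig_field al be n (dsym (p + Suc p0))) x (ep/n)}
   <= ennreal (2*gauss_mass ?f (2*q*(p + Suc p0))) + ennreal (2*pi*E*(1/16) ^ (q*(p + Suc p0)))"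
   unfolding ep_def by (rule high_derivative_event[OF n E(1) q])
  also have "... <= ennreal (2*gauss_mass ?f (p + 2*q*Suc p0)) + ennreal (?H p)"
  proof (intro add_mono ennreal_leI mult_left_mono)
   have "p <= 2*q*p" using q by simp
   then have "p + 2*q*Suc p0 <= 2*q*(p + Suc p0)" unfolding distrib_left by linarith
   then show "gauss_mass ?f (2*q*(p + Suc p0)) <= gauss_mass ?f (p + 2*q*Suc p0)"
    by (rule gauss_mass_antimono[OF fm])
   have "1*p + q*2 <= q*p + q*Suc p0" using q p0 by (intro add_mono mult_le_mono) auto
   then have "(1/16::real) ^ (q*(p + Suc p0)) <= (1/16) ^ (p + q*2)" unfolding distrib_left by (intro power_decreasing) auto
   also have "... = (1/16) ^ p*(1/256) ^ q" 
   proof -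
    have "(1/16::real) ^ (q*2) = ((1/16) ^ 2) ^ q" by (simp only: mult.commute[of q 2] power_mult[of _ 2 q])
    then show ?thesis by (simp add: power_add power2_eq_square)
   qed
   also have "... <= (1/2) ^ p*(1/32) ^ q" by (intro mult_mono power_mono) auto
   finally have "2*pi*E*(1/16) ^ (q*(p + Suc p0)) <= 2*pi*E*((1/2) ^ p*(1/32) ^ q)" using E(2) by (intro mult_left_mono) auto
   then show "2*pi*E*(1/16) ^ (q*(p + Suc p0)) <= ?H p" by (simp only: mult_ac)
  qed simp
  also have "ennreal (2*gauss_mass ?f (p + 2*q*Suc p0)) = ennreal 2*?G p" by (rule ennreal_mult') simp
  finally show "emeasure circ {x \<in> space circ. \<bar>?f x\<bar> <= ep ^ (p + Suc p0)*mean_abs (trig_field al be n (dsym (p + Suc p0))) x (ep/n)} <= ennreal 2*?G p + ennreal (?H p)" .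
 qed (auto intro: summableI)
 also have "... = (\<Sum>p. ennreal 2*?G p) + (\<Sum>p. ennreal (?H p))" by (rule suminf_add[symmetric]) (auto intro: summableI)
 also have "(\<Sum>p. ennreal 2*?G p) = ennreal 2*(\<Sum>p. ?G p)" by simp
 also have "ennreal 2*(\<Sum>p. ?G p) <= ennreal 2*ennreal T" by (intro mult_left_mono tail) simp
 also have "ennreal 2*ennreal T = ennreal (2*T)" by (rule ennreal_mult'[symmetric]) simp
 also have "(\<Sum>p. ennreal (?H p)) = ennreal (4*pi*E*(1/32) ^ q)"
 proof -
  have "?H sums (2*pi*E*(1/32) ^ q*(1/(1 - 1/2)))" by (intro sums_mult geometric_sums) simp
  moreover have "2*pi*E*(1/32) ^ q*(1/(1 - 1/2)) = 4*pi*E*(1/32) ^ q" by simp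
  ultimately have s: "?H sums (4*pi*E*(1/32) ^ q)" by (simp only:)
  have "(\<Sum>p. ennreal (?H p)) = ennreal (\<Sum>p. ?H p)"
   by (rule suminf_ennreal2[OF _ sums_summable[OF s]]) (use E(2) in simp)
  then show ?thesis unfolding sums_unique[OF s, symmetric] .
 qed
 also have "ennreal (2*T) + ennreal (4*pi*E*(1/32) ^ q) = ennreal (2*T + 4*pi*E*(1/32) ^ q)"
  using T E(2) by (intro ennreal_plus[symmetric]) auto
 finally show ?thesis by (simp add: add_right_mono)
qed

context gauss_spectral begin

text \<open>With \<open>ep = 16^(- q)\<close>, exceptional windows must have measure \<open>o(16^(- q))\<close>. In the event with \<open>p = 2\<close> the threshold \<open>8^q\<close> for the weighted second derivative leaves \<open>ep^2 8^q = 32^(- q)\<close> as the bound on the weighted value and \<open>64^(- q)\<close> from the Markov inequality. The choice of \<open>p0\<close> makes the events with \<open>p > p0\<close> of order \<open>32^(- q)\<close> too; windows with two up to \<open>p0\<close> zeros belong to the event with \<open>p = 2\<close>, which is therefore counted \<open>p0\<close> times.\<close>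

lemma zero_count_bounds:
 fixes wo :: 'w and q p0 :: nat
 defines "ep \<equiv> (1/16::real) ^ q"
 defines "rh \<equiv> sin ep/ep"
 defines "P \<equiv> 1/2 - arctan (rh/sqrt (1 - rh\<^sup>2))/pi"
 assumes q: "1 <= q" and et: "0 < et" and pos: "0 < measure circ (lev et)" and e: "0 < e"
  and char: "!!s t. (%n. (CI x. iexp (s*(wgt et x*F wo n one x) + t*(wgt et x*F wo n one (x + ep/real n))))) \<longlonglongrightarrow>
   cpx (measure circ (space circ - lev et) + measure circ (lev et)*exp (- (s^2 + t^2 + 2*rh * s*t)/2))"
 shows zero_count_lower: "eventually (%n. finite {t \<in> {0..2*pi}. F wo n one t = 0} -->
   16 ^ q*(measure circ (lev et)*(P - e)) <= (real (card {t \<in> {0..2*pi}. F wo n one t = 0}) + 1)/n) sequentially"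
  and zero_count_upper: "[|1 <= p0; qb ^ (2*Suc p0) <= 1/32; 0 <= C; 0 <= E; !!n. 1 <= n ==> energy (%k. a k wo) (%k. b k wo) n/n <= E;
   eventually (%n. (\<integral>\<^sup>+u. (CN x. ennreal ((wgt et x*F wo n (curv ep u) x)^2)) \<partial>unit_interval) <= ennreal 21) sequentially;
   !!I. eventually (%n. (\<Sum>i. ennreal (gauss_mass (F wo n one) (i + I))) <= ennreal (C*qb ^ I)) sequentially|] ==>
   eventually (%n. \<forall>Z. finite Z --> Z \<subseteq> {0..<2*pi} --> (\<forall>z\<in>Z. F wo n one z = 0) -->
    real (card Z)/n <= 16 ^ q*(real (1 + p0)*measure circ (space circ - lev et) + 2*pi*(P + e)) + (37*real p0 + 2*C + 4*pi*E)*(1/2) ^ q) sequentially"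
proof -
 let ?La = "measure circ (lev et)" and ?Lc = "measure circ (space circ - lev et)"
 let ?X = "%n x. wgt et x*F wo n one x" and ?V = "%n x. wgt et x*F wo n one (x + ep/real n)"
 have ep: "0 < ep" "ep <= 1" by (simp_all add: ep_def power_le_one)
 have e16: "16 ^ q*ep = 1" by (simp add: ep_def power_mult_distrib[symmetric])
 have rh1: "rh^2 < 1" unfolding rh_def by (rule sinc_square_less_1[OF ep])
 have P0: "0 < P" using arctan_ubound[of "rh/sqrt (1 - rh\<^sup>2)"] by (simp add: P_def field_simps)
 have La: "?La <= 2*pi" using circ.bounded_measure[of "lev et"] by (simp add: measure_circ_space)
 have La0: "0 <= ?La" by simp
 have Xm: "?X n \<in> bm circ" "?V n \<in> bm circ" for n by (auto intro!: measurable_circ)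
 have off: "\<forall>n. \<forall>x\<in>space circ - lev et. ?X n x = 0 \<and> ?V n x = 0" using wgt(5)[OF et] by simp
 note lim = limits_on_subset[where A = "lev et" and X = ?X and V = ?V and rh = rh, OF lev_sets pos Xm off rh1 char]
 have fm [measurable]: "(%x. F wo n one x) \<in> bm circ" "(%x. F wo n one (x + c)) \<in> bm circ" for n c
  by (auto intro!: measurable_circ)
 have sgn: "?X n x*?V n x = (wgt et x)^2*(F wo n one x*F wo n one (x + ep/real n))" for n x by (simp add: power2_eq_square)
 show "eventually (%n. finite {t \<in> {0..2*pi}. F wo n one t = 0} -->
   16 ^ q*(?La*(P - e)) <= (real (card {t \<in> {0..2*pi}. F wo n one t = 0}) + 1)/n) sequentially"
  using lim(2)[OF e, folded P_def] eventually_ge_at_top[of 1]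
 proof eventually_elim
  case (elim n)
  show ?case
  proof
   let ?Z = "{t \<in> {0..2*pi}. F wo n one t = 0}" and ?h = "ep/real n"
   assume fin: "finite ?Z"
   have h: "0 < ?h" "?h <= 1" using ep elim(2) by (simp_all add: field_simps)
   have "?La*(P - e) <= measure circ {x \<in> lev et. ?X n x*?V n x < 0}" using elim(1) by simp
   also have "... <= measure circ {x \<in> space circ. F wo n one x*F wo n one (x + ?h) < 0}"
   proof (rule circ.finite_measure_mono)
    show "{x \<in> lev et. ?X n x*?V n x < 0} \<subseteq> {x \<in> space circ. F wo n one x*F wo n one (x + ?h) < 0}"
     unfolding sgn using sets.sets_into_space[OF lev_sets, of et] by (auto simp: mult_less_0_iff)
   qed measurable
   also have "... <= ?h*(real (card ?Z) + 1)"
   proof -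
    have "emeasure circ {x \<in> space circ. F wo n one x*F wo n one (x + ?h) < 0} <= ennreal (?h*(real (card ?Z) + 1))"
     by (rule zeros_lower[OF trig_field_continuous[OF elim(2)] h fin])
    then show ?thesis using h by (subst (asm) circ.emeasure_eq_measure) (simp only: ennreal_le_iff mult_nonneg_nonneg)
   qed
   finally have "16 ^ q*(?La*(P - e)) <= 16 ^ q*(ep/real n*(real (card ?Z) + 1))" by (intro mult_left_mono) auto
   also have "... = (16 ^ q*ep)*(real (card ?Z) + 1)/n" by simp
   finally show "16 ^ q*(?La*(P - e)) <= (real (card ?Z) + 1)/n" unfolding e16 by simp
  qed
 qed
 assume p0: "1 <= p0" and qb32: "qb ^ (2*Suc p0) <= 1/32" and C: "0 <= C" and E: "0 <= E" "!!n. 1 <= n ==> energy (%k. a k wo) (%k. b k wo) n/n <= E"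
  and curv: "eventually (%n. (\<integral>\<^sup>+u. (CN x. ennreal ((wgt et x*F wo n (curv ep u) x)^2)) \<partial>unit_interval) <= ennreal 21) sequentially"
  and tail: "!!I. eventually (%n. (\<Sum>i. ennreal (gauss_mass (F wo n one) (i + I))) <= ennreal (C*qb ^ I)) sequentially"
 define de where "de = (1/32::real) ^ q"
 have de: "0 < de" by (simp add: de_def)
 define T where "T = C*qb ^ (2*q*Suc p0)"
 have T: "0 <= T" "T <= C*de"
 proof -
  show "0 <= T" using C qb by (simp add: T_def)
  have "qb ^ (2*q*Suc p0) = (qb ^ (2*Suc p0)) ^ q" by (simp only: power_mult[symmetric] mult_ac)
  also have "... <= (1/32) ^ q" using qb qb32 by (intro power_mono) auto
  finally show "T <= C*de" unfolding T_def de_def using C by (intro mult_left_mono) auto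
 qed
 show "eventually (%n. \<forall>Z. finite Z --> Z \<subseteq> {0..<2*pi} --> (\<forall>z\<in>Z. F wo n one z = 0) -->
    real (card Z)/n <= 16 ^ q*(real (1 + p0)*?Lc + 2*pi*(P + e)) + (37*real p0 + 2*C + 4*pi*E)*(1/2) ^ q) sequentially"
  using lim(1)[OF e, folded P_def] lim(3)[OF de] curv tail[of "2*q*Suc p0"] eventually_ge_at_top[of 1]
 proof eventually_elim
  case (elim n)
  note n = elim(5)
  let ?h = "ep/real n" and ?g = "%p. trig_field (%k. a k wo) (%k. b k wo) n (dsym p)"
  define Ev where "Ev = (%p. {x \<in> space circ. \<bar>?g 0 x\<bar> <= (real n*?h) ^ p*mean_abs (?g p) x ?h})"
  have h: "0 < ?h" "?h <= 1" using ep n by (simp_all add: field_simps)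
  have nh: "real n*?h = ep" using n by simp
  have gc: "continuous_on UNIV (?g p)" for p by (rule trig_field_continuous[OF n])
  have mm: "(%x. mean_abs (?g p) x ?h) \<in> bm borel" for p by (rule measurable_mean_abs[OF gc])
  have d: "(?g p has_real_derivative real n*?g (Suc p) y) (at y)" for p y
   using trig_field_deriv[OF n, of "%k. a k wo" "%k. b k wo" "dsym p" y] unfolding dsym_Suc .
  have term1: "emeasure circ {x \<in> space circ. ?g 0 x*?g 0 (x + ?h) <= 0} <= ennreal (?Lc + 2*pi*(P + e))"
  proof -
   have "measure circ {x \<in> space circ. ?g 0 x*?g 0 (x + ?h) <= 0} <= measure circ ((space circ - lev et) \<union> {x \<in> lev et. ?X n x*?V n x <= 0})"
   proof (rule circ.finite_measure_mono)
    show "{x \<in> space circ. ?g 0 x*?g 0 (x + ?h) <= 0} \<subseteq> (space circ - lev et) \<union> {x \<in> lev et. ?X n x*?V n x <= 0}"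
     unfolding sgn dsym_0 by (auto simp: mult_le_0_iff)
    have [measurable]: "?X n \<in> bm circ" "?V n \<in> bm circ" by (rule Xm)+
    show "(space circ - lev et) \<union> {x \<in> lev et. ?X n x*?V n x <= 0} \<in> sets circ" by measurable
   qed
   also have "... <= ?Lc + measure circ {x \<in> lev et. ?X n x*?V n x <= 0}"
   proof (rule measure_Un_le)
    have [measurable]: "?X n \<in> bm circ" "?V n \<in> bm circ" by (rule Xm)+
    show "{x \<in> lev et. ?X n x*?V n x <= 0} \<in> sets circ" by measurable
   qed measurable
   also have "... <= ?Lc + 2*pi*(P + e)"
   proof -
    have "?La*(P + e) <= 2*pi*(P + e)" using P0 e by (intro mult_right_mono La) simp
    then show ?thesis using elim(1) by linarith
   qed
   finally show ?thesis by (simp only: circ.emeasure_eq_measure ennreal_leI)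
  qed
  have term2: "emeasure circ (Ev 2) <= ennreal (?Lc + 37*de)"
  proof -
   let ?T = "{x \<in> space circ. 8 ^ q <= wgt et x*mean_abs (?g 2) x ?h}" and ?B = "{x \<in> lev et. \<bar>?X n x\<bar> <= de}"
   have Tm: "?T \<in> sets circ"
   proof -
    have [measurable]: "(%x. wgt et x*mean_abs (?g 2) x ?h) \<in> bm circ" using mm[of 2] by (intro measurable_circ) measurable
    show ?thesis by measurable
   qed
   have Bm: "?B \<in> sets circ"
   proof -
    have [measurable]: "?X n \<in> bm circ" by (rule Xm)
    show ?thesis by measurable
   qed
   have sub: "Ev 2 \<subseteq> ((space circ - lev et) \<union> ?B) \<union> ?T"
   proof
    fix x assume x: "x \<in> Ev 2"
    show "x \<in> ((space circ - lev et) \<union> ?B) \<union> ?T"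
    proof (cases "x \<in> lev et \<and> \<not> 8 ^ q <= wgt et x*mean_abs (?g 2) x ?h")
     case True
     have "\<bar>?X n x\<bar> = wgt et x*\<bar>?g 0 x\<bar>" unfolding dsym_0 using wgt(1)[OF et, of x] by (simp add: abs_mult)
     also have "... <= wgt et x*(ep^2*mean_abs (?g 2) x ?h)" using x wgt(1)[OF et, of x] unfolding Ev_def nh by (intro mult_left_mono) auto
     also have "... = ep^2*(wgt et x*mean_abs (?g 2) x ?h)" by simp
     also have "... <= ep^2*8 ^ q" using True by (intro mult_left_mono) auto
     also have "... = de" unfolding ep_def de_def power2_eq_square power_mult_distrib[symmetric] by simp
     finally show ?thesis using True by simp
    qed (use x in \<open>auto simp: Ev_def\<close>)
   qed
   have TT: "emeasure circ ?T <= ennreal (21*de)"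
   proof -
    have cu: "wgt et x*?g 2 (x + ?h*u) = wgt et x*F wo n (curv ep u) x" for x u
    proof -
     have "(%t. dsym 2 t*cis (real n*(?h*u)*t)) = curv ep u" unfolding curv_def[abs_def] using n by (simp add: mult.assoc)
     then show ?thesis unfolding trig_field_shift[OF n] by simp
    qed
    have "emeasure circ ?T <= ennreal (1/(8 ^ q)^2)*(\<integral>\<^sup>+u. (CN x. ennreal ((wgt et x*?g 2 (x + ?h*u))^2)) \<partial>unit_interval)"
     by (rule mean_abs_markov[OF gc measurable_wgt wgt(1)[OF et]]) simp
    also have "... <= ennreal (1/(8 ^ q)^2)*ennreal 21" unfolding cu by (intro mult_left_mono elim(3)) simp
    also have "... = ennreal (1/(8 ^ q)^2*21)" by (rule ennreal_mult'[symmetric]) simp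
    also have "... <= ennreal (21*de)"
    proof -
     have "1/(8 ^ q)^2 = (1/64::real) ^ q" by (simp add: power2_eq_square power_mult_distrib[symmetric] power_one_over)
     also have "... <= de" unfolding de_def by (intro power_mono) auto
     finally show ?thesis by (intro ennreal_leI) simp
    qed
    finally show ?thesis .
   qed
   have BB: "measure circ ?B <= 16*de"
   proof -
    have "measure circ ?B <= ?La*(2*de)" using elim(2) by simp
    also have "... <= 8*(2*de)" using La pi_less_4 de by (intro mult_right_mono) auto
    finally show ?thesis by simp
   qed
   have "emeasure circ (Ev 2) <= emeasure circ (((space circ - lev et) \<union> ?B) \<union> ?T)" using Tm Bm by (intro emeasure_mono sub) auto
   also have "... <= emeasure circ ((space circ - lev et) \<union> ?B) + emeasure circ ?T" using Tm Bm by (intro emeasure_subadditive) auto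
   also have "... <= ennreal (?Lc + 16*de) + ennreal (21*de)"
   proof (rule add_mono[OF _ TT])
    have "measure circ ((space circ - lev et) \<union> ?B) <= ?Lc + measure circ ?B" using Bm by (intro measure_Un_le) auto
    then show "emeasure circ ((space circ - lev et) \<union> ?B) <= ennreal (?Lc + 16*de)" using BB by (simp add: circ.emeasure_eq_measure ennreal_leI)
   qed
   also have "... = ennreal ((?Lc + 16*de) + 21*de)" using de by (intro ennreal_plus[symmetric]) auto
   also have "(?Lc + 16*de) + 21*de = ?Lc + 37*de" by simp
   finally show ?thesis .
  qed
  have term3: "(\<Sum>p. emeasure circ (Ev (p + Suc p0))) <= ennreal ((2*C + 4*pi*E)*de)"
  proof -
   have "(\<Sum>p. emeasure circ (Ev (p + Suc p0))) <= ennreal (2*T + 4*pi*E*de)"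
    unfolding Ev_def nh dsym_0 unfolding ep_def de_def
    by (rule high_derivative_tail[OF n E(2)[OF n] E(1) q p0 elim(4)[folded T_def] T(1)])
   also have "... <= ennreal ((2*C + 4*pi*E)*de)" using T(2) by (intro ennreal_leI) (simp add: algebra_simps)
   finally show ?thesis .
  qed
  show ?case
  proof (intro allI impI)
   fix Z assume Z: "finite Z" "Z \<subseteq> {0..<2*pi}" "\<forall>z\<in>Z. F wo n one z = 0"
   define A1 A2 A3 where "A1 = ?Lc + 2*pi*(P + e)" and "A2 = ?Lc + 37*de" and "A3 = (2*C + 4*pi*E)*de"
   have A: "0 <= A1" "0 <= A2" "0 <= A3" using P0 e de C E by (simp_all add: A1_def A2_def A3_def)
   have "ennreal (?h*real (card Z)) <= emeasure circ {x \<in> space circ. ?g 0 x*?g 0 (x + ?h) <= 0} + ennreal (real p0)*emeasure circ (Ev 2)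
    + (\<Sum>p. emeasure circ (Ev (p + Suc p0)))"
    unfolding Ev_def
   proof (rule zeros_upper[where g = ?g and c = "real n"])
    show "?g 0 (x + 2*pi) = ?g 0 x" for x by (rule trig_field_periodic)
    show "?g 0 z = 0" if "z \<in> Z" for z unfolding dsym_0 using Z(3) that by simp
   qed (use d n h Z p0 mm in auto)
   also have "... <= ennreal A1 + ennreal (real p0)*ennreal A2 + ennreal A3"
    unfolding A1_def A2_def A3_def by (intro add_mono mult_left_mono term1 term2 term3) simp
   also have "... = ennreal (A1 + real p0*A2 + A3)"
    using A by (simp add: ennreal_plus ennreal_mult)
   finally have "?h*real (card Z) <= A1 + real p0*A2 + A3" using A by (subst (asm) ennreal_le_iff) auto
   then have le: "16 ^ q*(?h*real (card Z)) <= 16 ^ q*(A1 + real p0*A2 + A3)" by (intro mult_left_mono) auto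
   have "16 ^ q*(?h*real (card Z)) = (16 ^ q*ep)*(real (card Z)/n)" by simp
   then have i1: "16 ^ q*(?h*real (card Z)) = real (card Z)/n" unfolding e16 mult_1_left .
   have i2: "16 ^ q*(A1 + real p0*A2 + A3) = 16 ^ q*(real (1 + p0)*?Lc + 2*pi*(P + e)) + (37*real p0 + 2*C + 4*pi*E)*(16 ^ q*de)"
    by (simp add: A1_def A2_def A3_def algebra_simps)
   have i3: "16 ^ q*de = (1/2) ^ q" unfolding de_def power_mult_distrib[symmetric] by simp
   show "real (card Z)/n <= 16 ^ q*(real (1 + p0)*?Lc + 2*pi*(P + e)) + (37*real p0 + 2*C + 4*pi*E)*(1/2) ^ q"
    using le unfolding i1 i2 i3 .
  qed
 qed
qed

lemma lev_exhausts: "(%m. measure circ (space circ - lev (1/(real m + 1)))) \<longlonglongrightarrow> 0"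
proof -
 let ?B = "%m. space circ - lev (1/(real m + 1))"
 have "(%m. measure circ (?B m)) \<longlonglongrightarrow> measure circ (\<Inter>m. ?B m)"
 proof (rule circ.finite_Lim_measure_decseq)
  show "decseq ?B"
  proof (rule decseq_SucI)
   fix m
   have "1/(real (Suc m) + 1) <= 1/(real m + 1)" by (simp add: field_simps)
   then show "?B (Suc m) \<subseteq> ?B m" by (auto simp: lev_def)
  qed
 qed auto
 moreover have "measure circ (\<Inter>m. ?B m) = 0"
 proof -
  have "AE x in circ. x \<notin> (\<Inter>m. ?B m)" using psi_pos
  proof eventually_elim
   case (elim x)
   then have "0 < sd x" by (simp add: sd_def)
   then obtain m where "1/(real m + 1) < sd x" using reals_Archimedean[of "sd x"] by (auto simp: inverse_eq_divide add.commute)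
   then have "x \<notin> ?B m" by (simp add: lev_def)
   then show ?case by blast
  qed
  moreover have "(\<Inter>m. ?B m) \<in> sets circ" by measurable
  ultimately have "(\<Inter>m. ?B m) \<in> null_sets circ" by (subst AE_iff_null_sets)
  then have "emeasure circ (\<Inter>m. ?B m) = 0" by (rule null_setsD1)
  then show ?thesis by (simp add: measure_def)
 qed
 ultimately show ?thesis by simp
qed

end

definition sign_prob :: "nat => real" where
 "sign_prob q = 1/2 - arctan ((sin ((1/16) ^ q)/(1/16) ^ q)/sqrt (1 - (sin ((1/16) ^ q)/(1/16) ^ q)\<^sup>2))/pi"

lemma sign_prob_limit: "(%q. 16 ^ q*(2*pi * sign_prob q)) \<longlonglongrightarrow> 2/sqrt 3"
proof -
 have "filterlim (%q. (1/16::real) ^ q) (at_right 0) sequentially"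
  by (rule tendsto_imp_filterlim_at_right) (auto intro!: LIMSEQ_power_zero)
 from filterlim_compose[OF sinc_asymptotics this]
 have "(%q. 2*pi/(1/16) ^ q * sign_prob q) \<longlonglongrightarrow> 2/sqrt 3" unfolding sign_prob_def .
 moreover have "2*pi/(1/16) ^ q*x = 16 ^ q*(2*pi*x)" for q x by (simp add: power_one_over)
 ultimately show ?thesis by simp
qed

lemma sign_prob_bounds: "0 <= sign_prob q" "sign_prob q <= 1"
 using arctan_bounded[of "(sin ((1/16) ^ q)/(1/16) ^ q)/sqrt (1 - (sin ((1/16) ^ q)/(1/16) ^ q)\<^sup>2)"]
 by (simp_all add: sign_prob_def field_simps)

text \<open>The half-open interval omits the endpoint \<open>2 pi\<close>, whence the additional \<open>1\<close>. A uniform bound on finite subsets also excludes infinitely many zeros.\<close>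

lemma card_from_subsets:
 assumes le: "!!Z. finite Z ==> Z \<subseteq> {0..<2*pi} ==> (\<forall>z\<in>Z. f z = 0) ==> real (card Z) <= B"
 shows "finite {t \<in> {0..2*pi}. f t = 0}" "real (card {t \<in> {0..2*pi}. f t = 0}) <= B + 1"
proof -
 let ?H = "{t \<in> {0..<2*pi}. f t = 0}"
 have fin: "finite ?H"
 proof (rule ccontr)
  assume "infinite ?H"
  then obtain Z where Z: "finite Z" "card Z = nat \<lceil>B\<rceil> + 1" "Z \<subseteq> ?H" using infinite_arbitrarily_large by blast
  then have "real (card Z) <= B" by (intro le) auto
  then show False using Z(2) by linarith
 qed
 have sub: "{t \<in> {0..2*pi}. f t = 0} \<subseteq> insert (2*pi) ?H" by auto
 show "finite {t \<in> {0..2*pi}. f t = 0}" using finite_subset[OF sub] fin by simp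
 have "card {t \<in> {0..2*pi}. f t = 0} <= card (insert (2*pi) ?H)" using fin by (intro card_mono sub) simp
 also have "... <= card ?H + 1" using fin by (simp add: card_insert_if)
 finally have "card {t \<in> {0..2*pi}. f t = 0} <= card ?H + 1" .
 moreover have "real (card ?H) <= B" using fin by (intro le) auto
 ultimately show "real (card {t \<in> {0..2*pi}. f t = 0}) <= B + 1" by linarith
qed

context gauss_spectral begin

text \<open>The parameters are fixed in the order \<open>q\<close>, then the level \<open>1/(m + 1)\<close> of the density, then \<open>n\<close>: the error from low density carries the factor \<open>16^q\<close> and vanishes only as \<open>m\<close> grows.\<close>

theorem AE_num_zeros: "AE wo in M. (%n. num_zeros (F wo n one) {0..2*pi} / of_nat n) \<longlonglongrightarrow> ennreal (2/sqrt 3)"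
proof -
 define ep where "ep = (%q. (1/16::real) ^ q)"
 define et where "et = (%m. 1/(real m + 1))"
 have ep: "0 < ep q" "ep q <= 1" for q by (simp_all add: ep_def power_le_one)
 have et: "0 < et m" for m by (simp add: et_def)
 have c: "AE wo in M. \<forall>q m. \<forall>s t. (%n. (CI x. iexp (s*(wgt (et m) x*F wo n one x) + t*(wgt (et m) x*F wo n one (x + ep q/real n))))) \<longlonglongrightarrow>
   cpx (measure circ (space circ - lev (et m)) + measure circ (lev (et m))*exp (- (s^2 + t^2 + 2*(sin (ep q)/ep q) * s*t)/2))"
  unfolding AE_all_countable using AE_two_point_char[OF ep(1) et] by blast
 have v: "AE wo in M. \<forall>q m. eventually (%n. (\<integral>\<^sup>+u. (CN x. ennreal ((wgt (et m) x*F wo n (curv (ep q) u) x)^2)) \<partial>unit_interval) <= ennreal 21) sequentially"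
  unfolding AE_all_countable using AE_curvature_energy[OF ep et] by blast
 from c v AE_small_ball_tail AE_regular_energy show ?thesis
 proof eventually_elim
  case (elim wo)
  let ?Z = "%n. {t \<in> {0..2*pi}. F wo n one t = 0}"
  obtain E where E: "0 <= E" "!!n. 1 <= n ==> energy (%k. a k wo) (%k. b k wo) n/n <= E"
   using regular_energy_consequences(1)[OF Q1 elim(4)] by blast
  obtain C where C: "0 <= C" "!!I. eventually (%n. (\<Sum>i. ennreal (gauss_mass (F wo n one) (i + I))) <= ennreal (C*qb ^ I)) sequentially"
   using elim(3) by blast
  obtain p where p: "qb ^ p < 1/32" using real_arch_pow_inv[of "1/32" qb] qb by auto
  define p0 where "p0 = Suc p"
  have p0: "1 <= p0" by (simp add: p0_def)
  have "qb ^ (2*Suc p0) <= qb ^ p" using qb by (intro power_decreasing) (auto simp: p0_def)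
  then have qb32: "qb ^ (2*Suc p0) <= 1/32" using p by linarith
  define D where "D = 37*real p0 + 2*C + 4*pi*E"
  have main: "eventually (%n. finite (?Z n) \<and> \<bar>real (card (?Z n))/n - 2/sqrt 3\<bar> < e) sequentially" if e: "0 < e" for e
  proof -
   have "(%q. D*(1/2) ^ q) \<longlonglongrightarrow> D*0" by (intro tendsto_mult_left LIMSEQ_power_zero) simp
   then have "eventually (%q. D*(1/2) ^ q < e/4) sequentially" using e by (intro order_tendstoD) auto
   moreover have "eventually (%q. dist (16 ^ q*(2*pi * sign_prob q)) (2/sqrt 3) < e/4) sequentially" using e by (intro tendstoD[OF sign_prob_limit]) simp
   ultimately have "eventually (%q. 1 <= q \<and> D*(1/2) ^ q < e/4 \<and> \<bar>16 ^ q*(2*pi * sign_prob q) - 2/sqrt 3\<bar> < e/4) sequentially"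
    using eventually_ge_at_top[of 1] by eventually_elim (simp add: dist_real_def)
   then obtain q where q: "1 <= q" "D*(1/2) ^ q < e/4" "\<bar>16 ^ q*(2*pi * sign_prob q) - 2/sqrt 3\<bar> < e/4"
    unfolding eventually_sequentially by blast
   define P where "P = sign_prob q"
   define e' where "e' = e/(16 ^ q*(2*pi)*8)"
   have e': "0 < e'" "16 ^ q*(2*pi*e') = e/8" using e by (simp_all add: e'_def)
   have "(%m. 16 ^ q*(real (1 + p0)*measure circ (space circ - lev (et m)))) \<longlonglongrightarrow> 16 ^ q*(real (1 + p0)*0)"
    unfolding et_def by (intro tendsto_mult_left lev_exhausts)
   then have "eventually (%m. 16 ^ q*(real (1 + p0)*measure circ (space circ - lev (et m))) < e/8) sequentially" by (rule order_tendstoD(2)) (use e in simp)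
   moreover have "eventually (%m. measure circ (space circ - lev (et m)) < 1) sequentially" unfolding et_def by (rule order_tendstoD(2)[OF lev_exhausts]) simp
   ultimately have "eventually (%m. 16 ^ q*(real (1 + p0)*measure circ (space circ - lev (et m))) < e/8 \<and> measure circ (space circ - lev (et m)) < 1) sequentially"
    by eventually_elim simp
   then obtain m where m: "16 ^ q*(real (1 + p0)*measure circ (space circ - lev (et m))) < e/8" "measure circ (space circ - lev (et m)) < 1"
    unfolding eventually_sequentially by blast
   have q3: "2/sqrt 3 - e/4 < 16 ^ q*(2*pi*P)" "16 ^ q*(2*pi*P) < 2/sqrt 3 + e/4"
    using q(3) unfolding P_def abs_diff_less_iff by auto
   have ar1: "u < l + e*3/4" if "u = x + y + z + w" "x < e/8" "y < l + e/4" "z = e/8" "w < e/4" for u l x y z w :: real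
    using that by linarith
   have ar2: "l - e*3/4 < c" if "L <= c + d" "L = y - x - z + w" "x <= x'" "0 <= w" "x' < e/8" "l - e/4 < y" "z = e/8" "d < e/4"
    for L c d y x z w x' l :: real using that by linarith
   have ar3: "\<bar>c - l\<bar> < e" if "c <= u + d" "u < l + e*3/4" "d < e/4" "l - e*3/4 < c" for c u d l :: real
    using that e by (simp add: abs_diff_less_iff)
   define La Lc where "La = measure circ (lev (et m))" and "Lc = measure circ (space circ - lev (et m))"
   have LaLc: "La = 2*pi - Lc" using circ.finite_measure_compl[of "lev (et m)"] by (simp add: La_def Lc_def measure_circ_space)
   have Lc0: "0 <= Lc" by (simp add: Lc_def)
   have pos: "0 < measure circ (lev (et m))" using LaLc m(2) pi_gt3 unfolding La_def Lc_def by linarith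
   have ch: "!!s t. (%n. (CI x. iexp (s*(wgt (et m) x*F wo n one x) + t*(wgt (et m) x*F wo n one (x + (1/16) ^ q/real n))))) \<longlonglongrightarrow>
    cpx (measure circ (space circ - lev (et m)) + measure circ (lev (et m))*exp (- (s^2 + t^2 + 2*(sin ((1/16) ^ q)/(1/16) ^ q) * s*t)/2))"
    using elim(1) unfolding ep_def by blast
   have cu: "eventually (%n. (\<integral>\<^sup>+u. (CN x. ennreal ((wgt (et m) x*F wo n (curv ((1/16) ^ q) u) x)^2)) \<partial>unit_interval) <= ennreal 21) sequentially"
    using elim(2) unfolding ep_def by blast
   have lower: "eventually (%n. finite (?Z n) --> 16 ^ q*(La*(P - e')) <= (real (card (?Z n)) + 1)/n) sequentially"
    using zero_count_lower[OF q(1) et pos e'(1) ch] unfolding La_def P_def sign_prob_def .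
   have upper: "eventually (%n. \<forall>Z. finite Z --> Z \<subseteq> {0..<2*pi} --> (\<forall>z\<in>Z. F wo n one z = 0) -->
    real (card Z)/n <= 16 ^ q*(real (1 + p0)*Lc + 2*pi*(P + e')) + D*(1/2) ^ q) sequentially"
    using zero_count_upper[OF q(1) et pos e'(1) ch p0 qb32 C(1) E cu C(2)] unfolding Lc_def P_def sign_prob_def D_def .
   have small: "eventually (%n. 1/real n < e/4) sequentially"
    using e by (intro order_tendstoD(2)[OF lim_1_over_n]) simp
   from lower upper small eventually_ge_at_top[of 1] show ?thesis
   proof eventually_elim
    case (elim n)
    define U where "U = 16 ^ q*(real (1 + p0)*Lc + 2*pi*(P + e')) + D*(1/2) ^ q"
    have n: "0 < real n" using elim(4) by simp
    have le: "real (card Z) <= real n*U" if "finite Z" "Z \<subseteq> {0..<2*pi}" "\<forall>z\<in>Z. F wo n one z = 0" for Z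
    proof -
     have "real (card Z)/n <= U" unfolding U_def by (rule elim(2)[THEN spec, THEN mp, THEN mp, THEN mp, OF that])
     then show ?thesis unfolding pos_divide_le_eq[OF n] by (simp only: mult.commute)
    qed
    have cf1: "finite (?Z n)" by (rule card_from_subsets(1)[where B = "real n*U"]) (rule le)
    have cf2: "real (card (?Z n)) <= real n*U + 1" by (rule card_from_subsets(2)) (rule le)
    have "real (card (?Z n))/n <= (real n*U + 1)/n" by (rule divide_right_mono[OF cf2]) simp
    also have "... = U + 1/n" using n by (simp add: add_divide_distrib)
    finally have up: "real (card (?Z n))/n <= U + 1/n" .
    have "U = 16 ^ q*(real (1 + p0)*Lc) + 16 ^ q*(2*pi*P) + 16 ^ q*(2*pi*e') + D*(1/2) ^ q"
     unfolding U_def by (simp only: distrib_left)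
    then have U: "U < 2/sqrt 3 + e*3/4" by (rule ar1[OF _ m(1)[folded Lc_def] q3(2) e'(2) q(2)])
    have 1: "16 ^ q*(La*(P - e')) <= real (card (?Z n))/n + 1/n" using elim(1) cf1 by (simp add: add_divide_distrib)
    have 2: "16 ^ q*(La*(P - e')) = 16 ^ q*(2*pi*P) - 16 ^ q*(Lc*P) - 16 ^ q*(2*pi*e') + 16 ^ q*(Lc*e')"
     unfolding LaLc by (simp add: algebra_simps)
    have 3: "16 ^ q*(Lc*P) <= 16 ^ q*(real (1 + p0)*Lc)"
    proof -
     have "Lc*P <= Lc*real (1 + p0)" using sign_prob_bounds[of q] Lc0 by (intro mult_left_mono) (auto simp: P_def)
     then show ?thesis by (intro mult_left_mono) (simp_all add: mult.commute)
    qed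
    have 4: "0 <= 16 ^ q*(Lc*e')" using Lc0 e'(1) by simp
    have lo: "2/sqrt 3 - e*3/4 < real (card (?Z n))/n" by (rule ar2[OF 1 2 3 4 m(1)[folded Lc_def] q3(1) e'(2) elim(3)])
    show ?case using cf1 ar3[OF up U elim(3) lo] by (rule conjI)
   qed
  qed
  have "(%n. real (card (?Z n))/real n) \<longlonglongrightarrow> 2/sqrt 3"
  proof (rule tendstoI)
   fix e :: real assume "0 < e"
   from main[OF this] show "eventually (%n. dist (real (card (?Z n))/real n) (2/sqrt 3) < e) sequentially"
    by eventually_elim (simp add: dist_real_def)
  qed
  then have l: "(%n. ennreal (real (card (?Z n))/real n)) \<longlonglongrightarrow> ennreal (2/sqrt 3)" by (rule tendsto_ennrealI)
  have "eventually (%n. ennreal (real (card (?Z n))/real n) = num_zeros (F wo n one) {0..2*pi} / of_nat n) sequentially"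
   using main[OF zero_less_one] eventually_ge_at_top[of 1]
  proof eventually_elim
   case (elim n)
   have "num_zeros (F wo n one) {0..2*pi} = ennreal (real (card (?Z n)))"
    unfolding num_zeros_def using elim(1) by (subst emeasure_count_space_finite) (auto simp: ennreal_of_nat_eq_real_of_nat)
   then show ?case using elim(2) by (simp add: ennreal_of_nat_eq_real_of_nat divide_ennreal)
  qed
  with l show ?case by (rule Lim_transform_eventually)
 qed
qed

end

lemma trig_sum_eq: "trig_sum al be n = trig_field al be n one"
proof
 fix x
 show "trig_sum al be n x = trig_field al be n one x"
  by (simp add: trig_sum_def trig_field_def pairing_def wave_def sum_distrib_left cis.sel field_simps)
qed

lemma correlation_cnj: "correlation \<mu> (- j) = cnj (correlation \<mu> j)"
 unfolding correlation_def Bochner_Integration.integral_cnj[symmetric]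
 by (intro Bochner_Integration.integral_cong refl) (simp add: exp_cnj)

lemma spectral_density_fourier:
 assumes d: "spectral_density \<mu> \<psi>" and p: "prob_space \<mu>"
 shows "(CN x. ennreal (\<psi> x)) = 1"
  "(CI u. cpx (\<psi> u)*cis (- (of_int j*u))) = correlation \<mu> j"
proof -
 let ?N = "restrict_space lborel {-pi..pi}"
 have \<psi> [measurable]: "\<psi> \<in> bm borel" and \<psi>0: "!!x. 0 <= \<psi> x" and per: "!!x. \<psi> (x + 2*pi) = \<psi> x" and \<mu>: "\<mu> = density ?N (%x. ennreal (\<psi> x))"
  using d unfolding spectral_density_def by auto
 have \<psi>N [measurable]: "\<psi> \<in> bm ?N" by (rule measurable_restrict_space1) simp
 have idN: "(%x. x) \<in> measurable ?N borel" by (rule measurable_restrict_space1) simp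
 have nnN: "(\<integral>\<^sup>+x. h x \<partial>?N) = (CN x. h x)" if "h \<in> bm borel" "!!x. h (x + 2*pi) = h x" for h :: "real => ennreal"
  using nn_integral_Icc_pi[of h] that by (simp add: nn_integral_restrict_space)
 have "emeasure \<mu> (space \<mu>) = (\<integral>\<^sup>+x. ennreal (\<psi> x) \<partial>?N)"
  unfolding \<mu> space_density
  by (subst emeasure_density[OF _ sets.top]) (auto intro!: nn_integral_cong simp: indicator_def)
 also have "... = (CN x. ennreal (\<psi> x))" by (rule nnN) (simp_all add: per)
 finally show "(CN x. ennreal (\<psi> x)) = 1" using prob_space.emeasure_space_1[OF p] by simp
 let ?g = "%u. cpx (\<psi> u)*cis (- (of_int j*u))"
 have gper: "?g (x + 2*pi) = ?g x" for x
 proof -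
  have "cis (- (of_int j*(x + 2*pi))) = cis (- (of_int j*x))*cis (2*pi * of_int (- j))"
   unfolding cis_mult by (rule arg_cong[where f = cis]) (simp add: algebra_simps)
  also have "cis (2*pi * of_int (- j)) = 1" by (rule cis_multiple_2pi) simp
  finally show ?thesis by (simp add: per)
 qed
 have em: "(%x. exp (- \<i> * of_int j * of_real x) :: complex) \<in> bm ?N"
  by (rule measurable_compose[OF idN]) measurable
 have "correlation \<mu> j = (\<integral>x. \<psi> x *\<^sub>R exp (- \<i> * of_int j * of_real x) \<partial>?N)"
  unfolding correlation_def \<mu> by (rule integral_density[OF em \<psi>N]) (simp add: \<psi>0)
 also have "... = (\<integral>x. ?g x \<partial>?N)"
  by (intro Bochner_Integration.integral_cong refl) (simp add: scaleR_conv_of_real cis_conv_exp mult_ac)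
 also have "... = (CI x. ?g x)"
  by (rule integral_periodic_transfer[where g = ?g and T = "%x. x" and N = ?N, OF _ gper idN]) (measurable, erule nnN)
 finally show "(CI u. ?g u) = correlation \<mu> j" ..
qed

theorem theorem1p4:
  fixes M :: "'w measure" and a b :: "nat \<Rightarrow> 'w \<Rightarrow> real"
    and \<mu> :: "real measure" and \<psi> :: "real \<Rightarrow> real"
  assumes "prob_space M"
    and "spectral_measure \<mu>"
    and "stationary_gaussian_sequence M (correlation \<mu>) a"
    and "stationary_gaussian_sequence M (correlation \<mu>) b"
    and "independent_sequences M a b"
    and "spectral_density \<mu> \<psi>"
    and A1: "\<exists>\<alpha>>0. L1_second_difference_smooth \<psi> \<alpha>"
    and A2: "\<exists>\<gamma>>0. inverse_in_Lp \<psi> \<gamma>"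
  shows "AE \<omega> in M.
    (\<lambda>n. num_zeros (trig_sum (\<lambda>k. a k \<omega>) (\<lambda>k. b k \<omega>) n) {0..2*pi} / of_nat n)
      \<longlonglongrightarrow> ennreal (2 / sqrt 3)"
proof -
 obtain \<alpha> where \<alpha>: "0 < \<alpha>" "L1_second_difference_smooth \<psi> \<alpha>" using A1 by blast
 obtain \<gamma> where \<gamma>: "0 < \<gamma>" "inverse_in_Lp \<psi> \<gamma>" using A2 by blast
 \<comment> \<open>All values are real: for nonnegative lags they are covariances of \<open>a\<close>, for negative ones conjugates of these.\<close>
 define r where "r = (\<lambda>j. Re (correlation \<mu> j))"
 have cov: "complex_of_real (\<integral>\<omega>. X k \<omega> * X l \<omega> \<partial>M) = correlation \<mu> \<bar>int k - int l\<bar>"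
  if "stationary_gaussian_sequence M (correlation \<mu>) X" "1 \<le> k" "1 \<le> l" for X k l
  using that unfolding stationary_gaussian_sequence_def by blast
 have real: "correlation \<mu> j = complex_of_real (r j)" for j
 proof -
  have pos: "correlation \<mu> j \<in> \<real>" if "0 \<le> j" for j
  proof -
   have "complex_of_real (\<integral>\<omega>. a (nat j + 1) \<omega> * a 1 \<omega> \<partial>M) = correlation \<mu> \<bar>int (nat j + 1) - int 1\<bar>"
    by (rule cov[OF assms(3)]) auto
   then have "correlation \<mu> j = complex_of_real (\<integral>\<omega>. a (nat j + 1) \<omega> * a 1 \<omega> \<partial>M)" using that by simp
   then show ?thesis by (simp only: Reals_of_real)
  qed
  have "correlation \<mu> j \<in> \<real>"
  proof (cases "0 \<le> j")
   case False
   then have "cnj (correlation \<mu> (- j)) \<in> \<real>" using pos[of "- j"] by (simp add: Reals_cnj_iff)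
   then show ?thesis using correlation_cnj[of \<mu> "- j"] by simp
  qed (rule pos)
  then show ?thesis unfolding r_def by (simp add: of_real_Re)
 qed
 have rs: "r (- j) = r j" for j unfolding r_def correlation_cnj by simp
 have ra: "r \<bar>j\<bar> = r j" for j using rs[of j] by (simp add: abs_if)
 have gp: "gauss_pair M a b r"
 proof (rule gauss_pair.intro[OF assms(1) gauss_pair_axioms.intro])
  show "independent_sequences M a b" by (rule assms(5))
  show "r (- j) = r j" for j by (rule rs)
  show "gaussian_process M {1..} a" "gaussian_process M {1..} b" "\<And>k. 1 \<le> k \<Longrightarrow> (\<integral>\<omega>. a k \<omega> \<partial>M) = 0" "\<And>k. 1 \<le> k \<Longrightarrow> (\<integral>\<omega>. b k \<omega> \<partial>M) = 0"
   using assms(3,4) unfolding stationary_gaussian_sequence_def by blast+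
  show "(\<integral>\<omega>. a k \<omega> * a l \<omega> \<partial>M) = r (int k - int l)" if "1 \<le> k" "1 \<le> l" for k l
   using cov[OF assms(3) that] unfolding real ra of_real_eq_iff .
  show "(\<integral>\<omega>. b k \<omega> * b l \<omega> \<partial>M) = r (int k - int l)" if "1 \<le> k" "1 \<le> l" for k l
   using cov[OF assms(4) that] unfolding real ra of_real_eq_iff .
 qed
 have p: "prob_space \<mu>" using assms(2) unfolding spectral_measure_def by blast
 have sp: "spectral \<psi> r"
 proof (rule spectral.intro)
  show "\<psi> \<in> borel_measurable borel" "\<And>x. 0 \<le> \<psi> x" "\<And>x. \<psi> (x + 2*pi) = \<psi> x" using assms(6) unfolding spectral_density_def by blast+
  show "(\<integral>\<^sup>+x. ennreal (\<psi> x) \<partial>circ) = 1" by (rule spectral_density_fourier(1)[OF assms(6) p])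
  show "(\<integral>u. complex_of_real (\<psi> u) * cis (- (of_int j * u)) \<partial>circ) = complex_of_real (r j)" for j
   unfolding real[symmetric] by (rule spectral_density_fourier(2)[OF assms(6) p])
 qed
 interpret S: spectral \<psi> r by (rule sp)
 obtain C d where Cd: "0 \<le> C" "0 < d" "\<forall>h. 0 < h \<longrightarrow> h \<le> d \<longrightarrow> S.om2 h \<le> C * h powr \<alpha>"
  using S.smooth_bound[OF \<alpha>(2,1)] by blast
 have om: "\<exists>d>0. \<forall>h. \<bar>h\<bar> \<le> d \<longrightarrow> S.om h \<le> e" if "0 < e" for e
  by (rule S.om_small[OF S.smooth_om2_small[OF \<alpha>(1) Cd] that])
 obtain K where K: "0 \<le> K" "\<And>j. 1 \<le> j \<Longrightarrow> \<bar>r (int j)\<bar> \<le> K * real j powr (- \<alpha>)"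
  using S.r_decay[OF \<alpha>(1) Cd] by blast
 define a0 where "a0 = min (1/2) (\<alpha>/2)"
 have a0: "0 < a0" using \<alpha> by (simp add: a0_def)
 \<comment> \<open>On the block indices \<open>(j + 1)^Q\<close> the rate \<open>n^(- a0)\<close> becomes \<open>(j + 1)^(- 16)\<close>.\<close>
 obtain Q :: nat where Q: "16 / a0 \<le> Q" using real_arch_simple by blast
 have Qa: "16 \<le> a0 * Q" using Q a0 by (simp add: field_simps)
 have Q1: "1 \<le> Q" using Qa by (cases Q) auto
 define \<beta> where "\<beta> = min (1/2) \<gamma>"
 have \<beta>: "0 < \<beta>" "\<beta> \<le> \<gamma>" "\<beta> \<le> 1/2" using \<gamma> by (simp_all add: \<beta>_def)
 obtain CU where CU: "0 \<le> CU" "\<And>\<kappa>. 0 < \<kappa> \<Longrightarrow> (\<integral>\<^sup>+x. \<integral>\<^sup>+\<xi>. ennreal (exp (- (\<kappa> * (2*pi * \<psi> x) * \<xi>\<^sup>2 / 2))) \<partial>std_gauss \<partial>circ) \<le> ennreal (CU * \<kappa> powr (- \<beta>))"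
  using S.gauss_average_bound[OF \<gamma>(2,1) \<beta>] by blast
 have decay: "mean_square_corr r (base Q j) \<le> (3 + K) / (real j + 1) ^ 16" for j
 proof -
  have j: "0 < real j + 1" by simp
  have "mean_square_corr r (base Q j) \<le> (3 + K) * real (base Q j) powr (- a0)"
   unfolding a0_def by (rule S.mean_square_corr_decay[OF \<alpha>(1) K base_pos])
  also have "real (base Q j) powr (- a0) = (real j + 1) powr (- (a0 * Q))"
  proof -
   have "real (base Q j) = (real j + 1) powr real Q" using j by (simp add: base_def powr_realpow add.commute)
   then show ?thesis by (simp add: powr_powr mult.commute)
  qed
  also have "(3 + K) * (real j + 1) powr (- (a0 * Q)) \<le> (3 + K) * (real j + 1) powr (- 16)"
   using Qa K(1) by (intro mult_left_mono powr_mono) auto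
  also have "(real j + 1) powr (- 16) = 1 / (real j + 1) ^ 16"
   using powr_realpow[OF j, of 16] by (simp add: powr_minus_divide)
  finally show ?thesis by simp
 qed
 interpret G: gauss_spectral M a b r \<psi> Q "3 + K" CU \<beta>
 proof (rule gauss_spectral.intro[OF gp sp gauss_spectral_axioms.intro])
  show "AE x in circ. 0 < \<psi> x" by (rule S.inverse_Lp_consequences(1)[OF \<gamma>(2,1) \<beta>(1,2)])
 qed (use Q1 K(1) decay om \<beta>(1) CU in auto)
 show ?thesis unfolding trig_sum_eq by (rule G.AE_num_zeros)
qed

end
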